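(* Assume $\mu\ge2$, let $\gamma(\varepsilon)$ and $\omega(\varepsilon)$ be as in the context. If $\varepsilon_j\downarrow0$ is such that $\omega(\varepsilon_j)\to\infty$ or $\omega(\varepsilon_j)\to0$, then $$\lim_{j\to\infty}\frac{Z_K-\mu^K}{\mu^K\,\varepsilon_j^{\alpha\mu^{\gamma(\varepsilon_j)-K}}}=\Big(\frac{\lambda}{\mu}-1\Big)\,p_\lambda\,p_\mu^{-\frac{\lambda-1}{\mu-1}}$$ in probability under $\mathbb{P}(\,\cdot\,|\,W<\varepsilon_j)$; that is, for every $\eta>0$ the conditional probability given $W<\varepsilon_j$ that the quotient on the left differs from the constant on the right by more than $\eta$ tends to $0$ as $j\to\infty$.
   Context: $(Z_n)_{n\ge 0}$ is the sequence of generation sizes of a Galton–Watson tree with $Z_0=1$ whose offspring variable $N$ is nondegenerate (not almost surely constant), with $P(N=0)=0$ and $E[N\log N]<\infty$. Put $p_n:=P(N=n)$, $a:=E[N]\in(1,\infty)$, $\mu:=\min\{n\in\mathbb{N}:p_n>0\}$, assumed $\ge 2$, and $\lambda:=\min\{n>\mu:p_n>0\}$. The martingale limit $W:=\lim_{n\to\infty}Z_n/a^n$ exists and is strictly positive almost surely. Let $K:=\min\{k\in\mathbb{N}:Z_k>\mu^k\}$ (almost surely finite). Let $\beta:=\log\mu/\log a$, $\alpha:=\beta/(1-\beta)$, $\kappa(\varepsilon):=\lfloor\log(1/\varepsilon)/\log(a/\mu)\rfloor$, $y=y(\varepsilon):=\varepsilon(a/\mu)^{\kappa(\varepsilon)}\in(\mu/a,1]$.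 Let $\phi(z):=\mathbb{E}e^{-zW}$, $f(s):=\sum_j p_js^j$, $f_0(s):=s$, $f_m:=f\circ f_{m-1}$, and $b(s):=\lim_{m\to\infty}\mu^{-m}\log f_m(s)$ for $s\in(0,1]$ (the limit exists). One has $b\circ\phi<0$ on $(0,\infty)$, and $(b\circ\phi)'$ increases from $-\infty$ to $0$ on $(0,\infty)$, so there is a unique $u_1=u_1(\varepsilon)>0$ with $(b\circ\phi)'(u_1)=-y(\varepsilon)$. Put $$H(\varepsilon):=\frac{1}{\log\mu}\log\Big(-\frac{b(\phi(u_1))\,y^{\alpha}(\lambda-\mu)}{\alpha}\Big),\qquad \gamma(\varepsilon):=\frac{\log(1/\varepsilon)}{\log(a/\mu)}-\frac{\log\log(1/\varepsilon)}{\log\mu}+H(\varepsilon),$$ and, with $\{x\}:=\lceil x\rceil-x$, $$\omega(\varepsilon):=\frac{\varepsilon^{\alpha(\mu^{-\{\gamma(\varepsilon)\}}-1)}}{\log(1/\varepsilon)}.$$ *)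

theory Defs
  imports "HOL-Probability.Probability"
begin

text \<open>
  \<open>X n i\<close> is the number of children of the \<open>i\<close>-th individual of generation \<open>n\<close>;
  only the values with \<open>i\<close> below the size of generation \<open>n\<close> enter the process.
\<close>

locale galton_watson = prob_space M
  for M :: "'a measure" and p :: "nat pmf" and X :: "nat \<Rightarrow> nat \<Rightarrow> 'a \<Rightarrow> nat" +
  assumes indep_offspring: "indep_vars (\<lambda>_. count_space UNIV) (\<lambda>(n, i). X n i) UNIV"
    and distr_offspring: "\<And>n i. distr M (count_space UNIV) (X n i) = measure_pmf p"

primrec gen_size :: "(nat \<Rightarrow> nat \<Rightarrow> 'a \<Rightarrow> nat) \<Rightarrow> nat \<Rightarrow> 'a \<Rightarrow> nat" where
  "gen_size X 0 x = 1"
| "gen_size X (Suc n) x = (\<Sum>i<gen_size X n x. X n i x)"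

definition offspring_mean :: "nat pmf \<Rightarrow> real" where
  "offspring_mean p = measure_pmf.expectation p real"

definition min_offspring :: "nat pmf \<Rightarrow> nat" where
  "min_offspring p = (LEAST n. pmf p n > 0)"

definition next_offspring :: "nat pmf \<Rightarrow> nat" where
  "next_offspring p = (LEAST n. n > min_offspring p \<and> pmf p n > 0)"

definition mart_limit :: "nat pmf \<Rightarrow> (nat \<Rightarrow> nat \<Rightarrow> 'a \<Rightarrow> nat) \<Rightarrow> 'a \<Rightarrow> real" where
  "mart_limit p X x = lim (\<lambda>n. real (gen_size X n x) / offspring_mean p ^ n)"

definition first_nonmin_gen :: "nat pmf \<Rightarrow> (nat \<Rightarrow> nat \<Rightarrow> 'a \<Rightarrow> nat) \<Rightarrow> 'a \<Rightarrow> nat" where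
  "first_nonmin_gen p X x = (LEAST k. gen_size X k x > min_offspring p ^ k)"

definition beta_exp :: "nat pmf \<Rightarrow> real" where
  "beta_exp p = ln (real (min_offspring p)) / ln (offspring_mean p)"

definition alpha_exp :: "nat pmf \<Rightarrow> real" where
  "alpha_exp p = beta_exp p / (1 - beta_exp p)"

definition kappa_gen :: "nat pmf \<Rightarrow> real \<Rightarrow> int" where
  "kappa_gen p \<epsilon> = \<lfloor>ln (1 / \<epsilon>) / ln (offspring_mean p / real (min_offspring p))\<rfloor>"

definition y_scale :: "nat pmf \<Rightarrow> real \<Rightarrow> real" where
  "y_scale p \<epsilon> = \<epsilon> * (offspring_mean p / real (min_offspring p)) powi kappa_gen p \<epsilon>"

definition laplace_W ::
    "'a measure \<Rightarrow> nat pmf \<Rightarrow> (nat \<Rightarrow> nat \<Rightarrow> 'a \<Rightarrow> nat) \<Rightarrow> real \<Rightarrow> real" where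
  "laplace_W M p X z = (LINT x|M. exp (- z * mart_limit p X x))"

definition offspring_gf :: "nat pmf \<Rightarrow> real \<Rightarrow> real" where
  "offspring_gf p s = (\<Sum>j. pmf p j * s ^ j)"

definition b_fun :: "nat pmf \<Rightarrow> real \<Rightarrow> real" where
  "b_fun p s = lim (\<lambda>m. ln ((offspring_gf p ^^ m) s) / real (min_offspring p) ^ m)"

definition u1 ::
    "'a measure \<Rightarrow> nat pmf \<Rightarrow> (nat \<Rightarrow> nat \<Rightarrow> 'a \<Rightarrow> nat) \<Rightarrow> real \<Rightarrow> real" where
  "u1 M p X \<epsilon> =
    (THE u. u > 0 \<and> deriv (b_fun p \<circ> laplace_W M p X) u = - y_scale p \<epsilon>)"

definition H_fun ::
    "'a measure \<Rightarrow> nat pmf \<Rightarrow> (nat \<Rightarrow> nat \<Rightarrow> 'a \<Rightarrow> nat) \<Rightarrow> real \<Rightarrow> real" where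
  "H_fun M p X \<epsilon> = 1 / ln (real (min_offspring p)) *
    ln (- b_fun p (laplace_W M p X (u1 M p X \<epsilon>)) * y_scale p \<epsilon> powr alpha_exp p *
          (real (next_offspring p) - real (min_offspring p)) / alpha_exp p)"

definition gamma_fun ::
    "'a measure \<Rightarrow> nat pmf \<Rightarrow> (nat \<Rightarrow> nat \<Rightarrow> 'a \<Rightarrow> nat) \<Rightarrow> real \<Rightarrow> real" where
  "gamma_fun M p X \<epsilon> =
    ln (1 / \<epsilon>) / ln (offspring_mean p / real (min_offspring p))
    - ln (ln (1 / \<epsilon>)) / ln (real (min_offspring p)) + H_fun M p X \<epsilon>"

text \<open>Distance to the next integer above; not the usual fractional part \<open>frac\<close>.\<close>

definition upper_frac :: "real \<Rightarrow> real" where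
  "upper_frac x = real_of_int \<lceil>x\<rceil> - x"

definition omega_fun ::
    "'a measure \<Rightarrow> nat pmf \<Rightarrow> (nat \<Rightarrow> nat \<Rightarrow> 'a \<Rightarrow> nat) \<Rightarrow> real \<Rightarrow> real" where
  "omega_fun M p X \<epsilon> =
    \<epsilon> powr (alpha_exp p *
      (real (min_offspring p) powr (- upper_frac (gamma_fun M p X \<epsilon>)) - 1)) / ln (1 / \<epsilon>)"

definition excess_ratio ::
    "'a measure \<Rightarrow> nat pmf \<Rightarrow> (nat \<Rightarrow> nat \<Rightarrow> 'a \<Rightarrow> nat) \<Rightarrow> real \<Rightarrow> 'a \<Rightarrow> real" where
  "excess_ratio M p X \<epsilon> x =
    (let K = first_nonmin_gen p X x; m = real (min_offspring p) in
      (real (gen_size X K x) - m ^ K) /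
      (m ^ K * \<epsilon> powr (alpha_exp p * m powr (gamma_fun M p X \<epsilon> - real K))))"

end

(*
The proof compares the conditional law given W < e with an exponential tilt. Write phi for the
Laplace transform of W, B = b o phi, n = kappa(e), u = u1(e), and let Z_k be the size of generation k.
For an event A of the first k <= n generations, E[exp(-u a^n W); A] = E[phi(a^(n-k) u)^(Z_k); A].
The Cauchy kernel 1 / (1 + x^2), whose Fourier transform is exp(-|t|), turns bounds for
|phi(u + i t)| / phi(u) into
  P(A, W < e) <= C exp(u e a^n) mu^(-n/2) E[phi(a^(n-k) u)^(Z_k); A],
and, u being the saddle point, a Gaussian comparison gives for the whole space a lower bound of the
same order. Hence P(A | W < e) is at most a constant times the tilted probability of A, uniformly
in A: the polynomial loss of a plain exponential Chebyshev bound never appears.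

Under the tilt, generation k - 1 consists of independent individuals with offspring law proportional
to p_j s^j, s = phi(a^(n-k) u), where s^(lam-mu) is p_mu^(-(lam-mu)/(mu-1)) e^(alpha mu^(gamma-k)) up to
a factor tending to 1. The tree is therefore minimal up to generation k - 1 as long as
mu^(k-1) s^(lam-mu) evaluated there is small, and in the first generation where the corresponding
quantity is large the excess obeys a weak law of large numbers by Chebyshev's inequality. The
hypothesis on omega makes this generation deterministic.
*)

theory Submission
  imports Defs "HOL-Complex_Analysis.Complex_Analysis" "HOL-Real_Asymp.Real_Asymp"
begin

section \<open>Independence of the past and the present generation\<close>

text \<open>Everything rests on the exact identity
  \<open>ln (lap (a ^ k * u)) = mu ^ k * BB u - Er (a ^ k * u)\<close>, where \<open>BB\<close> is B
  and \<open>Er\<close> tends to ln p_mu / (mu - 1) at infinity. That limit is the origin of the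
  powers of p_mu, and for k = n - K the identity ties e^(alpha mu^(gamma-K)) to the Laplace
  transform. As e a^n = y mu^n with y in (mu/a, 1], the saddle stays in one compact interval, so
  pointwise facts become uniform.

  Off the real axis phi(a^k z) may wind around 0, and its principal logarithm is of no use. Instead
  the principal logarithms of f(s) / s^mu at s = phi(a^l z), l < k, are summed: on a cone around the
  axis these numbers have real part at least p_mu / 2. The logarithm so obtained, divided by mu^k,
  is bounded uniformly in k, and Cauchy's estimates bound its derivatives uniformly too.

  No density of W is at hand. The factor exp(-|t|) makes the integrals converge, so away from t = 0
  a bound |phi(u + i t)| <= q phi(u) with q < 1 is enough; since Z_k >= mu^k, its power mu^n
  survives the restriction to any event A.\<close>

context galton_watson
begin

text \<open>All individuals of the earlier generations are kept, also those that are never born, so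
  that the past lives on one fixed product space, disjoint from row \<open>n\<close>.\<close>

definition gen_coords :: "nat \<Rightarrow> (nat \<times> nat) set" where
  "gen_coords n = {..<n} \<times> UNIV"

abbreviation coord_space :: "(nat \<times> nat) set \<Rightarrow> (nat \<times> nat \<Rightarrow> nat) measure" where
  "coord_space I \<equiv> PiM I (\<lambda>_. count_space UNIV)"

definition hist :: "nat \<Rightarrow> 'a \<Rightarrow> nat \<times> nat \<Rightarrow> nat" where
  "hist n x = restrict (\<lambda>(j, i). X j i x) (gen_coords n)"

definition row :: "nat \<Rightarrow> 'a \<Rightarrow> nat \<times> nat \<Rightarrow> nat" where
  "row n x = restrict (\<lambda>(j, i). X j i x) ({n} \<times> UNIV)"

text \<open>Events are encoded as preimages under \<open>hist n\<close>, so that each can be carried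
  over to the product space on which Fubini's theorem applies.\<close>

definition past :: "nat \<Rightarrow> 'a set set" where
  "past n = {A. \<exists>B\<in>sets (coord_space (gen_coords n)). A = hist n -` B \<inter> space M}"

lemma X_measurable [measurable]: "X n i \<in> measurable M (count_space UNIV)"
proof -
  have "\<forall>q\<in>UNIV. (case q of (j, i) \<Rightarrow> X j i) \<in> measurable M (count_space UNIV)"
    using indep_offspring unfolding indep_vars_def by blast
  from bspec[OF this, of "(n, i)"] show ?thesis by simp
qed

lemma gen_size_measurable [measurable]: "gen_size X n \<in> measurable M (count_space UNIV)"
proof (induction n)
  case (Suc n)
  have "(\<lambda>x. (\<lambda>m x. \<Sum>i<m. X n i x) (gen_size X n x) x) \<in> measurable M (count_space UNIV)"
    by (rule measurable_compose_countable[OF _ Suc]) measurable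
  then show ?case by simp
qed simp

text \<open>Grouping an independent family into disjoint blocks of indices preserves independence;
  the boolean index encodes the pair of blocks.\<close>

lemma indep_hist_row:
  "indep_var (coord_space (gen_coords n)) (hist n) (coord_space ({n} \<times> UNIV)) (row n)"
proof -
  have "indep_vars (\<lambda>b. coord_space (case_bool (gen_coords n) ({n} \<times> UNIV) b))
     (\<lambda>b x. restrict (\<lambda>i. (case i of (n, i) \<Rightarrow> X n i) x) (case_bool (gen_coords n) ({n} \<times> UNIV) b)) UNIV"
    by (rule indep_vars_restrict[OF indep_offspring])
       (auto simp: disjoint_family_on_def gen_coords_def split: bool.splits)
  moreover have "(\<lambda>b. coord_space (case_bool (gen_coords n) ({n} \<times> UNIV) b)) =
      case_bool (coord_space (gen_coords n)) (coord_space ({n} \<times> UNIV))"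
    by (auto simp: fun_eq_iff split: bool.splits)
  moreover have "(\<lambda>b x. restrict (\<lambda>i. (case i of (n, i) \<Rightarrow> X n i) x)
        (case_bool (gen_coords n) ({n} \<times> UNIV) b)) = case_bool (hist n) (row n)"
    by (auto simp: fun_eq_iff hist_def row_def restrict_def split: bool.splits prod.splits)
  ultimately show ?thesis by (simp add: indep_var_def)
qed

lemma hist_measurable [measurable]: "hist n \<in> measurable M (coord_space (gen_coords n))"
  and row_measurable [measurable]: "row n \<in> measurable M (coord_space ({n} \<times> UNIV))"
  using indep_hist_row[of n] by (auto dest: indep_var_rv1 indep_var_rv2)

text \<open>The recursion of the process on the product space, which shows that generation sizes up
  to \<open>n\<close> can be read off from \<open>hist n\<close>.\<close>

fun coord_gen_size :: "nat \<Rightarrow> (nat \<times> nat \<Rightarrow> nat) \<Rightarrow> nat" where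
  "coord_gen_size 0 w = 1"
| "coord_gen_size (Suc n) w = (\<Sum>i<coord_gen_size n w. w (n, i))"

lemma coord_gen_size_hist: "j \<le> n \<Longrightarrow> coord_gen_size j (hist n x) = gen_size X j x"
  by (induction j) (auto simp: hist_def gen_coords_def)

lemma coord_gen_size_measurable:
  "j \<le> n \<Longrightarrow> coord_gen_size j \<in> measurable (coord_space (gen_coords n)) (count_space UNIV)"
proof (induction j)
  case (Suc j)
  have [measurable]: "(\<lambda>w. w (j, i)) \<in> measurable (coord_space (gen_coords n)) (count_space UNIV)" for i
    using Suc.prems by (intro measurable_component_singleton) (auto simp: gen_coords_def)
  have "(\<lambda>x. (\<lambda>m w. \<Sum>i<m. w (j, i)) (coord_gen_size j x) x) \<in> measurable (coord_space (gen_coords n)) (count_space UNIV)"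
    by (rule measurable_compose_countable[OF _ Suc.IH]) (use Suc.prems in \<open>measurable, simp\<close>)
  then show ?case by simp
next
  case 0
  have "coord_gen_size 0 = (\<lambda>_. 1)" by (simp add: fun_eq_iff)
  then show ?case by simp
qed

lemma past_sets [measurable_dest]: "A \<in> past n \<Longrightarrow> A \<in> sets M"
  by (auto simp: past_def intro!: measurable_sets[OF hist_measurable])

lemma past_gen_size: "j \<le> n \<Longrightarrow> {x\<in>space M. gen_size X j x \<in> S} \<in> past n"
  unfolding past_def
  by (auto intro!: bexI[of _ "coord_gen_size j -` S \<inter> space (coord_space (gen_coords n))"]
        measurable_sets[OF coord_gen_size_measurable] measurable_space[OF hist_measurable]
      simp: coord_gen_size_hist)

lemma past_Int: assumes "A \<in> past n" "B \<in> past n" shows "A \<inter> B \<in> past n"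
proof -
  obtain A' B' where *: "A' \<in> sets (coord_space (gen_coords n))" "A = hist n -` A' \<inter> space M"
      "B' \<in> sets (coord_space (gen_coords n))" "B = hist n -` B' \<inter> space M"
    using assms by (auto simp: past_def)
  then have "A \<inter> B = hist n -` (A' \<inter> B') \<inter> space M" by auto
  with * show ?thesis unfolding past_def by blast
qed

lemma past_space: "space M \<in> past n"
  using past_gen_size[of 0 n UNIV] by simp

lemma past_mono: assumes "A \<in> past n" "n \<le> k" shows "A \<in> past k"
proof -
  from assms obtain B where B: "B \<in> sets (coord_space (gen_coords n))" "A = hist n -` B \<inter> space M"
    by (auto simp: past_def)
  have sub: "gen_coords n \<subseteq> gen_coords k" using assms by (auto simp: gen_coords_def)
  let ?r = "\<lambda>w. restrict w (gen_coords n)"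
  have m: "?r \<in> measurable (coord_space (gen_coords k)) (coord_space (gen_coords n))"
    using sub by (rule measurable_restrict_subset)
  have e: "?r (hist k x) = hist n x" for x
    using sub by (auto simp: hist_def fun_eq_iff)
  have "A = hist k -` (?r -` B \<inter> space (coord_space (gen_coords k))) \<inter> space M"
    using B e measurable_space[OF hist_measurable, of _ k] by auto
  then show ?thesis using measurable_sets[OF m B(1)] unfolding past_def by blast
qed

lemma row_sum: "(\<Sum>i<m. row n x (n, i)) = (\<Sum>i<m. X n i x)"
  by (simp add: row_def)

lemma pair_sum_measurable:
  assumes h: "\<And>m l. h m l \<in> space N"
  shows "(\<lambda>(w, v). h (coord_gen_size n w) (\<Sum>i<coord_gen_size n w. v (n, i)))
     \<in> measurable (coord_space (gen_coords n) \<Otimes>\<^sub>M coord_space ({n} \<times> UNIV)) N"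
proof -
  let ?P = "coord_space (gen_coords n) \<Otimes>\<^sub>M coord_space ({n} \<times> UNIV)"
  have 1: "(\<lambda>q. coord_gen_size n (fst q)) \<in> measurable ?P (count_space UNIV)"
    using measurable_compose[OF measurable_fst coord_gen_size_measurable[OF order_refl]] .
  have 2: "(\<lambda>q. \<Sum>i<m. snd q (n, i)) \<in> measurable ?P (count_space UNIV)" for m
  proof -
    have [measurable]: "(\<lambda>q. snd q (n, i)) \<in> measurable ?P (count_space UNIV)" for i
      by (rule measurable_compose[OF measurable_snd measurable_component_singleton]) auto
    show ?thesis by measurable
  qed
  have "(\<lambda>q. (\<lambda>m q. h m (\<Sum>i<m. snd q (n, i))) (coord_gen_size n (fst q)) q) \<in> measurable ?P N"
    by (rule measurable_compose_countable[OF _ 1], rule measurable_compose[OF 2]) (simp add: h)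
  then show ?thesis by (simp add: case_prod_beta)
qed

text \<open>The joint law of \<open>hist n\<close> and \<open>row n\<close> is a product measure, so
  Fubini freezes the size of generation \<open>n\<close> at \<open>x\<close> and draws its offspring
  at an independent \<open>y\<close>. This takes the place of conditioning on the past.\<close>

lemma one_step_nn_integral:
  fixes h :: "nat \<Rightarrow> nat \<Rightarrow> ennreal"
  shows "(\<integral>\<^sup>+x. h (gen_size X n x) (gen_size X (Suc n) x) \<partial>M) =
    (\<integral>\<^sup>+x. (\<integral>\<^sup>+y. h (gen_size X n x) (\<Sum>i<gen_size X n x. X n i y) \<partial>M) \<partial>M)"
proof -
  let ?S = "coord_space (gen_coords n)" and ?T = "coord_space ({n} \<times> UNIV)"
  let ?F = "\<lambda>w v. h (coord_gen_size n w) (\<Sum>i<coord_gen_size n w. v (n, i))"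
  interpret R: prob_space "distr M ?T (row n)" by (rule prob_space_distr) simp
  have F[measurable]: "(\<lambda>(w, v). ?F w v) \<in> borel_measurable (?S \<Otimes>\<^sub>M ?T)"
    by (rule pair_sum_measurable) simp
  have D: "distr M ?S (hist n) \<Otimes>\<^sub>M distr M ?T (row n) = distr M (?S \<Otimes>\<^sub>M ?T) (\<lambda>x. (hist n x, row n x))"
    using indep_hist_row[of n] by (simp add: indep_var_distribution_eq)
  have "(\<integral>\<^sup>+x. h (gen_size X n x) (gen_size X (Suc n) x) \<partial>M) = (\<integral>\<^sup>+x. (\<lambda>(w, v). ?F w v) (hist n x, row n x) \<partial>M)"
    by (simp add: coord_gen_size_hist row_sum)
  also have "\<dots> = (\<integral>\<^sup>+q. (\<lambda>(w, v). ?F w v) q \<partial>distr M (?S \<Otimes>\<^sub>M ?T) (\<lambda>x. (hist n x, row n x)))"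
    by (rule nn_integral_distr[symmetric]) measurable
  also have "\<dots> = (\<integral>\<^sup>+w. \<integral>\<^sup>+v. ?F w v \<partial>distr M ?T (row n) \<partial>distr M ?S (hist n))"
    unfolding D[symmetric] by (subst R.nn_integral_fst[symmetric]) (auto simp: measurable_cong_sets[OF sets_pair_measure_cong[OF sets_distr sets_distr] refl])
  also have "\<dots> = (\<integral>\<^sup>+x. \<integral>\<^sup>+v. ?F (hist n x) v \<partial>distr M ?T (row n) \<partial>M)"
  proof -
    have "(\<lambda>(w, v). ?F w v) \<in> borel_measurable (?S \<Otimes>\<^sub>M distr M ?T (row n))"
      using F by (simp add: measurable_cong_sets[OF sets_pair_measure_cong[OF refl sets_distr] refl])
    then have "(\<lambda>w. \<integral>\<^sup>+v. ?F w v \<partial>distr M ?T (row n)) \<in> borel_measurable ?S"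
      by (intro R.borel_measurable_nn_integral)
    then show ?thesis by (subst nn_integral_distr) auto
  qed
  also have "\<dots> = (\<integral>\<^sup>+x. \<integral>\<^sup>+y. ?F (hist n x) (row n y) \<partial>M \<partial>M)"
  proof (rule nn_integral_cong)
    fix x assume "x \<in> space M"
    then have x: "hist n x \<in> space ?S" by (rule measurable_space[OF hist_measurable])
    have "(\<lambda>v. ?F (hist n x) v) \<in> borel_measurable ?T"
      using measurable_Pair2[OF F x] by simp
    then show "(\<integral>\<^sup>+v. ?F (hist n x) v \<partial>distr M ?T (row n)) = (\<integral>\<^sup>+y. ?F (hist n x) (row n y) \<partial>M)"
      by (subst nn_integral_distr) auto
  qed
  also have "\<dots> = (\<integral>\<^sup>+x. (\<integral>\<^sup>+y. h (gen_size X n x) (\<Sum>i<gen_size X n x. X n i y) \<partial>M) \<partial>M)"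
    by (simp add: coord_gen_size_hist row_sum)
  finally show ?thesis .
qed

text \<open>The same freezing for signed and complex integrands, where Fubini needs integrability,
  hence the bound \<open>C\<close>. The event \<open>A\<close> travels along as a function of
  \<open>hist n\<close>.\<close>

lemma one_step_integral:
  fixes h :: "nat \<Rightarrow> nat \<Rightarrow> 'b :: {banach, second_countable_topology}"
  assumes A: "A \<in> past n" and bnd: "\<And>m l. norm (h m l) \<le> C"
  shows "(\<integral>x. indicator A x *\<^sub>R h (gen_size X n x) (gen_size X (Suc n) x) \<partial>M) =
    (\<integral>x. indicator A x *\<^sub>R (\<integral>y. h (gen_size X n x) (\<Sum>i<gen_size X n x. X n i y) \<partial>M) \<partial>M)"
proof -
  let ?S = "coord_space (gen_coords n)" and ?T = "coord_space ({n} \<times> UNIV)"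
  obtain B where B[measurable]: "B \<in> sets ?S" and AB: "A = hist n -` B \<inter> space M"
    using A by (auto simp: past_def)
  let ?G = "\<lambda>w v. h (coord_gen_size n w) (\<Sum>i<coord_gen_size n w. v (n, i))"
  let ?F = "\<lambda>w v. indicator B w *\<^sub>R ?G w v"
  interpret H: prob_space "distr M ?S (hist n)" by (rule prob_space_distr) simp
  interpret R: prob_space "distr M ?T (row n)" by (rule prob_space_distr) simp
  interpret P: pair_prob_space "distr M ?S (hist n)" "distr M ?T (row n)" ..
  have G[measurable]: "(\<lambda>(w, v). ?G w v) \<in> borel_measurable (?S \<Otimes>\<^sub>M ?T)"
    by (rule pair_sum_measurable) simp
  have F[measurable]: "(\<lambda>(w, v). ?F w v) \<in> borel_measurable (?S \<Otimes>\<^sub>M ?T)"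
    using G by (simp add: case_prod_beta)
  have D: "distr M ?S (hist n) \<Otimes>\<^sub>M distr M ?T (row n) = distr M (?S \<Otimes>\<^sub>M ?T) (\<lambda>x. (hist n x, row n x))"
    using indep_hist_row[of n] by (simp add: indep_var_distribution_eq)
  have C: "0 \<le> C" using bnd[of 0 0] norm_ge_zero order_trans by blast
  have int: "integrable (distr M ?S (hist n) \<Otimes>\<^sub>M distr M ?T (row n)) (\<lambda>(w, v). ?F w v)"
    using bnd C
    by (intro P.P.integrable_const_bound[where B=C])
       (auto simp: indicator_def measurable_cong_sets[OF sets_pair_measure_cong[OF sets_distr sets_distr] refl])
  have ind: "indicator B (hist n x) = (indicator A x :: real)" if "x \<in> space M" for x
    using that by (auto simp: AB indicator_def)
  have "(\<integral>x. indicator A x *\<^sub>R h (gen_size X n x) (gen_size X (Suc n) x) \<partial>M) = (\<integral>x. (\<lambda>(w, v). ?F w v) (hist n x, row n x) \<partial>M)"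
    by (intro Bochner_Integration.integral_cong) (auto simp: coord_gen_size_hist row_sum ind)
  also have "\<dots> = (\<integral>q. (\<lambda>(w, v). ?F w v) q \<partial>distr M (?S \<Otimes>\<^sub>M ?T) (\<lambda>x. (hist n x, row n x)))"
    by (rule integral_distr[symmetric]) measurable
  also have "\<dots> = (\<integral>w. \<integral>v. ?F w v \<partial>distr M ?T (row n) \<partial>distr M ?S (hist n))"
    unfolding D[symmetric] using int by (subst P.integral_fst'[symmetric]) auto
  also have "\<dots> = (\<integral>x. \<integral>v. ?F (hist n x) v \<partial>distr M ?T (row n) \<partial>M)"
  proof (rule integral_distr)
    have "(\<lambda>(w, v). ?F w v) \<in> borel_measurable (?S \<Otimes>\<^sub>M distr M ?T (row n))"
      using F by (simp add: measurable_cong_sets[OF sets_pair_measure_cong[OF refl sets_distr] refl])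
    then show "(\<lambda>w. \<integral>v. ?F w v \<partial>distr M ?T (row n)) \<in> borel_measurable ?S"
      by (intro R.borel_measurable_lebesgue_integral)
  qed simp
  also have "\<dots> = (\<integral>x. \<integral>y. ?F (hist n x) (row n y) \<partial>M \<partial>M)"
  proof (intro Bochner_Integration.integral_cong)
    fix x assume "x \<in> space M"
    then have x: "hist n x \<in> space ?S" by (rule measurable_space[OF hist_measurable])
    have "(\<lambda>v. ?F (hist n x) v) \<in> borel_measurable ?T"
      using measurable_Pair2[OF F x] by simp
    then show "(\<integral>v. ?F (hist n x) v \<partial>distr M ?T (row n)) = (\<integral>y. ?F (hist n x) (row n y) \<partial>M)"
      by (intro integral_distr row_measurable)
  qed simp
  also have "\<dots> = (\<integral>x. indicator A x *\<^sub>R (\<integral>y. h (gen_size X n x) (\<Sum>i<gen_size X n x. X n i y) \<partial>M) \<partial>M)"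
    by (intro Bochner_Integration.integral_cong) (auto simp: coord_gen_size_hist row_sum ind)
  finally show ?thesis .
qed

section \<open>Products and second moments over independent offspring\<close>

lemma integral_offspring:
  fixes h :: "nat \<Rightarrow> 'b :: {banach, second_countable_topology}"
  shows "(\<integral>x. h (X n i x) \<partial>M) = measure_pmf.expectation p h"
    and "integrable M (\<lambda>x. h (X n i x)) \<longleftrightarrow> integrable (measure_pmf p) h"
  unfolding distr_offspring[of n i, symmetric]
  by (simp_all add: integral_distr integrable_distr_eq)

lemma prod_offspring_integral:
  fixes h :: "nat \<Rightarrow> nat \<Rightarrow> 'b :: {real_normed_field, banach, second_countable_topology}"
  assumes "finite I" and int: "\<And>i. i \<in> I \<Longrightarrow> integrable (measure_pmf p) (h i)"
  shows "(\<integral>x. (\<Prod>i\<in>I. h i (X n i x)) \<partial>M) = (\<Prod>i\<in>I. measure_pmf.expectation p (h i))"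
    and "integrable M (\<lambda>x. \<Prod>i\<in>I. h i (X n i x))"
proof -
  let ?J = "Pair n ` I"
  have iv: "indep_vars (\<lambda>_. borel) (\<lambda>q x. h (snd q) ((case q of (j, i) \<Rightarrow> X j i) x)) ?J"
    by (rule indep_vars_compose2[OF indep_vars_subset[OF indep_offspring]]) auto
  have ii: "integrable M (\<lambda>x. h (snd q) ((case q of (j, i) \<Rightarrow> X j i) x))" if "q \<in> ?J" for q
    using int that by (auto simp: integral_offspring)
  have fin: "finite ?J" using assms(1) by simp
  show "(\<integral>x. (\<Prod>i\<in>I. h i (X n i x)) \<partial>M) = (\<Prod>i\<in>I. measure_pmf.expectation p (h i))"
    using indep_vars_lebesgue_integral[OF fin iv ii]
    by (simp add: prod.reindex inj_on_def integral_offspring)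
  show "integrable M (\<lambda>x. \<Prod>i\<in>I. h i (X n i x))"
    using indep_vars_integrable[OF fin iv ii] by (simp add: prod.reindex inj_on_def)
qed

text \<open>After expanding the square, every mixed term contains a centred factor and vanishes, and
  \<open>m\<close> equal diagonal terms remain. Constant \<open>w\<close> gives the variance of a
  sum; \<open>w j = s ^ j\<close> gives the unnormalised variance under a tilted offspring
  law.\<close>

lemma weighted_second_moment:
  fixes h w :: "nat \<Rightarrow> real"
  assumes i0: "integrable (measure_pmf p) w"
    and i1: "integrable (measure_pmf p) (\<lambda>j. h j * w j)"
    and i2: "integrable (measure_pmf p) (\<lambda>j. (h j)\<^sup>2 * w j)"
    and centred: "measure_pmf.expectation p (\<lambda>j. h j * w j) = 0"
  shows "(\<integral>x. (\<Sum>i<m. h (X n i x))\<^sup>2 * (\<Prod>i<m. w (X n i x)) \<partial>M) =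
      real m * measure_pmf.expectation p (\<lambda>j. (h j)\<^sup>2 * w j) * measure_pmf.expectation p w ^ (m - 1)"
    and "integrable M (\<lambda>x. (\<Sum>i<m. h (X n i x))\<^sup>2 * (\<Prod>i<m. w (X n i x)))"
proof -
  \<comment> \<open>The factor that individual \<open>l\<close> contributes to the term with indices
    \<open>i\<close> and \<open>j\<close>; for \<open>i = j\<close> both copies of \<open>h\<close>
    fall on the same individual.\<close>
  define k where "k i j l v = w v * (if l = i then h v else 1) * (if l = j then h v else 1)" for i j l :: nat and v
  have ik: "integrable (measure_pmf p) (k i j l)" for i j l
    using i0 i1 i2 unfolding k_def
    by (cases "l = i"; cases "l = j") (simp_all add: mult_ac power2_eq_square)
  have ek: "(\<Sum>i<m. h (X n i x))\<^sup>2 * (\<Prod>i<m. w (X n i x)) = (\<Sum>i<m. \<Sum>j<m. \<Prod>l<m. k i j l (X n l x))" for x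
  proof -
    have "(\<Prod>l<m. k i j l (X n l x)) = h (X n i x) * h (X n j x) * (\<Prod>l<m. w (X n l x))"
      if "i < m" "j < m" for i j
    proof -
      have "(\<Prod>l<m. k i j l (X n l x)) = (\<Prod>l<m. w (X n l x)) * (\<Prod>l<m. (if l = i then h (X n i x) else 1))
          * (\<Prod>l<m. (if l = j then h (X n j x) else 1))"
        unfolding k_def prod.distrib[symmetric] by (intro prod.cong) auto
      then show ?thesis using that by (simp add: prod.delta)
    qed
    then have "(\<Sum>i<m. \<Sum>j<m. \<Prod>l<m. k i j l (X n l x)) =
        (\<Sum>i<m. \<Sum>j<m. h (X n i x) * h (X n j x) * (\<Prod>l<m. w (X n l x)))"
      by (intro sum.cong refl) auto
    then show ?thesis
      unfolding power2_eq_square sum_product by (simp only: sum_distrib_right)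
  qed
  show "integrable M (\<lambda>x. (\<Sum>i<m. h (X n i x))\<^sup>2 * (\<Prod>i<m. w (X n i x)))"
    unfolding ek by (intro Bochner_Integration.integrable_sum prod_offspring_integral ik finite_lessThan)
  have off: "(\<Prod>l<m. measure_pmf.expectation p (k i j l)) = 0" if "i < m" "j < m" "i \<noteq> j" for i j
  proof -
    have "k i j i = (\<lambda>v. h v * w v)"
      using that by (simp add: k_def fun_eq_iff mult.commute)
    then have "measure_pmf.expectation p (k i j i) = 0"
      using centred by simp
    then show ?thesis using that by (intro prod_zero) auto
  qed
  have diag: "(\<Prod>l<m. measure_pmf.expectation p (k i i l)) =
      measure_pmf.expectation p (\<lambda>j. (h j)\<^sup>2 * w j) * measure_pmf.expectation p w ^ (m - 1)" if "i < m" for i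
  proof -
    have "(\<Prod>l<m. measure_pmf.expectation p (k i i l)) =
      measure_pmf.expectation p (k i i i) * (\<Prod>l\<in>{..<m} - {i}. measure_pmf.expectation p (k i i l))"
      using that by (intro prod.remove) auto
    also have "(\<Prod>l\<in>{..<m} - {i}. measure_pmf.expectation p (k i i l)) = (\<Prod>l\<in>{..<m} - {i}. measure_pmf.expectation p w)"
    proof (intro prod.cong refl)
      fix l assume "l \<in> {..<m} - {i}"
      then have "k i i l = w" by (simp add: k_def fun_eq_iff)
      then show "measure_pmf.expectation p (k i i l) = measure_pmf.expectation p w" by simp
    qed
    also have "k i i i = (\<lambda>j. (h j)\<^sup>2 * w j)" by (simp add: k_def fun_eq_iff power2_eq_square mult_ac)
    finally show ?thesis using that by simp
  qed
  have "(\<integral>x. (\<Sum>i<m. h (X n i x))\<^sup>2 * (\<Prod>i<m. w (X n i x)) \<partial>M) =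
      (\<Sum>i<m. \<Sum>j<m. \<Prod>l<m. measure_pmf.expectation p (k i j l))"
    unfolding ek
    by (simp add: Bochner_Integration.integral_sum Bochner_Integration.integrable_sum prod_offspring_integral ik)
  also have "\<dots> = (\<Sum>i<m. \<Prod>l<m. measure_pmf.expectation p (k i i l))"
  proof (intro sum.cong refl)
    fix i assume i: "i \<in> {..<m}"
    have "(\<Sum>j<m. \<Prod>l<m. measure_pmf.expectation p (k i j l)) =
       (\<Sum>j<m. if j = i then \<Prod>l<m. measure_pmf.expectation p (k i i l) else 0)"
      using i off by (intro sum.cong) auto
    then show "(\<Sum>j<m. \<Prod>l<m. measure_pmf.expectation p (k i j l)) = (\<Prod>l<m. measure_pmf.expectation p (k i i l))"
      using i by simp
  qed
  also have "\<dots> = real m * measure_pmf.expectation p (\<lambda>j. (h j)\<^sup>2 * w j) * measure_pmf.expectation p w ^ (m - 1)"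
    by (simp add: diag)
  finally show "(\<integral>x. (\<Sum>i<m. h (X n i x))\<^sup>2 * (\<Prod>i<m. w (X n i x)) \<partial>M) = \<dots>" .
qed

end

section \<open>The offspring law\<close>

text \<open>An expectation instead of a series, over a general field, so that the real and the
  complex version share their lemmas.\<close>

definition pgf :: "nat pmf \<Rightarrow> 'b \<Rightarrow> 'b :: {real_normed_field, banach, second_countable_topology}" where
  "pgf p s = measure_pmf.expectation p (\<lambda>n. s ^ n)"

text \<open>The generating function of N - mu, that is f(s) / s^mu continued to s = 0. On [0, 1] it
  stays between p_mu and 1, so its logarithm is bounded there, unlike that of f.\<close>

definition exgf :: "nat pmf \<Rightarrow> 'b \<Rightarrow> 'b :: {real_normed_field, banach, second_countable_topology}" where
  "exgf p s = measure_pmf.expectation p (\<lambda>n. s ^ (n - min_offspring p))"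

locale boettcher_gw = galton_watson M p X
  for M :: "'a measure" and p :: "nat pmf" and X :: "nat \<Rightarrow> nat \<Rightarrow> 'a \<Rightarrow> nat" +
  assumes nondegenerate: "\<not> (\<exists>c. AE n in measure_pmf p. n = c)"
    and NlogN: "integrable (measure_pmf p) (\<lambda>n. real n * ln (real n))"
    and mu_ge_2: "min_offspring p \<ge> 2"
begin

abbreviation "mu \<equiv> min_offspring p"
abbreviation "lam \<equiv> next_offspring p"
abbreviation "a \<equiv> offspring_mean p"
abbreviation "Z \<equiv> gen_size X"
abbreviation "W \<equiv> mart_limit p X"

lemma pmf_mu_pos: "pmf p mu > 0"
proof -
  obtain n where "n \<in> set_pmf p" using set_pmf_not_empty by fastforce
  then have "pmf p n > 0" by (simp add: pmf_positive)
  then show ?thesis unfolding min_offspring_def by (rule LeastI)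
qed

lemma set_pmf_ge_mu: "n \<in> set_pmf p \<Longrightarrow> mu \<le> n"
  unfolding min_offspring_def by (rule Least_le) (simp add: pmf_positive)

lemma AE_ge_mu: "AE n in measure_pmf p. mu \<le> n"
  by (rule AE_pmfI) (rule set_pmf_ge_mu)

lemma lam_props: "mu < lam" "pmf p lam > 0"
  and set_pmf_ge_lam: "n \<in> set_pmf p \<Longrightarrow> n \<noteq> mu \<Longrightarrow> lam \<le> n"
proof -
  have "\<exists>n\<in>set_pmf p. n \<noteq> mu"
    using nondegenerate by (auto simp: AE_measure_pmf_iff)
  then obtain n where "n \<in> set_pmf p" "n \<noteq> mu" by auto
  then have "mu < n \<and> pmf p n > 0"
    using set_pmf_ge_mu[of n] by (auto simp: pmf_positive)
  then have "mu < lam \<and> pmf p lam > 0"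
    unfolding next_offspring_def by (rule LeastI)
  then show "mu < lam" "pmf p lam > 0" by auto
  show "lam \<le> n" if "n \<in> set_pmf p" "n \<noteq> mu" for n
    unfolding next_offspring_def
    using that set_pmf_ge_mu[of n] by (intro Least_le) (auto simp: pmf_positive)
qed

text \<open>Since N >= 2 almost surely and ln 2 >= 1/2, N is dominated by 2 N log N.\<close>

lemma integrable_offspring: "integrable (measure_pmf p) real"
proof (rule Bochner_Integration.integrable_bound)
  show "integrable (measure_pmf p) (\<lambda>n. 2 * (real n * ln (real n)))"
    using NlogN by simp
  show "AE n in measure_pmf p. norm (real n) \<le> norm (2 * (real n * ln (real n)))"
  proof (rule AE_pmfI)
    fix n assume "n \<in> set_pmf p"
    then have n: "n \<ge> 2" using set_pmf_ge_mu[of n] mu_ge_2 by simp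
    have "1 / 2 \<le> ln (2::real)" using ln2_ge_two_thirds by simp
    also have "\<dots> \<le> ln (real n)" using n by simp
    finally have "real n * 1 \<le> real n * (2 * ln (real n))" by (intro mult_left_mono) auto
    moreover have "0 \<le> ln (real n)" using n by simp
    ultimately show "norm (real n) \<le> norm (2 * (real n * ln (real n)))"
      by (simp add: abs_mult mult_ac)
  qed
qed simp

lemma integrable_diff: "integrable (measure_pmf p) (\<lambda>n. real (n - mu))"
  by (rule Bochner_Integration.integrable_bound[OF integrable_offspring]) auto

lemma mean_eq: "a = real mu + measure_pmf.expectation p (\<lambda>n. real (n - mu))"
proof -
  have "a = measure_pmf.expectation p (\<lambda>n. real mu + real (n - mu))"
    unfolding offspring_mean_def
    by (rule integral_cong_AE) (auto intro!: AE_pmfI simp: set_pmf_ge_mu)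
  then show ?thesis using integrable_diff by simp
qed

lemma mean_gt_mu: "real mu < a"
proof -
  have "pmf p lam * real (lam - mu) \<le> measure_pmf.expectation p (\<lambda>n. real (n - mu))"
  proof -
    have "pmf p lam * real (lam - mu) = measure_pmf.expectation p (\<lambda>n. indicator {lam} n * real (lam - mu))"
      by (simp add: measure_pmf_single)
    also have "\<dots> \<le> measure_pmf.expectation p (\<lambda>n. real (n - mu))"
      by (intro integral_mono integrable_diff integrable_mult_left)
        (auto simp: indicator_def intro!: measure_pmf.integrable_const_bound[where B=1])
    finally show ?thesis .
  qed
  moreover have "0 < pmf p lam * real (lam - mu)" using lam_props by simp
  ultimately show ?thesis using mean_eq by linarith
qed

lemma mean_gt_1: "1 < a" and mean_pos: "0 < a" and mu_pos: "0 < mu" "0 < real mu" "1 < real mu"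
  using mean_gt_mu mu_ge_2 by auto

lemma integrable_power:
  fixes s :: "'b :: {real_normed_field, banach, second_countable_topology}"
  assumes "norm s \<le> 1"
  shows "integrable (measure_pmf p) (\<lambda>n. s ^ f n)"
  by (rule measure_pmf.integrable_const_bound[where B=1])
     (auto simp: norm_power assms power_le_one)

lemma pgf_eq: "pgf p s = s ^ mu * exgf p s"
  for s :: "'b :: {real_normed_field, banach, second_countable_topology}"
proof -
  have "pgf p s = measure_pmf.expectation p (\<lambda>n. s ^ mu * s ^ (n - mu))"
    unfolding pgf_def
    by (rule integral_cong_AE) (auto intro!: AE_pmfI simp: set_pmf_ge_mu simp flip: power_add)
  then show ?thesis unfolding exgf_def by simp
qed

lemma exgf_of_real: "exgf p (of_real s) = (of_real (exgf p s) :: 'b :: {real_normed_field, banach, second_countable_topology})"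
  if "\<bar>s\<bar> \<le> 1"
  unfolding exgf_def of_real_power[symmetric] using that
  by (intro has_bochner_integral_integral_eq has_bochner_integral_of_real has_bochner_integral_integrable integrable_power) simp

lemma pgf_of_real: "pgf p (of_real s) = (of_real (pgf p s) :: 'b :: {real_normed_field, banach, second_countable_topology})"
  if "\<bar>s\<bar> \<le> 1"
  unfolding pgf_def of_real_power[symmetric] using that integrable_power[of s id]
  by (intro has_bochner_integral_integral_eq has_bochner_integral_of_real has_bochner_integral_integrable) simp

lemma norm_exgf_le:
  fixes s :: "'b :: {real_normed_field, banach, second_countable_topology}"
  assumes "norm s \<le> 1"
  shows "norm (exgf p s) \<le> exgf p (norm s)"
  unfolding exgf_def
  using integral_norm_bound[of p "\<lambda>n. s ^ (n - mu)"] by (simp add: norm_power)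

lemma exgf_mono:
  fixes s t :: real
  assumes "0 \<le> s" "s \<le> t" "t \<le> 1"
  shows "exgf p s \<le> exgf p t"
  unfolding exgf_def using assms
  by (intro integral_mono integrable_power power_mono) auto

lemma exgf_bounds:
  fixes s :: real
  assumes "0 \<le> s" "s \<le> 1"
  shows "pmf p mu \<le> exgf p s" "exgf p s \<le> 1" "0 < exgf p s"
proof -
  have "exgf p s \<le> exgf p 1" using assms by (intro exgf_mono) auto
  then show "exgf p s \<le> 1" by (simp add: exgf_def)
  have "pmf p mu = measure_pmf.expectation p (\<lambda>n. indicator {mu} n)"
    by (simp add: measure_pmf_single)
  also have "\<dots> \<le> exgf p s" unfolding exgf_def
    using assms by (intro integral_mono integrable_power)
      (auto simp: indicator_def intro!: measure_pmf.integrable_const_bound[where B=1])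
  finally show "pmf p mu \<le> exgf p s" .
  with pmf_mu_pos show "0 < exgf p s" by linarith
qed

text \<open>On the unit ball the power n - mu has Lipschitz constant n - mu <= n, and n averages to
  \<open>a\<close>. This constant fixes the opening of the cone used later.\<close>

lemma exgf_lipschitz:
  fixes s t :: "'b :: {real_normed_field, banach, second_countable_topology}"
  assumes "norm s \<le> 1" "norm t \<le> 1"
  shows "norm (exgf p s - exgf p t) \<le> a * norm (s - t)"
proof -
  have "exgf p s - exgf p t = measure_pmf.expectation p (\<lambda>n. s ^ (n - mu) - t ^ (n - mu))"
    unfolding exgf_def using assms by (simp add: integrable_power)
  then have "norm (exgf p s - exgf p t) \<le> measure_pmf.expectation p (\<lambda>n. norm (s ^ (n - mu) - t ^ (n - mu)))"
    using integral_norm_bound by metis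
  also have "\<dots> \<le> measure_pmf.expectation p (\<lambda>n. real n * norm (s - t))"
  proof (rule integral_mono)
    show "integrable (measure_pmf p) (\<lambda>n. norm (s ^ (n - mu) - t ^ (n - mu)))"
      using assms by (intro integrable_norm Bochner_Integration.integrable_diff integrable_power)
    fix n
    have "norm (s ^ (n - mu) - t ^ (n - mu)) \<le> real (n - mu) * norm (s - t)"
      by (rule norm_power_diff) fact+
    also have "\<dots> \<le> real n * norm (s - t)" by (intro mult_right_mono) auto
    finally show "norm (s ^ (n - mu) - t ^ (n - mu)) \<le> real n * norm (s - t)" .
  qed (use integrable_offspring in simp)
  finally show ?thesis by (simp add: offspring_mean_def)
qed

text \<open>On the support either n = mu, where the difference is exactly 0, or n >= lam, where a
  power of exponent at least lam - mu remains.\<close>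

lemma exgf_near_0:
  fixes s :: "'b :: {real_normed_field, banach, second_countable_topology}"
  assumes "norm s \<le> 1"
  shows "norm (exgf p s - of_real (pmf p mu)) \<le> norm s ^ (lam - mu)"
proof -
  have "exgf p s - of_real (pmf p mu) = measure_pmf.expectation p (\<lambda>n. s ^ (n - mu) - of_real (indicator {mu} n))"
    unfolding exgf_def using assms
  proof (subst Bochner_Integration.integral_diff)
    have "has_bochner_integral (measure_pmf p) (\<lambda>n. of_real (indicator {mu} n) :: 'b) (of_real (pmf p mu))"
      by (intro has_bochner_integral_of_real) (simp add: has_bochner_integral_iff measure_pmf_single
        measure_pmf.integrable_const_bound[where B=1])
    then show "integrable (measure_pmf p) (\<lambda>n. of_real (indicator {mu} n) :: 'b)"
      "measure_pmf.expectation p (\<lambda>n. s ^ (n - mu)) - of_real (pmf p mu) =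
       measure_pmf.expectation p (\<lambda>n. s ^ (n - mu)) - measure_pmf.expectation p (\<lambda>n. of_real (indicator {mu} n))"
      by (auto simp: has_bochner_integral_iff)
  qed (rule integrable_power)
  then have "norm (exgf p s - of_real (pmf p mu)) \<le>
     measure_pmf.expectation p (\<lambda>n. norm (s ^ (n - mu) - of_real (indicator {mu} n)))"
    using integral_norm_bound by metis
  also have "\<dots> \<le> measure_pmf.expectation p (\<lambda>n. norm s ^ (lam - mu))"
  proof (rule integral_mono_AE)
    show "AE n in measure_pmf p. norm (s ^ (n - mu) - of_real (indicator {mu} n)) \<le> norm s ^ (lam - mu)"
    proof (rule AE_pmfI)
      fix n assume n: "n \<in> set_pmf p"
      show "norm (s ^ (n - mu) - of_real (indicator {mu} n)) \<le> norm s ^ (lam - mu)"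
      proof (cases "n = mu")
        case False
        then have "lam \<le> n" using set_pmf_ge_lam n by blast
        then show ?thesis using False assms by (auto simp: norm_power intro!: power_decreasing)
      qed simp
    qed
    show "integrable (measure_pmf p) (\<lambda>n. norm (s ^ (n - mu) - of_real (indicator {mu} n)))"
      using assms by (intro integrable_norm Bochner_Integration.integrable_diff integrable_power
          measure_pmf.integrable_const_bound[where B=1]) (auto simp: indicator_def)
  qed simp
  finally show ?thesis by simp
qed

lemma pgf_real_bounds:
  fixes s :: real
  assumes "0 \<le> s" "s \<le> 1"
  shows "0 \<le> pgf p s" "pgf p s \<le> s ^ mu" "pgf p s \<le> 1"
proof -
  show "0 \<le> pgf p s" and le: "pgf p s \<le> s ^ mu"
    using exgf_bounds[OF assms] assms by (auto simp: pgf_eq intro!: mult_left_le)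
  have "s ^ mu \<le> 1" using assms by (simp add: power_le_one)
  with le show "pgf p s \<le> 1" by linarith
qed

lemma norm_pgf_le_1:
  fixes s :: "'b :: {real_normed_field, banach, second_countable_topology}"
  assumes "norm s \<le> 1" shows "norm (pgf p s) \<le> 1"
proof -
  have "norm (exgf p s) \<le> 1"
    using norm_exgf_le[OF assms] exgf_bounds[of "norm s"] assms by simp
  then show ?thesis using assms by (auto simp: pgf_eq norm_mult norm_power intro!: mult_le_one power_le_one)
qed

lemma offspring_gf_eq: assumes "0 \<le> s" "s \<le> 1" shows "offspring_gf p s = pgf p s"
proof -
  have i: "integrable (count_space UNIV) (\<lambda>j. pmf p j * s ^ j)"
    using assms integrable_power[of s id]
    by (simp add: integrable_density measure_pmf_eq_density)
  have "pgf p s = (\<integral>j. pmf p j * s ^ j \<partial>count_space UNIV)"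
    unfolding pgf_def measure_pmf_eq_density by (subst integral_density) auto
  then show ?thesis using i by (simp add: offspring_gf_def integral_count_space_nat)
qed

section \<open>Generating functions of the generation sizes\<close>

lemma one_step_pgf:
  fixes s :: "'b :: {real_normed_field, banach, second_countable_topology}"
  assumes A: "A \<in> past n" and s: "norm s \<le> 1"
  shows "(\<integral>x. indicator A x *\<^sub>R s ^ Z (Suc n) x \<partial>M) = (\<integral>x. indicator A x *\<^sub>R pgf p s ^ Z n x \<partial>M)"
proof -
  have "(\<integral>x. indicator A x *\<^sub>R s ^ Z (Suc n) x \<partial>M) =
      (\<integral>x. indicator A x *\<^sub>R (\<integral>y. s ^ (\<Sum>i<Z n x. X n i y) \<partial>M) \<partial>M)"
    using one_step_integral[OF A, of "\<lambda>m l. s ^ l" 1] s by (simp add: norm_power power_le_one)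
  moreover have "(\<integral>y. s ^ (\<Sum>i<m. X n i y) \<partial>M) = pgf p s ^ m" for m
    using prod_offspring_integral(1)[of "{..<m}" "\<lambda>_ j. s ^ j" n] integrable_power[OF s, of id]
    by (simp add: power_sum pgf_def)
  ultimately show ?thesis by simp
qed

lemma pgf_iter_norm_le_1:
  fixes s :: "'b :: {real_normed_field, banach, second_countable_topology}"
  shows "norm s \<le> 1 \<Longrightarrow> norm ((pgf p ^^ m) s) \<le> 1"
  by (induction m) (auto intro: norm_pgf_le_1)

lemma multi_step_pgf:
  fixes s :: "'b :: {real_normed_field, banach, second_countable_topology}"
  assumes A: "A \<in> past k" and s: "norm s \<le> 1"
  shows "(\<integral>x. indicator A x *\<^sub>R s ^ Z (m + k) x \<partial>M) = (\<integral>x. indicator A x *\<^sub>R (pgf p ^^ m) s ^ Z k x \<partial>M)"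
  using s
proof (induction m arbitrary: s)
  case (Suc m)
  have "(\<integral>x. indicator A x *\<^sub>R s ^ Z (Suc m + k) x \<partial>M) = (\<integral>x. indicator A x *\<^sub>R pgf p s ^ Z (m + k) x \<partial>M)"
    using one_step_pgf[OF past_mono[OF A] Suc.prems, of "m + k"] by simp
  also have "\<dots> = (\<integral>x. indicator A x *\<^sub>R (pgf p ^^ m) (pgf p s) ^ Z k x \<partial>M)"
    by (rule Suc.IH) (rule norm_pgf_le_1[OF Suc.prems])
  finally show ?case by (simp add: funpow_swap1)
qed simp

lemma gen_size_pos_lower: "AE x in M. \<forall>n. mu ^ n \<le> Z n x \<and> mu * Z n x \<le> Z (Suc n) x"
proof -
  have "AE x in M. mu \<le> X n i x" for n i
  proof -
    have "AE j in distr M (count_space UNIV) (X n i). mu \<le> j"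
      unfolding distr_offspring by (rule AE_ge_mu)
    then show ?thesis by (subst (asm) AE_distr_iff) auto
  qed
  then have "AE x in M. \<forall>n i. mu \<le> X n i x" by (simp add: AE_all_countable)
  then show ?thesis
  proof eventually_elim
    case (elim x)
    have step: "mu * Z n x \<le> Z (Suc n) x" for n
      using sum_mono[of "{..<Z n x}" "\<lambda>_. mu" "\<lambda>i. X n i x"] elim by (simp add: mult.commute)
    have "mu ^ n \<le> Z n x" for n
    proof (induction n)
      case (Suc n)
      have "mu ^ Suc n \<le> mu * Z n x" using Suc by simp
      with step[of n] show ?case by linarith
    qed simp
    with step show ?case by blast
  qed
qed

section \<open>The martingale limit\<close>

lemma nn_offspring: "(\<integral>\<^sup>+x. ennreal (real (X n i x)) \<partial>M) = ennreal a"
proof -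
  have "(\<integral>\<^sup>+x. ennreal (real (X n i x)) \<partial>M) = ennreal (\<integral>x. real (X n i x) \<partial>M)"
    by (rule nn_integral_eq_integral) (simp_all add: integral_offspring integrable_offspring)
  then show ?thesis by (simp add: integral_offspring offspring_mean_def)
qed

lemma nn_gen_size: "(\<integral>\<^sup>+x. ennreal (real (Z n x)) \<partial>M) = ennreal (a ^ n)"
proof (induction n)
  case (Suc n)
  have inner: "(\<integral>\<^sup>+y. ennreal (real (\<Sum>i<m. X n i y)) \<partial>M) = ennreal (real m * a)" for m
  proof -
    have "(\<integral>\<^sup>+y. ennreal (real (\<Sum>i<m. X n i y)) \<partial>M) = (\<integral>\<^sup>+y. (\<Sum>i<m. ennreal (real (X n i y))) \<partial>M)"
      by (simp add: sum_ennreal)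
    also have "\<dots> = (\<Sum>i<m. \<integral>\<^sup>+y. ennreal (real (X n i y)) \<partial>M)"
      by (rule nn_integral_sum) measurable
    also have "\<dots> = ennreal (real m * a)"
      using mean_pos by (simp add: nn_offspring ennreal_mult ennreal_of_nat_eq_real_of_nat)
    finally show ?thesis .
  qed
  have "(\<integral>\<^sup>+x. ennreal (real (Z (Suc n) x)) \<partial>M) = (\<integral>\<^sup>+x. ennreal a * ennreal (real (Z n x)) \<partial>M)"
    unfolding one_step_nn_integral[of "\<lambda>_ l. ennreal (real l)"] inner
    using mean_pos by (simp add: ennreal_mult mult.commute)
  also have "\<dots> = ennreal a * ennreal (a ^ n)"
    by (subst nn_integral_cmult) (simp_all add: Suc)
  also have "\<dots> = ennreal (a ^ Suc n)"
    using mean_pos by (simp add: ennreal_mult)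
  finally show ?case .
qed (simp add: emeasure_space_1)

lemma integral_gen_size: "integrable M (\<lambda>x. real (Z n x))" "(\<integral>x. real (Z n x) \<partial>M) = a ^ n"
proof -
  show "integrable M (\<lambda>x. real (Z n x))"
    by (rule integrableI_nonneg) (simp_all add: nn_gen_size)
  show "(\<integral>x. real (Z n x) \<partial>M) = a ^ n"
    using mean_pos by (subst integral_eq_nn_integral) (simp_all add: nn_gen_size)
qed

section \<open>Truncation and summability of the martingale increments in L1\<close>

definition tail_mean :: "real \<Rightarrow> real" where
  "tail_mean c = measure_pmf.expectation p (\<lambda>j. if real j \<le> c then 0 else real j)"

lemma integrable_tail: "integrable (measure_pmf p) (\<lambda>j. if real j \<le> c then 0 else real j)"
  by (rule Bochner_Integration.integrable_bound[OF integrable_offspring]) auto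

lemma integrable_trunc: "integrable (measure_pmf p) (\<lambda>j. if real j \<le> c then real j else 0)"
  by (rule Bochner_Integration.integrable_bound[OF integrable_offspring]) auto

lemma tail_mean_nonneg: "0 \<le> tail_mean c"
  unfolding tail_mean_def by (rule integral_nonneg_AE) auto

text \<open>Offspring numbers are cut at \<open>c\<close>: the centred truncated sum is estimated by
  its variance, the remainder by its mean. The bound is affine in \<open>m\<close>, so it can
  afterwards be averaged over the size of a generation.\<close>

lemma L1_deviation:
  fixes c d :: real
  assumes c: "0 \<le> c" and d: "0 < d"
  shows "(\<integral>\<^sup>+y. ennreal \<bar>real (\<Sum>i<m. X n i y) - a * real m\<bar> \<partial>M) \<le>
     ennreal ((real m * (c * a) / d + d) / 2 + 2 * real m * tail_mean c)"
proof -
  let ?t = "\<lambda>j. if real j \<le> c then real j else 0" and ?s = "\<lambda>j. if real j \<le> c then 0 else real j"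
  define v where "v = measure_pmf.expectation p ?t"
  define h where "h j = ?t j - v" for j
  let ?S = "\<lambda>y. \<Sum>i<m. h (X n i y)"
  have av: "a - v = tail_mean c"
  proof -
    have "v + tail_mean c = measure_pmf.expectation p (\<lambda>j. ?t j + ?s j)"
      unfolding v_def tail_mean_def by (simp add: integrable_tail integrable_trunc)
    also have "(\<lambda>j. ?t j + ?s j) = real" by auto
    finally show ?thesis by (simp add: offspring_mean_def)
  qed
  have v0: "0 \<le> v" unfolding v_def by (rule integral_nonneg_AE) auto
  have it2: "integrable (measure_pmf p) (\<lambda>j. (?t j)\<^sup>2)"
    using c by (intro measure_pmf.integrable_const_bound[where B="c\<^sup>2"]) (auto intro!: power_mono)
  have ih: "integrable (measure_pmf p) h"
    unfolding h_def by (intro Bochner_Integration.integrable_diff integrable_trunc) simp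
  have ih2: "integrable (measure_pmf p) (\<lambda>j. (h j)\<^sup>2)"
    unfolding h_def power2_diff
    by (intro Bochner_Integration.integrable_diff Bochner_Integration.integrable_add it2
        integrable_mult_left integrable_mult_right integrable_trunc) simp
  have eh: "measure_pmf.expectation p h = 0"
    unfolding h_def by (simp add: integrable_trunc v_def)
  have "measure_pmf.expectation p (\<lambda>j. (h j)\<^sup>2) = measure_pmf.expectation p (\<lambda>j. (?t j)\<^sup>2) - v\<^sup>2"
    unfolding h_def power2_diff
    by (simp add: it2 integrable_trunc integrable_mult_left integrable_mult_right flip: v_def)
      (simp add: power2_eq_square)
  also have "\<dots> \<le> measure_pmf.expectation p (\<lambda>j. (?t j)\<^sup>2)" by simp
  also have "\<dots> \<le> measure_pmf.expectation p (\<lambda>j. c * real j)"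
    using c by (intro integral_mono it2 integrable_mult_right integrable_offspring)
      (auto simp: power2_eq_square intro: mult_right_mono)
  also have "\<dots> = c * a" by (simp add: offspring_mean_def)
  finally have eh2: "measure_pmf.expectation p (\<lambda>j. (h j)\<^sup>2) \<le> c * a" .
  note var = weighted_second_moment[of "\<lambda>_. 1" h n m, simplified, OF ih ih2 eh]
  have pt: "\<bar>real (\<Sum>i<m. X n i y) - a * real m\<bar> \<le>
     ((?S y)\<^sup>2 / d + d) / 2 + ((\<Sum>i<m. ?s (X n i y)) + real m * tail_mean c)" for y
  proof -
    have "real (\<Sum>i<m. X n i y) - a * real m = (\<Sum>i<m. h (X n i y) + ?s (X n i y) - tail_mean c)"
    proof -
      have "h j + ?s j - tail_mean c = real j - a" for j
        using av by (auto simp: h_def)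
      then show ?thesis by (simp add: sum_subtractf mult.commute)
    qed
    also have "\<dots> = ?S y + ((\<Sum>i<m. ?s (X n i y)) - real m * tail_mean c)"
      by (simp add: sum.distrib sum_subtractf)
    finally have e: "real (\<Sum>i<m. X n i y) - a * real m = ?S y + ((\<Sum>i<m. ?s (X n i y)) - real m * tail_mean c)" .
    \<comment> \<open>The inequality 2 d x <= x^2 + d^2 replaces Cauchy-Schwarz: it avoids the
      square root of the second moment and leaves \<open>d\<close> free to be optimised.\<close>
    have "\<bar>?S y\<bar> \<le> ((?S y)\<^sup>2 / d + d) / 2"
    proof -
      have "0 \<le> (\<bar>?S y\<bar> - d)\<^sup>2" by simp
      then have "2 * d * \<bar>?S y\<bar> \<le> (?S y)\<^sup>2 + d\<^sup>2" by (simp add: power2_diff mult_ac)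
      then show ?thesis using d by (simp add: field_simps power2_eq_square)
    qed
    moreover have "0 \<le> (\<Sum>i<m. ?s (X n i y))" by (intro sum_nonneg) auto
    moreover have "0 \<le> real m * tail_mean c" using tail_mean_nonneg by simp
    ultimately show ?thesis unfolding e by linarith
  qed
  have is1: "integrable M (\<lambda>y. ?s (X n i y))" for i
    using integrable_tail[of c] integral_offspring(2)[of ?s n i] by simp
  have isum: "integrable M (\<lambda>y. \<Sum>i<m. ?s (X n i y))"
    by (intro Bochner_Integration.integrable_sum is1)
  have es: "(\<integral>y. (\<Sum>i<m. ?s (X n i y)) \<partial>M) = real m * tail_mean c"
  proof -
    have "(\<integral>y. ?s (X n i y) \<partial>M) = tail_mean c" for i
      unfolding tail_mean_def by (rule integral_offspring(1)[of ?s])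
    then show ?thesis using is1 by (simp add: Bochner_Integration.integral_sum)
  qed
  have ii: "integrable M (\<lambda>y. ((?S y)\<^sup>2 / d + d) / 2 + ((\<Sum>i<m. ?s (X n i y)) + real m * tail_mean c))"
    using var(2) isum by (intro Bochner_Integration.integrable_add Bochner_Integration.integrable_divide) auto
  have "(\<integral>\<^sup>+y. ennreal \<bar>real (\<Sum>i<m. X n i y) - a * real m\<bar> \<partial>M) \<le>
     (\<integral>\<^sup>+y. ennreal (((?S y)\<^sup>2 / d + d) / 2 + ((\<Sum>i<m. ?s (X n i y)) + real m * tail_mean c)) \<partial>M)"
    by (intro nn_integral_mono ennreal_leI pt)
  also have "\<dots> = ennreal (\<integral>y. ((?S y)\<^sup>2 / d + d) / 2 + ((\<Sum>i<m. ?s (X n i y)) + real m * tail_mean c) \<partial>M)"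
    using ii by (rule nn_integral_eq_integral) (use pt in \<open>auto intro: order_trans[OF abs_ge_zero]\<close>)
  also have "(\<integral>y. ((?S y)\<^sup>2 / d + d) / 2 + ((\<Sum>i<m. ?s (X n i y)) + real m * tail_mean c) \<partial>M) =
      ((\<integral>y. (?S y)\<^sup>2 \<partial>M) / d + d) / 2 + ((\<integral>y. (\<Sum>i<m. ?s (X n i y)) \<partial>M) + real m * tail_mean c)"
    using var(2) isum by (simp add: prob_space)
  also have "\<dots> \<le> (real m * (c * a) / d + d) / 2 + 2 * real m * tail_mean c"
  proof -
    have "(\<integral>y. (?S y)\<^sup>2 \<partial>M) \<le> real m * (c * a)"
      unfolding var(1) using eh2 by (simp add: mult_left_mono)
    then have "(\<integral>y. (?S y)\<^sup>2 \<partial>M) / d \<le> real m * (c * a) / d"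
      using d by (intro divide_right_mono) auto
    moreover have "(u + d) / 2 + (t + t) \<le> (v + d) / 2 + 2 * t" if "u \<le> v" for u v t :: real
      using that by simp
    ultimately show ?thesis unfolding es by (simp only: mult.assoc)
  qed
  finally show ?thesis by (simp add: ennreal_leI)
qed

text \<open>A fourth root of the mean, so that the truncation level a^(n/2) and the balancing
  parameter a^(3n/4) are both natural powers of it.\<close>

definition qrt :: real where "qrt = a powr (1/4)"

lemma qrt: "1 < qrt" "qrt ^ 4 = a"
proof -
  show "1 < qrt" using mean_gt_1 by (simp add: qrt_def)
  have "qrt ^ 4 = qrt powr 4" using \<open>1 < qrt\<close> by (simp add: powr_numeral)
  also have "\<dots> = a" using mean_pos by (simp add: qrt_def powr_powr)
  finally show "qrt ^ 4 = a" .
qed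

text \<open>After exchanging sum and expectation, the value j is counted for those n with
  \<open>qrt ^ (2 * n) < j\<close>, at most 1 + ln j / ln qrt many; the N log N moment controls the
  result.\<close>

lemma summable_tail_mean: "summable (\<lambda>n. tail_mean (qrt ^ (2 * n)))"
proof (rule summableI_nonneg_bounded)
  let ?b = "\<lambda>j. real j * (1 + ln (real j) / ln qrt)"
  have lq: "0 < ln qrt" using qrt by simp
  have ib: "integrable (measure_pmf p) ?b"
  proof -
    have "?b = (\<lambda>j. real j + (real j * ln (real j)) / ln qrt)" by (auto simp: field_simps)
    then show ?thesis using integrable_offspring NlogN by simp
  qed
  fix N
  have "(\<Sum>n<N. tail_mean (qrt ^ (2 * n))) = measure_pmf.expectation p (\<lambda>j. \<Sum>n<N. if real j \<le> qrt ^ (2 * n) then 0 else real j)"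
    unfolding tail_mean_def by (simp add: integrable_tail Bochner_Integration.integral_sum)
  also have "\<dots> \<le> measure_pmf.expectation p ?b"
  proof (intro integral_mono_AE Bochner_Integration.integrable_sum integrable_tail ib AE_pmfI)
    fix j assume "j \<in> set_pmf p"
    then have j: "j \<ge> 1" using set_pmf_ge_mu[of j] mu_ge_2 by simp
    have l0: "0 \<le> ln (real j) / ln qrt" using j lq by simp
    have "(\<Sum>n<N. if real j \<le> qrt ^ (2 * n) then 0 else real j) = (\<Sum>n\<in>{n. n < N \<and> \<not> real j \<le> qrt ^ (2 * n)}. real j)"
      by (simp add: sum.If_cases Int_def)
    also have "\<dots> = real j * real (card {n. n < N \<and> \<not> real j \<le> qrt ^ (2 * n)})" by simp
    also have "\<dots> \<le> real j * (1 + ln (real j) / ln qrt)"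
    proof (intro mult_left_mono)
      have sub: "{n. n < N \<and> \<not> real j \<le> qrt ^ (2 * n)} \<subseteq> {..nat \<lfloor>ln (real j) / ln qrt\<rfloor>}"
      proof safe
        fix n assume n: "\<not> real j \<le> qrt ^ (2 * n)"
        have "qrt ^ n \<le> qrt ^ (2 * n)" using qrt by (intro power_increasing) auto
        then have "qrt ^ n < real j" using n by linarith
        then have "ln (qrt ^ n) < ln (real j)" using qrt j by (subst ln_less_cancel_iff) auto
        then have "real n < ln (real j) / ln qrt" using qrt lq by (simp add: ln_realpow field_simps)
        then show "n \<le> nat \<lfloor>ln (real j) / ln qrt\<rfloor>" by linarith
      qed
      then have "card {n. n < N \<and> \<not> real j \<le> qrt ^ (2 * n)} \<le> card {..nat \<lfloor>ln (real j) / ln qrt\<rfloor>}"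
        by (intro card_mono) auto
      also have "\<dots> = nat \<lfloor>ln (real j) / ln qrt\<rfloor> + 1" by simp
      finally show "real (card {n. n < N \<and> \<not> real j \<le> qrt ^ (2 * n)}) \<le> 1 + ln (real j) / ln qrt"
        using l0 by linarith
    qed simp
    finally show "(\<Sum>n<N. if real j \<le> qrt ^ (2 * n) then 0 else real j) \<le> ?b j" .
  qed
  finally show "(\<Sum>n<N. tail_mean (qrt ^ (2 * n))) \<le> measure_pmf.expectation p ?b" .
qed (rule tail_mean_nonneg)

definition scaled_size :: "nat \<Rightarrow> 'a \<Rightarrow> real" where
  "scaled_size n x = real (Z n x) / a ^ n"

lemma scaled_size_measurable [measurable]: "scaled_size n \<in> borel_measurable M"
  unfolding scaled_size_def by measurable

definition incr_bound :: "nat \<Rightarrow> real" where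
  "incr_bound n = (a + 1) / 2 * (1 / qrt) ^ n + 2 * tail_mean (qrt ^ (2 * n))"

lemma incr_bound_nonneg: "0 \<le> incr_bound n"
  unfolding incr_bound_def using tail_mean_nonneg qrt mean_pos by (intro add_nonneg_nonneg) auto

text \<open>
  The truncation level \<open>a\<^sup>n\<^sup>/\<^sup>2\<close> makes the \<open>L\<^sup>1\<close> norms of the increments summable,
  so that no martingale convergence theorem is needed.
\<close>

lemma L1_increment:
  "(\<integral>\<^sup>+x. ennreal \<bar>scaled_size (Suc n) x - scaled_size n x\<bar> \<partial>M) \<le> ennreal (incr_bound n)"
proof -
  define c where "c = qrt ^ (2 * n)"
  \<comment> \<open>With this \<open>d\<close>, the variance term and \<open>d\<close> itself are
    both of order a^(3n/4) in mean; after division by a^n a multiple of (1 / qrt)^n is left.\<close>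
  define d where "d = qrt ^ (3 * n)"
  have pos: "0 < c" "0 < d" "0 < qrt" using qrt by (auto simp: c_def d_def)
  have an: "a ^ n = qrt ^ (4 * n)" using qrt by (simp add: power_mult)
  have "(\<integral>\<^sup>+x. ennreal \<bar>real (Z (Suc n) x) - a * real (Z n x)\<bar> \<partial>M) =
     (\<integral>\<^sup>+x. (\<integral>\<^sup>+y. ennreal \<bar>real (\<Sum>i<Z n x. X n i y) - a * real (Z n x)\<bar> \<partial>M) \<partial>M)"
    by (rule one_step_nn_integral[of "\<lambda>m l. ennreal \<bar>real l - a * real m\<bar>"])
  also have "\<dots> \<le> (\<integral>\<^sup>+x. ennreal ((real (Z n x) * (c * a) / d + d) / 2 + 2 * real (Z n x) * tail_mean c) \<partial>M)"
    using pos by (intro nn_integral_mono L1_deviation) auto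
  also have "\<dots> = ennreal (\<integral>x. (real (Z n x) * (c * a) / d + d) / 2 + 2 * real (Z n x) * tail_mean c \<partial>M)"
    using pos mean_pos tail_mean_nonneg[of c]
    by (intro nn_integral_eq_integral Bochner_Integration.integrable_add Bochner_Integration.integrable_divide
        integrable_mult_left integrable_mult_right integral_gen_size AE_I2 add_nonneg_nonneg) auto
  also have "(\<integral>x. (real (Z n x) * (c * a) / d + d) / 2 + 2 * real (Z n x) * tail_mean c \<partial>M) =
      (a ^ n * (c * a) / d + d) / 2 + 2 * a ^ n * tail_mean c"
    by (simp add: integral_gen_size prob_space mult_ac)
  also have "a ^ n * (c * a) / d = a * d"
    unfolding an c_def d_def using pos
    by (simp add: field_simps flip: power_add)
  also have "(a * d + d) / 2 + 2 * a ^ n * tail_mean c = a ^ n * incr_bound n"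
  proof -
    have "d = a ^ n * (1 / qrt) ^ n"
      unfolding an d_def using pos by (simp add: power_divide field_simps flip: power_add)
    then have "a ^ n * incr_bound n = (a + 1) / 2 * d + 2 * a ^ n * tail_mean c"
      unfolding incr_bound_def by (simp add: c_def algebra_simps)
    then show ?thesis by (simp add: field_simps)
  qed
  finally have *: "(\<integral>\<^sup>+x. ennreal \<bar>real (Z (Suc n) x) - a * real (Z n x)\<bar> \<partial>M) \<le> ennreal (a ^ n * incr_bound n)" .
  have "(\<integral>\<^sup>+x. ennreal \<bar>scaled_size (Suc n) x - scaled_size n x\<bar> \<partial>M) =
     (\<integral>\<^sup>+x. ennreal (1 / a ^ Suc n) * ennreal \<bar>real (Z (Suc n) x) - a * real (Z n x)\<bar> \<partial>M)"
  proof (intro nn_integral_cong)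
    fix x
    have "scaled_size (Suc n) x - scaled_size n x = (1 / a ^ Suc n) * (real (Z (Suc n) x) - a * real (Z n x))"
      using mean_pos by (simp add: scaled_size_def field_simps)
    then have "\<bar>scaled_size (Suc n) x - scaled_size n x\<bar> = 1 / a ^ Suc n * \<bar>real (Z (Suc n) x) - a * real (Z n x)\<bar>"
      using mean_pos by (simp add: abs_mult del: gen_size.simps)
    moreover have "0 \<le> 1 / a ^ Suc n" using mean_pos by simp
    ultimately show "ennreal \<bar>scaled_size (Suc n) x - scaled_size n x\<bar> =
        ennreal (1 / a ^ Suc n) * ennreal \<bar>real (Z (Suc n) x) - a * real (Z n x)\<bar>"
      by (simp only: ennreal_mult abs_ge_zero)
  qed
  also have "\<dots> = ennreal (1 / a ^ Suc n) * (\<integral>\<^sup>+x. ennreal \<bar>real (Z (Suc n) x) - a * real (Z n x)\<bar> \<partial>M)"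
    by (rule nn_integral_cmult) measurable
  also have "\<dots> \<le> ennreal (1 / a ^ Suc n) * ennreal (a ^ n * incr_bound n)"
    using * by (rule mult_left_mono) simp
  also have "\<dots> = ennreal (incr_bound n / a)"
    using mean_pos incr_bound_nonneg by (simp flip: ennreal_mult)
  also have "\<dots> \<le> ennreal (incr_bound n)"
    using mean_gt_1 incr_bound_nonneg[of n] mult_right_mono[of 1 a "incr_bound n"]
    by (intro ennreal_leI) (simp add: field_simps)
  finally show ?thesis .
qed

lemma summable_incr_bound: "summable incr_bound"
  unfolding incr_bound_def using qrt
  by (intro summable_add summable_mult summable_tail_mean summable_geometric) simp

lemma nn_total_increment:
  "(\<integral>\<^sup>+x. (\<Sum>n. ennreal \<bar>scaled_size (Suc n) x - scaled_size n x\<bar>) \<partial>M) < \<infinity>"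
proof -
  have "(\<integral>\<^sup>+x. (\<Sum>n. ennreal \<bar>scaled_size (Suc n) x - scaled_size n x\<bar>) \<partial>M) =
     (\<Sum>n. \<integral>\<^sup>+x. ennreal \<bar>scaled_size (Suc n) x - scaled_size n x\<bar> \<partial>M)"
    by (rule nn_integral_suminf) measurable
  also have "\<dots> \<le> (\<Sum>n. ennreal (incr_bound n))"
    by (intro suminf_le L1_increment) auto
  also have "\<dots> < \<infinity>"
    using ennreal_suminf_neq_top[OF summable_incr_bound incr_bound_nonneg] by (simp add: top.not_eq_extremum)
  finally show ?thesis .
qed

text \<open>Its almost sure finiteness yields the limit, and \<open>1 + total_incr\<close> is an
  integrable majorant of the whole sequence, which yields E W = 1 by dominated convergence.\<close>

definition total_incr :: "'a \<Rightarrow> real" where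
  "total_incr x = (\<Sum>n. \<bar>scaled_size (Suc n) x - scaled_size n x\<bar>)"

lemma AE_summable_increment: "AE x in M. summable (\<lambda>n. \<bar>scaled_size (Suc n) x - scaled_size n x\<bar>)"
proof -
  have "AE x in M. (\<Sum>n. ennreal \<bar>scaled_size (Suc n) x - scaled_size n x\<bar>) \<noteq> \<infinity>"
    using nn_total_increment by (intro nn_integral_PInf_AE) auto
  then show ?thesis
    by eventually_elim (auto intro: summable_suminf_not_top)
qed

lemma integrable_total_incr: "integrable M total_incr"
proof (rule integrableI_nonneg)
  show "total_incr \<in> borel_measurable M" unfolding total_incr_def by measurable
  show "AE x in M. 0 \<le> total_incr x"
    using AE_summable_increment by eventually_elim (auto simp: total_incr_def intro: suminf_nonneg)
  have "(\<integral>\<^sup>+x. ennreal (total_incr x) \<partial>M) = (\<integral>\<^sup>+x. (\<Sum>n. ennreal \<bar>scaled_size (Suc n) x - scaled_size n x\<bar>) \<partial>M)"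
    using AE_summable_increment
    by (intro nn_integral_cong_AE, eventually_elim) (simp add: total_incr_def suminf_ennreal2)
  then show "(\<integral>\<^sup>+x. ennreal (total_incr x) \<partial>M) < \<infinity>"
    using nn_total_increment by simp
qed

lemma AE_scaled_size_tendsto: "AE x in M. (\<lambda>n. scaled_size n x) \<longlonglongrightarrow> W x"
  using AE_summable_increment
proof eventually_elim
  case (elim x)
  then have "summable (\<lambda>n. scaled_size (Suc n) x - scaled_size n x)"
    by (rule summable_rabs_cancel)
  then have "convergent (\<lambda>n. scaled_size n x - scaled_size 0 x)"
    using sum_lessThan_telescope[of "\<lambda>n. scaled_size n x"] by (simp add: summable_iff_convergent)
  then have "convergent (\<lambda>n. scaled_size n x)"
    by (simp add: convergent_diff_const_right_iff)
  then show ?case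
    by (simp add: convergent_LIMSEQ_iff mart_limit_def scaled_size_def)
qed

lemma scaled_size_bound: "AE x in M. \<forall>n. \<bar>scaled_size n x\<bar> \<le> 1 + total_incr x"
  using AE_summable_increment
proof eventually_elim
  case (elim x)
  have "\<bar>scaled_size n x\<bar> \<le> 1 + total_incr x" for n
  proof -
    have "scaled_size n x = 1 + (\<Sum>k<n. scaled_size (Suc k) x - scaled_size k x)"
      by (subst sum_lessThan_telescope) (simp add: scaled_size_def)
    also have "\<bar>\<dots>\<bar> \<le> 1 + (\<Sum>k<n. \<bar>scaled_size (Suc k) x - scaled_size k x\<bar>)"
      by (rule order_trans[OF abs_triangle_ineq]) (simp add: sum_abs)
    also have "\<dots> \<le> 1 + total_incr x"
      unfolding total_incr_def using elim by (intro add_left_mono sum_le_suminf) auto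
    finally show ?thesis .
  qed
  then show ?case by blast
qed

lemma W_measurable [measurable]: "W \<in> borel_measurable M"
  unfolding mart_limit_def by measurable

lemma integrable_W: "integrable M W" and integral_W: "(\<integral>x. W x \<partial>M) = 1"
proof -
  have dct: "integrable M W" "(\<lambda>n. \<integral>x. scaled_size n x \<partial>M) \<longlonglongrightarrow> (\<integral>x. W x \<partial>M)"
  proof -
    have w: "integrable M (\<lambda>x. 1 + total_incr x)" using integrable_total_incr by simp
    have b: "AE x in M. norm (scaled_size n x) \<le> 1 + total_incr x" for n
      using scaled_size_bound by eventually_elim simp
    show "integrable M W"
      by (rule integrable_dominated_convergence[OF W_measurable scaled_size_measurable w AE_scaled_size_tendsto b])
    show "(\<lambda>n. \<integral>x. scaled_size n x \<partial>M) \<longlonglongrightarrow> (\<integral>x. W x \<partial>M)"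
      by (rule integral_dominated_convergence[OF W_measurable scaled_size_measurable w AE_scaled_size_tendsto b])
  qed
  then show "integrable M W" by blast
  have "(\<integral>x. scaled_size n x \<partial>M) = 1" for n
    unfolding scaled_size_def using integral_gen_size mean_pos by simp
  with dct(2) show "(\<integral>x. W x \<partial>M) = 1" by (simp add: LIMSEQ_const_iff)
qed

lemma W_nonneg: "AE x in M. 0 \<le> W x"
  using AE_scaled_size_tendsto
proof eventually_elim
  case (elim x)
  moreover have "0 \<le> scaled_size n x" for n
    using mean_pos by (simp add: scaled_size_def)
  ultimately show ?case by (intro LIMSEQ_le_const) auto
qed

end

section \<open>The Laplace transform of the limit\<close>

text \<open>The derivative of exp(-z) has modulus at most 1 on the closed right half-plane, which is
  convex.\<close>

lemma norm_exp_minus_diff_le: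
  fixes x y :: complex
  assumes "0 \<le> Re x" "0 \<le> Re y"
  shows "norm (exp (- x) - exp (- y)) \<le> norm (x - y)"
proof -
  have "norm (exp (- x) - exp (- y)) \<le> 1 * norm (x - y)"
  proof (rule field_differentiable_bound[where S = "{z. 0 \<le> Re z}" and f = "\<lambda>z. exp (- z)" and f' = "\<lambda>z. - exp (- z)"])
    show "convex {z. 0 \<le> Re z}" by (rule convex_halfspace_Re_ge)
    show "((\<lambda>z. exp (- z)) has_field_derivative - exp (- z)) (at z within {z. 0 \<le> Re z})" for z
      by (auto intro!: derivative_eq_intros)
  qed (use assms in auto)
  then show ?thesis by simp
qed

context boettcher_gw
begin

abbreviation "lap \<equiv> laplace_W M p X"

definition phi :: "complex \<Rightarrow> complex" where
  "phi z = (\<integral>x. exp (- z * of_real (W x)) \<partial>M)"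

lemma AE_norm_exp_W_le_1: "0 \<le> Re z \<Longrightarrow> AE x in M. norm (exp (- z * of_real (W x))) \<le> 1"
  using W_nonneg by eventually_elim simp

lemma integrable_exp_W: "0 \<le> Re z \<Longrightarrow> integrable M (\<lambda>x. exp (- z * of_real (W x)))"
  by (rule integrable_const_bound[OF AE_norm_exp_W_le_1]) auto

lemma integrable_exp_W': "0 \<le> Re z \<Longrightarrow> integrable M (\<lambda>x. exp (- (z * of_real (W x))))"
  using integrable_exp_W[of z] by simp

lemma integrable_exp_W_real: "0 \<le> u \<Longrightarrow> integrable M (\<lambda>x. exp (- u * W x))"
  by (rule integrable_const_bound[where B=1]) (use W_nonneg in \<open>auto elim!: eventually_mono\<close>)

lemma phi_of_real: "0 \<le> u \<Longrightarrow> phi (of_real u) = of_real (lap u)"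
proof -
  have "phi (of_real u) = (\<integral>x. complex_of_real (exp (- u * W x)) \<partial>M)"
    unfolding phi_def by (simp flip: exp_of_real)
  then show ?thesis unfolding laplace_W_def by simp
qed

lemma norm_phi_le: assumes "0 \<le> Re z" shows "norm (phi z) \<le> lap (Re z)"
  unfolding phi_def laplace_W_def
  using integral_norm_bound[of M "\<lambda>x. exp (- z * of_real (W x))"] by simp

lemma lap_le_1: "0 \<le> u \<Longrightarrow> lap u \<le> 1"
proof -
  assume u: "0 \<le> u"
  have "lap u \<le> (\<integral>x. 1 \<partial>M)" unfolding laplace_W_def
    using W_nonneg u by (intro integral_mono_AE integrable_exp_W_real)
      (auto elim!: eventually_mono)
  then show ?thesis by (simp add: prob_space)
qed

lemma norm_phi_le_1: "0 \<le> Re z \<Longrightarrow> norm (phi z) \<le> 1"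
  using norm_phi_le[of z] lap_le_1[of "Re z"] by simp

lemma lap_pos: assumes "0 \<le> u" shows "0 < lap u"
proof -
  have "0 \<le> lap u" unfolding laplace_W_def by (intro integral_nonneg_AE) simp
  moreover have "lap u \<noteq> 0"
  proof
    assume "lap u = 0"
    then have "AE x in M. exp (- u * W x) = 0"
      unfolding laplace_W_def using integrable_exp_W_real[OF assms]
      by (subst (asm) integral_nonneg_eq_0_iff_AE) auto
    then show False by simp
  qed
  ultimately show ?thesis by simp
qed

lemma lap_antimono: assumes "0 \<le> u" "u \<le> v" shows "lap v \<le> lap u"
  unfolding laplace_W_def using W_nonneg assms
  by (intro integral_mono_AE integrable_exp_W_real)
    (auto elim!: eventually_mono intro: mult_right_mono)

lemma norm_exp_scaled:
  assumes "0 \<le> Re z" shows "norm (exp (- z / of_real (a ^ m))) \<le> 1"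
  using assms mean_pos by (simp add: Re_divide_of_real)

lemma exp_power_eq_scaled:
  "exp (- z / of_real (a ^ m)) ^ Z m x = exp (- z * of_real (scaled_size m x))" for z :: complex
  unfolding exp_of_nat_mult[symmetric] by (simp add: scaled_size_def mult.commute)

lemma exp_scaled_tendsto:
  assumes z: "0 \<le> Re z" and A: "A \<in> sets M"
  shows "(\<lambda>m. \<integral>x. indicator A x *\<^sub>R exp (- z / of_real (a ^ m)) ^ Z m x \<partial>M) \<longlonglongrightarrow>
     (\<integral>x. indicator A x *\<^sub>R exp (- z * of_real (W x)) \<partial>M)"
proof (rule integral_dominated_convergence[where w="\<lambda>_. 1"])
  show "AE x in M. (\<lambda>m. indicator A x *\<^sub>R exp (- z / of_real (a ^ m)) ^ Z m x) \<longlonglongrightarrow>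
      indicator A x *\<^sub>R exp (- z * of_real (W x))"
    unfolding exp_power_eq_scaled using AE_scaled_size_tendsto
    by eventually_elim (intro tendsto_intros)
  show "AE x in M. norm (indicator A x *\<^sub>R exp (- z / of_real (a ^ m)) ^ Z m x) \<le> 1" for m
    using norm_exp_scaled[OF z, of m] by (intro AE_I2) (auto simp: indicator_def norm_power power_le_one simp del: norm_exp_eq_Re)
qed (use A in auto)

lemma pgf_iter_tendsto_phi:
  assumes z: "0 \<le> Re z"
  shows "(\<lambda>m. (pgf p ^^ m) (exp (- z / of_real (a ^ m)))) \<longlonglongrightarrow> phi z"
proof -
  have "(\<integral>x. indicator (space M) x *\<^sub>R exp (- z / of_real (a ^ m)) ^ Z m x \<partial>M) =
      (pgf p ^^ m) (exp (- z / of_real (a ^ m)))" for m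
    using multi_step_pgf[where k = 0 and m = m, OF past_space norm_exp_scaled[OF z, of m]]
    by (simp add: prob_space cong: Bochner_Integration.integral_cong)
  moreover have "(\<integral>x. indicator (space M) x *\<^sub>R exp (- z * of_real (W x)) \<partial>M) = phi z"
    unfolding phi_def by (rule Bochner_Integration.integral_cong) auto
  ultimately show ?thesis
    using exp_scaled_tendsto[OF z sets.top] by simp
qed

text \<open>The branching property: given the past, a^k W is a sum of \<open>Z k\<close> independent
  copies of W. No copies are constructed; both sides are limits, as m grows, of the same integrals
  of powers of exp(-z / a^(m+k)) with exponent \<open>Z (m + k)\<close>, evaluated through iterated
  generating functions.\<close>

lemma laplace_past:
  assumes A: "A \<in> past k" and z: "0 \<le> Re z"
  shows "(\<integral>x. indicator A x *\<^sub>R exp (- z * of_real (W x)) \<partial>M) =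
     (\<integral>x. indicator A x *\<^sub>R phi (z / of_real (a ^ k)) ^ Z k x \<partial>M)"
proof -
  define z' where "z' = z / of_real (a ^ k)"
  have z': "0 \<le> Re z'" using z mean_pos by (simp add: z'_def Re_divide_of_real)
  have e: "exp (- z / of_real (a ^ (m + k))) = exp (- z' / of_real (a ^ m))" for m
    by (simp add: z'_def power_add mult.commute)
  have "(\<lambda>m. \<integral>x. indicator A x *\<^sub>R (pgf p ^^ m) (exp (- z' / of_real (a ^ m))) ^ Z k x \<partial>M) \<longlonglongrightarrow>
     (\<integral>x. indicator A x *\<^sub>R exp (- z * of_real (W x)) \<partial>M)"
    using LIMSEQ_ignore_initial_segment[OF exp_scaled_tendsto[OF z past_sets[OF A]], of k]
    unfolding e by (subst (asm) multi_step_pgf[OF A norm_exp_scaled[OF z']])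
  moreover have "(\<lambda>m. \<integral>x. indicator A x *\<^sub>R (pgf p ^^ m) (exp (- z' / of_real (a ^ m))) ^ Z k x \<partial>M) \<longlonglongrightarrow>
     (\<integral>x. indicator A x *\<^sub>R phi z' ^ Z k x \<partial>M)"
  proof (rule integral_dominated_convergence[where w="\<lambda>_. 1"])
    show "AE x in M. (\<lambda>m. indicator A x *\<^sub>R (pgf p ^^ m) (exp (- z' / of_real (a ^ m))) ^ Z k x) \<longlonglongrightarrow>
      indicator A x *\<^sub>R phi z' ^ Z k x"
      by (intro AE_I2 tendsto_intros pgf_iter_tendsto_phi z')
    show "AE x in M. norm (indicator A x *\<^sub>R (pgf p ^^ m) (exp (- z' / of_real (a ^ m))) ^ Z k x) \<le> 1" for m
      using pgf_iter_norm_le_1[OF norm_exp_scaled[OF z', of m], of m]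
      by (intro AE_I2) (auto simp: indicator_def norm_power power_le_one)
  qed (use past_sets[OF A] in auto)
  ultimately show ?thesis unfolding z'_def by (rule LIMSEQ_unique)
qed

text \<open>The functional equation of Poincare: the branching identity for \<open>k = 1\<close>,
  with the first generation integrated out.\<close>

lemma phi_mult_a: assumes z: "0 \<le> Re z" shows "phi (of_real a * z) = pgf p (phi z)"
proof -
  have az: "0 \<le> Re (of_real a * z)" using z mean_pos by simp
  have "phi (of_real a * z) = (\<integral>x. indicator (space M) x *\<^sub>R exp (- (of_real a * z) * of_real (W x)) \<partial>M)"
    unfolding phi_def by (rule Bochner_Integration.integral_cong) auto
  also have "\<dots> = (\<integral>x. indicator (space M) x *\<^sub>R phi z ^ Z 1 x \<partial>M)"
    using laplace_past[OF past_space az, of 1] mean_pos by simp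
  also have "\<dots> = (\<integral>x. indicator (space M) x *\<^sub>R pgf p (phi z) ^ Z 0 x \<partial>M)"
    using one_step_pgf[OF past_space norm_phi_le_1[OF z], of 0] by simp
  also have "\<dots> = pgf p (phi z)"
    by (simp add: prob_space cong: Bochner_Integration.integral_cong)
  finally show ?thesis .
qed

lemma lap_mult_a: assumes "0 \<le> u" shows "lap (a * u) = pgf p (lap u)"
proof -
  have "complex_of_real (lap (a * u)) = phi (of_real a * of_real u)"
    using assms mean_pos phi_of_real[of "a * u"] by simp
  also have "\<dots> = pgf p (of_real (lap u))"
    using phi_mult_a[of "of_real u"] assms phi_of_real[of u] by simp
  also have "\<dots> = of_real (pgf p (lap u))"
    using lap_le_1[OF assms] lap_pos[OF assms] by (intro pgf_of_real) simp
  finally show ?thesis using of_real_eq_iff by blast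
qed

lemma lap_mult_power_a_le: "0 \<le> u \<Longrightarrow> lap (a ^ m * u) \<le> lap u ^ mu ^ m"
proof (induction m)
  case (Suc m)
  have "lap (a ^ Suc m * u) = pgf p (lap (a ^ m * u))"
    using Suc.prems mean_pos lap_mult_a[of "a ^ m * u"] by (simp add: mult.assoc)
  also have "\<dots> \<le> lap (a ^ m * u) ^ mu"
    using Suc.prems mean_pos lap_pos[of "a ^ m * u"] lap_le_1[of "a ^ m * u"]
    by (intro pgf_real_bounds) auto
  also have "\<dots> \<le> (lap u ^ mu ^ m) ^ mu"
    using Suc mean_pos lap_pos[of "a ^ m * u"] by (intro power_mono) auto
  finally show ?case by (simp add: power_mult[symmetric] mult.commute)
qed simp

text \<open>Otherwise exp(-u W) = 1 almost surely, hence W = 0, against E W = 1.\<close>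

lemma lap_less_1: assumes "0 < u" shows "lap u < 1"
proof (rule ccontr)
  assume "\<not> lap u < 1"
  then have "lap u = 1" using lap_le_1[of u] assms by simp
  moreover have i: "integrable M (\<lambda>x. exp (- u * W x))" using assms by (intro integrable_exp_W_real) simp
  ultimately have "(\<integral>x. 1 - exp (- u * W x) \<partial>M) = 0"
    by (simp add: prob_space laplace_W_def)
  moreover have "integrable M (\<lambda>x. 1 - exp (- u * W x))" using i by simp
  moreover have "AE x in M. 0 \<le> 1 - exp (- u * W x)"
    using W_nonneg assms by (auto elim!: eventually_mono)
  ultimately have "AE x in M. 1 - exp (- u * W x) = 0"
    by (subst (asm) integral_nonneg_eq_0_iff_AE)
  then have "AE x in M. W x = 0"
    using assms by (auto elim!: eventually_mono)
  then have "(\<integral>x. W x \<partial>M) = (\<integral>x. 0 \<partial>M)" by (intro integral_cong_AE) auto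
  then show False by (simp add: integral_W)
qed

text \<open>By monotonicity it is enough to look along \<open>a ^ m\<close>, where iterating the
  functional equation gives the bound \<open>lap 1 ^ mu ^ m\<close>.\<close>

lemma lap_tendsto_0: "(lap \<longlongrightarrow> 0) at_top"
proof (rule tendstoI)
  fix e :: real assume e: "0 < e"
  have l: "0 < lap 1" "lap 1 < 1" using lap_pos[of 1] lap_less_1[of 1] by auto
  have "(\<lambda>m. lap 1 ^ m) \<longlonglongrightarrow> 0" using l by (intro LIMSEQ_power_zero) auto
  then obtain m where m: "lap 1 ^ m < e"
    using e order_tendstoD(2)[of "\<lambda>m. lap 1 ^ m" 0 sequentially e] by (auto simp: eventually_sequentially)
  have "m \<le> mu ^ m"
    using less_exp[of m] power_mono[OF mu_ge_2, of m] by linarith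
  then have "lap 1 ^ mu ^ m \<le> lap 1 ^ m" using l by (intro power_decreasing) auto
  then have *: "lap (a ^ m * 1) < e" using lap_mult_power_a_le[of 1 m] m by linarith
  show "\<forall>\<^sub>F u in at_top. dist (lap u) 0 < e"
    using eventually_ge_at_top[of "a ^ m"]
  proof eventually_elim
    case (elim u)
    have am: "0 \<le> a ^ m" using mean_pos by simp
    then show ?case using lap_antimono[OF am elim] * lap_pos[of u] elim by simp
  qed
qed

text \<open>A constant W equals its mean 1. The functional equation then reads exgf(exp(-u)) =
  exp(-(a - mu) u), which tends to 0 although exgf is at least p_mu.\<close>

lemma W_not_const: "\<not> (AE x in M. W x = c)"
proof
  assume c: "AE x in M. W x = c"
  then have "(\<integral>x. W x \<partial>M) = (\<integral>x. c \<partial>M)" by (intro integral_cong_AE) auto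
  then have "c = 1" by (simp add: integral_W prob_space)
  with c have "AE x in M. W x = 1" by simp
  then have lap: "lap u = exp (- u)" for u
  proof -
    have "lap u = (\<integral>x. exp (- u) \<partial>M)" unfolding laplace_W_def
      using \<open>AE x in M. W x = 1\<close> by (intro integral_cong_AE) (auto elim!: eventually_mono)
    then show ?thesis by (simp add: prob_space)
  qed
  have "pmf p mu \<le> exp (- ((a - mu) * u))" if "0 \<le> u" for u
  proof -
    have "exp (- (a * u)) = exp (- u) ^ mu * exgf p (exp (- u))"
      using lap_mult_a[OF that] unfolding lap pgf_eq .
    also have "\<dots> = exp (- (real mu * u)) * exgf p (exp (- u))"
      by (simp flip: exp_of_nat_mult)
    finally have "exgf p (exp (- u)) = exp (- (a * u)) / exp (- (real mu * u))" by simp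
    also have "\<dots> = exp (- ((a - mu) * u))" by (simp flip: exp_diff add: algebra_simps)
    finally show ?thesis using exgf_bounds(1)[of "exp (- u)"] that by simp
  qed
  \<comment> \<open>The right-hand side is the \<open>u\<close> at which the exponent becomes ln
    p_mu - 1, so that the bound drops below p_mu.\<close>
  moreover have "0 \<le> (1 - ln (pmf p mu)) / (a - mu)"
    using mean_gt_mu pmf_mu_pos pmf_le_1[of p mu] ln_le_minus_one[of "pmf p mu"] by (intro divide_nonneg_nonneg) auto
  ultimately have "pmf p mu \<le> exp (- ((a - mu) * ((1 - ln (pmf p mu)) / (a - mu))))" by blast
  then have "pmf p mu \<le> exp (ln (pmf p mu) - 1)"
    using mean_gt_mu by simp
  then have "ln (pmf p mu) \<le> ln (pmf p mu) - 1"
    using pmf_mu_pos by (subst (asm) ln_le_cancel_iff[symmetric]) auto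
  then show False by simp
qed

lemma phi_lipschitz:
  assumes "0 \<le> Re z" "0 \<le> Re w"
  shows "norm (phi z - phi w) \<le> norm (z - w)"
proof -
  have "phi z - phi w = (\<integral>x. exp (- z * of_real (W x)) - exp (- w * of_real (W x)) \<partial>M)"
    unfolding phi_def using assms by (simp add: integrable_exp_W')
  also have "norm \<dots> \<le> (\<integral>x. norm (exp (- z * of_real (W x)) - exp (- w * of_real (W x))) \<partial>M)"
    by (rule integral_norm_bound)
  also have "\<dots> \<le> (\<integral>x. norm (z - w) * W x \<partial>M)"
  proof (rule integral_mono_AE)
    show "AE x in M. norm (exp (- z * of_real (W x)) - exp (- w * of_real (W x))) \<le> norm (z - w) * W x"
      using W_nonneg
    proof eventually_elim
      case (elim x)
      have "norm (exp (- (z * of_real (W x))) - exp (- (w * of_real (W x)))) \<le> norm (z * of_real (W x) - w * of_real (W x))"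
        using elim assms by (intro norm_exp_minus_diff_le) auto
      also have "\<dots> = norm (z - w) * W x"
        using elim by (simp add: norm_mult flip: left_diff_distrib)
      finally show ?case by simp
    qed
  qed (use assms integrable_W in \<open>auto intro!: integrable_norm Bochner_Integration.integrable_diff integrable_exp_W'\<close>)
  finally show ?thesis using integral_W by simp
qed

text \<open>Because u w exp(-u w) <= 1, the bound depends only on the direction of \<open>z\<close>
  and not on its size; hence one and the same cone serves at all scales
  \<open>a ^ l\<close>.\<close>

lemma phi_near_real:
  assumes "0 < Re z"
  shows "norm (phi z - phi (of_real (Re z))) \<le> \<bar>Im z\<bar> / Re z"
proof -
  let ?u = "complex_of_real (Re z)"
  have "phi z - phi ?u = (\<integral>x. exp (- z * of_real (W x)) - exp (- ?u * of_real (W x)) \<partial>M)"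
    unfolding phi_def using assms by (subst Bochner_Integration.integral_diff) (auto intro!: integrable_exp_W')
  also have "norm \<dots> \<le> (\<integral>x. norm (exp (- z * of_real (W x)) - exp (- ?u * of_real (W x))) \<partial>M)"
    by (rule integral_norm_bound)
  also have "\<dots> \<le> (\<integral>x. \<bar>Im z\<bar> / Re z \<partial>M)"
  proof (rule integral_mono_AE)
    show "AE x in M. norm (exp (- z * of_real (W x)) - exp (- ?u * of_real (W x))) \<le> \<bar>Im z\<bar> / Re z"
      using W_nonneg
    proof eventually_elim
      case (elim x)
      have "z = ?u + \<i> * of_real (Im z)" by (simp add: complex_eq)
      then have "exp (- z * of_real (W x)) = exp (- ?u * of_real (W x)) * exp (- (\<i> * of_real (Im z) * of_real (W x)))"
      proof -
        have "z * of_real (W x) = ?u * of_real (W x) + \<i> * of_real (Im z) * of_real (W x)"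
          by (subst \<open>z = _\<close>) (simp only: distrib_right)
        then have "- z * of_real (W x) = - ?u * of_real (W x) + - (\<i> * of_real (Im z) * of_real (W x))"
          by (simp only: mult_minus_left minus_add_distrib)
        then show ?thesis by (simp only: exp_add)
      qed
      then have "norm (exp (- z * of_real (W x)) - exp (- ?u * of_real (W x))) =
         norm (exp (- ?u * of_real (W x))) * norm (exp (- (\<i> * of_real (Im z) * of_real (W x))) - exp (- 0))"
        unfolding norm_mult[symmetric] by (simp add: algebra_simps)
      also have "\<dots> \<le> exp (- Re z * W x) * (\<bar>Im z\<bar> * W x)"
      proof (rule mult_mono)
        have "norm (exp (- (\<i> * of_real (Im z) * of_real (W x))) - exp (- 0)) \<le> norm (\<i> * of_real (Im z) * of_real (W x) - 0)"
          by (rule norm_exp_minus_diff_le) auto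
        then show "norm (exp (- (\<i> * of_real (Im z) * of_real (W x))) - exp (- 0)) \<le> \<bar>Im z\<bar> * W x"
          using elim by (simp add: norm_mult)
      qed (use elim in auto)
      also have "\<dots> = \<bar>Im z\<bar> / Re z * ((Re z * W x) * exp (- (Re z * W x)))"
        using assms by (simp add: field_simps)
      also have "\<dots> \<le> \<bar>Im z\<bar> / Re z * 1"
      proof (rule mult_left_mono)
        have "Re z * W x \<le> exp (Re z * W x)" using exp_ge_add_one_self[of "Re z * W x"] by linarith
        then show "(Re z * W x) * exp (- (Re z * W x)) \<le> 1" by (simp add: exp_minus field_simps)
      qed (use assms in auto)
      finally show ?case by simp
    qed
  qed (use assms in \<open>auto intro!: integrable_norm Bochner_Integration.integrable_diff integrable_exp_W'\<close>)
  finally show ?thesis by (simp add: prob_space)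
qed

end

section \<open>The transform off the real axis\<close>

lemma power_fact_le_exp: "x ^ k / fact k \<le> exp x" if "0 \<le> x" for x :: real
proof -
  have "(\<Sum>i\<in>{k}. x ^ i /\<^sub>R fact i) \<le> (\<Sum>i. x ^ i /\<^sub>R fact i)"
    using that by (intro sum_le_suminf summable_exp_generic) auto
  then show ?thesis by (simp add: exp_def field_simps)
qed

lemma power_exp_le: "w ^ k * exp (- (s * w)) \<le> fact k / s ^ k" if "0 \<le> w" "0 < s" for w s :: real
proof -
  have "(s * w) ^ k / fact k \<le> exp (s * w)" using that by (intro power_fact_le_exp) simp
  then have "(s * w) ^ k * exp (- (s * w)) \<le> fact k" by (simp add: exp_minus field_simps)
  then show ?thesis using that by (simp add: power_mult_distrib field_simps)
qed

lemma has_field_derivative_quadratic_bound: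
  fixes f :: "'b :: real_normed_field \<Rightarrow> 'b"
  assumes "0 < r" and bnd: "\<And>h. norm h < r \<Longrightarrow> norm (f (z + h) - f z - D * h) \<le> K * (norm h)\<^sup>2"
  shows "(f has_field_derivative D) (at z)"
proof -
  have "((\<lambda>h. (f (z + h) - f z) / h - D) \<longlongrightarrow> 0) (at 0)"
  proof (rule Lim_null_comparison)
    show "\<forall>\<^sub>F h in at 0. norm ((f (z + h) - f z) / h - D) \<le> K * norm h"
      unfolding eventually_at
    proof (intro exI[of _ r] conjI ballI impI)
      fix h :: 'b assume h: "h \<noteq> 0 \<and> dist h 0 < r"
      then have "(f (z + h) - f z) / h - D = (f (z + h) - f z - D * h) / h" by (simp add: field_simps)
      also have "norm \<dots> \<le> K * (norm h)\<^sup>2 / norm h"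
        using bnd[of h] h by (simp add: norm_divide divide_right_mono)
      finally show "norm ((f (z + h) - f z) / h - D) \<le> K * norm h" using h by (simp add: power2_eq_square)
    qed (use assms in simp)
    show "((\<lambda>h. K * norm h) \<longlongrightarrow> 0) (at (0::'b))" by (intro tendsto_eq_intros) auto
  qed
  then show ?thesis by (simp add: DERIV_def LIM_zero_iff)
qed

lemma pgf_sums:
  fixes s :: complex
  assumes "norm s \<le> 1"
  shows "(\<lambda>j. of_real (pmf q j) * s ^ j) sums pgf q s"
proof -
  have i: "integrable (measure_pmf q) (\<lambda>j. s ^ j)"
    by (rule measure_pmf.integrable_const_bound[where B=1]) (auto simp: norm_power assms power_le_one)
  then have "integrable (count_space UNIV) (\<lambda>j. pmf q j *\<^sub>R s ^ j)"
    by (simp add: integrable_density measure_pmf_eq_density)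
  from sums_integral_count_space_nat[OF this]
  show ?thesis unfolding pgf_def measure_pmf_eq_density
    by (subst integral_density) (auto simp: scaleR_conv_of_real)
qed

lemma exgf_eq_pgf: "exgf p s = pgf (map_pmf (\<lambda>n. n - min_offspring p) p) s"
  unfolding exgf_def pgf_def by simp

lemma exgf_holomorphic: "exgf p holomorphic_on ball (0::complex) 1"
  unfolding exgf_eq_pgf
  by (rule power_series_holomorphic[where a = "\<lambda>j. of_real (pmf (map_pmf (\<lambda>n. n - min_offspring p) p) j)"])
     (use pgf_sums in \<open>simp add: less_imp_le\<close>)

context boettcher_gw
begin

text \<open>Up to the sign (-1)^k this is the k-th derivative of \<open>phi\<close>.\<close>

definition phi_moment :: "nat \<Rightarrow> complex \<Rightarrow> complex" where
  "phi_moment k z = (\<integral>x. of_real (W x ^ k) * exp (- z * of_real (W x)) \<partial>M)"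

lemma phi_moment_0: "phi_moment 0 = phi"
  by (simp add: fun_eq_iff phi_moment_def phi_def)

lemma AE_norm_moment_le:
  assumes "0 < s" "s \<le> Re z"
  shows "AE x in M. norm (of_real (W x ^ k) * exp (- z * of_real (W x))) \<le> fact k / s ^ k"
  using W_nonneg
proof eventually_elim
  case (elim x)
  have "norm (of_real (W x ^ k) * exp (- z * of_real (W x))) = W x ^ k * exp (- (Re z * W x))"
    using elim by (simp add: norm_mult norm_power)
  also have "\<dots> \<le> W x ^ k * exp (- (s * W x))"
    using elim assms by (intro mult_left_mono) (auto intro: mult_right_mono)
  also have "\<dots> \<le> fact k / s ^ k" using elim assms by (intro power_exp_le) auto
  finally show ?case .
qed

lemma integrable_moment:
  assumes "0 < Re z"
  shows "integrable M (\<lambda>x. of_real (W x ^ k) * exp (- z * of_real (W x)))"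
  by (rule integrable_const_bound[OF AE_norm_moment_le[OF assms order_refl]]) measurable

lemma phi_moment_derivative:
  assumes "0 < Re z"
  shows "(phi_moment k has_field_derivative - phi_moment (Suc k) z) (at z)"
proof (rule has_field_derivative_quadratic_bound)
  \<comment> \<open>The damping exp(-Re z W) is halved: one half absorbs the growth of exp(-h W) in
    the Taylor remainder, the other half the power W^(k+2).\<close>
  define s where "s = Re z / 2"
  show s: "0 < s" using assms by (simp add: s_def)
  fix h :: complex assume h: "norm h < s"
  have Reh: "\<bar>Re h\<bar> < s" using h abs_Re_le_cmod[of h] by linarith
  have zh: "0 < Re (z + h)" using Reh s by (simp add: s_def)
  let ?r = "\<lambda>x. of_real (W x ^ k) * exp (- (z + h) * of_real (W x)) - of_real (W x ^ k) * exp (- z * of_real (W x))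
      - (- (of_real (W x ^ Suc k) * exp (- z * of_real (W x)))) * h"
  have lin: "integrable M (\<lambda>x. f x - g x - - l x * h)"
      "(\<integral>x. f x \<partial>M) - (\<integral>x. g x \<partial>M) - - (\<integral>x. l x \<partial>M) * h = (\<integral>x. f x - g x - - l x * h \<partial>M)"
    if "integrable M f" "integrable M g" "integrable M l" for f g l :: "'a \<Rightarrow> complex"
    using that by simp_all
  note lin = lin[OF integrable_moment[OF zh] integrable_moment[OF assms] integrable_moment[OF assms]]
  have i: "integrable M ?r" by (rule lin(1))
  have eq: "phi_moment k (z + h) - phi_moment k z - - phi_moment (Suc k) z * h = (\<integral>x. ?r x \<partial>M)"
    unfolding phi_moment_def by (rule lin(2))
  have le: "norm (\<integral>x. ?r x \<partial>M) \<le> (\<integral>x. norm (?r x) \<partial>M)" by (rule integral_norm_bound)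
  have "(\<integral>x. norm (?r x) \<partial>M) \<le> (\<integral>x. fact (k + 2) / s ^ (k + 2) * (norm h)\<^sup>2 \<partial>M)"
  proof (rule integral_mono_AE)
    show "AE x in M. norm (?r x) \<le> fact (k + 2) / s ^ (k + 2) * (norm h)\<^sup>2"
      using W_nonneg
    proof eventually_elim
      case (elim x)
      define w where "w = W x"
      have w: "0 \<le> w" using elim by (simp add: w_def)
      define y where "y = - h * of_real w"
      have "norm (exp y - (1 + y)) \<le> exp \<bar>Re y\<bar> * norm y ^ 2"
        using Taylor_exp[of y 1] by (simp add: power2_eq_square)
      also have "\<dots> \<le> exp (s * w) * (norm h * w) ^ 2"
        using w Reh by (intro mult_mono) (auto simp: y_def norm_mult abs_mult intro!: mult_right_mono)
      finally have T: "norm (exp y - (1 + y)) \<le> exp (s * w) * (norm h * w) ^ 2" .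
      have "?r x = of_real (w ^ k) * exp (- z * of_real w) * (exp y - (1 + y))"
        by (simp add: w_def[symmetric] y_def algebra_simps exp_add[symmetric])
      also have "norm \<dots> = w ^ k * exp (- (Re z * w)) * norm (exp y - (1 + y))"
        using w by (simp add: norm_mult norm_power)
      also have "\<dots> \<le> w ^ k * exp (- (Re z * w)) * (exp (s * w) * (norm h * w) ^ 2)"
        using w T by (intro mult_left_mono) auto
      also have "w ^ k * exp (- (Re z * w)) * (exp (s * w) * (norm h * w) ^ 2) =
          (norm h)\<^sup>2 * (w ^ (k + 2) * exp (- (s * w)))"
      proof -
        have "exp (- (Re z * w)) = exp (- (s * w)) * exp (- (s * w))"
          by (simp add: s_def flip: exp_add)
        moreover have "exp (- (s * w)) * exp (s * w) = 1" by (simp flip: exp_add)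
        moreover have "w ^ k * (P * P) * (Q * (norm h * w) ^ 2) = (norm h)\<^sup>2 * (w ^ (k + 2) * P) * (P * Q)" for P Q :: real
          by (simp add: power_mult_distrib power_add power2_eq_square mult_ac)
        ultimately show ?thesis by (simp only: mult_1_right)
      qed
      also have "\<dots> \<le> (norm h)\<^sup>2 * (fact (k + 2) / s ^ (k + 2))"
        using w s by (intro mult_left_mono power_exp_le) auto
      finally show ?case by (simp only: mult.commute)
    qed
  qed (use i in auto)
  then have "(\<integral>x. norm (?r x) \<partial>M) \<le> fact (k + 2) / s ^ (k + 2) * (norm h)\<^sup>2"
    by (simp add: prob_space)
  with le show "norm (phi_moment k (z + h) - phi_moment k z - - phi_moment (Suc k) z * h) \<le>
      fact (k + 2) / s ^ (k + 2) * (norm h)\<^sup>2"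
    unfolding eq by (rule order_trans)
qed

lemma phi_moment_holomorphic: "phi_moment k holomorphic_on {z. 0 < Re z}"
  using phi_moment_derivative
  by (auto simp: holomorphic_on_open open_halfspace_Re_gt intro!: exI)

lemma phi_holomorphic: "phi holomorphic_on {z. 0 < Re z}"
  using phi_moment_holomorphic[of 0] by (simp add: phi_moment_0)

lemma phi_continuous: "continuous_on {z. 0 \<le> Re z} phi"
proof (rule continuous_on_iff[THEN iffD2], safe)
  fix z :: complex and e :: real assume *: "0 \<le> Re z" "0 < e"
  show "\<exists>d>0. \<forall>x'\<in>{z. 0 \<le> Re z}. dist x' z < d \<longrightarrow> dist (phi x') (phi z) < e"
  proof (intro exI[of _ e] conjI ballI impI)
    fix y assume "y \<in> {z. 0 \<le> Re z}" "dist y z < e"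
    then show "dist (phi y) (phi z) < e"
      using phi_lipschitz[of y z] * by (simp add: dist_norm)
  qed fact
qed

text \<open>The characteristic function at -Im z of the law of W reweighted by exp(-Re z W).\<close>

definition chi :: "complex \<Rightarrow> complex" where
  "chi z = phi z / of_real (lap (Re z))"

lemma norm_chi: "0 \<le> Re z \<Longrightarrow> norm (chi z) = norm (phi z) / lap (Re z)"
  using lap_pos[of "Re z"] by (simp add: chi_def norm_divide)

lemma norm_chi_le_1: "0 \<le> Re z \<Longrightarrow> norm (chi z) \<le> 1"
  using norm_phi_le[of z] lap_pos[of "Re z"] by (simp add: norm_chi)

text \<open>In phi(a z) = phi(z)^mu exgf(phi(z)) the second factor is at most its value at
  \<open>lap (Re z)\<close>, which is exactly the factor appearing for the real transform and
  cancels in the quotient.\<close>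

lemma norm_chi_mult_a:
  assumes z: "0 \<le> Re z" shows "norm (chi (of_real a * z)) \<le> norm (chi z) ^ mu"
proof -
  have l: "0 < lap (Re z)" "lap (Re z) \<le> 1" "0 < lap (a * Re z)"
    using z lap_pos[of "Re z"] lap_le_1[of "Re z"] lap_pos[of "a * Re z"] mean_pos by auto
  have "norm (phi (of_real a * z)) = norm (phi z) ^ mu * norm (exgf p (phi z))"
    using phi_mult_a[OF z] by (simp add: pgf_eq norm_mult norm_power)
  also have "norm (exgf p (phi z)) \<le> exgf p (lap (Re z))"
    using norm_exgf_le[OF norm_phi_le_1[OF z]] exgf_mono[OF norm_ge_zero norm_phi_le[OF z]] l by linarith
  also have "norm (phi z) ^ mu * exgf p (lap (Re z)) = norm (chi z) ^ mu * lap (a * Re z)"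
    using lap_mult_a[OF z] l z by (simp add: norm_chi pgf_eq power_divide)
  finally have "norm (phi (of_real a * z)) \<le> norm (chi z) ^ mu * lap (a * Re z)"
    by (simp add: mult_left_mono)
  then show ?thesis using l z mean_pos by (simp add: norm_chi field_simps)
qed

lemma norm_chi_mult_power_a:
  assumes z: "0 \<le> Re z" shows "norm (chi (of_real (a ^ m) * z)) \<le> norm (chi z) ^ mu ^ m"
proof (induction m)
  case (Suc m)
  have "norm (chi (of_real (a ^ Suc m) * z)) = norm (chi (of_real a * (of_real (a ^ m) * z)))"
    by (simp add: mult.assoc)
  also have "\<dots> \<le> norm (chi (of_real (a ^ m) * z)) ^ mu"
    by (rule norm_chi_mult_a) (use z mean_pos in simp)
  also have "\<dots> \<le> (norm (chi z) ^ mu ^ m) ^ mu"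
    using Suc by (intro power_mono) auto
  finally show ?case by (simp add: power_mult[symmetric] mult.commute)
qed simp

text \<open>Equality in the triangle inequality for integrals: once phi(z) is turned onto the
  positive axis, exp(-Re z W) (1 - cos) is nonnegative with integral 0.\<close>

lemma phase_if_norm_phi_eq:
  assumes z: "0 \<le> Re z" and eq: "norm (phi z) = lap (Re z)"
  shows "\<exists>t. AE x in M. cos (t + Im z * W x) = 1"
proof -
  define t where "t = Arg (phi z)"
  have nz: "phi z \<noteq> 0" using eq lap_pos[OF z] by auto
  have pt: "phi z = of_real (norm (phi z)) * cis t"
    using nz by (simp add: t_def cis_Arg complex_sgn_def scaleR_conv_of_real)
  have "phi z * cis (- t) = of_real (norm (phi z))"
    by (subst pt) (simp add: cis_mult mult.assoc)
  then have "lap (Re z) = Re (phi z * cis (- t))" using eq by simp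
  also have "phi z * cis (- t) = (\<integral>x. exp (- z * of_real (W x)) * cis (- t) \<partial>M)"
    unfolding phi_def using z by (simp add: integrable_exp_W')
  also have "Re \<dots> = (\<integral>x. Re (exp (- z * of_real (W x)) * cis (- t)) \<partial>M)"
    using integrable_exp_W[OF z] by (subst integral_Re) auto
  also have "\<dots> = (\<integral>x. exp (- Re z * W x) * cos (t + Im z * W x) \<partial>M)"
  proof (rule Bochner_Integration.integral_cong)
    fix x
    have "exp (- z * of_real (W x)) * cis (- t) = exp (of_real (- Re z * W x)) * cis (- (t + Im z * W x))"
    proof -
      have "- z * of_real (W x) = of_real (- Re z * W x) + \<i> * of_real (- (Im z * W x))"
        by (simp add: complex_eq_iff)
      then have "exp (- z * of_real (W x)) = exp (of_real (- Re z * W x)) * cis (- (Im z * W x))"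
        by (simp only: exp_add cis_conv_exp)
      then show ?thesis by (simp add: cis_mult mult.assoc add.commute)
    qed
    then have "Re (exp (- z * of_real (W x)) * cis (- t)) = Re (of_real (exp (- Re z * W x)) * cis (- (t + Im z * W x)))"
      by (simp only: exp_of_real)
    also have "\<dots> = exp (- Re z * W x) * cos (t + Im z * W x)"
      by (simp only: Re_complex_of_real Im_complex_of_real times_complex.sel cis.sel cos_minus mult_zero_left diff_zero)
    finally show "Re (exp (- z * of_real (W x)) * cis (- t)) = exp (- Re z * W x) * cos (t + Im z * W x)" .
  qed simp
  finally have l: "lap (Re z) = (\<integral>x. exp (- Re z * W x) * cos (t + Im z * W x) \<partial>M)" .
  have i1: "integrable M (\<lambda>x. exp (- Re z * W x))" by (rule integrable_exp_W_real[OF z])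
  have i2: "integrable M (\<lambda>x. exp (- Re z * W x) * cos (t + Im z * W x))"
    by (rule Bochner_Integration.integrable_bound[OF i1]) (auto simp: abs_mult intro!: mult_left_le)
  have i3: "integrable M (\<lambda>x. exp (- Re z * W x) - exp (- Re z * W x) * cos (t + Im z * W x))"
    using i1 i2 by simp
  have "(\<integral>x. exp (- Re z * W x) - exp (- Re z * W x) * cos (t + Im z * W x) \<partial>M) = 0"
    using l i1 i2 by (subst Bochner_Integration.integral_diff) (auto simp: laplace_W_def)
  moreover have "AE x in M. 0 \<le> exp (- Re z * W x) - exp (- Re z * W x) * cos (t + Im z * W x)"
    by (auto intro!: AE_I2 mult_left_le)
  ultimately have "AE x in M. exp (- Re z * W x) - exp (- Re z * W x) * cos (t + Im z * W x) = 0"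
    using i3 by (subst (asm) integral_nonneg_eq_0_iff_AE)
  then have "AE x in M. cos (t + Im z * W x) = 1" by (auto elim!: eventually_mono)
  then show ?thesis ..
qed

text \<open>
  If the modulus were maximal at \<open>z\<close>, it would be maximal at all \<open>z / a\<^sup>m\<close>, forcing \<open>W\<close> into
  lattices of arbitrarily large span and hence to be constant.
\<close>

lemma norm_chi_less_1:
  assumes z: "0 \<le> Re z" "Im z \<noteq> 0"
  shows "norm (chi z) < 1"
proof (rule ccontr)
  assume "\<not> norm (chi z) < 1"
  then have c1: "norm (chi z) = 1" using norm_chi_le_1[OF z(1)] by simp
  have "\<exists>t. AE x in M. cos (t + Im z / a ^ m * W x) = 1" for m
  proof -
    define w where "w = z / of_real (a ^ m)"
    have w: "0 \<le> Re w" "Im w = Im z / a ^ m"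
      using z mean_pos by (auto simp: w_def Re_divide_of_real Im_divide_of_real simp flip: of_real_power)
    have zw: "z = of_real (a ^ m) * w" using mean_pos by (simp add: w_def)
    have "norm (chi w) = 1"
    proof (rule ccontr)
      assume "norm (chi w) \<noteq> 1"
      then have "norm (chi w) < 1" using norm_chi_le_1[OF w(1)] by simp
      then have "norm (chi w) ^ mu ^ m < 1" using mu_pos by (simp add: power_less_one_iff)
      then show False using norm_chi_mult_power_a[OF w(1), of m] c1 zw by simp
    qed
    then have "norm (phi w) = lap (Re w)" using w(1) lap_pos[OF w(1)] by (simp add: norm_chi)
    from phase_if_norm_phi_eq[OF w(1) this] show ?thesis by (simp add: w(2))
  qed
  then obtain t where t: "\<And>m. AE x in M. cos (t m + Im z / a ^ m * W x) = 1" by metis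
  then have all: "AE x in M. \<forall>m. cos (t m + Im z / a ^ m * W x) = 1" by (simp add: AE_all_countable)
  then obtain x0 where x0: "\<And>m. cos (t m + Im z / a ^ m * W x0) = 1"
    using eventually_happens'[OF ae_filter_bot all] by blast
  from all have "AE x in M. W x = W x0"
  proof eventually_elim
    case (elim x)
    \<comment> \<open>The phases at x and x0 differ by D / a^m and also by a multiple of 2 pi. For m
      so large that |D| < a^m the difference is below 1, so it is 0.\<close>
    define D where "D = Im z * (W x - W x0)"
    obtain m where m: "\<bar>D\<bar> < a ^ m" using real_arch_pow[OF mean_gt_1] by blast
    define A where "A = t m + Im z / a ^ m * W x"
    define B where "B = t m + Im z / a ^ m * W x0"
    have cA: "cos A = 1" and cB: "cos B = 1" using elim x0 by (auto simp: A_def B_def)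
    then have "sin A = 0" "sin B = 0" using sin_cos_squared_add[of A] sin_cos_squared_add[of B] by auto
    then have "cos (A - B) = 1" using cA cB by (simp add: cos_diff)
    then obtain n :: int where n: "A - B = real_of_int n * (2 * pi)" using cos_one_2pi_int by (auto simp: mult.assoc)
    have AB: "A - B = D / a ^ m" by (simp add: A_def B_def D_def algebra_simps diff_divide_distrib)
    have "\<bar>D / a ^ m\<bar> < 1" using m mean_pos by (simp add: abs_divide)
    then have "\<bar>real_of_int n * (2 * pi)\<bar> < 1" using n AB by metis
    then have "\<bar>real_of_int n\<bar> * (2 * pi) < 1" by (simp add: abs_mult)
    have "n = 0"
    proof (rule ccontr)
      assume "n \<noteq> 0"
      then have "1 \<le> \<bar>real_of_int n\<bar>" by linarith
      then have "1 * (2 * pi) \<le> \<bar>real_of_int n\<bar> * (2 * pi)" by (intro mult_right_mono) auto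
      then show False using \<open>\<bar>real_of_int n\<bar> * (2 * pi) < 1\<close> pi_gt3 by linarith
    qed
    then have "D = 0" using n AB mean_pos by simp
    then show ?case using z by (simp add: D_def)
  qed
  then show False using W_not_const by blast
qed

lemma chi_continuous: "continuous_on {z. 0 \<le> Re z} chi"
proof -
  have "continuous_on {z. 0 \<le> Re z} (\<lambda>z. phi z / phi (of_real (Re z)))"
  proof (intro continuous_on_divide phi_continuous ballI)
    show "continuous_on {z. 0 \<le> Re z} (\<lambda>z. phi (of_real (Re z)))"
      by (rule continuous_on_compose2[OF phi_continuous]) (auto intro!: continuous_intros)
    show "phi (of_real (Re z)) \<noteq> 0" if "z \<in> {z. 0 \<le> Re z}" for z
      using that lap_pos[of "Re z"] by (simp add: phi_of_real)
  qed
  then show ?thesis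
    by (rule continuous_on_eq) (simp add: chi_def phi_of_real)
qed

text \<open>On a compact range of Im z the continuous modulus attains a maximum below 1. Larger |Im
  z| is divided by a power of \<open>a\<close> until it enters this range, and the power inequality
  for \<open>chi\<close> can only improve the bound.\<close>

lemma chi_uniform_gap:
  assumes d: "0 < d" and U: "0 \<le> U"
  shows "\<exists>q. 0 \<le> q \<and> q < 1 \<and> (\<forall>z. 0 \<le> Re z \<longrightarrow> Re z \<le> U \<longrightarrow> d \<le> \<bar>Im z\<bar> \<longrightarrow> norm (chi z) \<le> q)"
proof -
  \<comment> \<open>Lowering \<open>d\<close> to at most 1 puts the whole period 1 <= |Im z| <= a
    into \<open>K\<close>, the target of the rescaling.\<close>
  define e where "e = min d 1"
  have e: "0 < e" "e \<le> d" "e \<le> 1" using d by (auto simp: e_def)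
  define K where "K = {z. 0 \<le> Re z \<and> Re z \<le> U \<and> e \<le> \<bar>Im z\<bar> \<and> \<bar>Im z\<bar> \<le> a}"
  have "closed K" unfolding K_def
    by (intro closed_Collect_conj closed_Collect_le continuous_intros)
  moreover have "bounded K"
  proof (rule boundedI)
    fix z assume "z \<in> K"
    then show "norm z \<le> U + a" using cmod_le[of z] by (auto simp: K_def)
  qed
  ultimately have "compact K" by (simp add: compact_eq_bounded_closed)
  moreover have "Complex 0 1 \<in> K" using e U mean_gt_1 by (simp add: K_def)
  then have "K \<noteq> {}" by auto
  moreover have "continuous_on K (\<lambda>z. norm (chi z))"
    by (intro continuous_on_norm continuous_on_subset[OF chi_continuous]) (auto simp: K_def)
  ultimately obtain z0 where z0: "z0 \<in> K" "\<And>z. z \<in> K \<Longrightarrow> norm (chi z) \<le> norm (chi z0)"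
    using continuous_attains_sup[of K "\<lambda>z. norm (chi z)"] by blast
  have q: "norm (chi z0) < 1" using z0(1) e by (intro norm_chi_less_1) (auto simp: K_def)
  have "norm (chi z) \<le> norm (chi z0)" if z: "0 \<le> Re z" "Re z \<le> U" "d \<le> \<bar>Im z\<bar>" for z
  proof (cases "\<bar>Im z\<bar> \<le> a")
    case True
    then show ?thesis using z e by (intro z0(2)) (auto simp: K_def)
  next
    case False
    define m where "m = (LEAST m. \<bar>Im z\<bar> \<le> a ^ m)"
    obtain m' where "\<bar>Im z\<bar> < a ^ m'" using real_arch_pow[OF mean_gt_1] by blast
    then have m: "\<bar>Im z\<bar> \<le> a ^ m" unfolding m_def using LeastI[of "\<lambda>m. \<bar>Im z\<bar> \<le> a ^ m" m'] by simp
    have "m \<noteq> 0" using m False mean_gt_1 by (intro notI) simp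
    then obtain k where k: "m = Suc k" by (cases m) auto
    have k1: "a ^ k < \<bar>Im z\<bar>"
      using not_less_Least[of k "\<lambda>m. \<bar>Im z\<bar> \<le> a ^ m"] k unfolding m_def by simp
    have ak: "1 \<le> a ^ k" using mean_gt_1 by simp
    define w where "w = z / of_real (a ^ k)"
    have w: "Re w = Re z / a ^ k" "Im w = Im z / a ^ k"
      by (auto simp: w_def Re_divide_of_real Im_divide_of_real simp flip: of_real_power)
    have "w \<in> K"
    proof -
      have "Re z / a ^ k \<le> Re z / 1" using z ak by (intro divide_left_mono) auto
      moreover have "0 \<le> Re z / a ^ k" using z ak by simp
      moreover have "1 \<le> \<bar>Im z\<bar> / a ^ k" "\<bar>Im z\<bar> / a ^ k \<le> a" using k1 m k ak by (auto simp: field_simps)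
      moreover have "\<bar>Im w\<bar> = \<bar>Im z\<bar> / a ^ k" using ak by (simp add: w abs_divide)
      ultimately show ?thesis using z e by (simp add: K_def w(1))
    qed
    have "norm (chi z) = norm (chi (of_real (a ^ k) * w))" using mean_pos by (simp add: w_def)
    also have "\<dots> \<le> norm (chi w) ^ mu ^ k"
      using \<open>w \<in> K\<close> by (intro norm_chi_mult_power_a) (simp add: K_def)
    also have "\<dots> \<le> norm (chi w) ^ 1"
      using \<open>w \<in> K\<close> norm_chi_le_1[of w] mu_pos by (intro power_decreasing) (auto simp: K_def Suc_le_eq)
    also have "\<dots> \<le> norm (chi z0)" using z0(2)[OF \<open>w \<in> K\<close>] by simp
    finally show ?thesis .
  qed
  with q show ?thesis by (intro exI[of _ "norm (chi z0)"]) auto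
qed

end

section \<open>The Boettcher function\<close>

lemma has_real_derivative_Re_of_real:
  assumes "(f has_field_derivative D) (at (complex_of_real u))"
  shows "((\<lambda>x. Re (f (of_real x))) has_real_derivative Re D) (at u)"
    and "((\<lambda>x. Im (f (of_real x))) has_real_derivative Im D) (at u)"
  unfolding has_real_derivative_iff_has_vector_derivative
  using has_vector_derivative_real_field[OF assms]
  by (rule bounded_linear.has_vector_derivative[OF bounded_linear_Re],
      rule bounded_linear.has_vector_derivative[OF bounded_linear_Im])

lemma Ln_lipschitz_halfplane:
  assumes "0 < c" "c \<le> Re z" "c \<le> Re w"
  shows "norm (Ln z - Ln w) \<le> 1 / c * norm (z - w)"
proof (rule field_differentiable_bound[where S = "{z. c \<le> Re z}" and f' = inverse])
  show "convex {z. c \<le> Re z}" by (rule convex_halfspace_Re_ge)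
  fix z assume z: "z \<in> {z. c \<le> Re z}"
  then have "z \<notin> \<real>\<^sub>\<le>\<^sub>0" using assms(1) by (auto simp: complex_nonpos_Reals_iff)
  then show "(Ln has_field_derivative inverse z) (at z within {z. c \<le> Re z})"
    by (rule has_field_derivative_at_within[OF has_field_derivative_Ln])
  have "c \<le> norm z" using z complex_Re_le_cmod[of z] by simp
  then have "inverse (norm z) \<le> inverse c" using assms(1) by (intro le_imp_inverse_le)
  then show "norm (inverse z) \<le> 1 / c" unfolding norm_inverse by (simp add: inverse_eq_divide)
qed (use assms in auto)

context boettcher_gw
begin

text \<open>Chosen so that \<open>a * aperture = pmf p mu / 2\<close>: with Lipschitz constant
  \<open>a\<close>, the value \<open>exgf p (phi z)\<close> then moves away from its real
  counterpart by at most half of the lower bound p_mu.\<close>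

definition aperture :: real where "aperture = pmf p mu / (2 * a)"

definition cone :: "complex set" where
  "cone = {z. 0 < Re z \<and> \<bar>Im z\<bar> < aperture * Re z}"

text \<open>Applying f(s) = s^mu exgf(s) along s = phi(a^l z) multiplies the logarithm by mu and
  adds ln exgf(s); the divisor mu^(l+1) undoes the accumulated multiplications.\<close>

definition Eterm :: "nat \<Rightarrow> complex \<Rightarrow> complex" where
  "Eterm l z = Ln (exgf p (phi (of_real (a ^ l) * z))) / of_real (real mu ^ Suc l)"

definition EE :: "complex \<Rightarrow> complex" where
  "EE z = (\<Sum>l. Eterm l z)"

text \<open>The value of the series \<open>EE\<close> when every factor exgf is replaced by p_mu,
  since the powers mu^-(l+1) sum to 1 / (mu - 1).\<close>

definition EE_lim :: real where "EE_lim = ln (pmf p mu) / (real mu - 1)"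

lemma aperture_pos: "0 < aperture"
  using pmf_mu_pos mean_pos by (simp add: aperture_def)

lemma of_real_in_cone [simp]: "0 < u \<Longrightarrow> of_real u \<in> cone"
  using aperture_pos by (simp add: cone_def)

lemma open_cone: "open cone"
  unfolding cone_def by (intro open_Collect_conj open_Collect_less continuous_intros)

lemma cone_Re_pos: "z \<in> cone \<Longrightarrow> 0 < Re z"
  by (simp add: cone_def)

lemma cone_scale: "z \<in> cone \<Longrightarrow> 0 < c \<Longrightarrow> of_real c * z \<in> cone"
  by (auto simp: cone_def abs_mult mult.left_commute)

lemma cone_scale_power: "z \<in> cone \<Longrightarrow> of_real (a ^ l) * z \<in> cone"
  using mean_pos by (intro cone_scale) auto

text \<open>The distance to the real axis is controlled by \<open>phi_near_real\<close>, the effect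
  on exgf by its Lipschitz constant. Staying in a right half-plane keeps the principal logarithm
  holomorphic and Lipschitz.\<close>

lemma exgf_phi_cone:
  assumes z: "z \<in> cone"
  shows "pmf p mu / 2 \<le> Re (exgf p (phi z))" "norm (exgf p (phi z)) \<le> 1"
proof -
  have R: "0 < Re z" using z by (rule cone_Re_pos)
  have l: "0 < lap (Re z)" "lap (Re z) \<le> 1" using lap_pos[of "Re z"] lap_le_1[of "Re z"] R by auto
  have "norm (exgf p (phi z) - exgf p (phi (of_real (Re z)))) \<le> a * norm (phi z - phi (of_real (Re z)))"
    using R by (intro exgf_lipschitz norm_phi_le_1) auto
  also have "\<dots> \<le> a * (\<bar>Im z\<bar> / Re z)"
    using R mean_pos by (intro mult_left_mono phi_near_real) auto
  also have "\<dots> \<le> a * aperture"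
    using z R mean_pos by (intro mult_left_mono) (auto simp: cone_def field_simps)
  also have "\<dots> = pmf p mu / 2" using mean_pos by (simp add: aperture_def)
  finally have d: "norm (exgf p (phi z) - exgf p (phi (of_real (Re z)))) \<le> pmf p mu / 2" .
  have "exgf p (phi (of_real (Re z))) = complex_of_real (exgf p (lap (Re z)))"
    using R l by (simp add: phi_of_real exgf_of_real)
  then have "pmf p mu \<le> Re (exgf p (phi (of_real (Re z))))"
    using exgf_bounds[of "lap (Re z)"] l by simp
  with d show "pmf p mu / 2 \<le> Re (exgf p (phi z))"
    using abs_Re_le_cmod[of "exgf p (phi z) - exgf p (phi (of_real (Re z)))"] by simp
  have "norm (exgf p (phi z)) \<le> exgf p (norm (phi z))"
    using R by (intro norm_exgf_le norm_phi_le_1) simp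
  also have "\<dots> \<le> 1" using norm_phi_le_1[of z] R by (intro exgf_bounds) auto
  finally show "norm (exgf p (phi z)) \<le> 1" .
qed

lemma exgf_phi_cone_nonzero: "z \<in> cone \<Longrightarrow> exgf p (phi z) \<noteq> 0"
  using exgf_phi_cone(1)[of z] pmf_mu_pos by auto

lemma Ln_exgf_phi_holomorphic: "(\<lambda>z. Ln (exgf p (phi z))) holomorphic_on cone"
proof -
  have "(exgf p \<circ> phi) holomorphic_on cone"
  proof (rule holomorphic_on_compose_gen[OF _ exgf_holomorphic])
    show "phi holomorphic_on cone"
      by (rule holomorphic_on_subset[OF phi_holomorphic]) (auto simp: cone_def)
    show "phi ` cone \<subseteq> ball 0 1"
    proof safe
      fix z assume "z \<in> cone"
      then have R: "0 < Re z" by (rule cone_Re_pos)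
      then show "phi z \<in> ball 0 1"
        using norm_phi_le[of z] lap_less_1[OF R] by simp
    qed
  qed
  then have "(\<lambda>z. Ln ((exgf p \<circ> phi) z)) holomorphic_on cone"
  proof (rule holomorphic_on_Ln'[rotated])
    fix z assume "z \<in> cone"
    then have "0 < Re (exgf p (phi z))" using exgf_phi_cone(1)[of z] pmf_mu_pos by linarith
    then show "(exgf p \<circ> phi) z \<notin> \<real>\<^sub>\<le>\<^sub>0" by (auto simp: complex_nonpos_Reals_iff)
  qed
  then show ?thesis by simp
qed

lemma Eterm_holomorphic: "Eterm l holomorphic_on cone"
proof -
  have "((\<lambda>z. Ln (exgf p (phi z))) \<circ> (\<lambda>z. of_real (a ^ l) * z)) holomorphic_on cone"
    using cone_scale_power
    by (intro holomorphic_on_compose_gen[OF _ Ln_exgf_phi_holomorphic] holomorphic_intros) auto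
  then have "(\<lambda>z. Ln (exgf p (phi (of_real (a ^ l) * z))) / of_real (real mu ^ Suc l)) holomorphic_on cone"
    using mu_pos unfolding o_def by (intro holomorphic_on_divide holomorphic_on_const) auto
  then show ?thesis unfolding Eterm_def[abs_def] .
qed

lemma Ln_exgf_phi_near:
  assumes z: "z \<in> cone"
  shows "norm (Ln (exgf p (phi z)) - of_real (ln (pmf p mu))) \<le> 2 / pmf p mu * lap (Re z) ^ (lam - mu)"
proof -
  have R: "0 < Re z" using z by (rule cone_Re_pos)
  have "norm (Ln (exgf p (phi z)) - Ln (of_real (pmf p mu))) \<le>
     1 / (pmf p mu / 2) * norm (exgf p (phi z) - of_real (pmf p mu))"
    using exgf_phi_cone[OF z] pmf_mu_pos by (intro Ln_lipschitz_halfplane) auto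
  also have "\<dots> \<le> 1 / (pmf p mu / 2) * norm (phi z) ^ (lam - mu)"
    using R pmf_mu_pos by (intro mult_left_mono exgf_near_0 norm_phi_le_1) auto
  also have "\<dots> \<le> 1 / (pmf p mu / 2) * lap (Re z) ^ (lam - mu)"
    using R pmf_mu_pos by (intro mult_left_mono power_mono norm_phi_le) auto
  finally show ?thesis using pmf_mu_pos by (simp add: Ln_of_real)
qed

definition EE_const :: real where "EE_const = 2 / pmf p mu + \<bar>ln (pmf p mu)\<bar>"

lemma norm_Ln_exgf_phi_le: assumes z: "z \<in> cone" shows "norm (Ln (exgf p (phi z))) \<le> EE_const"
proof -
  have R: "0 < Re z" using z by (rule cone_Re_pos)
  have "lap (Re z) ^ (lam - mu) \<le> 1"
    using R lap_pos[of "Re z"] lap_le_1[of "Re z"] by (intro power_le_one) auto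
  then have "2 / pmf p mu * lap (Re z) ^ (lam - mu) \<le> 2 / pmf p mu"
    using pmf_mu_pos by (intro mult_left_le) auto
  moreover have "norm (Ln (exgf p (phi z))) \<le>
      norm (Ln (exgf p (phi z)) - of_real (ln (pmf p mu))) + norm (complex_of_real (ln (pmf p mu)))"
    using norm_triangle_sub[of "Ln (exgf p (phi z))" "complex_of_real (ln (pmf p mu))"] by linarith
  ultimately show ?thesis using Ln_exgf_phi_near[OF z] by (simp add: EE_const_def)
qed

lemma EE_const_pos: "0 < EE_const"
  unfolding EE_const_def using pmf_mu_pos by (intro add_pos_nonneg) auto

lemma norm_Eterm_le: assumes z: "z \<in> cone" shows "norm (Eterm l z) \<le> EE_const * (1 / real mu) ^ Suc l"
proof -
  have "norm (Eterm l z) = norm (Ln (exgf p (phi (of_real (a ^ l) * z)))) / real mu ^ Suc l"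
    by (simp add: Eterm_def norm_divide norm_mult norm_power)
  also have "\<dots> \<le> EE_const / real mu ^ Suc l"
    by (intro divide_right_mono norm_Ln_exgf_phi_le cone_scale_power z) simp
  finally show ?thesis by (simp add: power_one_over field_simps)
qed

lemma inverse_mu_sums: "(\<lambda>l. (1 / real mu) ^ Suc l) sums (1 / (real mu - 1))"
proof -
  have "(\<lambda>l. 1 / real mu * (1 / real mu) ^ l) sums (1 / real mu * (1 / (1 - 1 / real mu)))"
    using mu_pos by (intro sums_mult geometric_sums) auto
  moreover have "1 / real mu * (1 / (1 - 1 / real mu)) = 1 / (real mu - 1)"
    using mu_pos by (simp add: field_simps)
  ultimately show ?thesis by simp
qed

lemma summable_Eterm_bound: "summable (\<lambda>l. EE_const * (1 / real mu) ^ Suc l)"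
  by (rule summable_mult[OF sums_summable[OF inverse_mu_sums]])

lemma Eterm_summable: "z \<in> cone \<Longrightarrow> summable (\<lambda>l. Eterm l z)"
  by (rule summable_comparison_test'[OF summable_Eterm_bound norm_Eterm_le])

lemma EE_uniform_limit: "uniform_limit cone (\<lambda>k z. \<Sum>l<k. Eterm l z) EE sequentially"
  unfolding EE_def[abs_def]
  by (rule Weierstrass_m_test[OF norm_Eterm_le summable_Eterm_bound])

text \<open>The series converges uniformly on the cone, so it may be differentiated termwise. The
  second part later carries supporting lines of the summands over to the sum.\<close>

lemma EE_derivative:
  assumes "z \<in> cone"
  shows "(EE has_field_derivative deriv EE z) (at z)"
    and "(\<lambda>k. \<Sum>l<k. deriv (Eterm l) z) \<longlonglongrightarrow> deriv EE z"
proof -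
  have "\<exists>g'. \<forall>x\<in>cone. (EE has_field_derivative g' x) (at x) \<and> (\<lambda>k. \<Sum>l<k. deriv (Eterm l) x) \<longlonglongrightarrow> g' x"
  proof (rule has_complex_derivative_uniform_sequence[OF open_cone])
    show "((\<lambda>z. \<Sum>l<k. Eterm l z) has_field_derivative (\<Sum>l<k. deriv (Eterm l) x)) (at x)" if "x \<in> cone" for k x
      using holomorphic_derivI[OF Eterm_holomorphic open_cone that] by (intro DERIV_sum) auto
    show "\<exists>d>0. cball x d \<subseteq> cone \<and> uniform_limit (cball x d) (\<lambda>k z. \<Sum>l<k. Eterm l z) EE sequentially" if "x \<in> cone" for x
      using open_cone that open_contains_cball uniform_limit_on_subset[OF EE_uniform_limit] by metis
  qed
  then obtain g' where g: "(EE has_field_derivative g' z) (at z)" "(\<lambda>k. \<Sum>l<k. deriv (Eterm l) z) \<longlonglongrightarrow> g' z"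
    using assms by blast
  then have "g' z = deriv EE z" by (simp add: DERIV_imp_deriv)
  with g show "(EE has_field_derivative deriv EE z) (at z)"
    "(\<lambda>k. \<Sum>l<k. deriv (Eterm l) z) \<longlonglongrightarrow> deriv EE z" by auto
qed

lemma EE_holomorphic: "EE holomorphic_on cone"
  using EE_derivative(1) by (auto simp: holomorphic_on_open open_cone)

text \<open>Termwise comparison with the geometric series of \<open>EE_lim\<close>; as
  \<open>lap\<close> decreases, the error at every scale \<open>a ^ l\<close> is bounded by the one
  for l = 0.\<close>

lemma EE_near_lim:
  assumes z: "z \<in> cone"
  shows "norm (EE z - of_real EE_lim) \<le> 2 / pmf p mu * lap (Re z) ^ (lam - mu)"
proof -
  have R: "0 < Re z" using z by (rule cone_Re_pos)
  let ?K = "2 / pmf p mu * lap (Re z) ^ (lam - mu)"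
  have K0: "0 \<le> ?K" using pmf_mu_pos lap_pos[of "Re z"] R by simp
  have s1: "(\<lambda>l. of_real (ln (pmf p mu) * (1 / real mu) ^ Suc l)) sums complex_of_real EE_lim"
    using sums_mult[OF inverse_mu_sums, of "ln (pmf p mu)"] by (intro sums_of_real) (simp add: EE_lim_def)
  have s2: "(\<lambda>l. Eterm l z) sums EE z"
    unfolding EE_def by (rule summable_sums[OF Eterm_summable[OF z]])
  have s3: "(\<lambda>l. Eterm l z - of_real (ln (pmf p mu) * (1 / real mu) ^ Suc l)) sums (EE z - of_real EE_lim)"
    by (rule sums_diff[OF s2 s1])
  have bnd: "norm (Eterm l z - of_real (ln (pmf p mu) * (1 / real mu) ^ Suc l)) \<le> ?K * (1 / real mu) ^ Suc l" for l
  proof -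
    have "Eterm l z - of_real (ln (pmf p mu) * (1 / real mu) ^ Suc l) =
      (Ln (exgf p (phi (of_real (a ^ l) * z))) - of_real (ln (pmf p mu))) / of_real (real mu ^ Suc l)"
      unfolding Eterm_def diff_divide_distrib by (simp add: power_one_over)
    then have "norm (Eterm l z - of_real (ln (pmf p mu) * (1 / real mu) ^ Suc l)) =
      norm (Ln (exgf p (phi (of_real (a ^ l) * z))) - of_real (ln (pmf p mu))) / real mu ^ Suc l"
      by (simp only: norm_divide norm_of_real) simp
    also have "\<dots> \<le> (2 / pmf p mu * lap (Re (of_real (a ^ l) * z)) ^ (lam - mu)) / real mu ^ Suc l"
      by (intro divide_right_mono Ln_exgf_phi_near cone_scale_power z) simp
    also have "\<dots> \<le> ?K / real mu ^ Suc l"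
    proof (intro divide_right_mono mult_left_mono power_mono)
      have "1 * Re z \<le> a ^ l * Re z" using R mean_gt_1 by (intro mult_right_mono) auto
      then show "lap (Re (of_real (a ^ l) * z)) \<le> lap (Re z)" using R by (intro lap_antimono) auto
      show "0 \<le> lap (Re (of_real (a ^ l) * z))" using R mean_pos lap_pos[of "Re (of_real (a ^ l) * z)"] by auto
    qed (use pmf_mu_pos in auto)
    finally show ?thesis by (simp add: power_one_over)
  qed
  have sb: "(\<lambda>l. ?K * (1 / real mu) ^ Suc l) sums (?K * (1 / (real mu - 1)))"
    by (rule sums_mult[OF inverse_mu_sums])
  have "norm (EE z - of_real EE_lim) \<le> (\<Sum>l. ?K * (1 / real mu) ^ Suc l)"
    unfolding sums_unique[OF s3] by (rule norm_suminf_le[OF bnd sums_summable[OF sb]])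
  also have "\<dots> = ?K * (1 / (real mu - 1))" using sums_unique[OF sb] by simp
  also have "\<dots> \<le> ?K"
  proof (rule mult_left_le)
    show "1 / (real mu - 1) \<le> 1" using mu_ge_2 by simp
  qed (rule K0)
  finally show ?thesis .
qed

lemma Eterm_shift: "Eterm (l + k) z = Eterm l (of_real (a ^ k) * z) / of_real (real mu ^ k)"
  by (simp add: Eterm_def power_add mult_ac)

text \<open>Self-similarity of the series: the tail from index k on is the full series at the larger
  scale \<open>a ^ k\<close>, divided by mu^k.\<close>

lemma EE_split:
  assumes z: "z \<in> cone"
  shows "EE z = (\<Sum>l<k. Eterm l z) + EE (of_real (a ^ k) * z) / of_real (real mu ^ k)"
proof -
  have "EE z = (\<Sum>l. Eterm (l + k) z) + (\<Sum>l<k. Eterm l z)"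
    unfolding EE_def by (rule suminf_split_initial_segment[OF Eterm_summable[OF z]])
  also have "(\<Sum>l. Eterm (l + k) z) = EE (of_real (a ^ k) * z) / of_real (real mu ^ k)"
    unfolding Eterm_shift EE_def
    by (rule suminf_divide[OF Eterm_summable[OF cone_scale_power[OF z]]])
  finally show ?thesis by simp
qed

section \<open>The correction term on the real axis\<close>

lemma Eterm_of_real:
  assumes "0 < u"
  shows "Eterm l (of_real u) = of_real (ln (exgf p (lap (a ^ l * u))) / real mu ^ Suc l)"
proof -
  have au: "0 < a ^ l * u" using assms mean_pos by simp
  then have l: "0 < lap (a ^ l * u)" "lap (a ^ l * u) \<le> 1" using lap_pos[of "a ^ l * u"] lap_le_1[of "a ^ l * u"] by auto
  have "exgf p (phi (of_real (a ^ l) * of_real u)) = complex_of_real (exgf p (lap (a ^ l * u)))"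
    using phi_of_real[of "a ^ l * u"] au l by (simp add: exgf_of_real)
  then show ?thesis using exgf_bounds(3)[of "lap (a ^ l * u)"] l
    by (simp add: Eterm_def Ln_of_real)
qed

definition Er :: "real \<Rightarrow> real" where "Er u = Re (EE (of_real u))"

lemma Er_sums: "0 < u \<Longrightarrow> (\<lambda>l. ln (exgf p (lap (a ^ l * u))) / real mu ^ Suc l) sums Er u"
  using sums_Re[OF summable_sums[OF Eterm_summable[of "of_real u"]]]
  by (simp add: Eterm_of_real Er_def EE_def)

lemma Er_nonpos: assumes "0 < u" shows "Er u \<le> 0"
proof -
  have "ln (exgf p (lap (a ^ l * u))) / real mu ^ Suc l \<le> 0" for l
  proof -
    have au: "0 < a ^ l * u" using assms mean_pos by simp
    then have "0 < exgf p (lap (a ^ l * u))" "exgf p (lap (a ^ l * u)) \<le> 1"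
      using lap_pos[of "a ^ l * u"] lap_le_1[of "a ^ l * u"] by (auto intro: exgf_bounds)
    then show ?thesis by (intro divide_nonpos_nonneg) auto
  qed
  then show ?thesis using sums_le[OF _ Er_sums[OF assms] sums_zero] by blast
qed

lemma Er_near_lim: assumes "0 < u" shows "\<bar>Er u - EE_lim\<bar> \<le> 2 / pmf p mu * lap u ^ (lam - mu)"
proof -
  have "\<bar>Re (EE (of_real u) - of_real EE_lim)\<bar> \<le> norm (EE (of_real u) - of_real EE_lim)" by (rule abs_Re_le_cmod)
  also have "\<dots> \<le> 2 / pmf p mu * lap u ^ (lam - mu)" using EE_near_lim[of "of_real u"] assms by simp
  finally show ?thesis by (simp add: Er_def)
qed

text \<open>\<open>mu ^ k * FF k z\<close> serves as a logarithm of phi(a^k z). It is assembled from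
  logarithms of single factors, because the principal logarithm of phi(a^k z) itself would
  jump.\<close>

definition FF :: "nat \<Rightarrow> complex \<Rightarrow> complex" where
  "FF k z = Ln (phi z) + (\<Sum>l<k. Eterm l z)"

text \<open>Induction on k: one more step of the functional equation multiplies the exponent by mu
  and adds the logarithm stored in \<open>Eterm k\<close>.\<close>

lemma exp_FF:
  assumes z: "z \<in> cone" and nz: "phi z \<noteq> 0"
  shows "exp (of_nat (mu ^ k) * FF k z) = phi (of_real (a ^ k) * z)"
proof (induction k)
  case 0
  then show ?case using nz by (simp add: FF_def)
next
  case (Suc k)
  have zk: "of_real (a ^ k) * z \<in> cone" by (rule cone_scale_power[OF z])
  have "of_nat (mu ^ Suc k) * FF (Suc k) z =
     of_nat mu * (of_nat (mu ^ k) * FF k z) + of_nat (mu ^ Suc k) * Eterm k z"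
    by (simp add: FF_def algebra_simps)
  also have "of_nat (mu ^ Suc k) * Eterm k z = Ln (exgf p (phi (of_real (a ^ k) * z)))"
    using mu_pos by (simp add: Eterm_def)
  finally have "exp (of_nat (mu ^ Suc k) * FF (Suc k) z) =
     exp (of_nat (mu ^ k) * FF k z) ^ mu * exgf p (phi (of_real (a ^ k) * z))"
    using exgf_phi_cone_nonzero[OF zk] by (simp add: exp_add exp_of_nat_mult)
  also have "\<dots> = pgf p (phi (of_real (a ^ k) * z))" unfolding Suc by (simp add: pgf_eq)
  also have "\<dots> = phi (of_real a * (of_real (a ^ k) * z))"
    using cone_Re_pos[OF zk] by (intro phi_mult_a[symmetric]) simp
  finally show ?case by (simp add: mult.assoc)
qed

text \<open>The cone controls exgf(phi(z)) but not phi(z) itself. The extra bound on Im z keeps Re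
  phi(z) above \<open>lap U / 2\<close>, so that \<open>Ln (phi z)\<close> is holomorphic as
  well.\<close>

definition window :: "real \<Rightarrow> complex set" where
  "window U = {z \<in> cone. Re z < U \<and> \<bar>Im z\<bar> < lap U / 2 * Re z}"

lemma open_window: "open (window U)"
proof -
  have "window U = cone \<inter> {z. Re z < U \<and> \<bar>Im z\<bar> < lap U / 2 * Re z}" by (auto simp: window_def)
  moreover have "open {z. Re z < U \<and> \<bar>Im z\<bar> < lap U / 2 * Re z}"
    by (intro open_Collect_conj open_Collect_less continuous_intros)
  ultimately show ?thesis using open_cone by auto
qed

lemma Re_phi_window: assumes "z \<in> window U" shows "lap U / 2 < Re (phi z)"
proof -
  have R: "0 < Re z" "Re z < U" using assms cone_Re_pos[of z] by (auto simp: window_def)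
  have "norm (phi z - phi (of_real (Re z))) \<le> \<bar>Im z\<bar> / Re z" by (rule phi_near_real[OF R(1)])
  also have "\<dots> < lap U / 2" using assms R by (simp add: window_def field_simps)
  finally have "\<bar>Re (phi z - phi (of_real (Re z)))\<bar> < lap U / 2"
    using abs_Re_le_cmod order_le_less_trans by blast
  moreover have "Re (phi (of_real (Re z))) = lap (Re z)" using R by (simp add: phi_of_real)
  moreover have "lap U \<le> lap (Re z)" using R by (intro lap_antimono) auto
  ultimately show ?thesis unfolding abs_less_iff minus_complex.sel by linarith
qed

lemma FF_holomorphic: assumes "0 < U" shows "FF k holomorphic_on window U"
proof -
  have sub: "window U \<subseteq> cone" "window U \<subseteq> {z. 0 < Re z}" by (auto simp: window_def cone_def)
  have "(\<lambda>z. Ln (phi z)) holomorphic_on window U"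
  proof (rule holomorphic_on_Ln'[OF _ holomorphic_on_subset[OF phi_holomorphic sub(2)]])
    fix z assume "z \<in> window U"
    then have "0 < Re (phi z)" using Re_phi_window[of z U] lap_pos[of U] assms by simp
    then show "phi z \<notin> \<real>\<^sub>\<le>\<^sub>0" by (auto simp: complex_nonpos_Reals_iff)
  qed
  then show ?thesis unfolding FF_def
    by (intro holomorphic_on_add holomorphic_on_sum holomorphic_on_subset[OF Eterm_holomorphic sub(1)])
qed

text \<open>The bound is free of \<open>k\<close>, because the added terms decay geometrically; this
  makes the later Cauchy estimates uniform in the generation.\<close>

lemma norm_FF_le:
  assumes U: "0 < U" and z: "z \<in> window U"
  shows "norm (FF k z) \<le> \<bar>ln (lap U / 2)\<bar> + pi + EE_const"
proof -
  have zc: "z \<in> cone" using z by (simp add: window_def)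
  have Rp: "lap U / 2 < Re (phi z)" by (rule Re_phi_window[OF z])
  have lU: "0 < lap U" using lap_pos[of U] U by simp
  have nz: "phi z \<noteq> 0" using Rp lU by auto
  have "lap U / 2 \<le> norm (phi z)" using Rp complex_Re_le_cmod[of "phi z"] by linarith
  moreover have "norm (phi z) \<le> 1" using norm_phi_le_1[of z] cone_Re_pos[OF zc] by simp
  moreover have "\<bar>ln (norm (phi z))\<bar> \<le> \<bar>ln (lap U / 2)\<bar>"
  proof -
    have "ln (lap U / 2) \<le> ln (norm (phi z))" using calculation(1) lU nz by (subst ln_le_cancel_iff) auto
    moreover have "ln (norm (phi z)) \<le> 0" using \<open>norm (phi z) \<le> 1\<close> nz by (subst ln_le_zero_iff) auto
    ultimately show ?thesis by linarith
  qed
  moreover have "\<bar>Im (Ln (phi z))\<bar> \<le> pi" using Im_Ln_le_pi[OF nz] mpi_less_Im_Ln[OF nz] by simp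
  ultimately have 1: "norm (Ln (phi z)) \<le> \<bar>ln (lap U / 2)\<bar> + pi"
    using cmod_le[of "Ln (phi z)"] Re_Ln[OF nz] by linarith
  have "norm (\<Sum>l<k. Eterm l z) \<le> (\<Sum>l<k. EE_const * (1 / real mu) ^ Suc l)"
    by (intro order_trans[OF norm_sum] sum_mono norm_Eterm_le zc)
  also have "\<dots> \<le> (\<Sum>l. EE_const * (1 / real mu) ^ Suc l)"
    using EE_const_pos by (intro sum_le_suminf summable_Eterm_bound) auto
  also have "\<dots> = EE_const * (1 / (real mu - 1))"
    by (rule sums_unique[OF sums_mult[OF inverse_mu_sums], symmetric])
  also have "\<dots> \<le> EE_const" using EE_const_pos mu_ge_2 by (intro mult_left_le) auto
  finally have "norm (\<Sum>l<k. Eterm l z) \<le> EE_const" .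
  with 1 show ?thesis unfolding FF_def by (intro order_trans[OF norm_triangle_ineq]) simp
qed

end

section \<open>Convexity and the saddle point\<close>

lemma exp_eq_one_plus_iff: "exp x = 1 + x \<longleftrightarrow> x = 0" for x :: real
proof
  assume "exp x = 1 + x"
  then have "ln (exp x) = exp x - 1" unfolding ln_exp by linarith
  then have "exp x = 1" by (intro ln_eq_minus_one) auto
  then show "x = 0" by simp
qed simp

text \<open>f(v) - c v has a minimum at u. This identifies slopes found by convexity with
  derivatives obtained from holomorphy.\<close>

lemma supporting_slope_eq_derivative:
  fixes f :: "real \<Rightarrow> real"
  assumes "(f has_real_derivative D) (at u)" "0 < u"
    and "\<And>v. 0 < v \<Longrightarrow> f v - f u \<ge> c * (v - u)"
  shows "c = D"
proof -
  have "((\<lambda>v. f v - c * v) has_real_derivative D - c * 1) (at u)"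
    by (intro DERIV_diff DERIV_cmult assms DERIV_ident)
  then have "D - c * 1 = 0"
  proof (rule DERIV_local_min[where d = u])
    show "\<forall>y. \<bar>u - y\<bar> < u \<longrightarrow> f u - c * u \<le> f y - c * y"
    proof (intro allI impI)
      fix y assume "\<bar>u - y\<bar> < u"
      then have "0 < y" by (simp add: abs_less_iff)
      from assms(3)[OF this] show "f u - c * u \<le> f y - c * y" by (simp add: algebra_simps)
    qed
  qed (rule assms)
  then show ?thesis by simp
qed

context boettcher_gw
begin

definition lap_slope :: "real \<Rightarrow> real" where
  "lap_slope u = - Re (phi_moment (Suc 0) (of_real u)) / lap u"

text \<open>The mean of N - mu under the offspring law proportional to p_n s^n, and at the same time
  the derivative of ln exgf with respect to ln s.\<close>

definition mean_slope :: "real \<Rightarrow> real" where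
  "mean_slope s = measure_pmf.expectation p (\<lambda>n. real (n - mu) * s ^ (n - mu)) / exgf p s"

lemma ln_lap_derivative:
  assumes "0 < u"
  shows "((\<lambda>v. ln (lap v)) has_real_derivative lap_slope u) (at u)"
proof -
  have "(phi has_field_derivative - phi_moment (Suc 0) (of_real u)) (at (of_real u))"
    using phi_moment_derivative[of "of_real u" 0] assms by (simp add: phi_moment_0)
  from has_real_derivative_Re_of_real(1)[OF this]
  have "((\<lambda>x. Re (phi (of_real x))) has_real_derivative - Re (phi_moment (Suc 0) (of_real u))) (at u)"
    by simp
  then have "(lap has_real_derivative - Re (phi_moment (Suc 0) (of_real u))) (at u)"
  proof (rule has_field_derivative_transform_within_open[where S = "{0<..}"])
    show "Re (phi (of_real x)) = lap x" if "x \<in> {0<..}" for x using that by (simp add: phi_of_real)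
  qed (use assms in auto)
  then show ?thesis
    unfolding lap_slope_def using lap_pos[of u] assms by (auto intro!: derivative_eq_intros)
qed

lemma moment1_real:
  assumes "0 < u"
  shows "Re (phi_moment (Suc 0) (of_real u)) = (\<integral>x. W x * exp (- u * W x) \<partial>M)"
    and "integrable M (\<lambda>x. W x * exp (- u * W x))"
proof -
  have e: "of_real (W x ^ Suc 0) * exp (- of_real u * of_real (W x)) = complex_of_real (W x * exp (- u * W x))" for x
    by (simp flip: exp_of_real)
  have i: "integrable M (\<lambda>x. complex_of_real (W x ^ Suc 0) * exp (- of_real u * of_real (W x)))"
    by (rule integrable_moment) (use assms in simp)
  show "Re (phi_moment (Suc 0) (of_real u)) = (\<integral>x. W x * exp (- u * W x) \<partial>M)"
    unfolding phi_moment_def e by (simp only: integral_complex_of_real Re_complex_of_real)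
  show "integrable M (\<lambda>x. W x * exp (- u * W x))"
    using i unfolding e by (simp only: complex_of_real_integrable_eq)
qed

text \<open>Strict convexity of a logarithmic Laplace transform: exp(x) >= 1 + x is integrated at x
  = -(v - u) (W - m), where m is the mean of W under the weight exp(-u W). Equality would force W =
  m almost surely.\<close>

lemma ln_lap_supporting:
  assumes u: "0 < u" and v: "0 < v" and uv: "u \<noteq> v"
  shows "lap_slope u * (v - u) < ln (lap v) - ln (lap u)"
proof -
  define m where "m = - lap_slope u"
  define c where "c = v - u"
  have lu: "0 < lap u" "0 < lap v" using u v lap_pos by auto
  have i0: "integrable M (\<lambda>x. exp (- u * W x))" using u by (intro integrable_exp_W_real) simp
  have iv: "integrable M (\<lambda>x. exp (- v * W x))" using v by (intro integrable_exp_W_real) simp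
  have i1: "integrable M (\<lambda>x. W x * exp (- u * W x))" by (rule moment1_real[OF u])
  have m1: "(\<integral>x. W x * exp (- u * W x) \<partial>M) = m * lap u"
    using lu by (simp add: m_def lap_slope_def moment1_real[OF u])
  \<comment> \<open>The tangent minorant of exp(-v W); its integral is explicit because W - m is
    centred under the weight exp(-u W).\<close>
  let ?g = "\<lambda>x. exp (- c * m) * (exp (- u * W x) - c * (W x * exp (- u * W x)) + c * m * exp (- u * W x))"
  have ig: "integrable M ?g"
    by (intro integrable_mult_right Bochner_Integration.integrable_add Bochner_Integration.integrable_diff i0 i1)
  have eg: "(\<integral>x. ?g x \<partial>M) = exp (- c * m) * lap u"
  proof -
    have "(\<integral>x. ?g x \<partial>M) = exp (- c * m) * ((\<integral>x. exp (- u * W x) \<partial>M) - c * (\<integral>x. W x * exp (- u * W x) \<partial>M)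
        + c * m * (\<integral>x. exp (- u * W x) \<partial>M))"
      using i0 i1 by simp
    then show ?thesis unfolding m1 by (simp add: laplace_W_def)
  qed
  have fac: "exp (- v * W x) - ?g x = exp (- c * m) * exp (- u * W x) * (exp (- c * (W x - m)) - (1 + - c * (W x - m)))" for x
  proof -
    have "- v * W x = - c * m + - u * W x + - c * (W x - m)" by (simp add: c_def algebra_simps)
    then have "exp (- v * W x) = exp (- c * m) * exp (- u * W x) * exp (- c * (W x - m))"
      by (simp only: exp_add)
    then show ?thesis by (simp add: algebra_simps)
  qed
  have nn: "0 \<le> exp (- v * W x) - ?g x" for x
    unfolding fac using exp_ge_add_one_self[of "- c * (W x - m)"] by (intro mult_nonneg_nonneg) auto
  have id: "integrable M (\<lambda>x. exp (- v * W x) - ?g x)" using iv ig by simp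
  have "(\<integral>x. exp (- v * W x) - ?g x \<partial>M) \<noteq> 0"
  proof
    assume "(\<integral>x. exp (- v * W x) - ?g x \<partial>M) = 0"
    then have "AE x in M. exp (- v * W x) - ?g x = 0"
      using id nn by (subst (asm) integral_nonneg_eq_0_iff_AE) auto
    then have "AE x in M. W x = m"
    proof eventually_elim
      case (elim x)
      then have "exp (- c * (W x - m)) = 1 + - c * (W x - m)" unfolding fac by simp
      then have "- c * (W x - m) = 0" by (simp only: exp_eq_one_plus_iff)
      then show ?case using uv by (simp add: c_def)
    qed
    then show False using W_not_const by blast
  qed
  moreover have "0 \<le> (\<integral>x. exp (- v * W x) - ?g x \<partial>M)" by (intro integral_nonneg_AE AE_I2 nn)
  ultimately have "0 < (\<integral>x. exp (- v * W x) - ?g x \<partial>M)" by simp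
  also have "\<dots> = (\<integral>x. exp (- v * W x) \<partial>M) - (\<integral>x. ?g x \<partial>M)"
    by (rule Bochner_Integration.integral_diff[OF iv ig])
  also have "\<dots> = lap v - exp (- c * m) * lap u"
    unfolding eg by (simp add: laplace_W_def)
  finally have "exp (- c * m) * lap u < lap v" by simp
  then have "ln (exp (- c * m) * lap u) < ln (lap v)" using lu by (subst ln_less_cancel_iff) auto
  then show ?thesis using lu by (simp add: ln_mult c_def m_def algebra_simps)
qed

lemma ln_lap_supporting_le:
  "0 < u \<Longrightarrow> 0 < v \<Longrightarrow> lap_slope u * (v - u) \<le> ln (lap v) - ln (lap u)"
  using ln_lap_supporting[of u v] by (cases "u = v") auto

lemma integrable_weighted_diff:
  "0 \<le> s \<Longrightarrow> s \<le> 1 \<Longrightarrow> integrable (measure_pmf p) (\<lambda>n. real (n - mu) * s ^ (n - mu))" for s :: real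
  by (rule Bochner_Integration.integrable_bound[OF integrable_diff])
     (auto simp: abs_mult power_le_one intro!: mult_left_le)

lemma mean_slope_nonneg: "0 \<le> s \<Longrightarrow> s \<le> 1 \<Longrightarrow> 0 \<le> mean_slope s"
  unfolding mean_slope_def using exgf_bounds(3)[of s]
  by (intro divide_nonneg_nonneg integral_nonneg_AE) (auto intro: less_imp_le)

text \<open>Convexity in the variable ln s, by exp(x) >= 1 + x under the offspring law tilted by
  \<open>s\<close>.\<close>

lemma ln_exgf_supporting:
  assumes s: "0 < s" "s \<le> 1" and t: "0 < t" "t \<le> 1"
  shows "mean_slope s * (ln t - ln s) \<le> ln (exgf p t) - ln (exgf p s)"
proof -
  define m where "m = mean_slope s"
  define c where "c = ln t - ln s"
  have gs: "0 < exgf p s" "0 < exgf p t" using s t exgf_bounds by auto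
  have i0: "integrable (measure_pmf p) (\<lambda>n. s ^ (n - mu))" using s by (intro integrable_power) auto
  have it: "integrable (measure_pmf p) (\<lambda>n. t ^ (n - mu))" using t by (intro integrable_power) auto
  have i1: "integrable (measure_pmf p) (\<lambda>n. real (n - mu) * s ^ (n - mu))" using s by (intro integrable_weighted_diff) auto
  have m1: "measure_pmf.expectation p (\<lambda>n. real (n - mu) * s ^ (n - mu)) = m * exgf p s"
    using gs by (simp add: m_def mean_slope_def)
  let ?g = "\<lambda>n. exp (c * m) * (s ^ (n - mu) + c * (real (n - mu) * s ^ (n - mu)) - c * m * s ^ (n - mu))"
  have "measure_pmf.expectation p ?g = exp (c * m) * (measure_pmf.expectation p (\<lambda>n. s ^ (n - mu)) +
      c * measure_pmf.expectation p (\<lambda>n. real (n - mu) * s ^ (n - mu)) - c * m * measure_pmf.expectation p (\<lambda>n. s ^ (n - mu)))"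
    using i0 i1 by simp
  then have "exp (c * m) * exgf p s = measure_pmf.expectation p ?g" unfolding m1 by (simp add: exgf_def)
  also have "\<dots> \<le> exgf p t" unfolding exgf_def
  proof (rule integral_mono)
    show "integrable (measure_pmf p) ?g"
      by (intro integrable_mult_right Bochner_Integration.integrable_add Bochner_Integration.integrable_diff i0 i1)
    fix n
    let ?J = "real (n - mu)"
    have "t = s * exp c" using s t by (simp add: c_def exp_diff)
    then have "t ^ (n - mu) = s ^ (n - mu) * exp (?J * c)" by (simp add: power_mult_distrib flip: exp_of_nat_mult)
    also have "exp (?J * c) = exp (c * m) * exp (c * (?J - m))" by (simp flip: exp_add add: algebra_simps)
    finally have tj: "t ^ (n - mu) = s ^ (n - mu) * (exp (c * m) * exp (c * (?J - m)))" .
    have "?g n = s ^ (n - mu) * (exp (c * m) * (1 + c * (?J - m)))" by (simp add: algebra_simps)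
    also have "\<dots> \<le> t ^ (n - mu)"
      unfolding tj using s exp_ge_add_one_self[of "c * (?J - m)"] by (intro mult_left_mono) auto
    finally show "?g n \<le> t ^ (n - mu)" .
  qed (rule it)
  finally have "ln (exp (c * m) * exgf p s) \<le> ln (exgf p t)" using gs by (subst ln_le_cancel_iff) auto
  then show ?thesis using gs by (simp add: ln_mult c_def m_def mult.commute)
qed

lemma Er_derivative: "0 < u \<Longrightarrow> (Er has_real_derivative Re (deriv EE (of_real u))) (at u)"
  unfolding Er_def[abs_def] by (intro has_real_derivative_Re_of_real EE_derivative) simp

text \<open>ln exgf is convex and nondecreasing in ln s, and s = lap(a^l u) with ln lap convex.
  Chaining the two supporting lines uses \<open>mean_slope >= 0\<close>; the resulting slope must be
  the derivative.\<close>

lemma Eterm_supporting: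
  assumes u: "0 < u" and v: "0 < v"
  shows "Re (deriv (Eterm l) (of_real u)) * (v - u) \<le> Re (Eterm l (of_real v)) - Re (Eterm l (of_real u))"
proof -
  define c where "c = mean_slope (lap (a ^ l * u)) * lap_slope (a ^ l * u) * a ^ l / real mu ^ Suc l"
  have al: "0 < a ^ l" using mean_pos by simp
  have sup: "c * (v - u) \<le> Re (Eterm l (of_real v)) - Re (Eterm l (of_real u))" if v: "0 < v" for v
  proof -
    have p: "0 < a ^ l * u" "0 < a ^ l * v" using u v al by auto
    have lp: "0 < lap (a ^ l * u)" "lap (a ^ l * u) \<le> 1" "0 < lap (a ^ l * v)" "lap (a ^ l * v) \<le> 1"
      using p lap_pos lap_le_1 by (auto intro: less_imp_le)
    have "mean_slope (lap (a ^ l * u)) * (lap_slope (a ^ l * u) * (a ^ l * v - a ^ l * u)) \<le>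
        mean_slope (lap (a ^ l * u)) * (ln (lap (a ^ l * v)) - ln (lap (a ^ l * u)))"
      using p lp by (intro mult_left_mono ln_lap_supporting_le mean_slope_nonneg) auto
    also have "\<dots> \<le> ln (exgf p (lap (a ^ l * v))) - ln (exgf p (lap (a ^ l * u)))"
      using lp by (intro ln_exgf_supporting) auto
    finally have "mean_slope (lap (a ^ l * u)) * (lap_slope (a ^ l * u) * (a ^ l * v - a ^ l * u)) / real mu ^ Suc l \<le>
        (ln (exgf p (lap (a ^ l * v))) - ln (exgf p (lap (a ^ l * u)))) / real mu ^ Suc l"
      by (rule divide_right_mono) simp
    also have "mean_slope (lap (a ^ l * u)) * (lap_slope (a ^ l * u) * (a ^ l * v - a ^ l * u)) / real mu ^ Suc l = c * (v - u)"
      by (simp add: c_def algebra_simps)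
    finally show ?thesis using u v by (simp add: Eterm_of_real diff_divide_distrib del: power_Suc)
  qed
  have "((\<lambda>x. Re (Eterm l (of_real x))) has_real_derivative Re (deriv (Eterm l) (of_real u))) (at u)"
    using u by (intro has_real_derivative_Re_of_real holomorphic_derivI[OF Eterm_holomorphic open_cone]) simp
  from supporting_slope_eq_derivative[OF this u sup] sup[OF v] show ?thesis by simp
qed

lemma Er_supporting:
  assumes u: "0 < u" and v: "0 < v"
  shows "Re (deriv EE (of_real u)) * (v - u) \<le> Er v - Er u"
proof (rule LIMSEQ_le)
  show "(\<lambda>k. Re (\<Sum>l<k. deriv (Eterm l) (of_real u)) * (v - u)) \<longlonglongrightarrow> Re (deriv EE (of_real u)) * (v - u)"
    using u by (intro tendsto_intros EE_derivative) simp
  have "(\<lambda>k. \<Sum>l<k. Eterm l (of_real w)) \<longlonglongrightarrow> EE (of_real w)" if "0 < w" for w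
    using summable_LIMSEQ[OF Eterm_summable[of "of_real w"]] that by (simp add: EE_def)
  then show "(\<lambda>k. Re (\<Sum>l<k. Eterm l (of_real v)) - Re (\<Sum>l<k. Eterm l (of_real u))) \<longlonglongrightarrow> Er v - Er u"
    unfolding Er_def using u v by (intro tendsto_intros) auto
  have "Re (\<Sum>l<k. deriv (Eterm l) (of_real u)) * (v - u) \<le>
      Re (\<Sum>l<k. Eterm l (of_real v)) - Re (\<Sum>l<k. Eterm l (of_real u))" for k
  proof -
    have "(\<Sum>l<k. Re (deriv (Eterm l) (of_real u)) * (v - u)) \<le>
        (\<Sum>l<k. Re (Eterm l (of_real v)) - Re (Eterm l (of_real u)))"
      by (intro sum_mono Eterm_supporting u v)
    then show ?thesis by (simp add: sum_distrib_right sum_subtractf)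
  qed
  then show "\<exists>N. \<forall>k\<ge>N. Re (\<Sum>l<k. deriv (Eterm l) (of_real u)) * (v - u) \<le>
      Re (\<Sum>l<k. Eterm l (of_real v)) - Re (\<Sum>l<k. Eterm l (of_real u))" by blast
qed

text \<open>This is b o phi, as \<open>b_fun_lap\<close> confirms. The chosen form exhibits its
  convexity and its holomorphic extension.\<close>

definition BB :: "real \<Rightarrow> real" where "BB u = ln (lap u) + Er u"

definition BB' :: "real \<Rightarrow> real" where "BB' u = lap_slope u + Re (deriv EE (of_real u))"

lemma BB_derivative: "0 < u \<Longrightarrow> (BB has_real_derivative BB' u) (at u)"
  unfolding BB_def[abs_def] BB'_def by (intro DERIV_add ln_lap_derivative Er_derivative)

lemma BB_supporting: "0 < u \<Longrightarrow> 0 < v \<Longrightarrow> u \<noteq> v \<Longrightarrow> BB' u * (v - u) < BB v - BB u"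
  using ln_lap_supporting[of u v] Er_supporting[of u v] by (simp add: BB_def BB'_def algebra_simps)

lemma BB'_strict_mono: assumes "0 < u" "u < v" shows "BB' u < BB' v"
proof -
  have "BB' u * (v - u) < BB v - BB u" "BB' v * (u - v) < BB u - BB v"
    using assms by (auto intro!: BB_supporting)
  then have "(BB' u - BB' v) * (v - u) < 0" by (simp add: algebra_simps)
  then show ?thesis using assms by (simp add: mult_less_0_iff)
qed

text \<open>Iterating the functional equation k times collects the first k terms of the series for
  \<open>Er u\<close>; the missing tail is \<open>Er (a ^ k * u) / mu ^ k\<close>. The identity is
  exact, with a bounded last term.\<close>

lemma ln_lap_mult_power_a:
  assumes "0 < u" shows "ln (lap (a ^ k * u)) = real mu ^ k * BB u - Er (a ^ k * u)"
proof -
  have "real mu ^ k * (ln (lap u) + (\<Sum>l<k. ln (exgf p (lap (a ^ l * u))) / real mu ^ Suc l)) = ln (lap (a ^ k * u))"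
  proof (induction k)
    case (Suc k)
    have ak: "0 < a ^ k * u" using assms mean_pos by simp
    have l: "0 < lap (a ^ k * u)" "lap (a ^ k * u) \<le> 1" using lap_pos[of "a ^ k * u"] lap_le_1[of "a ^ k * u"] ak by auto
    have "lap (a ^ Suc k * u) = lap (a ^ k * u) ^ mu * exgf p (lap (a ^ k * u))"
      using lap_mult_a[of "a ^ k * u"] ak by (simp add: pgf_eq mult.assoc)
    then have "ln (lap (a ^ Suc k * u)) = real mu * ln (lap (a ^ k * u)) + ln (exgf p (lap (a ^ k * u)))"
      using l exgf_bounds(3)[of "lap (a ^ k * u)"] by (simp add: ln_mult ln_realpow)
    moreover have "real mu ^ Suc k * (x + (S + t / real mu ^ Suc k)) = real mu * (real mu ^ k * (x + S)) + t" for x S t :: real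
      using mu_pos by (simp add: field_simps)
    ultimately show ?case using Suc by (simp only: sum.lessThan_Suc)
  qed simp
  moreover have "Er u = (\<Sum>l<k. ln (exgf p (lap (a ^ l * u))) / real mu ^ Suc l) + Er (a ^ k * u) / real mu ^ k"
  proof -
    have "EE (of_real u) = (\<Sum>l<k. Eterm l (of_real u)) + EE (of_real (a ^ k * u)) / of_real (real mu ^ k)"
      using EE_split[of "of_real u" k] assms by simp
    then have "Er u = (\<Sum>l<k. Re (Eterm l (of_real u))) + Re (EE (of_real (a ^ k * u)) / of_real (real mu ^ k))"
      unfolding Er_def by (metis plus_complex.sel(1) Re_sum)
    then show ?thesis using assms
      by (simp add: Eterm_of_real Re_divide_of_real Er_def del: power_Suc flip: of_real_power of_nat_power)
  qed
  ultimately have "ln (lap (a ^ k * u)) = real mu ^ k * (BB u - Er (a ^ k * u) / real mu ^ k)"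
    by (simp add: BB_def)
  then show ?thesis using mu_pos by (simp add: algebra_simps)
qed

text \<open>The iterates of f at \<open>lap u\<close> are the values \<open>lap (a ^ m * u)\<close>;
  dividing the exact identity by mu^m removes the bounded term \<open>Er\<close>.\<close>

lemma b_fun_lap: assumes "0 < u" shows "b_fun p (lap u) = BB u"
proof -
  have it: "(offspring_gf p ^^ m) (lap u) = lap (a ^ m * u)" for m
  proof (induction m)
    case (Suc m)
    have "0 \<le> a ^ m * u" using assms mean_pos by simp
    then show ?case using Suc lap_mult_a[of "a ^ m * u"] lap_le_1[of "a ^ m * u"] lap_pos[of "a ^ m * u"]
      by (simp add: offspring_gf_eq mult.assoc)
  qed simp
  have "ln ((offspring_gf p ^^ m) (lap u)) / real mu ^ m = BB u - Er (a ^ m * u) / real mu ^ m" for m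
    unfolding it using ln_lap_mult_power_a[OF assms, of m] mu_pos by (simp add: diff_divide_distrib)
  moreover have "(\<lambda>m. BB u - Er (a ^ m * u) / real mu ^ m) \<longlonglongrightarrow> BB u - 0"
  proof (intro tendsto_diff tendsto_const)
    define C where "C = \<bar>EE_lim\<bar> + 2 / pmf p mu"
    have b: "norm (Er (a ^ m * u) / real mu ^ m) \<le> C * (1 / real mu) ^ m" for m
    proof -
      have am: "0 < a ^ m * u" using assms mean_pos by simp
      have "lap (a ^ m * u) ^ (lam - mu) \<le> 1" using lap_pos[of "a ^ m * u"] lap_le_1[of "a ^ m * u"] am by (intro power_le_one) auto
      then have "2 / pmf p mu * lap (a ^ m * u) ^ (lam - mu) \<le> 2 / pmf p mu" using pmf_mu_pos by (intro mult_left_le) auto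
      then have "\<bar>Er (a ^ m * u)\<bar> \<le> C" using Er_near_lim[OF am] unfolding C_def by linarith
      then show ?thesis using mu_pos by (simp add: power_one_over divide_right_mono)
    qed
    have "(\<lambda>m. C * (1 / real mu) ^ m) \<longlonglongrightarrow> C * 0"
      using mu_pos by (intro tendsto_mult tendsto_const LIMSEQ_power_zero) auto
    then show "(\<lambda>m. Er (a ^ m * u) / real mu ^ m) \<longlonglongrightarrow> 0"
      by (intro Lim_null_comparison[OF always_eventually[OF allI[OF b]]]) simp
  qed
  ultimately show ?thesis unfolding b_fun_def by (simp add: limI)
qed

lemma BB_mult_a: assumes "0 < u" shows "BB (a * u) = real mu * BB u"
proof -
  have au: "0 < a * u" using assms mean_pos by simp
  have "ln (lap (a * u)) = real mu * BB u - Er (a * u)"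
    using ln_lap_mult_power_a[OF assms, of 1] by simp
  then show ?thesis by (simp add: BB_def)
qed

lemma BB'_mult_a: assumes "0 < u" shows "a * BB' (a * u) = real mu * BB' u"
proof -
  have au: "0 < a * u" using assms mean_pos by simp
  have "((\<lambda>u. BB (a * u)) has_real_derivative BB' (a * u) * a) (at u)"
    by (rule DERIV_chain2[where f = BB and g = "\<lambda>u. a * u", OF BB_derivative[OF au]])
       (auto intro!: derivative_eq_intros)
  moreover have "((\<lambda>u. BB (a * u)) has_real_derivative real mu * BB' u) (at u)"
  proof (rule has_field_derivative_transform_within_open[where S = "{0<..}"])
    show "((\<lambda>u. real mu * BB u) has_real_derivative real mu * BB' u) (at u)"
      by (intro DERIV_cmult BB_derivative assms)
    show "real mu * BB x = BB (a * x)" if "x \<in> {0<..}" for x using that BB_mult_a by simp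
  qed (use assms in auto)
  ultimately show ?thesis using DERIV_unique by (metis mult.commute)
qed

lemma BB_neg: assumes "0 < u" shows "BB u < 0"
proof -
  have "ln (lap u) < 0" using lap_less_1[OF assms] lap_pos[of u] assms by (simp add: ln_less_zero)
  then show ?thesis using Er_nonpos[OF assms] by (simp add: BB_def)
qed

text \<open>A nonnegative slope at u would give BB(a u) > BB(u), whereas BB(a u) = mu BB(u) is
  smaller, BB being negative.\<close>

lemma BB'_neg: assumes "0 < u" shows "BB' u < 0"
proof (rule ccontr)
  assume "\<not> BB' u < 0"
  then have "0 \<le> BB' u * (a * u - u)" using assms mean_gt_1 by (intro mult_nonneg_nonneg) auto
  also have "\<dots> < BB (a * u) - BB u" using assms mean_gt_1 by (intro BB_supporting) auto
  also have "\<dots> = (real mu - 1) * BB u" using BB_mult_a[OF assms] by (simp add: algebra_simps)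
  also have "\<dots> < 0" using BB_neg[OF assms] mu_pos by (intro mult_pos_neg) auto
  finally show False .
qed

lemma BB'_continuous: "continuous_on {0<..} BB'"
proof -
  have "continuous_on {0<..} (\<lambda>u. Re (deriv EE (of_real u)))"
    by (intro continuous_on_Re continuous_on_compose2[OF holomorphic_on_imp_continuous_on[OF
          holomorphic_deriv[OF EE_holomorphic open_cone]]] continuous_intros) auto
  moreover have "continuous_on {0<..} (\<lambda>u. - Re (phi_moment (Suc 0) (of_real u)) / Re (phi (of_real u)))"
  proof (intro continuous_on_divide continuous_on_minus continuous_on_Re)
    show "continuous_on {0<..} (\<lambda>u. phi_moment (Suc 0) (of_real u))" "continuous_on {0<..} (\<lambda>u. phi (of_real u))"
      by (rule continuous_on_compose2[OF holomorphic_on_imp_continuous_on[OF phi_moment_holomorphic]]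
        continuous_on_compose2[OF holomorphic_on_imp_continuous_on[OF phi_holomorphic]]; auto intro!: continuous_intros)+
    show "\<forall>u\<in>{0<..}. Re (phi (of_real u)) \<noteq> 0"
    proof
      fix u :: real assume "u \<in> {0<..}"
      then show "Re (phi (of_real u)) \<noteq> 0" using lap_pos[of u] by (simp add: phi_of_real)
    qed
  qed
  then have "continuous_on {0<..} lap_slope"
    by (rule continuous_on_eq) (simp add: lap_slope_def phi_of_real)
  ultimately show ?thesis unfolding BB'_def[abs_def] by (intro continuous_on_add)
qed

lemma BB'_mult_power_a: assumes "0 < u" shows "BB' (a ^ m * u) = (real mu / a) ^ m * BB' u"
proof (induction m)
  case (Suc m)
  have "0 < a ^ m * u" using assms mean_pos by simp
  from BB'_mult_a[OF this] have "BB' (a * (a ^ m * u)) = real mu / a * BB' (a ^ m * u)"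
    using mean_pos by (simp add: field_simps)
  then show ?case unfolding Suc by (simp add: mult.assoc)
qed simp

text \<open>By BB'(a^m u) = (mu / a)^m BB'(u), the slope comes arbitrarily close to 0 and becomes
  arbitrarily negative; the intermediate value theorem does the rest.\<close>

lemma ex_BB'_eq: assumes "0 < y" shows "\<exists>u>0. BB' u = - y"
proof -
  have q: "0 < real mu / a" "real mu / a < 1" using mean_gt_mu mu_pos by auto
  have b1: "BB' 1 < 0" by (rule BB'_neg) simp
  have "0 < y / - BB' 1" using assms b1 by (intro divide_pos_pos) auto
  then have "\<exists>m. (real mu / a) ^ m < y / - BB' 1"
    using q by (intro real_arch_pow_inv)
  then obtain m where "(real mu / a) ^ m < y / - BB' 1" ..
  then have m: "- y < BB' (a ^ m * 1)"
    using b1 BB'_mult_power_a[of 1 m] by (simp add: field_simps)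
  obtain k where k: "y / - BB' 1 < (a / real mu) ^ k"
    using real_arch_pow[of "a / real mu"] mean_gt_mu mu_pos by auto
  define v where "v = 1 / a ^ k"
  have v: "0 < v" "v \<le> 1" using mean_gt_1 by (auto simp: v_def)
  have "BB' (a ^ k * v) = (real mu / a) ^ k * BB' v" by (rule BB'_mult_power_a[OF v(1)])
  then have "BB' 1 = (real mu / a) ^ k * BB' v" using mean_pos by (simp add: v_def)
  then have "BB' v = (a / real mu) ^ k * BB' 1" using mean_pos mu_pos by (simp add: power_divide field_simps)
  then have k': "BB' v < - y" using k b1 by (simp add: field_simps)
  have "1 \<le> a ^ m" using mean_gt_1 by simp
  then have "v \<le> a ^ m * 1" using v by linarith
  then have "\<exists>x\<ge>v. x \<le> a ^ m * 1 \<and> BB' x = - y"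
    using v k' m by (intro IVT') (auto intro!: continuous_on_subset[OF BB'_continuous])
  then obtain x where "v \<le> x" "BB' x = - y" by blast
  then show ?thesis using v by (intro exI[of _ x]) auto
qed

text \<open>The saddle point for y = 1, the upper end of the range of y.\<close>

definition U0 :: real where "U0 = (SOME u. 0 < u \<and> BB' u = - 1)"

lemma U0: "0 < U0" "BB' U0 = - 1"
  using someI_ex[OF ex_BB'_eq[of 1, unfolded]] by (auto simp: U0_def)

lemma deriv_b_lap: "0 < u \<Longrightarrow> deriv (b_fun p \<circ> lap) u = BB' u"
proof (rule DERIV_imp_deriv)
  assume u: "0 < u"
  show "(b_fun p \<circ> lap has_real_derivative BB' u) (at u)"
    by (rule has_field_derivative_transform_within_open[where S = "{0<..}", OF BB_derivative[OF u]])
       (use u in \<open>auto simp: b_fun_lap\<close>)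
qed

text \<open>BB' increases from -1 at \<open>U0\<close> to -mu/a at \<open>a * U0\<close>, and y lies
  in (mu/a, 1], so the saddle never leaves this interval. Strict monotonicity of BB' makes the
  definite description in \<open>u1\<close> meaningful.\<close>

lemma u1_props:
  assumes y: "real mu / a < y_scale p e" "y_scale p e \<le> 1"
  shows "U0 \<le> u1 M p X e" "u1 M p X e \<le> a * U0" "BB' (u1 M p X e) = - y_scale p e"
proof -
  have y0: "0 < y_scale p e" using y mu_pos mean_pos by (intro less_trans[OF _ y(1)]) simp
  obtain u where u: "0 < u" "BB' u = - y_scale p e" using ex_BB'_eq[OF y0] by blast
  have "u1 M p X e = u" unfolding u1_def
  proof (rule the_equality)
    show "0 < u \<and> deriv (b_fun p \<circ> lap) u = - y_scale p e" using u by (simp add: deriv_b_lap)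
    fix v assume "0 < v \<and> deriv (b_fun p \<circ> lap) v = - y_scale p e"
    then have v: "0 < v" "BB' v = - y_scale p e" by (auto simp: deriv_b_lap)
    then show "v = u" using u BB'_strict_mono[of u v] BB'_strict_mono[of v u] by (metis less_irrefl linorder_neqE_linordered_idom)
  qed
  moreover have "U0 \<le> u" using BB'_strict_mono[of u U0] U0 u y by (force simp: not_le[symmetric])
  moreover have "u \<le> a * U0"
  proof (rule ccontr)
    assume "\<not> u \<le> a * U0"
    then have "BB' (a * U0) < BB' u" using U0 mean_pos by (intro BB'_strict_mono) auto
    moreover have "BB' (a * U0) = - (real mu / a)" using BB'_mult_a[OF U0(1)] U0 mean_pos by (simp add: field_simps)
    ultimately show False using u y by simp
  qed
  ultimately show "U0 \<le> u1 M p X e" "u1 M p X e \<le> a * U0" "BB' (u1 M p X e) = - y_scale p e" using u by auto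
qed

end

section \<open>Gaussian behaviour near the real axis\<close>

lemma Im_deriv_eq_0:
  assumes h: "h holomorphic_on S" "open S" "complex_of_real u \<in> S"
    and I: "open I" "u \<in> I" "\<And>x. x \<in> I \<Longrightarrow> Im (h (of_real x)) = 0"
  shows "Im (deriv h (of_real u)) = 0"
proof -
  have "((\<lambda>x. Im (h (of_real x))) has_real_derivative Im (deriv h (of_real u))) (at u)"
    by (rule has_real_derivative_Re_of_real(2)[OF holomorphic_derivI[OF h]])
  moreover have "((\<lambda>x. Im (h (of_real x))) has_real_derivative 0) (at u)"
    by (rule has_field_derivative_transform_within_open[OF _ I(1,2), of "\<lambda>_. 0"]) (use I(3) in auto)
  ultimately show ?thesis by (rule DERIV_unique)
qed

context boettcher_gw
begin

definition U1 :: real where "U1 = a * U0"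

lemma U0_less_U1: "U0 < U1" and U1_pos: "0 < U1"
  using U0 mean_gt_1 mean_pos by (auto simp: U1_def)

text \<open>Half of a radius for which all discs about points of \<open>{U0..U1}\<close> stay in the
  window; Cauchy's estimate with radius \<open>win_r\<close> is then available at every point within
  \<open>win_r\<close> of them.\<close>

definition win_r :: real where
  "win_r = min (U0 / 2) (min aperture (lap (2 * U1) / 2) * U0 / 4) / 2"

lemma win_r_pos: "0 < win_r"
  using U0 aperture_pos lap_pos[of "2 * U1"] U1_pos by (simp add: win_r_def)

lemma cball_window:
  assumes u: "u \<in> {U0..U1}" and z: "norm (z - of_real u) \<le> 2 * win_r"
  shows "z \<in> window (2 * U1)"
proof -
  define m where "m = min aperture (lap (2 * U1) / 2)"
  have m: "0 < m" "m \<le> aperture" "m \<le> lap (2 * U1) / 2"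
    using aperture_pos lap_pos[of "2 * U1"] U1_pos by (auto simp: m_def)
  have r: "2 * win_r \<le> U0 / 2" "2 * win_r \<le> m * U0 / 4" by (auto simp: win_r_def m_def)
  have "\<bar>Re z - u\<bar> \<le> U0 / 2" "\<bar>Im z\<bar> \<le> m * U0 / 4"
    using abs_Re_le_cmod[of "z - of_real u"] abs_Im_le_cmod[of "z - of_real u"] z r by simp_all
  moreover from this have "Re z - u \<le> U0 / 2" "u - Re z \<le> U0 / 2" by linarith+
  ultimately have R: "U0 / 2 \<le> Re z" "Re z < 2 * U1" and I: "\<bar>Im z\<bar> \<le> m * U0 / 4"
    using u U0(1) U0_less_U1 unfolding atLeastAtMost_iff by linarith+
  have "m * U0 / 4 < m * (U0 / 2)" using m U0 by simp
  also have "\<dots> \<le> m * Re z" using m R by (intro mult_left_mono) auto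
  finally have "\<bar>Im z\<bar> < m * Re z" using I by linarith
  moreover have "m * Re z \<le> aperture * Re z" "m * Re z \<le> lap (2 * U1) / 2 * Re z"
    using m R U0 by (auto intro!: mult_right_mono simp del: times_divide_eq_left)
  ultimately have "\<bar>Im z\<bar> < aperture * Re z" "\<bar>Im z\<bar> < lap (2 * U1) / 2 * Re z" by linarith+
  then show ?thesis using R U0 by (simp add: window_def cone_def)
qed

definition FF_bound :: real where "FF_bound = \<bar>ln (lap (2 * U1) / 2)\<bar> + pi + EE_const + 1"

lemma FF_bound_pos: "0 < FF_bound"
  unfolding FF_bound_def using EE_const_pos pi_gt_zero by linarith

lemma norm_FF_less: "z \<in> window (2 * U1) \<Longrightarrow> norm (FF k z) < FF_bound"
  using norm_FF_le[of "2 * U1" z k] U1_pos by (simp add: FF_bound_def)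

lemmas FF_hol = FF_holomorphic[of "2 * U1"]

lemma higher_deriv_FF_bound:
  assumes u: "u \<in> {U0..U1}" and w: "norm (w - of_real u) \<le> win_r" and n: "0 < n"
  shows "norm ((deriv ^^ n) (FF k) w) \<le> fact n * FF_bound / win_r ^ n"
proof -
  have sub: "cball w win_r \<subseteq> window (2 * U1)"
  proof
    fix z assume "z \<in> cball w win_r"
    then have "norm (z - w) \<le> win_r" by (simp add: dist_norm norm_minus_commute)
    then have "norm (z - of_real u) \<le> 2 * win_r"
      using norm_triangle_ineq[of "z - w" "w - of_real u"] w by simp
    then show "z \<in> window (2 * U1)" by (rule cball_window[OF u])
  qed
  have hol: "FF k holomorphic_on cball w win_r"
    using U1_pos by (intro holomorphic_on_subset[OF FF_hol sub]) simp
  show ?thesis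
  proof (rule Cauchy_higher_deriv_bound[OF _ _ _ win_r_pos n])
    show "FF k holomorphic_on ball w win_r" by (rule holomorphic_on_subset[OF hol]) auto
    show "continuous_on (cball w win_r) (FF k)" by (rule holomorphic_on_imp_continuous_on[OF hol])
    show "FF k z \<in> ball 0 FF_bound" if "z \<in> ball w win_r" for z
      using norm_FF_less[of z k] sub that by (auto simp: subset_iff)
  qed
qed

text \<open>The sum of the Cauchy bounds 3! F / r^3 and 2! F / r^2, so that one constant serves the
  cubic remainder and the second derivative.\<close>

definition tay_C :: real where "tay_C = 6 * FF_bound / win_r ^ 3 + 2 * FF_bound / win_r ^ 2"

lemma tay_C_pos: "0 < tay_C"
  unfolding tay_C_def using FF_bound_pos win_r_pos by (intro add_pos_pos divide_pos_pos) auto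

abbreviation FF2 :: "nat \<Rightarrow> complex \<Rightarrow> complex" where "FF2 k \<equiv> deriv (deriv (FF k))"

lemma norm_FF2_le: assumes "u \<in> {U0..U1}" shows "norm (FF2 k (of_real u)) \<le> tay_C"
proof -
  have "norm ((deriv ^^ 2) (FF k) (of_real u)) \<le> fact 2 * FF_bound / win_r ^ 2"
    using win_r_pos by (intro higher_deriv_FF_bound[OF assms]) auto
  moreover have "0 \<le> 6 * FF_bound / win_r ^ 3" using FF_bound_pos win_r_pos by simp
  ultimately show ?thesis by (simp add: tay_C_def eval_nat_numeral)
qed

lemma taylor_FF:
  assumes u: "u \<in> {U0..U1}" and t: "\<bar>t\<bar> \<le> win_r"
  shows "norm (FF k (of_real u + \<i> * of_real t) -
    (FF k (of_real u) + \<i> * of_real t * deriv (FF k) (of_real u) - of_real (t\<^sup>2 / 2) * FF2 k (of_real u))) \<le> tay_C * \<bar>t\<bar> ^ 3"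
proof -
  let ?u = "complex_of_real u" and ?z = "of_real u + \<i> * complex_of_real t"
  have sub: "cball ?u win_r \<subseteq> window (2 * U1)"
    using cball_window[OF u] win_r_pos by (auto simp: dist_norm norm_minus_commute)
  have zu: "norm (?z - ?u) = \<bar>t\<bar>" by (simp add: norm_mult)
  have "norm ((deriv ^^ 0) (FF k) ?z - (\<Sum>i\<le>2. (deriv ^^ i) (FF k) ?u * (?z - ?u) ^ i / fact i))
     \<le> (6 * FF_bound / win_r ^ 3) * norm (?z - ?u) ^ Suc 2 / fact 2"
  proof (rule complex_Taylor[where S = "cball ?u win_r"])
    show "convex (cball ?u win_r)" by simp
    show "((deriv ^^ i) (FF k) has_field_derivative (deriv ^^ Suc i) (FF k) x) (at x within cball ?u win_r)"
      if "x \<in> cball ?u win_r" for i x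
    proof -
      have "(deriv ^^ i) (FF k) holomorphic_on window (2 * U1)"
        using U1_pos by (intro holomorphic_higher_deriv FF_hol open_window) simp
      from holomorphic_derivI[OF this open_window, of x] sub that
      show ?thesis by (auto intro: has_field_derivative_at_within)
    qed
    show "norm ((deriv ^^ Suc 2) (FF k) x) \<le> 6 * FF_bound / win_r ^ 3" if "x \<in> cball ?u win_r" for x
      using higher_deriv_FF_bound[OF u, of x 3 k] that
      by (simp add: dist_norm norm_minus_commute eval_nat_numeral)
  qed (use zu t win_r_pos in \<open>auto simp: dist_norm norm_minus_commute\<close>)
  also have "(\<Sum>i\<le>2. (deriv ^^ i) (FF k) ?u * (?z - ?u) ^ i / fact i) =
      FF k ?u + \<i> * of_real t * deriv (FF k) ?u - of_real (t\<^sup>2 / 2) * FF2 k ?u"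
  proof -
    have "(?z - ?u)\<^sup>2 = - of_real (t\<^sup>2)" by (simp add: power_mult_distrib)
    then show ?thesis by (simp add: eval_nat_numeral)
  qed
  also have "(6 * FF_bound / win_r ^ 3) * norm (?z - ?u) ^ Suc 2 / fact 2 \<le> tay_C * \<bar>t\<bar> ^ 3"
  proof -
    have "6 * FF_bound / win_r ^ 3 / 2 \<le> tay_C"
    proof -
      have "0 \<le> FF_bound / win_r ^ 3" "0 \<le> FF_bound / win_r ^ 2" using FF_bound_pos win_r_pos by auto
      then show ?thesis unfolding tay_C_def by (simp add: field_simps)
    qed
    then have "6 * FF_bound / win_r ^ 3 / 2 * \<bar>t\<bar> ^ 3 \<le> tay_C * \<bar>t\<bar> ^ 3"
      by (rule mult_right_mono) simp
    moreover have "(6 * FF_bound / win_r ^ 3) * norm (?z - ?u) ^ Suc 2 / fact 2 = 6 * FF_bound / win_r ^ 3 / 2 * \<bar>t\<bar> ^ 3"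
      unfolding zu by (simp add: fact_numeral)
    ultimately show ?thesis by (simp only:)
  qed
  finally show ?thesis by simp
qed

lemma of_real_window: "0 < u \<Longrightarrow> u < U \<Longrightarrow> of_real u \<in> window U"
  using lap_pos[of U] by (simp add: window_def)

lemma FF_of_real:
  assumes "0 < u" shows "FF k (of_real u) = of_real (BB u - Er (a ^ k * u) / real mu ^ k)"
proof -
  have 1: "Ln (phi (of_real u)) = of_real (ln (lap u))"
    using assms lap_pos[of u] by (simp add: phi_of_real Ln_of_real)
  have 2: "Eterm l (of_real u) = of_real (Re (Eterm l (of_real u)))" for l
    using assms by (simp add: Eterm_of_real)
  have 3: "Re (\<Sum>l<k. Eterm l (of_real u)) = Er u - Er (a ^ k * u) / real mu ^ k"
  proof -
    have "EE (of_real u) = (\<Sum>l<k. Eterm l (of_real u)) + EE (of_real (a ^ k * u)) / of_real (real mu ^ k)"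
      using EE_split[of "of_real u" k] assms by simp
    then have "Re (EE (of_real u)) = Re (\<Sum>l<k. Eterm l (of_real u)) + Re (EE (of_real (a ^ k * u)) / of_real (real mu ^ k))"
      by (metis plus_complex.sel(1))
    then show ?thesis by (simp add: Er_def Re_divide_of_real del: of_real_power flip: of_real_power of_nat_power)
  qed
  have "(\<Sum>l<k. Eterm l (of_real u)) = of_real (Re (\<Sum>l<k. Eterm l (of_real u)))"
    by (subst 2) simp
  then show ?thesis unfolding FF_def 1 3 by (simp add: BB_def)
qed

lemma Im_deriv_FF: assumes "0 < u" "u < 2 * U1" shows "Im (deriv (FF k) (of_real u)) = 0"
  using assms U1_pos
  by (intro Im_deriv_eq_0[OF FF_hol open_window of_real_window, of _ "{0<..<2 * U1}"]) (auto simp: FF_of_real)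

definition EE_drift :: real where
  "EE_drift = (\<bar>EE_lim\<bar> + 2 / pmf p mu + 1) / (min (1/2) (aperture / 4) * U0)"

lemma norm_EE_less: assumes "z \<in> cone" shows "norm (EE z) < \<bar>EE_lim\<bar> + 2 / pmf p mu + 1"
proof -
  have R: "0 < Re z" by (rule cone_Re_pos[OF assms])
  have "lap (Re z) ^ (lam - mu) \<le> 1" using R lap_pos[of "Re z"] lap_le_1[of "Re z"] by (intro power_le_one) auto
  then have "2 / pmf p mu * lap (Re z) ^ (lam - mu) \<le> 2 / pmf p mu" using pmf_mu_pos by (intro mult_left_le) auto
  moreover have "norm (EE z) \<le> norm (EE z - of_real EE_lim) + \<bar>EE_lim\<bar>"
    using norm_triangle_sub[of "EE z" "of_real EE_lim"] by simp
  ultimately show ?thesis using EE_near_lim[OF assms] by linarith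
qed

text \<open>Cauchy's estimate on a disc whose radius is a fixed fraction of a^k u. Such discs lie in
  the cone at every scale, where EE is bounded, and the growing radius pays for the factor
  a^k.\<close>

lemma norm_deriv_EE_le:
  assumes u: "U0 \<le> u" shows "a ^ k * norm (deriv EE (of_real (a ^ k * u))) \<le> EE_drift"
proof -
  define d where "d = min (1/2) (aperture / 4)"
  have d: "0 < d" "d \<le> 1/2" "d \<le> aperture / 4" using aperture_pos by (auto simp: d_def)
  define w where "w = a ^ k * u"
  have ak: "0 < a ^ k" using mean_pos by simp
  have w: "0 < w" using u U0 ak by (simp add: w_def)
  have sub: "cball (of_real w) (d * w) \<subseteq> cone"
  proof
    fix z assume "z \<in> cball (complex_of_real w) (d * w)"
    then have n: "norm (z - of_real w) \<le> d * w" by (simp add: dist_norm norm_minus_commute)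
    then have "\<bar>Re z - w\<bar> \<le> d * w" "\<bar>Im z\<bar> \<le> d * w"
      using abs_Re_le_cmod[of "z - of_real w"] abs_Im_le_cmod[of "z - of_real w"] by simp_all
    moreover have "d * w \<le> 1/2 * w" "d * w \<le> aperture / 4 * w" using d w by (auto intro!: mult_right_mono simp del: times_divide_eq_left)
    ultimately have R: "w / 2 \<le> Re z" and I: "\<bar>Im z\<bar> \<le> aperture / 4 * w" by (auto simp: abs_le_iff)
    have "aperture / 4 * w < aperture * (w / 2)" using aperture_pos w by simp
    also have "\<dots> \<le> aperture * Re z" using R aperture_pos by (intro mult_left_mono) auto
    finally show "z \<in> cone" using I R w by (simp add: cone_def)
  qed
  have hol: "EE holomorphic_on cball (of_real w) (d * w)" by (rule holomorphic_on_subset[OF EE_holomorphic sub])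
  have "norm ((deriv ^^ 1) EE (of_real w)) \<le> fact 1 * (\<bar>EE_lim\<bar> + 2 / pmf p mu + 1) / (d * w) ^ 1"
  proof (rule Cauchy_higher_deriv_bound)
    show "EE holomorphic_on ball (of_real w) (d * w)" by (rule holomorphic_on_subset[OF hol]) auto
    show "continuous_on (cball (of_real w) (d * w)) EE" by (rule holomorphic_on_imp_continuous_on[OF hol])
    show "EE z \<in> ball 0 (\<bar>EE_lim\<bar> + 2 / pmf p mu + 1)" if "z \<in> ball (of_real w) (d * w)" for z
      using norm_EE_less[of z] sub that by (auto simp: subset_iff)
  qed (use d w in auto)
  then have "a ^ k * norm (deriv EE (of_real w)) \<le> a ^ k * ((\<bar>EE_lim\<bar> + 2 / pmf p mu + 1) / (d * w))"
    using ak by (intro mult_left_mono) auto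
  also have "\<dots> = (\<bar>EE_lim\<bar> + 2 / pmf p mu + 1) / (d * u)"
    using mean_pos by (simp add: w_def)
  also have "\<dots> \<le> (\<bar>EE_lim\<bar> + 2 / pmf p mu + 1) / (d * U0)"
    using d u U0 pmf_mu_pos by (intro divide_left_mono mult_left_mono mult_pos_pos) auto
  finally show ?thesis by (simp add: EE_drift_def d_def w_def)
qed

lemma EE_drift_nonneg: "0 \<le> EE_drift"
  unfolding EE_drift_def using pmf_mu_pos aperture_pos U0 by (intro divide_nonneg_nonneg mult_nonneg_nonneg) auto

text \<open>On the real axis \<open>FF k\<close> is BB(u) - Er(a^k u) / mu^k. The saddle is defined
  through BB, so it misses that of \<open>FF k\<close> by a slope of order mu^-k, which is harmless
  after multiplication by mu^k.\<close>

lemma Re_deriv_FF: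
  assumes u: "u \<in> {U0..U1}"
  shows "\<bar>real mu ^ k * (Re (deriv (FF k) (of_real u)) - BB' u)\<bar> \<le> EE_drift"
proof -
  have u0: "0 < u" "u < 2 * U1" using u U0 U1_pos by auto
  have ak: "0 < a ^ k * u" using u0 mean_pos by simp
  have "((\<lambda>x. Re (FF k (of_real x))) has_real_derivative Re (deriv (FF k) (of_real u))) (at u)"
    using u0 U1_pos by (intro has_real_derivative_Re_of_real holomorphic_derivI[OF FF_hol open_window] of_real_window) auto
  moreover have "((\<lambda>x. Re (FF k (of_real x))) has_real_derivative
      BB' u - Re (deriv EE (of_real (a ^ k * u))) * a ^ k / real mu ^ k) (at u)"
  proof (rule has_field_derivative_transform_within_open[where S = "{0<..}"])
    have "((\<lambda>x. Er (a ^ k * x)) has_real_derivative Re (deriv EE (of_real (a ^ k * u))) * a ^ k) (at u)"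
      by (rule DERIV_chain2[where f = Er and g = "\<lambda>x. a ^ k * x", OF Er_derivative[OF ak]])
         (auto intro!: derivative_eq_intros)
    then show "((\<lambda>x. BB x - Er (a ^ k * x) / real mu ^ k) has_real_derivative
        BB' u - Re (deriv EE (of_real (a ^ k * u))) * a ^ k / real mu ^ k) (at u)"
      by (intro DERIV_diff BB_derivative u0 DERIV_cdivide)
  qed (use u0 in \<open>auto simp: FF_of_real\<close>)
  ultimately have "Re (deriv (FF k) (of_real u)) = BB' u - Re (deriv EE (of_real (a ^ k * u))) * a ^ k / real mu ^ k"
    by (rule DERIV_unique)
  then have "\<bar>real mu ^ k * (Re (deriv (FF k) (of_real u)) - BB' u)\<bar> = a ^ k * \<bar>Re (deriv EE (of_real (a ^ k * u)))\<bar>"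
    using mu_pos mean_pos by (simp add: abs_mult abs_minus_commute)
  also have "\<dots> \<le> a ^ k * norm (deriv EE (of_real (a ^ k * u)))"
    using mean_pos by (intro mult_left_mono abs_Re_le_cmod) auto
  also have "\<dots> \<le> EE_drift" using u by (intro norm_deriv_EE_le) auto
  finally show ?thesis .
qed

text \<open>The variance of W under the weight exp(-u W), that is the second derivative of ln
  lap.\<close>

definition tilt_var :: "real \<Rightarrow> real" where
  "tilt_var u = Re (phi_moment 2 (of_real u)) / lap u - (Re (phi_moment (Suc 0) (of_real u)) / lap u)\<^sup>2"

lemma moment2_real:
  assumes "0 < u"
  shows "Re (phi_moment 2 (of_real u)) = (\<integral>x. (W x)\<^sup>2 * exp (- u * W x) \<partial>M)"
    and "integrable M (\<lambda>x. (W x)\<^sup>2 * exp (- u * W x))"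
proof -
  have e: "of_real (W x ^ 2) * exp (- of_real u * of_real (W x)) = complex_of_real ((W x)\<^sup>2 * exp (- u * W x))" for x
    by (simp flip: exp_of_real)
  have i: "integrable M (\<lambda>x. complex_of_real (W x ^ 2) * exp (- of_real u * of_real (W x)))"
    by (rule integrable_moment) (use assms in simp)
  show "Re (phi_moment 2 (of_real u)) = (\<integral>x. (W x)\<^sup>2 * exp (- u * W x) \<partial>M)"
    unfolding phi_moment_def e by (simp only: integral_complex_of_real Re_complex_of_real)
  show "integrable M (\<lambda>x. (W x)\<^sup>2 * exp (- u * W x))"
    using i unfolding e by (simp only: complex_of_real_integrable_eq)
qed

lemma tilt_var_pos: assumes u: "0 < u" shows "0 < tilt_var u"
proof -
  define m where "m = Re (phi_moment (Suc 0) (of_real u)) / lap u"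
  have lu: "0 < lap u" using u lap_pos by simp
  have i0: "integrable M (\<lambda>x. exp (- u * W x))" using u by (intro integrable_exp_W_real) simp
  note i1 = moment1_real(2)[OF u] and i2 = moment2_real(2)[OF u]
  let ?f = "\<lambda>x. (W x)\<^sup>2 * exp (- u * W x) - 2 * m * (W x * exp (- u * W x)) + m\<^sup>2 * exp (- u * W x)"
  have sq: "?f x = (W x - m)\<^sup>2 * exp (- u * W x)" for x by (simp add: power2_eq_square algebra_simps)
  have if': "integrable M ?f"
    by (intro Bochner_Integration.integrable_add Bochner_Integration.integrable_diff integrable_mult_right i0 i1 i2)
  have "(\<integral>x. ?f x \<partial>M) = (\<integral>x. (W x)\<^sup>2 * exp (- u * W x) \<partial>M) - 2 * m * (\<integral>x. W x * exp (- u * W x) \<partial>M)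
      + m\<^sup>2 * (\<integral>x. exp (- u * W x) \<partial>M)"
    using i0 i1 i2 by simp
  also have "\<dots> = Re (phi_moment 2 (of_real u)) - 2 * m * (m * lap u) + m\<^sup>2 * lap u"
    unfolding moment2_real[OF u] using lu by (simp add: m_def moment1_real(1)[OF u] laplace_W_def)
  also have "\<dots> = lap u * tilt_var u"
    using lu by (simp add: tilt_var_def m_def[symmetric] field_simps power2_eq_square)
  finally have e: "(\<integral>x. ?f x \<partial>M) = lap u * tilt_var u" .
  have nn: "0 \<le> ?f x" for x unfolding sq by simp
  have "(\<integral>x. ?f x \<partial>M) \<noteq> 0"
  proof
    assume "(\<integral>x. ?f x \<partial>M) = 0"
    then have "AE x in M. ?f x = 0"
      using if' nn by (subst (asm) integral_nonneg_eq_0_iff_AE) auto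
    then have "AE x in M. W x = m" unfolding sq by (auto elim!: eventually_mono)
    then show False using W_not_const by blast
  qed
  moreover have "0 \<le> (\<integral>x. ?f x \<partial>M)" by (intro integral_nonneg_AE AE_I2 nn)
  ultimately have "0 < lap u * tilt_var u" unfolding e by linarith
  then show ?thesis using lu by (simp add: zero_less_mult_iff)
qed

lemma tilt_var_continuous: "continuous_on {0<..} tilt_var"
proof -
  have m: "continuous_on {0<..} (\<lambda>u. Re (phi_moment k (of_real u)))" for k
    by (intro continuous_on_Re continuous_on_compose2[OF holomorphic_on_imp_continuous_on[OF phi_moment_holomorphic]]
        continuous_intros) auto
  have nz: "\<forall>u\<in>{0<..}. Re (phi_moment 0 (of_real u)) \<noteq> 0"
  proof
    fix u :: real assume "u \<in> {0<..}"
    then show "Re (phi_moment 0 (of_real u)) \<noteq> 0" using lap_pos[of u] by (simp add: phi_moment_0 phi_of_real)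
  qed
  have "continuous_on {0<..} (\<lambda>u. Re (phi_moment 2 (of_real u)) / Re (phi_moment 0 (of_real u)) -
     (Re (phi_moment (Suc 0) (of_real u)) / Re (phi_moment 0 (of_real u)))\<^sup>2)"
    by (intro continuous_on_diff continuous_on_power continuous_on_divide m nz)
  then show ?thesis
    by (rule continuous_on_eq) (simp add: tilt_var_def phi_moment_0 phi_of_real)
qed

lemma Im_phi_moment_of_real: assumes "0 < u" shows "phi_moment k (of_real u) = of_real (Re (phi_moment k (of_real u)))"
proof -
  have "of_real (W x ^ k) * exp (- of_real u * of_real (W x)) = complex_of_real (W x ^ k * exp (- u * W x))" for x
    by (simp flip: exp_of_real)
  then show ?thesis unfolding phi_moment_def by (simp only: integral_complex_of_real Re_complex_of_real)
qed

lemma FF2_0: assumes u: "u \<in> {U0..U1}" shows "FF2 0 (of_real u) = of_real (tilt_var u)"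
proof -
  have FF0: "FF 0 = (\<lambda>z. Ln (phi z))" by (simp add: FF_def fun_eq_iff)
  have ph: "(phi has_field_derivative - phi_moment (Suc 0) z) (at z)" if "z \<in> window (2 * U1)" for z
    using phi_moment_derivative[of z 0] that by (simp add: phi_moment_0 window_def cone_def)
  have pos: "0 < Re (phi z)" if "z \<in> window (2 * U1)" for z
    using Re_phi_window[OF that] lap_pos[of "2 * U1"] U1_pos by simp
  have d1: "deriv (FF 0) z = - phi_moment (Suc 0) z / phi z" if z: "z \<in> window (2 * U1)" for z
  proof (rule DERIV_imp_deriv)
    have "phi z \<notin> \<real>\<^sub>\<le>\<^sub>0" using pos[OF z] by (auto simp: complex_nonpos_Reals_iff)
    then show "(FF 0 has_field_derivative - phi_moment (Suc 0) z / phi z) (at z)"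
      unfolding FF0 using ph[OF z] by (auto intro!: derivative_eq_intros simp: field_simps)
  qed
  have uw: "of_real u \<in> window (2 * U1)" using u U0 U1_pos by (intro of_real_window) auto
  have u0: "0 < u" using u U0 by simp
  have l: "0 < lap u" using u0 lap_pos by simp
  have "(deriv (FF 0) has_field_derivative
      (phi_moment 2 (of_real u) * phi (of_real u) - (phi_moment (Suc 0) (of_real u))\<^sup>2) / (phi (of_real u))\<^sup>2) (at (of_real u))"
  proof (rule has_field_derivative_transform_within_open[OF _ open_window uw])
    have "phi (of_real u) \<noteq> 0" using pos[OF uw] by auto
    then show "((\<lambda>z. - phi_moment (Suc 0) z / phi z) has_field_derivative
      (phi_moment 2 (of_real u) * phi (of_real u) - (phi_moment (Suc 0) (of_real u))\<^sup>2) / (phi (of_real u))\<^sup>2) (at (of_real u))"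
      using phi_moment_derivative[of "of_real u" "Suc 0"] ph[OF uw] u0
      by (auto intro!: derivative_eq_intros simp: power2_eq_square numeral_2_eq_2 diff_divide_distrib)
  qed (simp add: d1)
  then have "FF2 0 (of_real u) =
      (phi_moment 2 (of_real u) * phi (of_real u) - (phi_moment (Suc 0) (of_real u))\<^sup>2) / (phi (of_real u))\<^sup>2"
    by (rule DERIV_imp_deriv)
  also have "\<dots> = of_real ((Re (phi_moment 2 (of_real u)) * lap u - (Re (phi_moment (Suc 0) (of_real u)))\<^sup>2) / (lap u)\<^sup>2)"
  proof -
    define A1 where "A1 = Re (phi_moment (Suc 0) (of_real u))"
    define A2 where "A2 = Re (phi_moment 2 (of_real u))"
    have e: "phi_moment (Suc 0) (of_real u) = of_real A1" "phi_moment 2 (of_real u) = of_real A2" "phi (of_real u) = of_real (lap u)"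
      using Im_phi_moment_of_real[OF u0] phi_of_real[of u] u0 by (simp_all add: A1_def A2_def)
    show ?thesis unfolding A1_def[symmetric] A2_def[symmetric] unfolding e by simp
  qed
  also have "(Re (phi_moment 2 (of_real u)) * lap u - (Re (phi_moment (Suc 0) (of_real u)))\<^sup>2) / (lap u)\<^sup>2 = tilt_var u"
    using l by (simp add: tilt_var_def field_simps power2_eq_square)
  finally show ?thesis .
qed

lemma chi_eq_exp_FF:
  assumes u: "u \<in> {U0..U1}" and t: "\<bar>t\<bar> \<le> win_r"
  shows "chi (of_real (a ^ k) * (of_real u + \<i> * of_real t)) =
      exp (of_nat (mu ^ k) * (FF k (of_real u + \<i> * of_real t) - FF k (of_real u)))"
proof -
  let ?z = "of_real u + \<i> * complex_of_real t"
  have u0: "0 < u" using u U0 by simp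
  have w: "?z \<in> window (2 * U1)"
    using t win_r_pos by (intro cball_window[OF u]) (simp add: norm_mult)
  have lU: "0 < lap (2 * U1)" using lap_pos[of "2 * U1"] U1_pos by simp
  have zc: "?z \<in> cone" using w by (simp add: window_def)
  have nz: "phi ?z \<noteq> 0" using Re_phi_window[OF w] lU by auto
  have nu: "phi (of_real u) \<noteq> 0" using u0 lap_pos[of u] by (simp add: phi_of_real)
  have e1: "exp (of_nat (mu ^ k) * FF k ?z) = phi (of_real (a ^ k) * ?z)" by (rule exp_FF[OF zc nz])
  have e2: "exp (of_nat (mu ^ k) * FF k (of_real u)) = of_real (lap (a ^ k * u))"
    using exp_FF[OF of_real_in_cone[OF u0] nu, of k] phi_of_real[of "a ^ k * u"] u0 mean_pos by simp
  have R: "Re (of_real (a ^ k) * ?z) = a ^ k * u" by simp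
  have "exp (of_nat (mu ^ k) * (FF k ?z - FF k (of_real u))) =
     exp (of_nat (mu ^ k) * FF k ?z) / exp (of_nat (mu ^ k) * FF k (of_real u))"
    by (simp only: right_diff_distrib exp_diff)
  then show ?thesis unfolding e1 e2 chi_def R by simp
qed

text \<open>For k = 0 the quadratic term of the logarithm is governed by \<open>tilt_var\<close>,
  which has a positive minimum on the compact interval.\<close>

lemma chi_gaussian_bound:
  "\<exists>c d. 0 < c \<and> 0 < d \<and> d \<le> win_r \<and> (\<forall>u\<in>{U0..U1}. \<forall>t. \<bar>t\<bar> \<le> d \<longrightarrow> norm (chi (of_real u + \<i> * of_real t)) \<le> exp (- c * t\<^sup>2))"
proof -
  have "continuous_on {U0..U1} tilt_var" by (rule continuous_on_subset[OF tilt_var_continuous]) (use U0 in auto)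
  moreover have "{U0..U1} \<noteq> {}" using U0_less_U1 by auto
  ultimately obtain u' where u': "u' \<in> {U0..U1}" "\<And>u. u \<in> {U0..U1} \<Longrightarrow> tilt_var u' \<le> tilt_var u"
    using continuous_attains_inf[of "{U0..U1}" tilt_var] by auto
  define v where "v = tilt_var u'"
  have v: "0 < v" unfolding v_def using u' U0 by (intro tilt_var_pos) auto
  \<comment> \<open>For |t| up to this \<open>d\<close> the cubic remainder uses up at most half of
    the quadratic term v t^2 / 2.\<close>
  define d where "d = min win_r (v / (4 * tay_C))"
  have d: "0 < d" "d \<le> win_r" "d \<le> v / (4 * tay_C)" using v tay_C_pos win_r_pos by (auto simp: d_def)
  have "norm (chi (of_real u + \<i> * of_real t)) \<le> exp (- (v / 4) * t\<^sup>2)" if u: "u \<in> {U0..U1}" and t: "\<bar>t\<bar> \<le> d" for u t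
  proof -
    let ?z = "of_real u + \<i> * complex_of_real t"
    have tw: "\<bar>t\<bar> \<le> win_r" using t d by linarith
    have u0: "0 < u" "u < 2 * U1" using u U0 U1_pos by auto
    define R where "R = FF 0 ?z - (FF 0 (of_real u) + \<i> * of_real t * deriv (FF 0) (of_real u) - of_real (t\<^sup>2 / 2) * FF2 0 (of_real u))"
    have nR: "norm R \<le> tay_C * \<bar>t\<bar> ^ 3" unfolding R_def by (rule taylor_FF[OF u tw])
    have "FF 0 ?z - FF 0 (of_real u) = R + (\<i> * of_real t * deriv (FF 0) (of_real u) - of_real (t\<^sup>2 / 2) * of_real (tilt_var u))"
      unfolding R_def FF2_0[OF u] by simp
    then have "Re (FF 0 ?z - FF 0 (of_real u)) = Re R - t\<^sup>2 / 2 * tilt_var u"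
      using Im_deriv_FF[OF u0, of 0] by simp
    also have "\<dots> \<le> tay_C * \<bar>t\<bar> ^ 3 - t\<^sup>2 / 2 * v"
      using nR complex_Re_le_cmod[of R] u'(2)[OF u] by (intro diff_mono mult_left_mono) (auto simp: v_def)
    also have "tay_C * \<bar>t\<bar> ^ 3 \<le> v / 4 * t\<^sup>2"
    proof -
      have "tay_C * \<bar>t\<bar> \<le> tay_C * (v / (4 * tay_C))" using t d tay_C_pos by (intro mult_left_mono) auto
      also have "\<dots> = v / 4" using tay_C_pos by simp
      finally have "tay_C * \<bar>t\<bar> * t\<^sup>2 \<le> v / 4 * t\<^sup>2" by (rule mult_right_mono) simp
      then show ?thesis by (simp add: power3_eq_cube power2_eq_square)
    qed
    finally have "Re (FF 0 ?z - FF 0 (of_real u)) \<le> - (v / 4) * t\<^sup>2" by simp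
    moreover have "norm (chi ?z) = exp (Re (FF 0 ?z - FF 0 (of_real u)))"
      using chi_eq_exp_FF[OF u tw, of 0] by simp
    ultimately show ?thesis by simp
  qed
  then show ?thesis using v d by (intro exI[of _ "v / 4"] exI[of _ d]) auto
qed

end

section \<open>Transforms of small balls\<close>

text \<open>The Fourier pair of exp(-e |t|) and the Cauchy kernel of width \<open>e\<close>. The
  half-line and the cosine suffice, since the transforms at t and -t are conjugate.\<close>

lemma laplace_cos_integral:
  fixes x e :: real
  assumes e: "0 < e"
  shows "integrable lborel (\<lambda>t. indicator {0<..} t * (exp (- (t * e)) * cos (t * x)))"
    and "(\<integral>t. indicator {0<..} t * (exp (- (t * e)) * cos (t * x)) \<partial>lborel) = e / (e\<^sup>2 + x\<^sup>2)"
proof -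
  have i0: "set_integrable lborel {0<..} (\<lambda>t. exp (- (t * e)))" by (rule integrable_I0i_exp_mscale[OF e])
  have i: "set_integrable lborel {0<..} (\<lambda>t. exp (- (t * e)) * cos (t * x))"
    by (rule set_integrable_bound[OF i0]) (auto simp: set_borel_measurable_def abs_mult intro!: mult_left_le AE_I2)
  then show "integrable lborel (\<lambda>t. indicator {0<..} t * (exp (- (t * e)) * cos (t * x)))"
    by (simp add: set_integrable_def)
  \<comment> \<open>An antiderivative: the real part of exp(t (-e + i x)) / (-e + i x).\<close>
  define F where "F t = exp (- (t * e)) * (x * sin (t * x) - e * cos (t * x)) / (e\<^sup>2 + x\<^sup>2)" for t
  have ex: "e\<^sup>2 + x\<^sup>2 > 0" using e by (simp add: add_pos_nonneg)
  have E0: "((\<lambda>t. exp (- (t * e))) \<longlongrightarrow> 0) at_top"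
    using e by (auto intro!: exp_at_bot[THEN filterlim_compose] filterlim_tendsto_pos_mult_at_top filterlim_ident
             simp: filterlim_uminus_at_bot mult.commute[of _ e])
  have "(LBINT t=0..\<infinity>. exp (- (t * e)) * cos (t * x)) = 0 - (- e / (e\<^sup>2 + x\<^sup>2))"
  proof (rule interval_integral_FTC_integrable[where F = F])
    show "(F has_vector_derivative exp (- (t * e)) * cos (t * x)) (at t)" for t
    proof -
      have "(F has_real_derivative (exp (- (t * e)) * (- e) * (x * sin (t * x) - e * cos (t * x)) +
          exp (- (t * e)) * (x * (cos (t * x) * x) + e * (sin (t * x) * x))) / (e\<^sup>2 + x\<^sup>2)) (at t)"
        unfolding F_def using ex by (intro DERIV_cdivide) (auto intro!: derivative_eq_intros simp: algebra_simps)
      also have "(exp (- (t * e)) * (- e) * (x * sin (t * x) - e * cos (t * x)) +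
          exp (- (t * e)) * (x * (cos (t * x) * x) + e * (sin (t * x) * x))) / (e\<^sup>2 + x\<^sup>2) = exp (- (t * e)) * cos (t * x)"
      proof -
        have num: "exp (- (t * e)) * (- e) * (x * sin (t * x) - e * cos (t * x)) +
          exp (- (t * e)) * (x * (cos (t * x) * x) + e * (sin (t * x) * x)) = exp (- (t * e)) * cos (t * x) * (e\<^sup>2 + x\<^sup>2)"
          by (simp add: algebra_simps power2_eq_square)
        have "e\<^sup>2 + x\<^sup>2 \<noteq> 0" using ex by linarith
        then show ?thesis unfolding num by (rule nonzero_mult_div_cancel_right)
      qed
      finally show ?thesis by (simp add: has_real_derivative_iff_has_vector_derivative)
    qed
    show "isCont (\<lambda>t. exp (- (t * e)) * cos (t * x)) t" for t by (intro continuous_intros)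
    show "set_integrable lborel (einterval 0 \<infinity>) (\<lambda>t. exp (- (t * e)) * cos (t * x))"
      using i by (simp add: einterval_def zero_ereal_def greaterThan_def)
    have "(F \<longlongrightarrow> F 0) (at_right 0)"
      unfolding F_def using ex by (intro tendsto_intros) auto
    then show "((F \<circ> real_of_ereal) \<longlongrightarrow> - e / (e\<^sup>2 + x\<^sup>2)) (at_right 0)"
      by (simp add: zero_ereal_def ereal_tendsto_simps F_def)
    have "(F \<longlongrightarrow> 0) at_top"
    proof (rule Lim_null_comparison)
      show "\<forall>\<^sub>F t in at_top. norm (F t) \<le> exp (- (t * e)) * ((\<bar>x\<bar> + e) / (e\<^sup>2 + x\<^sup>2))"
      proof (intro always_eventually allI)
        fix t
        have "\<bar>x * sin (t * x) - e * cos (t * x)\<bar> \<le> \<bar>x * sin (t * x)\<bar> + \<bar>e * cos (t * x)\<bar>" by (rule abs_triangle_ineq4)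
        also have "\<dots> \<le> \<bar>x\<bar> + e" using e by (intro add_mono) (auto simp: abs_mult intro!: mult_left_le)
        finally have "\<bar>x * sin (t * x) - e * cos (t * x)\<bar> \<le> \<bar>x\<bar> + e" .
        then show "norm (F t) \<le> exp (- (t * e)) * ((\<bar>x\<bar> + e) / (e\<^sup>2 + x\<^sup>2))"
          using ex unfolding F_def by (simp add: abs_mult divide_right_mono mult_left_mono)
      qed
      show "((\<lambda>t. exp (- (t * e)) * ((\<bar>x\<bar> + e) / (e\<^sup>2 + x\<^sup>2))) \<longlongrightarrow> 0) at_top"
        by (rule tendsto_mult_left_zero[OF E0])
    qed
    then show "((F \<circ> real_of_ereal) \<longlongrightarrow> 0) (at_left \<infinity>)"
      by (simp add: ereal_tendsto_simps)
  qed simp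
  then show "(\<integral>t. indicator {0<..} t * (exp (- (t * e)) * cos (t * x)) \<partial>lborel) = e / (e\<^sup>2 + x\<^sup>2)"
    by (simp add: interval_lebesgue_integral_0_infty set_lebesgue_integral_def)
qed

lemma half_gaussian_integral:
  fixes c :: real
  assumes c: "0 < c"
  shows "integrable lborel (\<lambda>t. indicator {0<..} t * exp (- c * t\<^sup>2))"
    and "(\<integral>t. indicator {0<..} t * exp (- c * t\<^sup>2) \<partial>lborel) = sqrt pi / (2 * sqrt c)"
proof -
  let ?g = "\<lambda>t. indicator {0..} t * exp (- t\<^sup>2) :: real"
  have g: "integrable lborel ?g" "integral\<^sup>L lborel ?g = sqrt pi / 2"
    using gaussian_moment_0 by (auto simp: has_bochner_integral_iff)
  have sc: "0 < sqrt c" using c by simp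
  have e: "?g (0 + sqrt c * t) = indicator {0..} t * exp (- c * t\<^sup>2)" for t
    using c by (simp add: indicator_def power_mult_distrib zero_le_mult_iff)
  have ae: "AE t in lborel. indicator {0..} t * exp (- c * t\<^sup>2) = (indicator {0<..} t * exp (- c * t\<^sup>2) :: real)"
    using AE_lborel_singleton[of 0] by eventually_elim (auto simp: indicator_def)
  have i: "integrable lborel (\<lambda>t. indicator {0..} t * exp (- c * t\<^sup>2))"
    using lborel_integrable_real_affine[OF g(1), of "sqrt c" 0] sc unfolding e by simp
  show "integrable lborel (\<lambda>t. indicator {0<..} t * exp (- c * t\<^sup>2))"
    by (rule integrable_cong_AE_imp[OF i _ ae]) measurable
  have "sqrt pi / 2 = sqrt c * (\<integral>t. indicator {0..} t * exp (- c * t\<^sup>2) \<partial>lborel)"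
    using lborel_integral_real_affine[of "sqrt c" ?g 0] sc g(2) unfolding e by simp
  also have "(\<integral>t. indicator {0..} t * exp (- c * t\<^sup>2) \<partial>lborel) = (\<integral>t. indicator {0<..} t * exp (- c * t\<^sup>2) \<partial>lborel)"
    by (rule integral_cong_AE) (use ae in auto)
  finally show "(\<integral>t. indicator {0<..} t * exp (- c * t\<^sup>2) \<partial>lborel) = sqrt pi / (2 * sqrt c)"
    using sc by (simp add: field_simps)
qed

text \<open>Bernoulli's inequality. The order 1 / n is enough, since the main terms are of order 1 /
  sqrt n.\<close>

lemma geometric_le_inverse:
  fixes q :: real
  assumes "0 < q" "q < 1" "0 < n"
  shows "q ^ n \<le> 1 / (1 / q - 1) / real n"
proof -
  have r: "0 < 1 / q - 1" using assms by simp
  have "1 + real n * (1 / q - 1) \<le> (1 + (1 / q - 1)) ^ n"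
    using r assms by (intro Bernoulli_inequality) simp
  then have "real n * (1 / q - 1) \<le> 1 / q ^ n" by (simp add: power_divide)
  then have "q ^ n * (real n * (1 / q - 1)) \<le> 1" using assms by (simp add: field_simps)
  then show ?thesis using r assms by (simp add: field_simps)
qed

lemma norm_exp_minus_1_le: "norm (exp z - 1) \<le> exp (norm z) * norm z" for z :: complex
  using Taylor_exp_field[of z 0] by simp

context boettcher_gw
begin

section \<open>Transforms restricted to events of the past\<close>

definition past_transform :: "'a set \<Rightarrow> complex \<Rightarrow> complex" where
  "past_transform A z = (\<integral>x. indicator A x *\<^sub>R exp (- z * of_real (W x)) \<partial>M)"

text \<open>For \<open>A\<close> in \<open>past k\<close> the branching identity makes this
  E[exp(-a^k h W); A], the unnormalised tilted probability of \<open>A\<close>.\<close>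

definition tilt_mass :: "'a set \<Rightarrow> nat \<Rightarrow> real \<Rightarrow> real" where
  "tilt_mass A k h = (\<integral>x. indicator A x * lap h ^ Z k x \<partial>M)"

lemma integrable_tilt: "A \<in> sets M \<Longrightarrow> 0 \<le> h \<Longrightarrow> integrable M (\<lambda>x. indicator A x * lap h ^ Z k x)"
  using lap_pos[of h] lap_le_1[of h]
  by (intro integrable_const_bound[where B=1]) (auto simp: indicator_def abs_mult power_le_one)

lemma tilt_mass_nonneg: "0 \<le> h \<Longrightarrow> 0 \<le> tilt_mass A k h"
  unfolding tilt_mass_def using lap_pos[of h] by (intro integral_nonneg_AE AE_I2) auto

text \<open>Each of the \<open>Z k\<close> factors phi(a^(n-k) z) loses |chi(z)|^(mu^(n-k)) against
  its real counterpart. Since \<open>Z k\<close> is at least mu^k, the full power mu^n is gained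
  whatever \<open>A\<close> is.\<close>

lemma norm_past_transform_le:
  assumes A: "A \<in> past k" and kn: "k \<le> n" and u: "0 < u"
  shows "norm (past_transform A (of_real (a ^ n) * (of_real u + \<i> * of_real t))) \<le>
    norm (chi (of_real u + \<i> * of_real t)) ^ mu ^ n * tilt_mass A k (a ^ (n - k) * u)"
proof -
  let ?z = "of_real u + \<i> * complex_of_real t"
  let ?w = "of_real (a ^ (n - k)) * ?z"
  have ank: "a ^ n / a ^ k = a ^ (n - k)" using kn mean_pos by (simp add: power_diff)
  have Rw: "0 \<le> Re ?w" "Re ?w = a ^ (n - k) * u" using u mean_pos by auto
  have "past_transform A (of_real (a ^ n) * ?z) = (\<integral>x. indicator A x *\<^sub>R phi ?w ^ Z k x \<partial>M)"
    unfolding past_transform_def using laplace_past[OF A, of "of_real (a ^ n) * ?z"] u mean_pos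
    by (simp add: ank[symmetric])
  also have "norm \<dots> \<le> (\<integral>x. norm (indicator A x *\<^sub>R phi ?w ^ Z k x) \<partial>M)" by (rule integral_norm_bound)
  also have "\<dots> \<le> (\<integral>x. norm (chi ?z) ^ mu ^ n * (indicator A x * lap (a ^ (n - k) * u) ^ Z k x) \<partial>M)"
  proof (rule integral_mono_AE)
    show "integrable M (\<lambda>x. norm (indicator A x *\<^sub>R phi ?w ^ Z k x))"
      using past_sets[OF A] norm_phi_le_1[OF Rw(1)]
      by (intro integrable_const_bound[where B=1]) (auto simp: indicator_def norm_power power_le_one)
    show "integrable M (\<lambda>x. norm (chi ?z) ^ mu ^ n * (indicator A x * lap (a ^ (n - k) * u) ^ Z k x))"
      using past_sets[OF A] u mean_pos by (intro integrable_mult_right integrable_tilt) auto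
    show "AE x in M. norm (indicator A x *\<^sub>R phi ?w ^ Z k x) \<le> norm (chi ?z) ^ mu ^ n * (indicator A x * lap (a ^ (n - k) * u) ^ Z k x)"
      using gen_size_pos_lower
    proof eventually_elim
      case (elim x)
      have l: "0 < lap (Re ?w)" using lap_pos[OF Rw(1)] .
      have c1: "norm (chi ?z) \<le> 1" using u by (intro norm_chi_le_1) simp
      have "norm (phi ?w) = norm (chi ?w) * lap (Re ?w)" using l Rw by (simp add: norm_chi)
      also have "\<dots> \<le> norm (chi ?z) ^ mu ^ (n - k) * lap (Re ?w)"
        using l u by (intro mult_right_mono norm_chi_mult_power_a) auto
      finally have "norm (phi ?w) ^ Z k x \<le> (norm (chi ?z) ^ mu ^ (n - k) * lap (Re ?w)) ^ Z k x"
        by (intro power_mono) auto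
      also have "\<dots> = norm (chi ?z) ^ (mu ^ (n - k) * Z k x) * lap (Re ?w) ^ Z k x"
        by (simp add: power_mult_distrib power_mult)
      also have "\<dots> \<le> norm (chi ?z) ^ mu ^ n * lap (Re ?w) ^ Z k x"
      proof (intro mult_right_mono power_decreasing)
        have "mu ^ n = mu ^ (n - k) * mu ^ k" using kn by (simp flip: power_add)
        also have "\<dots> \<le> mu ^ (n - k) * Z k x" using elim by simp
        finally show "mu ^ n \<le> mu ^ (n - k) * Z k x" .
      qed (use c1 l in auto)
      finally show ?case unfolding Rw(2) by (auto simp: indicator_def norm_power)
    qed
  qed
  finally show ?thesis by (simp add: tilt_mass_def)
qed

text \<open>Fubini for the kernel of width \<open>e\<close> centred at \<open>s\<close>; absolute
  integrability comes from exp(-t e) in t and exp(-u b W) in the sample point.\<close>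

lemma cauchy_kernel_transform:
  assumes A[measurable]: "A \<in> sets M" and u: "0 < u" and b: "0 < b" and e: "0 < e"
  shows "integrable M (\<lambda>x. indicator A x * (exp (- (u * b) * W x) * (e / (e\<^sup>2 + (b * W x - s)\<^sup>2))))"
    and "integrable lborel (\<lambda>t. indicator {0<..} t * (exp (- (t * e)) *
          Re (cis (t * s) * past_transform A (of_real b * (of_real u + \<i> * of_real t)))))"
    and "(\<integral>x. indicator A x * (exp (- (u * b) * W x) * (e / (e\<^sup>2 + (b * W x - s)\<^sup>2))) \<partial>M) =
      (\<integral>t. indicator {0<..} t * (exp (- (t * e)) *
          Re (cis (t * s) * past_transform A (of_real b * (of_real u + \<i> * of_real t)))) \<partial>lborel)"
proof -
  interpret P: pair_sigma_finite M lborel ..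
  let ?f = "\<lambda>x t. (indicator A x * exp (- (u * b) * W x)) * (indicator {0<..} t * (exp (- (t * e)) * cos (t * (b * W x - s)))) :: real"
  let ?g = "\<lambda>q. exp (- (u * b) * W (fst q)) * (indicator {0<..} (snd q) * exp (- (snd q * e))) :: real"
  have ie: "integrable lborel (\<lambda>t. indicator {0<..} t * exp (- (t * e)) :: real)"
    using laplace_cos_integral(1)[OF e, of 0] by simp
  have iw: "integrable M (\<lambda>x. exp (- (u * b) * W x))" using u b by (intro integrable_exp_W_real) simp
  have ig: "integrable (M \<Otimes>\<^sub>M lborel) ?g"
  proof (rule P.Fubini_integrable)
    show "?g \<in> borel_measurable (M \<Otimes>\<^sub>M lborel)" by measurable
    show "integrable M (\<lambda>x. \<integral>y. norm (?g (x, y)) \<partial>lborel)" using iw by (simp add: abs_mult)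
    show "AE x in M. integrable lborel (\<lambda>y. ?g (x, y))" using ie by simp
  qed
  have int: "integrable (M \<Otimes>\<^sub>M lborel) (\<lambda>(x, t). ?f x t)"
  proof (rule Bochner_Integration.integrable_bound[OF ig])
    show "(\<lambda>(x, t). ?f x t) \<in> borel_measurable (M \<Otimes>\<^sub>M lborel)" by measurable
    have "\<bar>?f x t\<bar> \<le> \<bar>?g (x, t)\<bar>" for x t
    proof -
      have "\<bar>?f x t\<bar> = indicator A x * \<bar>cos (t * (b * W x - s))\<bar> * (exp (- (u * b) * W x) * (indicator {0<..} t * exp (- (t * e))))"
        by (simp add: abs_mult indicator_def)
      also have "\<dots> \<le> 1 * (exp (- (u * b) * W x) * (indicator {0<..} t * exp (- (t * e))))"
        by (intro mult_right_mono) (auto simp: indicator_def)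
      finally show ?thesis by (simp add: abs_mult)
    qed
    then show "AE q in M \<Otimes>\<^sub>M lborel. norm (case q of (x, t) \<Rightarrow> ?f x t) \<le> norm (?g q)"
      by (intro AE_I2) auto
  qed
  have inner1: "(\<integral>t. ?f x t \<partial>lborel) = indicator A x * (exp (- (u * b) * W x) * (e / (e\<^sup>2 + (b * W x - s)\<^sup>2)))" for x
    by (simp add: laplace_cos_integral(2)[OF e])
  have inner2: "(\<integral>x. ?f x t \<partial>M) = indicator {0<..} t * (exp (- (t * e)) *
      Re (cis (t * s) * past_transform A (of_real b * (of_real u + \<i> * of_real t))))" for t
  proof -
    have ip: "integrable M (\<lambda>x. indicator A x *\<^sub>R exp (- (of_real b * (of_real u + \<i> * of_real t)) * of_real (W x)))"
      using u b by (intro integrable_mult_indicator[OF A] integrable_exp_W) simp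
    have pt: "indicator A x * exp (- (u * b) * W x) * cos (t * (b * W x - s)) =
       Re (cis (t * s) * (indicator A x *\<^sub>R exp (- (of_real b * (of_real u + \<i> * of_real t)) * of_real (W x))))" for x
    proof -
      have "- (of_real b * (of_real u + \<i> * of_real t)) * of_real (W x) =
          of_real (- (u * b) * W x) + \<i> * of_real (- (t * (b * W x)))"
        by (simp add: complex_eq_iff)
      then have "exp (- (of_real b * (of_real u + \<i> * of_real t)) * of_real (W x)) =
          of_real (exp (- (u * b) * W x)) * cis (- (t * (b * W x)))"
        by (simp only: exp_add cis_conv_exp exp_of_real)
      then have "cis (t * s) * (indicator A x *\<^sub>R exp (- (of_real b * (of_real u + \<i> * of_real t)) * of_real (W x))) =
          of_real (indicator A x * exp (- (u * b) * W x)) * (cis (t * s) * cis (- (t * (b * W x))))"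
        by (simp add: scaleR_conv_of_real)
      also have "cis (t * s) * cis (- (t * (b * W x))) = cis (- (t * (b * W x - s)))"
        by (simp add: cis_mult algebra_simps)
      finally have *: "cis (t * s) * (indicator A x *\<^sub>R exp (- (of_real b * (of_real u + \<i> * of_real t)) * of_real (W x))) =
          of_real (indicator A x * exp (- (u * b) * W x)) * cis (- (t * (b * W x - s)))" .
      show ?thesis unfolding * by (simp only: Re_complex_of_real Im_complex_of_real times_complex.sel cis.sel cos_minus mult_zero_left diff_zero)
    qed
    have "(\<integral>x. ?f x t \<partial>M) = indicator {0<..} t * (exp (- (t * e)) * (\<integral>x. indicator A x * exp (- (u * b) * W x) * cos (t * (b * W x - s)) \<partial>M))"
      by (simp flip: integral_mult_right_zero add: mult_ac)
    also have "(\<integral>x. indicator A x * exp (- (u * b) * W x) * cos (t * (b * W x - s)) \<partial>M) =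
        Re (\<integral>x. cis (t * s) * (indicator A x *\<^sub>R exp (- (of_real b * (of_real u + \<i> * of_real t)) * of_real (W x))) \<partial>M)"
      unfolding pt using ip by (intro integral_Re integrable_mult_right)
    also have "(\<integral>x. cis (t * s) * (indicator A x *\<^sub>R exp (- (of_real b * (of_real u + \<i> * of_real t)) * of_real (W x))) \<partial>M) =
        cis (t * s) * past_transform A (of_real b * (of_real u + \<i> * of_real t))"
      unfolding past_transform_def by (rule integral_mult_right_zero)
    finally show ?thesis .
  qed
  show "integrable M (\<lambda>x. indicator A x * (exp (- (u * b) * W x) * (e / (e\<^sup>2 + (b * W x - s)\<^sup>2))))"
    using P.integrable_fst[OF int] unfolding inner1 .
  show "integrable lborel (\<lambda>t. indicator {0<..} t * (exp (- (t * e)) *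
          Re (cis (t * s) * past_transform A (of_real b * (of_real u + \<i> * of_real t)))))"
    using P.integrable_snd[OF int] unfolding inner2 .
  show "(\<integral>x. indicator A x * (exp (- (u * b) * W x) * (e / (e\<^sup>2 + (b * W x - s)\<^sup>2))) \<partial>M) =
      (\<integral>t. indicator {0<..} t * (exp (- (t * e)) *
          Re (cis (t * s) * past_transform A (of_real b * (of_real u + \<i> * of_real t)))) \<partial>lborel)"
    using P.Fubini_integral[OF int] unfolding inner1 inner2 by simp
qed

text \<open>Gaussian decay near 0 and a gap elsewhere, uniformly over the saddle interval. The three
  constants are kept as parameters because the lower bound shrinks \<open>d\<close> while keeping
  \<open>c\<close>. Only t > 0 occurs, as the kernel is a cosine integral.\<close>

definition chi_dominated :: "real \<Rightarrow> real \<Rightarrow> real \<Rightarrow> bool" where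
  "chi_dominated c d q \<longleftrightarrow> 0 < c \<and> 0 < d \<and> d \<le> win_r \<and> 0 < q \<and> q < 1 \<and>
    (\<forall>u\<in>{U0..U1}. \<forall>t>(0::real). (t \<le> d \<longrightarrow> norm (chi (of_real u + \<i> * of_real t)) \<le> exp (- c * t\<^sup>2)) \<and>
       (d \<le> t \<longrightarrow> norm (chi (of_real u + \<i> * of_real t)) \<le> q))"

lemma chi_dominated_smaller:
  assumes "chi_dominated c d q" "0 < d'" "d' \<le> d"
  shows "\<exists>q'. chi_dominated c d' q'"
proof -
  obtain q' where q': "0 \<le> q'" "q' < 1"
    "\<And>z. 0 \<le> Re z \<Longrightarrow> Re z \<le> U1 \<Longrightarrow> d' \<le> \<bar>Im z\<bar> \<Longrightarrow> norm (chi z) \<le> q'"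
    using chi_uniform_gap[OF assms(2), of U1] U1_pos by auto
  have "chi_dominated c d' (max q' (1/2))"
    unfolding chi_dominated_def
  proof (intro conjI ballI allI impI)
    fix u t :: real assume u: "u \<in> {U0..U1}" and t: "0 < t"
    { assume "t \<le> d'"
      then show "norm (chi (of_real u + \<i> * of_real t)) \<le> exp (- c * t\<^sup>2)"
        using assms u t by (auto simp: chi_dominated_def) }
    { assume "d' \<le> t"
      then have "norm (chi (of_real u + \<i> * of_real t)) \<le> q'" using u t U0 by (intro q'(3)) auto
      then show "norm (chi (of_real u + \<i> * of_real t)) \<le> max q' (1/2)" by simp }
  qed (use assms q' in \<open>auto simp: chi_dominated_def\<close>)
  then show ?thesis ..
qed

lemma ex_chi_dominated: "\<exists>c d q. chi_dominated c d q"
proof -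
  obtain c d where cd: "0 < c" "0 < d" "d \<le> win_r"
    "\<And>u t. u \<in> {U0..U1} \<Longrightarrow> \<bar>t\<bar> \<le> d \<Longrightarrow> norm (chi (of_real u + \<i> * of_real t)) \<le> exp (- c * t\<^sup>2)"
    using chi_gaussian_bound by blast
  obtain q' where q': "0 \<le> q'" "q' < 1"
    "\<And>z. 0 \<le> Re z \<Longrightarrow> Re z \<le> U1 \<Longrightarrow> d \<le> \<bar>Im z\<bar> \<Longrightarrow> norm (chi z) \<le> q'"
    using chi_uniform_gap[OF cd(2), of U1] U1_pos by auto
  have "chi_dominated c d (max q' (1/2))"
    unfolding chi_dominated_def
  proof (intro conjI ballI allI impI)
    fix u t :: real assume u: "u \<in> {U0..U1}" and t: "0 < t"
    { assume "t \<le> d"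
      then show "norm (chi (of_real u + \<i> * of_real t)) \<le> exp (- c * t\<^sup>2)" using cd u t by simp }
    { assume "d \<le> t"
      then have "norm (chi (of_real u + \<i> * of_real t)) \<le> q'" using u t U0 by (intro q'(3)) auto
      then show "norm (chi (of_real u + \<i> * of_real t)) \<le> max q' (1/2)" by simp }
  qed (use cd q' in auto)
  then show ?thesis by blast
qed

text \<open>The Gaussian integral over the half-line plus the bound for the geometric remainder,
  with the factor 1 / sqrt(mu^n) taken out.\<close>

definition peak_const :: "real \<Rightarrow> real \<Rightarrow> real" where
  "peak_const c q = sqrt pi / (2 * sqrt c) + 1 / (1 / q - 1)"

lemma peak_const_pos: "0 < c \<Longrightarrow> 0 < q \<Longrightarrow> q < 1 \<Longrightarrow> 0 < peak_const c q"
  unfolding peak_const_def by (intro add_pos_pos divide_pos_pos) auto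

text \<open>|chi|^(mu^n) is at most a Gaussian of width mu^(-n/2) near 0 plus q^(mu^n). Only moduli
  enter, so the centre \<open>s\<close> is arbitrary and the mass of \<open>A\<close> factors
  out.\<close>

lemma cauchy_mass_upper:
  assumes dom: "chi_dominated c d q" and A: "A \<in> past k" and kn: "k \<le> n" and u: "u \<in> {U0..U1}"
  shows "(\<integral>x. indicator A x * (exp (- (u * a ^ n) * W x) * (1 / (1\<^sup>2 + (a ^ n * W x - s)\<^sup>2))) \<partial>M) \<le>
     peak_const c q / sqrt (real (mu ^ n)) * tilt_mass A k (a ^ (n - k) * u)"
proof -
  define m where "m = mu ^ n"
  define T where "T = tilt_mass A k (a ^ (n - k) * u)"
  have cdq: "0 < c" "0 < d" "0 < q" "q < 1" using dom by (auto simp: chi_dominated_def)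
  have m: "0 < m" "1 \<le> real m" using mu_pos by (auto simp: m_def)
  have u0: "0 < u" using u U0 by simp
  have an: "0 < a ^ n" using mean_pos by simp
  have T: "0 \<le> T" unfolding T_def using u0 mean_pos by (intro tilt_mass_nonneg) simp
  note ck = cauchy_kernel_transform[OF past_sets[OF A] u0 an zero_less_one, of s]
  let ?h = "\<lambda>t. T * (indicator {0<..} t * exp (- (c * real m) * t\<^sup>2) + q ^ m * (indicator {0<..} t * (exp (- (t * 1)) * cos (t * 0))))"
  have cm: "0 < c * real m" using cdq m by simp
  note hg = half_gaussian_integral[OF cm] and lc = laplace_cos_integral[OF zero_less_one, of 0]
  have "(\<integral>x. indicator A x * (exp (- (u * a ^ n) * W x) * (1 / (1\<^sup>2 + (a ^ n * W x - s)\<^sup>2))) \<partial>M) \<le> (\<integral>t. ?h t \<partial>lborel)"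
    unfolding ck(3)
  proof (rule integral_mono[OF ck(2)])
    show "integrable lborel ?h" by (intro integrable_mult_right Bochner_Integration.integrable_add hg lc)
    fix t :: real
    show "indicator {0<..} t * (exp (- (t * 1)) * Re (cis (t * s) * past_transform A (of_real (a ^ n) * (of_real u + \<i> * of_real t)))) \<le> ?h t"
    proof (cases "0 < t")
      case t: True
      let ?c = "norm (chi (of_real u + \<i> * of_real t))"
      have "Re (cis (t * s) * past_transform A (of_real (a ^ n) * (of_real u + \<i> * of_real t))) \<le>
          norm (cis (t * s) * past_transform A (of_real (a ^ n) * (of_real u + \<i> * of_real t)))"
        by (rule complex_Re_le_cmod)
      also have "\<dots> \<le> ?c ^ m * T" unfolding m_def T_def
        using norm_past_transform_le[OF A kn u0, of t] by (simp add: norm_mult)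
      finally have 1: "Re (cis (t * s) * past_transform A (of_real (a ^ n) * (of_real u + \<i> * of_real t))) \<le> ?c ^ m * T" .
      have 2: "exp (- t) * ?c ^ m \<le> exp (- (c * real m) * t\<^sup>2) + q ^ m * exp (- t)"
      proof (cases "t \<le> d")
        case True
        then have "?c \<le> exp (- c * t\<^sup>2)" using dom u t by (auto simp: chi_dominated_def)
        then have "?c ^ m \<le> exp (- c * t\<^sup>2) ^ m" by (intro power_mono) auto
        also have "\<dots> = exp (- (c * real m) * t\<^sup>2)" by (simp add: exp_of_nat_mult[symmetric] mult_ac)
        finally have "exp (- t) * ?c ^ m \<le> 1 * exp (- (c * real m) * t\<^sup>2)" using t by (intro mult_mono) auto
        then show ?thesis using cdq by (simp add: add_increasing2)
      next
        case False
        then have "?c \<le> q" using dom u t by (auto simp: chi_dominated_def)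
        then have "?c ^ m \<le> q ^ m" by (intro power_mono) auto
        then have "exp (- t) * ?c ^ m \<le> q ^ m * exp (- t)" by (simp add: mult.commute)
        then show ?thesis by (simp add: add_increasing)
      qed
      have "exp (- t) * Re (cis (t * s) * past_transform A (of_real (a ^ n) * (of_real u + \<i> * of_real t))) \<le> exp (- t) * (?c ^ m * T)"
        using 1 by (intro mult_left_mono) auto
      also have "\<dots> = T * (exp (- t) * ?c ^ m)" by simp
      also have "\<dots> \<le> T * (exp (- (c * real m) * t\<^sup>2) + q ^ m * exp (- t))" using 2 T by (intro mult_left_mono) auto
      finally show ?thesis using t by simp
    qed simp
  qed
  also have "(\<integral>t. ?h t \<partial>lborel) = T * (sqrt pi / (2 * sqrt (c * real m)) + q ^ m * (1 / (1\<^sup>2 + 0\<^sup>2)))"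
    by (subst integral_mult_right_zero, subst Bochner_Integration.integral_add)
       (use hg lc in \<open>auto simp del: power_one\<close>)
  also have "\<dots> = T * (sqrt pi / (2 * sqrt c) / sqrt (real m) + q ^ m)"
    by (simp add: real_sqrt_mult)
  also have "\<dots> \<le> T * (sqrt pi / (2 * sqrt c) / sqrt (real m) + 1 / (1 / q - 1) / sqrt (real m))"
  proof (intro mult_left_mono add_left_mono T)
    have "q ^ m \<le> 1 / (1 / q - 1) / real m" by (rule geometric_le_inverse[OF cdq(3,4) m(1)])
    also have "\<dots> \<le> 1 / (1 / q - 1) / sqrt (real m)"
    proof (intro divide_left_mono)
      have "sqrt (real m) * 1 \<le> sqrt (real m) * sqrt (real m)" using m by (intro mult_left_mono) auto
      then show "sqrt (real m) \<le> real m" using m by simp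
    qed (use cdq m in auto)
    finally show "q ^ m \<le> 1 / (1 / q - 1) / sqrt (real m)" .
  qed
  also have "\<dots> = peak_const c q / sqrt (real m) * T"
    by (simp add: peak_const_def add_divide_distrib algebra_simps)
  finally show ?thesis by (simp add: m_def T_def)
qed

end

section \<open>Upper bounds on events of the past, and the curvature of the logarithm\<close>

context boettcher_gw
begin

text \<open>The indicator of the small ball is dominated by a multiple of exp(u y) exp(-u a^n W)
  times the unit Cauchy kernel centred at \<open>y\<close>.\<close>

lemma small_ball_past_upper:
  assumes dom: "chi_dominated c d q" and A: "A \<in> past k" and kn: "k \<le> n" and u: "u \<in> {U0..U1}"
  shows "measure M {x \<in> A. a ^ n * W x < y} \<le>
    max 1 (2 / U0\<^sup>2) * peak_const c q * (exp (u * y) / sqrt (real (mu ^ n))) * tilt_mass A k (a ^ (n - k) * u)"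
proof -
  define C where "C = max 1 (2 / U0\<^sup>2)"
  have C: "1 \<le> C" "2 / U0\<^sup>2 \<le> C" by (auto simp: C_def)
  have u0: "0 < u" "U0 \<le> u" using u U0 by auto
  have an: "0 < a ^ n" using mean_pos by simp
  have AM[measurable]: "A \<in> sets M" by (rule past_sets[OF A])
  note ck = cauchy_kernel_transform(1)[OF AM u0(1) an zero_less_one, of y]
  have S[measurable]: "{x \<in> A. a ^ n * W x < y} \<in> sets M"
  proof -
    have "{x \<in> A. a ^ n * W x < y} = A \<inter> {x \<in> space M. a ^ n * W x < y}"
      using sets.sets_into_space[OF AM] by auto
    then show ?thesis by simp
  qed
  \<comment> \<open>With v = y - a^n W this is the required domination. The quadratic Taylor term of
    exp(u v) beats v^2 once C >= 2 / U0^2, because u >= U0.\<close>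
  have quad: "1 + v\<^sup>2 \<le> C * exp (u * v)" if "0 \<le> v" for v
  proof -
    have "v\<^sup>2 \<le> C * ((u * v)\<^sup>2 / 2)"
    proof -
      have "1 \<le> C * U0\<^sup>2 / 2" using C(2) U0 by (simp add: field_simps)
      also have "\<dots> \<le> C * u\<^sup>2 / 2" using C u0 U0 by (intro divide_right_mono mult_left_mono power_mono) auto
      finally have "1 * v\<^sup>2 \<le> C * u\<^sup>2 / 2 * v\<^sup>2" by (rule mult_right_mono) simp
      then show ?thesis by (simp add: power_mult_distrib)
    qed
    then have "1 + v\<^sup>2 \<le> C * (1 + (u * v)\<^sup>2 / 2)" using C by (simp add: distrib_left)
    also have "\<dots> \<le> C * (1 + u * v + (u * v)\<^sup>2 / 2)" using C u0 that by (intro mult_left_mono) auto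
    also have "\<dots> \<le> C * exp (u * v)" using C u0 that by (intro mult_left_mono exp_lower_Taylor_quadratic) auto
    finally show ?thesis .
  qed
  have "measure M {x \<in> A. a ^ n * W x < y} = (\<integral>x. indicator {x \<in> A. a ^ n * W x < y} x \<partial>M)"
    by simp
  also have "\<dots> \<le> (\<integral>x. C * exp (u * y) * (indicator A x * (exp (- (u * a ^ n) * W x) * (1 / (1\<^sup>2 + (a ^ n * W x - y)\<^sup>2)))) \<partial>M)"
  proof (rule integral_mono[OF _ integrable_mult_right[OF ck]])
    show "integrable M (\<lambda>x. indicator {x \<in> A. a ^ n * W x < y} x :: real)"
      by (rule integrable_const_bound[where B=1]) auto
    fix x
    show "indicator {x \<in> A. a ^ n * W x < y} x \<le>
        C * exp (u * y) * (indicator A x * (exp (- (u * a ^ n) * W x) * (1 / (1\<^sup>2 + (a ^ n * W x - y)\<^sup>2))))"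
    proof (cases "x \<in> A \<and> a ^ n * W x < y")
      case True
      define v where "v = y - a ^ n * W x"
      have v: "0 \<le> v" using True by (simp add: v_def)
      have p: "0 < 1 + v\<^sup>2" by (simp add: add_pos_nonneg)
      have "1 \<le> C * exp (u * v) / (1 + v\<^sup>2)" using quad[OF v] p by (simp add: field_simps)
      also have "exp (u * v) = exp (u * y) * exp (- (u * a ^ n) * W x)"
        by (simp add: v_def algebra_simps flip: exp_add)
      also have "(1 + v\<^sup>2) = 1\<^sup>2 + (a ^ n * W x - y)\<^sup>2" by (simp add: v_def power2_commute)
      finally show ?thesis using True by (simp add: mult.assoc)
    next
      case False
      have "0 \<le> 1 / (1\<^sup>2 + (a ^ n * W x - y)\<^sup>2)" by (intro divide_nonneg_nonneg add_nonneg_nonneg) auto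
      then show ?thesis using False C by (auto simp: indicator_def)
    qed
  qed
  also have "\<dots> = C * exp (u * y) * (\<integral>x. indicator A x * (exp (- (u * a ^ n) * W x) * (1 / (1\<^sup>2 + (a ^ n * W x - y)\<^sup>2))) \<partial>M)"
    by (rule integral_mult_right_zero)
  also have "\<dots> \<le> C * exp (u * y) * (peak_const c q / sqrt (real (mu ^ n)) * tilt_mass A k (a ^ (n - k) * u))"
    using C by (intro mult_left_mono cauchy_mass_upper[OF dom A kn u]) auto
  finally show ?thesis by (simp add: C_def mult_ac)
qed

lemma FF2_real: assumes u: "u \<in> {U0..U1}" shows "FF2 k (of_real u) = of_real (Re (FF2 k (of_real u)))"
proof -
  have "Im (deriv (deriv (FF k)) (of_real u)) = 0"
  proof (rule Im_deriv_eq_0[OF _ open_window])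
    show "deriv (FF k) holomorphic_on window (2 * U1)"
      using U1_pos by (intro holomorphic_deriv FF_hol open_window) simp
    show "of_real u \<in> window (2 * U1)" using u U0 U1_pos by (intro of_real_window) auto
    show "open {0<..<2 * U1}" "u \<in> {0<..<2 * U1}" using u U0 U1_pos by auto
    show "Im (deriv (FF k) (of_real x)) = 0" if "x \<in> {0<..<2 * U1}" for x
      using that by (intro Im_deriv_FF) auto
  qed
  then show ?thesis by (simp add: complex_eq_iff)
qed

definition FF_rem :: "nat \<Rightarrow> real \<Rightarrow> real \<Rightarrow> complex" where
  "FF_rem k u t = FF k (of_real u + \<i> * of_real t) -
    (FF k (of_real u) + \<i> * of_real t * deriv (FF k) (of_real u) - of_real (t\<^sup>2 / 2) * FF2 k (of_real u))"

lemma FF_expansion: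
  assumes u: "u \<in> {U0..U1}"
  shows "FF k (of_real u + \<i> * of_real t) - FF k (of_real u) =
    \<i> * of_real (t * Re (deriv (FF k) (of_real u))) - of_real (t\<^sup>2 / 2 * Re (FF2 k (of_real u))) + FF_rem k u t"
proof -
  have "deriv (FF k) (of_real u) = of_real (Re (deriv (FF k) (of_real u)))"
    using Im_deriv_FF[of u k] u U0 U1_pos by (simp add: complex_eq_iff)
  then obtain D V where e: "deriv (FF k) (of_real u) = complex_of_real D" "FF2 k (of_real u) = complex_of_real V"
    using FF2_real[OF u, of k] by blast
  show ?thesis unfolding FF_rem_def e by simp
qed

text \<open>The bound |chi(a^k z)| <= |chi(z)|^(mu^k) transfers the Gaussian decay from k = 0 to all
  k. Comparison with the Taylor expansion at one small t turns it into a lower bound for the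
  curvature.\<close>

lemma FF2_lower:
  assumes dom: "chi_dominated c d q" and u: "u \<in> {U0..U1}"
  shows "c \<le> Re (FF2 k (of_real u))"
proof -
  have cd: "0 < c" "0 < d" "d \<le> win_r" using dom by (auto simp: chi_dominated_def)
  define t where "t = min d (c / (2 * tay_C))"
  have t: "0 < t" "t \<le> d" "t \<le> win_r" "tay_C * t \<le> c / 2"
  proof -
    show "0 < t" "t \<le> d" using cd tay_C_pos by (auto simp: t_def)
    then show "t \<le> win_r" using cd by linarith
    have "tay_C * t \<le> tay_C * (c / (2 * tay_C))" using tay_C_pos by (intro mult_left_mono) (auto simp: t_def)
    then show "tay_C * t \<le> c / 2" using tay_C_pos by simp
  qed
  let ?z = "of_real u + \<i> * complex_of_real t"
  define v where "v = Re (FF2 k (of_real u))"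
  have rem: "norm (FF_rem k u t) \<le> tay_C * t ^ 3"
    using taylor_FF[OF u, of t k] t unfolding FF_rem_def by simp
  have Re: "Re (FF k ?z - FF k (of_real u)) = - (t\<^sup>2 / 2 * v) + Re (FF_rem k u t)"
    unfolding FF_expansion[OF u] by (simp add: v_def)
  have "exp (real (mu ^ k) * Re (FF k ?z - FF k (of_real u))) = norm (chi (of_real (a ^ k) * ?z))"
    using chi_eq_exp_FF[OF u, of t k] t by simp
  also have "\<dots> \<le> norm (chi ?z) ^ mu ^ k" using u U0 by (intro norm_chi_mult_power_a) auto
  also have "\<dots> \<le> exp (- c * t\<^sup>2) ^ mu ^ k" using dom u t by (intro power_mono) (auto simp: chi_dominated_def)
  also have "\<dots> = exp (real (mu ^ k) * (- c * t\<^sup>2))" by (simp only: exp_of_nat_mult)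
  finally have "real (mu ^ k) * Re (FF k ?z - FF k (of_real u)) \<le> real (mu ^ k) * (- c * t\<^sup>2)" by simp
  then have "Re (FF k ?z - FF k (of_real u)) \<le> - c * t\<^sup>2"
    using mu_pos by (subst (asm) mult_le_cancel_left_pos) auto
  then have "c * t\<^sup>2 \<le> t\<^sup>2 / 2 * v + \<bar>Re (FF_rem k u t)\<bar>" unfolding Re by linarith
  also have "\<bar>Re (FF_rem k u t)\<bar> \<le> tay_C * t * t\<^sup>2"
    using rem abs_Re_le_cmod[of "FF_rem k u t"] by (simp add: power3_eq_cube power2_eq_square)
  also have "\<dots> \<le> c / 2 * t\<^sup>2" using t by (intro mult_right_mono) auto
  finally have "c / 2 * t\<^sup>2 \<le> v / 2 * t\<^sup>2" by (simp add: algebra_simps)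
  then show ?thesis using t by (simp add: v_def)
qed

lemma mult_exp_neg_square_le: "x * exp (- (b * x\<^sup>2)) \<le> 1 / sqrt b" if "0 < b" "0 \<le> x" for x b :: real
proof -
  have "(sqrt b * x) \<le> 1 + (sqrt b * x)\<^sup>2"
  proof -
    have "0 \<le> (1 - sqrt b * x)\<^sup>2" by simp
    then have "2 * (sqrt b * x) \<le> 1 + (sqrt b * x)\<^sup>2" by (simp add: power2_diff)
    moreover have "0 \<le> sqrt b * x" using that by simp
    ultimately show ?thesis by linarith
  qed
  also have "\<dots> \<le> exp ((sqrt b * x)\<^sup>2)" by (rule exp_ge_add_one_self)
  also have "(sqrt b * x)\<^sup>2 = b * x\<^sup>2" using that by (simp add: power_mult_distrib)
  finally have "sqrt b * (x * exp (- (b * x\<^sup>2))) \<le> 1" by (simp add: exp_minus field_simps)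
  then show ?thesis using that by (simp add: field_simps)
qed

lemma square_mult_exp_neg_le: "m * x\<^sup>2 * exp (- (b * m * x\<^sup>2)) \<le> 1 / b" if "0 < b" for x b m :: real
proof -
  have "b * m * x\<^sup>2 \<le> exp (b * m * x\<^sup>2)" using exp_ge_add_one_self[of "b * m * x\<^sup>2"] by linarith
  then have "b * (m * x\<^sup>2 * exp (- (b * m * x\<^sup>2))) \<le> 1" by (simp add: exp_minus field_simps)
  then show ?thesis using that by (simp add: field_simps)
qed

text \<open>
  Local comparison of the transform of the tilted law with a Gaussian of variance
  of order \<open>mu ^ k\<close>; the linear term is bounded because \<open>u\<close> is the saddle point up to \<open>O(mu\<^sup>-\<^sup>k)\<close>.
\<close>

lemma transform_gaussian_comparison:
  assumes dom: "chi_dominated c d q"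
  shows "\<exists>d' L. 0 < d' \<and> d' \<le> d \<and> 0 < L \<and> (\<forall>u\<in>{U0..U1}. \<forall>k e t. 0 < e \<longrightarrow> e \<le> 1 \<longrightarrow> 0 < t \<longrightarrow> t \<le> d' \<longrightarrow>
    exp (- (real (mu ^ k) * tay_C * t\<^sup>2 / 2)) - L / sqrt (real (mu ^ k)) * exp (- (c / 8 * real (mu ^ k) * t\<^sup>2)) \<le>
    exp (- (t * e)) * Re (cis (t * (- BB' u * real (mu ^ k) - 1)) * chi (of_real (a ^ k) * (of_real u + \<i> * of_real t))))"
proof -
  have cd: "0 < c" "0 < d" "d \<le> win_r" using dom by (auto simp: chi_dominated_def)
  \<comment> \<open>For t <= d' the cubic error mu^k tay_C t^3 is at most c mu^k t^2 / 8, a quarter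
    of the available exponent c mu^k t^2 / 2.\<close>
  define d' where "d' = min d (c / (8 * tay_C))"
  have d': "0 < d'" "d' \<le> d" "tay_C * d' \<le> c / 8"
  proof -
    show "0 < d'" "d' \<le> d" using cd tay_C_pos by (auto simp: d'_def)
    have "tay_C * d' \<le> tay_C * (c / (8 * tay_C))" using tay_C_pos by (intro mult_left_mono) (auto simp: d'_def)
    then show "tay_C * d' \<le> c / 8" using tay_C_pos by simp
  qed
  \<comment> \<open>Three contributions to the linear term: the drift of the saddle, the shift of
    the centre by 1, and the damping rate \<open>e <= 1\<close>.\<close>
  define b where "b = EE_drift + 2"
  have b: "2 \<le> b" using EE_drift_nonneg by (simp add: b_def)
  define K where "K = (b + tay_C * (8 / c)) * exp (b * d')"
  have K: "0 < K" unfolding K_def using b tay_C_pos cd by (intro mult_pos_pos add_pos_pos) auto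
  define L where "L = K * (1 / sqrt (c / 8))"
  have L: "0 < L" unfolding L_def using K cd by simp
  have "exp (- (real (mu ^ k) * tay_C * t\<^sup>2 / 2)) - L / sqrt (real (mu ^ k)) * exp (- (c / 8 * real (mu ^ k) * t\<^sup>2)) \<le>
    exp (- (t * e)) * Re (cis (t * (- BB' u * real (mu ^ k) - 1)) * chi (of_real (a ^ k) * (of_real u + \<i> * of_real t)))"
    (is "?P u k e t") if u: "u \<in> {U0..U1}" and e: "0 < e" "e \<le> 1" and t: "0 < t" "t \<le> d'" for u k e t
  proof -
    define m where "m = real (mu ^ k)"
    have m: "0 < m" "1 \<le> m" using mu_pos by (auto simp: m_def)
    define v where "v = Re (FF2 k (of_real u))"
    have v: "c \<le> v" "v \<le> tay_C"
      using FF2_lower[OF dom u] norm_FF2_le[OF u, of k] complex_Re_le_cmod[of "FF2 k (of_real u)"] by (auto simp: v_def)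
    define D where "D = Re (deriv (FF k) (of_real u))"
    define s where "s = m * (D - BB' u) - 1"
    have s: "\<bar>s\<bar> \<le> b - 1" using Re_deriv_FF[OF u, of k] by (simp add: s_def b_def D_def m_def abs_le_iff)
    define R where "R = FF_rem k u t"
    have tw: "\<bar>t\<bar> \<le> win_r" using t d' cd by simp
    have R: "norm R \<le> tay_C * t ^ 3" using taylor_FF[OF u tw, of k] t unfolding R_def FF_rem_def by simp
    define w where "w = \<i> * of_real (t * s) - of_real (t * e) + of_real m * R"
    have key: "of_real (exp (- (t * e))) * (cis (t * (- BB' u * m - 1)) * chi (of_real (a ^ k) * (of_real u + \<i> * of_real t))) =
      of_real (exp (- (m * v * t\<^sup>2 / 2))) * exp w"
    proof -
      have "chi (of_real (a ^ k) * (of_real u + \<i> * of_real t)) =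
          exp (of_real m * (\<i> * of_real (t * D) - of_real (t\<^sup>2 / 2 * v) + R))"
        using chi_eq_exp_FF[OF u tw, of k] unfolding FF_expansion[OF u] by (simp add: m_def v_def D_def R_def)
      then have "of_real (exp (- (t * e))) * (cis (t * (- BB' u * m - 1)) * chi (of_real (a ^ k) * (of_real u + \<i> * of_real t))) =
         exp (of_real (- (t * e)) + (\<i> * of_real (t * (- BB' u * m - 1)) + of_real m * (\<i> * of_real (t * D) - of_real (t\<^sup>2 / 2 * v) + R)))"
        by (simp only: exp_add cis_conv_exp exp_of_real)
      also have "of_real (- (t * e)) + (\<i> * of_real (t * (- BB' u * m - 1)) + of_real m * (\<i> * of_real (t * D) - of_real (t\<^sup>2 / 2 * v) + R)) =
         of_real (- (m * v * t\<^sup>2 / 2)) + w"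
        unfolding w_def s_def by (simp add: algebra_simps)
      finally show ?thesis by (simp only: exp_add exp_of_real)
    qed
    have nw: "norm w \<le> b * t + m * tay_C * t ^ 3"
    proof -
      have "norm w \<le> norm (\<i> * complex_of_real (t * s)) + norm (complex_of_real (t * e)) + norm (of_real m * R)"
        unfolding w_def by (intro norm_triangle_le norm_triangle_le_diff add_mono order_refl)
      also have "\<dots> = t * \<bar>s\<bar> + t * e + m * norm R" using t e m by (simp add: norm_mult abs_mult)
      also have "\<dots> \<le> t * (b - 1) + t * 1 + m * (tay_C * t ^ 3)"
        using t e m s R by (intro add_mono mult_left_mono) auto
      finally show ?thesis by (simp add: algebra_simps)
    qed
    have t3: "m * tay_C * t ^ 3 \<le> c / 8 * m * t\<^sup>2"
    proof -
      have "tay_C * t \<le> tay_C * d'" using t tay_C_pos by (intro mult_left_mono) auto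
      then have "tay_C * t \<le> c / 8" using d' by linarith
      then have "tay_C * t * (m * t\<^sup>2) \<le> c / 8 * (m * t\<^sup>2)" using m by (intro mult_right_mono) auto
      then show ?thesis by (simp add: power3_eq_cube power2_eq_square mult_ac)
    qed
    have "exp (- (m * v * t\<^sup>2 / 2)) * norm (exp w - 1) \<le> exp (- (c / 2 * m * t\<^sup>2)) * (exp (b * t + c / 8 * m * t\<^sup>2) * (b * t + m * tay_C * t ^ 3))"
    proof (rule mult_mono)
      have "c * (m * t\<^sup>2) \<le> v * (m * t\<^sup>2)" using v m by (intro mult_right_mono) auto
      then show "exp (- (m * v * t\<^sup>2 / 2)) \<le> exp (- (c / 2 * m * t\<^sup>2))" by (simp add: mult_ac)
      have "norm (exp w - 1) \<le> exp (norm w) * norm w" by (rule norm_exp_minus_1_le)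
      also have "\<dots> \<le> exp (b * t + c / 8 * m * t\<^sup>2) * (b * t + m * tay_C * t ^ 3)"
        using nw t3 by (intro mult_mono) auto
      finally show "norm (exp w - 1) \<le> exp (b * t + c / 8 * m * t\<^sup>2) * (b * t + m * tay_C * t ^ 3)" .
    qed auto
    also have "\<dots> = exp (b * t) * exp (- (3 / 8 * c * m * t\<^sup>2)) * (b * t + m * tay_C * t ^ 3)"
    proof -
      have "exp (- (c / 2 * m * t\<^sup>2)) * exp (b * t + c / 8 * m * t\<^sup>2) = exp (b * t) * exp (- (3 / 8 * c * m * t\<^sup>2))"
        unfolding exp_add[symmetric] by (rule arg_cong[of _ _ exp]) (simp add: algebra_simps)
      then show ?thesis by (simp only: mult.assoc[symmetric])
    qed
    also have "\<dots> \<le> exp (b * d') * exp (- (3 / 8 * c * m * t\<^sup>2)) * (b * t + m * tay_C * t ^ 3)"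
      using t b m tay_C_pos by (intro mult_right_mono) auto
    \<comment> \<open>The remaining exponent 3/8 is divided into three parts: one turns t into 1 /
      sqrt m, one absorbs m t^2, and the last stays to keep the error integrable.\<close>
    also have "\<dots> = exp (b * d') * (t * exp (- (c / 8 * m * t\<^sup>2))) * ((b + tay_C * (m * t\<^sup>2)) * exp (- (c / 8 * m * t\<^sup>2))) * exp (- (c / 8 * m * t\<^sup>2))"
    proof -
      have "exp (- (3 / 8 * c * m * t\<^sup>2)) = exp (- (c / 8 * m * t\<^sup>2)) * exp (- (c / 8 * m * t\<^sup>2)) * exp (- (c / 8 * m * t\<^sup>2))"
        unfolding exp_add[symmetric] by (rule arg_cong[of _ _ exp]) (simp add: algebra_simps)
      moreover have "b * t + m * tay_C * t ^ 3 = t * (b + tay_C * (m * t\<^sup>2))"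
        by (simp add: algebra_simps power3_eq_cube power2_eq_square)
      ultimately show ?thesis by (simp only: mult_ac)
    qed
    also have "\<dots> \<le> exp (b * d') * (1 / sqrt (c / 8 * m)) * (b + tay_C * (8 / c)) * exp (- (c / 8 * m * t\<^sup>2))"
    proof (intro mult_right_mono mult_mono mult_left_mono)
      show "t * exp (- (c / 8 * m * t\<^sup>2)) \<le> 1 / sqrt (c / 8 * m)"
        using cd m t by (intro mult_exp_neg_square_le) auto
      have "(b + tay_C * (m * t\<^sup>2)) * exp (- (c / 8 * m * t\<^sup>2)) = b * exp (- (c / 8 * m * t\<^sup>2)) + tay_C * (m * t\<^sup>2 * exp (- (c / 8 * m * t\<^sup>2)))"
        by (simp add: algebra_simps)
      also have "\<dots> \<le> b * 1 + tay_C * (1 / (c / 8))"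
        using b tay_C_pos cd m by (intro add_mono mult_left_mono square_mult_exp_neg_le) auto
      finally show "(b + tay_C * (m * t\<^sup>2)) * exp (- (c / 8 * m * t\<^sup>2)) \<le> b + tay_C * (8 / c)" by simp
    qed (use b tay_C_pos m t cd in auto)
    also have "\<dots> = L / sqrt m * exp (- (c / 8 * m * t\<^sup>2))"
      unfolding L_def K_def real_sqrt_mult[of "c / 8" m] by simp
    finally have err: "exp (- (m * v * t\<^sup>2 / 2)) * norm (exp w - 1) \<le> L / sqrt m * exp (- (c / 8 * m * t\<^sup>2))" .
    have "exp (- (t * e)) * Re (cis (t * (- BB' u * m - 1)) * chi (of_real (a ^ k) * (of_real u + \<i> * of_real t))) =
        Re (of_real (exp (- (m * v * t\<^sup>2 / 2))) * exp w)"
      unfolding key[symmetric] by (simp only: times_complex.sel Re_complex_of_real Im_complex_of_real mult_zero_left diff_zero)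
    also have "\<dots> = exp (- (m * v * t\<^sup>2 / 2)) * (1 + Re (exp w - 1))" by simp
    also have "\<dots> \<ge> exp (- (m * v * t\<^sup>2 / 2)) * (1 - norm (exp w - 1))"
      using abs_Re_le_cmod[of "exp w - 1"] by (intro mult_left_mono) (auto simp: abs_le_iff)
    finally have "exp (- (m * v * t\<^sup>2 / 2)) - exp (- (m * v * t\<^sup>2 / 2)) * norm (exp w - 1) \<le>
      exp (- (t * e)) * Re (cis (t * (- BB' u * m - 1)) * chi (of_real (a ^ k) * (of_real u + \<i> * of_real t)))"
      by (simp add: right_diff_distrib)
    moreover have "exp (- (m * tay_C * t\<^sup>2 / 2)) \<le> exp (- (m * v * t\<^sup>2 / 2))"
    proof -
      have "v * (m * t\<^sup>2) \<le> tay_C * (m * t\<^sup>2)" using v m by (intro mult_right_mono) auto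
      then show ?thesis by (simp add: mult_ac)
    qed
    ultimately show ?thesis using err unfolding m_def by linarith
  qed
  then show ?thesis using d' L by (intro exI[of _ d'] exI[of _ L] conjI ballI allI impI)
qed

section \<open>Sharp bounds for small balls\<close>

lemma past_transform_space:
  assumes "0 \<le> Re z" shows "past_transform (space M) z = phi z"
  unfolding past_transform_def phi_def by (rule Bochner_Integration.integral_cong) auto

lemma tilt_mass_space: assumes "0 \<le> h" shows "tilt_mass (space M) k h = lap (a ^ k * h)"
proof -
  have h: "0 \<le> a ^ k * h" using assms mean_pos by simp
  have "complex_of_real (lap (a ^ k * h)) = past_transform (space M) (of_real (a ^ k * h))"
    using h phi_of_real[OF h] by (simp add: past_transform_space del: of_real_mult)
  also have "\<dots> = (\<integral>x. indicator (space M) x *\<^sub>R phi (of_real h) ^ Z k x \<partial>M)"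
    unfolding past_transform_def using laplace_past[OF past_space, of "of_real (a ^ k * h)" k] h mean_pos by simp
  also have "\<dots> = (\<integral>x. complex_of_real (indicator (space M) x * lap h ^ Z k x) \<partial>M)"
    using assms by (simp add: phi_of_real scaleR_conv_of_real)
  also have "\<dots> = of_real (tilt_mass (space M) k h)" unfolding tilt_mass_def by (rule integral_complex_of_real)
  finally show ?thesis using of_real_eq_iff by metis
qed

text \<open>A Cauchy kernel has heavy tails, so a lower bound for one kernel does not bound the
  ball. A kernel of small width \<open>e\<close> is used: its mass near the centre is bounded below
  by the Gaussian comparison, and its tail is at most 2 e times the unit kernel, whose mass is
  bounded above.\<close>

lemma small_ball_lower:
  "\<exists>C>0. \<exists>k0. \<forall>k\<ge>k0. \<forall>u\<in>{U0..U1}.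
    C * (exp (u * (- BB' u * real (mu ^ k))) / sqrt (real (mu ^ k))) * lap (a ^ k * u) \<le>
    measure M {x \<in> space M. a ^ k * W x < - BB' u * real (mu ^ k)}"
proof -
  obtain c d q0 where dom0: "chi_dominated c d q0" using ex_chi_dominated by blast
  obtain d' L where d': "0 < d'" "d' \<le> d" "0 < L" and comp:
    "\<And>u k e t. u \<in> {U0..U1} \<Longrightarrow> 0 < e \<Longrightarrow> e \<le> 1 \<Longrightarrow> 0 < t \<Longrightarrow> t \<le> d' \<Longrightarrow>
      exp (- (real (mu ^ k) * tay_C * t\<^sup>2 / 2)) - L / sqrt (real (mu ^ k)) * exp (- (c / 8 * real (mu ^ k) * t\<^sup>2)) \<le>
      exp (- (t * e)) * Re (cis (t * (- BB' u * real (mu ^ k) - 1)) * chi (of_real (a ^ k) * (of_real u + \<i> * of_real t)))"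
    using transform_gaussian_comparison[OF dom0] by blast
  obtain q where dom: "chi_dominated c d' q" using chi_dominated_smaller[OF dom0 d'(1,2)] by blast
  have cq: "0 < c" "0 < q" "q < 1" using dom by (auto simp: chi_dominated_def)
  \<comment> \<open>On 0 < t <= 1 / sqrt m the Gaussian exp(-m tay_C t^2 / 2) is at least this
    value.\<close>
  define c1 where "c1 = exp (- tay_C / 2)"
  have c1: "0 < c1" by (simp add: c1_def)
  define P where "P = peak_const c q"
  have P: "0 < P" unfolding P_def by (rule peak_const_pos[OF cq])
  \<comment> \<open>Makes the tail 2 e P at most half of the main term c1 / 2.\<close>
  define e where "e = min 1 (c1 / (8 * P))"
  have e: "0 < e" "e \<le> 1" "2 * e * P \<le> c1 / 4"
  proof -
    show "0 < e" "e \<le> 1" using c1 P by (auto simp: e_def)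
    have "e * P \<le> c1 / (8 * P) * P" using P by (intro mult_right_mono) (auto simp: e_def)
    then show "2 * e * P \<le> c1 / 4" using P by simp
  qed
  \<comment> \<open>Collects the two errors of order 1 / m: the integrated comparison error and the
    part beyond d'.\<close>
  define E where "E = L * (sqrt pi / (2 * sqrt (c / 8))) + 1 / (1 / q - 1) / e"
  have E: "0 < E" unfolding E_def using d' cq e by (intro add_pos_pos mult_pos_pos divide_pos_pos) auto
  \<comment> \<open>For k >= k0 the interval (0, 1 / sqrt m] lies below d', and E / m is at most
    half of c1 / sqrt m.\<close>
  obtain k0 where k0: "max ((1 / d')\<^sup>2) ((2 * E / c1)\<^sup>2) < real mu ^ k0"
    using real_arch_pow[OF mu_pos(3)] by blast
  \<comment> \<open>The factor exp(-2 U1) accounts for points of the ball with a^k W as low as y -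
    2.\<close>
  define C where "C = e * c1 / 4 * exp (- 2 * U1)"
  have C: "0 < C" unfolding C_def using e c1 by simp
  have "C * (exp (u * (- BB' u * real (mu ^ k))) / sqrt (real (mu ^ k))) * lap (a ^ k * u) \<le>
    measure M {x \<in> space M. a ^ k * W x < - BB' u * real (mu ^ k)}"
    if k: "k0 \<le> k" and u: "u \<in> {U0..U1}" for k u
  proof -
    define m where "m = mu ^ k"
    have m: "0 < m" using mu_pos by (simp add: m_def)
    have mk: "real mu ^ k0 \<le> real m" unfolding m_def of_nat_power using k mu_pos by (intro power_increasing) auto
    have "(1 / d')\<^sup>2 < real mu ^ k0" "(2 * E / c1)\<^sup>2 < real mu ^ k0" using k0 by auto
    then have "(1 / d')\<^sup>2 \<le> real m" "(2 * E / c1)\<^sup>2 \<le> real m" using mk by linarith+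
    then have rm: "1 / d' \<le> sqrt (real m)" "2 * E / c1 \<le> sqrt (real m)" by (auto intro: real_le_rsqrt)
    have sm: "0 < sqrt (real m)" using m by simp
    define y where "y = - BB' u * real m"
    define b where "b = a ^ k"
    have b: "0 < b" using mean_pos by (simp add: b_def)
    have u0: "0 < u" "u \<le> U1" using u U0 by auto
    define F where "F = lap (b * u)"
    have F: "0 < F" unfolding F_def using b u0 by (intro lap_pos) auto
    \<comment> \<open>Centred one unit inside the ball, the unit neighbourhood of \<open>s\<close>
      satisfies y - 2 < a^k W < y.\<close>
    define s where "s = y - 1"
    note ck = cauchy_kernel_transform[OF sets.top u0(1) b e(1), of s]
    have pt: "past_transform (space M) (of_real b * (of_real u + \<i> * of_real t)) =
        of_real F * chi (of_real b * (of_real u + \<i> * of_real t))" for t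
      using b u0 F by (subst past_transform_space) (auto simp: chi_def F_def)
    have ind_int: "integrable lborel (\<lambda>t. indicator {0<..1 / sqrt (real m)} t :: real)"
      and ind_val: "(\<integral>t. indicator {0<..1 / sqrt (real m)} t \<partial>lborel) = 1 / sqrt (real m)"
      using sm by auto
    have cm: "0 < c / 8 * real m" using cq m by simp
    note hg = half_gaussian_integral[OF cm] and lc = laplace_cos_integral[OF e(1), of 0]
    let ?h = "\<lambda>t. F * (c1 * indicator {0<..1 / sqrt (real m)} t - L / sqrt (real m) * (indicator {0<..} t * exp (- (c / 8 * real m) * t\<^sup>2))
        - q ^ m * (indicator {0<..} t * (exp (- (t * e)) * cos (t * 0))))"
    have low: "(\<integral>t. ?h t \<partial>lborel) \<le> (\<integral>x. indicator (space M) x * (exp (- (u * b) * W x) * (e / (e\<^sup>2 + (b * W x - s)\<^sup>2))) \<partial>M)"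
      unfolding ck(3)
    proof (rule integral_mono[OF _ ck(2)])
      show "integrable lborel ?h"
        by (intro integrable_mult_right Bochner_Integration.integrable_diff hg lc ind_int)
      fix t :: real
      show "?h t \<le> indicator {0<..} t * (exp (- (t * e)) * Re (cis (t * s) * past_transform (space M) (of_real b * (of_real u + \<i> * of_real t))))"
      proof (cases "0 < t")
        case t: True
        let ?c = "chi (of_real b * (of_real u + \<i> * of_real t))"
        have rhs: "Re (cis (t * s) * past_transform (space M) (of_real b * (of_real u + \<i> * of_real t))) = F * Re (cis (t * s) * ?c)"
          unfolding pt by (simp add: algebra_simps)
        have "c1 * indicator {0<..1 / sqrt (real m)} t - L / sqrt (real m) * exp (- (c / 8 * real m) * t\<^sup>2) - q ^ m * exp (- (t * e))
            \<le> exp (- (t * e)) * Re (cis (t * s) * ?c)"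
        proof (cases "t \<le> d'")
          case True
          have "c1 * indicator {0<..1 / sqrt (real m)} t \<le> exp (- (real m * tay_C * t\<^sup>2 / 2))"
          proof (cases "t \<le> 1 / sqrt (real m)")
            case True
            then have "t\<^sup>2 \<le> (1 / sqrt (real m))\<^sup>2" using t by (intro power_mono) auto
            then have "real m * t\<^sup>2 \<le> 1" using m by (simp add: power_divide field_simps)
            then have "tay_C * (real m * t\<^sup>2) \<le> tay_C * 1" using tay_C_pos by (intro mult_left_mono) auto
            then have "c1 \<le> exp (- (real m * tay_C * t\<^sup>2 / 2))" unfolding c1_def by (simp add: mult_ac)
            then show ?thesis using True t by simp
          qed simp
          moreover have "exp (- (real m * tay_C * t\<^sup>2 / 2)) - L / sqrt (real m) * exp (- (c / 8 * real m * t\<^sup>2))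
              \<le> exp (- (t * e)) * Re (cis (t * s) * ?c)"
            using comp[OF u e(1,2) t True, of k] by (simp add: m_def s_def y_def b_def)
          moreover have "0 \<le> q ^ m * exp (- (t * e))" using cq by simp
          ultimately show ?thesis by simp
        next
          case False
          have "norm ?c \<le> norm (chi (of_real u + \<i> * of_real t)) ^ mu ^ k"
            unfolding b_def using u0 by (intro norm_chi_mult_power_a) simp
          also have "\<dots> \<le> q ^ m" unfolding m_def using dom u t False by (intro power_mono) (auto simp: chi_dominated_def)
          finally have "norm (cis (t * s) * ?c) \<le> q ^ m" by (simp add: norm_mult)
          then have "- (q ^ m) \<le> Re (cis (t * s) * ?c)" using abs_Re_le_cmod[of "cis (t * s) * ?c"] by linarith
          then have "exp (- (t * e)) * (- (q ^ m)) \<le> exp (- (t * e)) * Re (cis (t * s) * ?c)" by (intro mult_left_mono) auto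
          moreover have "\<not> t \<le> 1 / sqrt (real m)"
          proof -
            have "1 / sqrt (real m) \<le> d'" using rm(1) d' sm by (simp add: field_simps)
            then show ?thesis using False by linarith
          qed
          moreover have "0 \<le> L / sqrt (real m) * exp (- (c / 8 * real m) * t\<^sup>2)" using d' sm by simp
          ultimately show ?thesis by (simp add: mult.commute)
        qed
        then have "F * (c1 * indicator {0<..1 / sqrt (real m)} t - L / sqrt (real m) * exp (- (c / 8 * real m) * t\<^sup>2) - q ^ m * exp (- (t * e)))
            \<le> F * (exp (- (t * e)) * Re (cis (t * s) * ?c))" using F by (intro mult_left_mono) auto
        then show ?thesis unfolding rhs using t by (simp add: mult_ac)
      qed simp
    qed
    have "(\<integral>t. ?h t \<partial>lborel) = F * (c1 * (1 / sqrt (real m)) - L / sqrt (real m) * (sqrt pi / (2 * sqrt (c / 8 * real m)))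
        - q ^ m * (e / (e\<^sup>2 + 0\<^sup>2)))"
      using hg lc ind_int ind_val by (simp del: power_zero_numeral)
    also have "\<dots> = F * (c1 / sqrt (real m) - L * (sqrt pi / (2 * sqrt (c / 8))) / real m - q ^ m / e)"
    proof -
      have "L / sqrt (real m) * (sqrt pi / (2 * sqrt (c / 8 * real m))) = L * (sqrt pi / (2 * sqrt (c / 8))) / (sqrt (real m) * sqrt (real m))"
        unfolding real_sqrt_mult[of "c / 8" "real m"] by simp
      moreover have "sqrt (real m) * sqrt (real m) = real m" by simp
      moreover have "e / (e\<^sup>2 + 0\<^sup>2) = 1 / e" by (simp add: power2_eq_square)
      ultimately show ?thesis by simp
    qed
    also have "\<dots> \<ge> F * (c1 / (2 * sqrt (real m)))"
    proof (rule mult_left_mono)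
      have "q ^ m / e \<le> 1 / (1 / q - 1) / real m / e"
        using e by (intro divide_right_mono geometric_le_inverse cq m) auto
      also have "\<dots> = 1 / (1 / q - 1) / e / real m" by (simp add: mult_ac)
      finally have "L * (sqrt pi / (2 * sqrt (c / 8))) / real m + q ^ m / e \<le> E / real m"
        unfolding E_def add_divide_distrib by (rule add_left_mono)
      also have "E / real m = E / (sqrt (real m) * sqrt (real m))" by simp
      also have "\<dots> \<le> (c1 * sqrt (real m) / 2) / (sqrt (real m) * sqrt (real m))"
        using rm(2) c1 sm by (intro divide_right_mono) (auto simp: field_simps)
      also have "\<dots> = c1 / (2 * sqrt (real m))"
      proof -
        have "(c1 * r / 2) / (r * r) = c1 / (2 * r)" if "0 < r" for r :: real using that by (simp add: field_simps)
        from this[OF sm] show ?thesis .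
      qed
      finally show "c1 / (2 * sqrt (real m)) \<le> c1 / sqrt (real m) - L * (sqrt pi / (2 * sqrt (c / 8))) / real m - q ^ m / e"
        by (simp add: field_simps)
    qed (use F in simp)
    finally have low2: "F * (c1 / (2 * sqrt (real m))) \<le> (\<integral>x. indicator (space M) x * (exp (- (u * b) * W x) * (e / (e\<^sup>2 + (b * W x - s)\<^sup>2))) \<partial>M)"
      using low by linarith
    have S[measurable]: "{x \<in> space M. b * W x < y} \<in> sets M" by measurable
    note ck1 = cauchy_kernel_transform(1)[OF sets.top u0(1) b zero_less_one, of s]
    \<comment> \<open>Within distance 1 of the centre the narrow kernel is at most 1 / e and the
      point lies in the ball; farther out it is at most 2 e times the unit kernel.\<close>
    let ?g = "\<lambda>x. 1 / e * exp (- (u * (y - 2))) * indicator {x \<in> space M. b * W x < y} x +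
        2 * e * (indicator (space M) x * (exp (- (u * b) * W x) * (1 / (1\<^sup>2 + (b * W x - s)\<^sup>2))))"
    have "(\<integral>x. indicator (space M) x * (exp (- (u * b) * W x) * (e / (e\<^sup>2 + (b * W x - s)\<^sup>2))) \<partial>M) \<le> (\<integral>x. ?g x \<partial>M)"
    proof (rule integral_mono[OF ck(1)])
      show "integrable M ?g"
        by (intro Bochner_Integration.integrable_add integrable_mult_right ck1 integrable_const_bound[where B=1]) auto
      fix x assume x: "x \<in> space M"
      define v where "v = b * W x - s"
      have p: "0 < 1 + v\<^sup>2" "0 < e\<^sup>2 + v\<^sup>2" using e by (auto simp: add_pos_nonneg)
      show "indicator (space M) x * (exp (- (u * b) * W x) * (e / (e\<^sup>2 + (b * W x - s)\<^sup>2))) \<le> ?g x"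
      proof (cases "\<bar>v\<bar> < 1")
        case True
        then have bw: "b * W x < y" "y - 2 < b * W x" by (auto simp: v_def s_def abs_less_iff)
        have "e / (e\<^sup>2 + v\<^sup>2) \<le> e / e\<^sup>2" using e p by (intro divide_left_mono) auto
        also have "\<dots> = 1 / e" using e by (simp add: power2_eq_square)
        finally have "exp (- (u * b) * W x) * (e / (e\<^sup>2 + v\<^sup>2)) \<le> exp (- (u * (y - 2))) * (1 / e)"
          using e p bw u0 by (intro mult_mono) (auto simp: mult.assoc)
        moreover have "0 \<le> 2 * e * (exp (- (u * b) * W x) * (1 / (1 + v\<^sup>2)))" using e p by simp
        ultimately show ?thesis using x bw unfolding v_def by simp
      next
        case False
        then have "1 \<le> v\<^sup>2" using one_le_power[of "\<bar>v\<bar>" 2] by simp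
        have "e / (e\<^sup>2 + v\<^sup>2) \<le> 2 * e * (1 / (1 + v\<^sup>2))"
        proof -
          have "1 + v\<^sup>2 \<le> 2 * (e\<^sup>2 + v\<^sup>2)" using \<open>1 \<le> v\<^sup>2\<close> zero_le_power2[of e] unfolding distrib_left by linarith
          then have "e * (1 + v\<^sup>2) \<le> e * (2 * (e\<^sup>2 + v\<^sup>2))" using e by (intro mult_left_mono) auto
          then show ?thesis using p by (simp add: field_simps)
        qed
        then have "exp (- (u * b) * W x) * (e / (e\<^sup>2 + v\<^sup>2)) \<le> exp (- (u * b) * W x) * (2 * e * (1 / (1 + v\<^sup>2)))"
          by (rule mult_left_mono) simp
        moreover have "0 \<le> 1 / e * exp (- (u * (y - 2))) * indicator {x \<in> space M. b * W x < y} x" using e by simp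
        ultimately show ?thesis using x unfolding v_def by (simp add: mult_ac)
      qed
    qed
    also have "(\<integral>x. ?g x \<partial>M) = 1 / e * exp (- (u * (y - 2))) * measure M {x \<in> space M. b * W x < y} +
        2 * e * (\<integral>x. indicator (space M) x * (exp (- (u * b) * W x) * (1 / (1\<^sup>2 + (b * W x - s)\<^sup>2))) \<partial>M)"
    proof -
      have i1: "integrable M (\<lambda>x. indicator {x \<in> space M. b * W x < y} x :: real)"
        by (rule integrable_const_bound[where B=1]) auto
      have v1: "(\<integral>x. indicator {x \<in> space M. b * W x < y} x \<partial>M) = measure M {x \<in> space M. b * W x < y}" by simp
      have lin: "(\<integral>x. r * f x + r' * g x \<partial>M) = r * (\<integral>x. f x \<partial>M) + r' * (\<integral>x. g x \<partial>M)"
        if "integrable M f" "integrable M g" for r r' :: real and f g :: "'a \<Rightarrow> real"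
        using that by simp
      show ?thesis unfolding v1[symmetric] by (rule lin[OF i1 ck1])
    qed
    also have "\<dots> \<le> 1 / e * exp (- (u * (y - 2))) * measure M {x \<in> space M. b * W x < y} + 2 * e * (P / sqrt (real m) * F)"
    proof (intro add_left_mono mult_left_mono)
      have "tilt_mass (space M) 0 (a ^ (k - 0) * u) = F"
        using u0 mean_pos by (subst tilt_mass_space) (auto simp: F_def b_def)
      then show "(\<integral>x. indicator (space M) x * (exp (- (u * b) * W x) * (1 / (1\<^sup>2 + (b * W x - s)\<^sup>2))) \<partial>M) \<le> P / sqrt (real m) * F"
        using cauchy_mass_upper[OF dom past_space[of 0] _ u, of k s] unfolding P_def b_def m_def by simp
    qed (use e in simp)
    also have "2 * e * (P / sqrt (real m) * F) \<le> c1 / 4 * (F / sqrt (real m))"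
    proof -
      have "2 * e * P * (F / sqrt (real m)) \<le> c1 / 4 * (F / sqrt (real m))"
        using e(3) F sm by (intro mult_right_mono) auto
      then show ?thesis by simp
    qed
    finally have "F * (c1 / (2 * sqrt (real m))) \<le>
        1 / e * exp (- (u * (y - 2))) * measure M {x \<in> space M. b * W x < y} + c1 / 4 * (F / sqrt (real m))"
      using low2 by linarith
    moreover have "F * (c1 / (2 * sqrt (real m))) = c1 / 4 * (F / sqrt (real m)) + c1 / 4 * (F / sqrt (real m))" using sm by (simp add: field_simps)
    ultimately have fin: "c1 / 4 * (F / sqrt (real m)) \<le> 1 / e * exp (- (u * (y - 2))) * measure M {x \<in> space M. b * W x < y}" by linarith
    have "C * (exp (u * y) / sqrt (real m)) * F = e * exp (- 2 * U1) * exp (u * y) * (c1 / 4 * (F / sqrt (real m)))"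
      by (simp add: C_def)
    also have "\<dots> \<le> e * exp (- 2 * U1) * exp (u * y) * (1 / e * exp (- (u * (y - 2))) * measure M {x \<in> space M. b * W x < y})"
      using fin e by (intro mult_left_mono) auto
    also have "\<dots> = exp (- 2 * U1) * exp (u * y) * exp (- (u * (y - 2))) * measure M {x \<in> space M. b * W x < y}"
      using e by simp
    also have "exp (- 2 * U1) * exp (u * y) * exp (- (u * (y - 2))) = exp (2 * (u - U1))"
      unfolding exp_add[symmetric] by (rule arg_cong[of _ _ exp]) (simp add: algebra_simps)
    also have "exp (2 * (u - U1)) * measure M {x \<in> space M. b * W x < y} \<le> 1 * measure M {x \<in> space M. b * W x < y}"
      using u0 by (intro mult_right_mono) auto
    finally show ?thesis by (simp add: m_def y_def b_def F_def)
  qed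
  with C show ?thesis by (intro exI[of _ C] conjI exI[of _ k0] allI impI ballI)
qed

text \<open>Upper and lower bound carry the same factor exp(u y) mu^(-n/2), which cancels. The
  quotient left over is exactly the tilted probability of \<open>A\<close>.\<close>

lemma conditional_past_bound:
  "\<exists>C>0. \<exists>n0. \<forall>n\<ge>n0. \<forall>k\<le>n. \<forall>A\<in>past k. \<forall>u\<in>{U0..U1}. \<forall>y. y = - BB' u * real (mu ^ n) \<longrightarrow>
    0 < measure M {x \<in> space M. a ^ n * W x < y} \<and>
    measure M {x \<in> A. a ^ n * W x < y} \<le>
      C * measure M {x \<in> space M. a ^ n * W x < y} * (tilt_mass A k (a ^ (n - k) * u) / lap (a ^ n * u))"
proof -
  obtain c d q where dom: "chi_dominated c d q" using ex_chi_dominated by blast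
  define C2 where "C2 = max 1 (2 / U0\<^sup>2) * peak_const c q"
  have C2: "0 < C2" unfolding C2_def using dom peak_const_pos[of c q] by (intro mult_pos_pos) (auto simp: chi_dominated_def)
  obtain C1 n0 where C1: "0 < C1" and low: "\<And>k u. n0 \<le> k \<Longrightarrow> u \<in> {U0..U1} \<Longrightarrow>
    C1 * (exp (u * (- BB' u * real (mu ^ k))) / sqrt (real (mu ^ k))) * lap (a ^ k * u) \<le>
    measure M {x \<in> space M. a ^ k * W x < - BB' u * real (mu ^ k)}"
    using small_ball_lower by blast
  show ?thesis
  proof (rule exI[of _ "C2 / C1"], intro conjI exI[of _ n0] allI impI ballI)
    fix n k A u y
    assume n: "n0 \<le> n" and k: "k \<le> n" and A: "A \<in> past k" and u: "u \<in> {U0..U1}" and y: "y = - BB' u * real (mu ^ n)"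
    let ?Q = "measure M {x \<in> space M. a ^ n * W x < y}"
    define G where "G = exp (u * y) / sqrt (real (mu ^ n))"
    have G: "0 < G" unfolding G_def using mu_pos by simp
    have l: "0 < lap (a ^ n * u)" using u U0 mean_pos by (intro lap_pos) auto
    have T: "0 \<le> tilt_mass A k (a ^ (n - k) * u)" using u U0 mean_pos by (intro tilt_mass_nonneg) auto
    have Q: "C1 * G * lap (a ^ n * u) \<le> ?Q" using low[OF n u] by (simp add: G_def y)
    have "0 < C1 * G * lap (a ^ n * u)" using C1 G l by simp
    with Q show "0 < ?Q" by linarith
    have "measure M {x \<in> A. a ^ n * W x < y} \<le> C2 * G * tilt_mass A k (a ^ (n - k) * u)"
      using small_ball_past_upper[OF dom A k u, of y] by (simp add: C2_def G_def)
    also have "\<dots> = C2 / C1 * (C1 * G * lap (a ^ n * u)) * (tilt_mass A k (a ^ (n - k) * u) / lap (a ^ n * u))"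
      using C1 l by simp
    also have "\<dots> \<le> C2 / C1 * ?Q * (tilt_mass A k (a ^ (n - k) * u) / lap (a ^ n * u))"
      using Q C1 C2 T l by (intro mult_right_mono mult_left_mono) auto
    finally show "measure M {x \<in> A. a ^ n * W x < y} \<le> C2 / C1 * ?Q * (tilt_mass A k (a ^ (n - k) * u) / lap (a ^ n * u))" .
  qed (use C1 C2 in simp)
qed

section \<open>The tilted offspring law\<close>

abbreviation "gap \<equiv> lam - mu"

lemma gap_pos: "0 < gap" and real_gap: "real gap = real lam - real mu"
  using lam_props by auto

section \<open>Minimality of the tree under the tilt\<close>

lemma prob_sum_minimal: "pmf p mu ^ m \<le> (\<integral>y. of_bool ((\<Sum>i<m. X n i y) = mu * m) \<partial>M)"
proof -
  have "(\<integral>y. (\<Prod>i<m. indicator {mu} (X n i y) :: real) \<partial>M) = (\<Prod>i<m. measure_pmf.expectation p (indicator {mu}))"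
    by (rule prod_offspring_integral) (auto intro!: measure_pmf.integrable_const_bound[where B=1])
  then have "pmf p mu ^ m = (\<integral>y. (\<Prod>i<m. indicator {mu} (X n i y) :: real) \<partial>M)"
    by (simp add: measure_pmf_single)
  also have "\<dots> \<le> (\<integral>y. of_bool ((\<Sum>i<m. X n i y) = mu * m) \<partial>M)"
  proof (rule integral_mono)
    show "integrable M (\<lambda>y. \<Prod>i<m. indicator {mu} (X n i y) :: real)"
      by (rule prod_offspring_integral) (auto intro!: measure_pmf.integrable_const_bound[where B=1])
    show "integrable M (\<lambda>y. of_bool ((\<Sum>i<m. X n i y) = mu * m) :: real)"
      by (rule integrable_const_bound[where B=1]) auto
    fix y
    show "(\<Prod>i<m. indicator {mu} (X n i y)) \<le> (of_bool ((\<Sum>i<m. X n i y) = mu * m) :: real)"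
    proof (cases "\<forall>i<m. X n i y = mu")
      case False
      then obtain i where "i < m" "X n i y \<noteq> mu" by auto
      then have "(\<Prod>i<m. indicator {mu} (X n i y)) = (0::real)" by (intro prod_zero bexI[of _ i]) auto
      then show ?thesis by (rule ord_eq_le_trans) simp
    qed (simp add: mult.commute)
  qed
  finally show ?thesis .
qed

text \<open>It suffices that each of the 1 + mu + ... + mu^(j-1) individuals in the earlier
  generations of the minimal tree has mu children.\<close>

lemma prob_minimal_tree:
  "pmf p mu ^ (\<Sum>i<j. mu ^ i) \<le> measure M {x \<in> space M. Z j x = mu ^ j}"
proof (induction j)
  case (Suc j)
  define A where "A = {x \<in> space M. Z j x = mu ^ j}"
  have A: "A \<in> past j" unfolding A_def using past_gen_size[of j j "{mu ^ j}"] by simp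
  have AM[measurable]: "A \<in> sets M" by (rule past_sets[OF A])
  have "pmf p mu ^ (\<Sum>i<Suc j. mu ^ i) = pmf p mu ^ (\<Sum>i<j. mu ^ i) * pmf p mu ^ mu ^ j"
    by (simp add: power_add)
  also have "\<dots> \<le> measure M A * pmf p mu ^ mu ^ j"
    using Suc by (intro mult_right_mono) (auto simp: A_def)
  also have "\<dots> = (\<integral>x. indicator A x * pmf p mu ^ mu ^ j \<partial>M)" by simp
  also have "\<dots> \<le> (\<integral>x. indicator A x *\<^sub>R (\<integral>y. of_bool ((\<Sum>i<Z j x. X j i y) = mu * Z j x) \<partial>M) \<partial>M)"
  proof (rule integral_mono)
    show "integrable M (\<lambda>x. indicator A x * pmf p mu ^ mu ^ j)"
      by (intro integrable_mult_left integrable_const_bound[where B=1]) auto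
    have "\<bar>\<integral>y. of_bool ((\<Sum>i<m. X j i y) = mu * m) \<partial>M\<bar> \<le> (1::real)" for m
    proof -
      have i: "integrable M (\<lambda>y. of_bool ((\<Sum>i<m. X j i y) = mu * m) :: real)"
        by (rule integrable_const_bound[where B=1]) auto
      have "(\<integral>y. of_bool ((\<Sum>i<m. X j i y) = mu * m) \<partial>M) \<le> (\<integral>y. (1::real) \<partial>M)"
        using i by (intro integral_mono) auto
      moreover have "0 \<le> (\<integral>y. of_bool ((\<Sum>i<m. X j i y) = mu * m) \<partial>M :: real)"
        by (intro integral_nonneg_AE) auto
      ultimately show ?thesis by (simp add: prob_space)
    qed
    moreover have "(\<lambda>x. \<integral>y. of_bool ((\<Sum>i<Z j x. X j i y) = mu * Z j x) \<partial>M :: real) \<in> borel_measurable M"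
      by (rule measurable_compose[OF gen_size_measurable[of j], where g = "\<lambda>m. \<integral>y. of_bool ((\<Sum>i<m. X j i y) = mu * m) \<partial>M"]) simp
    ultimately show "integrable M (\<lambda>x. indicator A x *\<^sub>R (\<integral>y. of_bool ((\<Sum>i<Z j x. X j i y) = mu * Z j x) \<partial>M :: real))"
      by (intro integrable_const_bound[where B=1]) (auto simp: indicator_def)
    show "indicator A x * pmf p mu ^ mu ^ j \<le> indicator A x *\<^sub>R (\<integral>y. of_bool ((\<Sum>i<Z j x. X j i y) = mu * Z j x) \<partial>M)" for x
      using prob_sum_minimal[of "mu ^ j" j] by (auto simp: indicator_def A_def)
  qed
  also have "\<dots> = (\<integral>x. indicator A x *\<^sub>R of_bool (Z (Suc j) x = mu * Z j x) \<partial>M)"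
    by (rule one_step_integral[OF A, symmetric, of "\<lambda>m l. of_bool (l = mu * m)" 1]) auto
  also have "\<dots> = (\<integral>x. indicator (A \<inter> {x \<in> space M. Z (Suc j) x = mu ^ Suc j}) x \<partial>M)"
    by (rule Bochner_Integration.integral_cong) (auto simp: indicator_def A_def simp del: gen_size.simps)
  also have "\<dots> = measure M (A \<inter> {x \<in> space M. Z (Suc j) x = mu ^ Suc j})" by (simp del: gen_size.simps)
  also have "\<dots> \<le> measure M {x \<in> space M. Z (Suc j) x = mu ^ Suc j}"
    by (rule finite_measure_mono) (auto simp del: gen_size.simps)
  finally show ?case .
qed (simp add: prob_space)

text \<open>The total tilted mass is lap(a^j h), and the minimal tree alone already carries almost
  all of it: at least p_mu^N lap(h)^(mu^j). The logarithm of the ratio is computed with the exact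
  identity, where the terms with BB cancel.\<close>

lemma tilt_mass_nonminimal:
  assumes h: "0 < h"
  shows "tilt_mass {x \<in> space M. Z j x \<noteq> mu ^ j} j h \<le>
    lap (a ^ j * h) * (4 / pmf p mu * (real mu ^ j * lap h ^ gap))"
proof -
  define A where "A = {x \<in> space M. Z j x = mu ^ j}"
  define A' where "A' = {x \<in> space M. Z j x \<noteq> mu ^ j}"
  have [measurable]: "A \<in> sets M" "A' \<in> sets M" unfolding A_def A'_def by measurable
  have h0: "0 \<le> h" using h by simp
  have aj: "0 < a ^ j * h" "h \<le> a ^ j * h"
  proof -
    show "0 < a ^ j * h" using h mean_pos by simp
    have "1 * h \<le> a ^ j * h" using h mean_gt_1 by (intro mult_right_mono) auto
    then show "h \<le> a ^ j * h" by simp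
  qed
  define r0 where "r0 = lap (a ^ j * h)"
  define r where "r = lap h"
  have r: "0 < r" "0 < r0" using lap_pos[of h] lap_pos[of "a ^ j * h"] h aj by (auto simp: r_def r0_def)
  have rr: "r0 \<le> r" unfolding r_def r0_def using h aj by (intro lap_antimono) auto
  have split: "tilt_mass (space M) j h = tilt_mass A j h + tilt_mass A' j h"
  proof -
    have "tilt_mass (space M) j h = (\<integral>x. indicator A x * lap h ^ Z j x + indicator A' x * lap h ^ Z j x \<partial>M)"
      unfolding tilt_mass_def by (intro Bochner_Integration.integral_cong) (auto simp: A_def A'_def indicator_def)
    then show ?thesis unfolding tilt_mass_def using h0 by (simp add: integrable_tilt)
  qed
  have "tilt_mass A j h = (\<integral>x. indicator A x * r ^ mu ^ j \<partial>M)"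
    unfolding tilt_mass_def r_def by (intro Bochner_Integration.integral_cong) (auto simp: A_def indicator_def)
  then have tA: "tilt_mass A j h = measure M A * r ^ mu ^ j" by simp
  \<comment> \<open>The number of individuals before generation j in the minimal tree. As N (mu - 1)
    = mu^j - 1, N ln p_mu is (mu^j - 1) times \<open>EE_lim\<close>.\<close>
  define N where "N = (\<Sum>i<j. mu ^ i)"
  have N: "real N * (real mu - 1) = real mu ^ j - 1"
    using power_diff_1_eq[of "real mu" j] by (simp add: N_def mult.commute)
  have PA: "pmf p mu ^ N \<le> measure M A" unfolding N_def A_def by (rule prob_minimal_tree)
  define x where "x = 4 / pmf p mu * (real mu ^ j * r ^ gap)"
  have lnr0: "ln r0 = real mu ^ j * BB h - Er (a ^ j * h)" unfolding r0_def by (rule ln_lap_mult_power_a[OF h])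
  have lnr: "ln r = BB h - Er h" unfolding r_def BB_def by simp
  have "real N * ln (pmf p mu) = real N * ((real mu - 1) * EE_lim)"
    unfolding EE_lim_def using mu_pos by simp
  also have "\<dots> = (real mu ^ j - 1) * EE_lim" unfolding N[symmetric] by simp
  finally have Np: "real N * ln (pmf p mu) = (real mu ^ j - 1) * EE_lim" .
  \<comment> \<open>Only differences of \<open>Er\<close> from its limit survive, and each is of the
    order r^gap.\<close>
  have "real N * ln (pmf p mu) + real mu ^ j * ln r - ln r0 = - (real mu ^ j) * (Er h - EE_lim) + (Er (a ^ j * h) - EE_lim)"
    unfolding Np lnr0 lnr by (simp add: algebra_simps)
  also have "\<dots> \<ge> - (real mu ^ j) * (2 / pmf p mu * r ^ gap) - real mu ^ j * (2 / pmf p mu * r ^ gap)"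
  proof -
    have "\<bar>Er h - EE_lim\<bar> \<le> 2 / pmf p mu * r ^ gap" unfolding r_def by (rule Er_near_lim[OF h])
    then have 1: "real mu ^ j * (Er h - EE_lim) \<le> real mu ^ j * (2 / pmf p mu * r ^ gap)" by (intro mult_left_mono) auto
    have "\<bar>Er (a ^ j * h) - EE_lim\<bar> \<le> 2 / pmf p mu * r0 ^ gap" unfolding r0_def by (rule Er_near_lim[OF aj(1)])
    also have "\<dots> \<le> 2 / pmf p mu * r ^ gap" using rr r pmf_mu_pos by (intro mult_left_mono power_mono) auto
    also have "\<dots> \<le> real mu ^ j * (2 / pmf p mu * r ^ gap)"
    proof -
      have "1 \<le> real mu ^ j" using mu_pos by (intro one_le_power) auto
      then have "1 * (2 / pmf p mu * r ^ gap) \<le> real mu ^ j * (2 / pmf p mu * r ^ gap)"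
        using r pmf_mu_pos by (intro mult_right_mono) auto
      then show ?thesis by simp
    qed
    finally show ?thesis using 1 by (simp add: abs_le_iff)
  qed
  finally have lb: "- x \<le> real N * ln (pmf p mu) + real mu ^ j * ln r - ln r0"
    by (simp add: x_def algebra_simps)
  have "1 - x \<le> exp (- x)" using exp_ge_add_one_self[of "- x"] by simp
  also have "\<dots> \<le> exp (real N * ln (pmf p mu) + real mu ^ j * ln r - ln r0)" using lb by simp
  also have "\<dots> = pmf p mu ^ N * r ^ mu ^ j / r0"
  proof -
    have "exp (real mu ^ j * ln r) = r ^ mu ^ j"
      using exp_of_nat_mult[of "mu ^ j" "ln r"] r by simp
    then show ?thesis using exp_of_nat_mult[of N "ln (pmf p mu)"] r pmf_mu_pos by (simp add: exp_diff exp_add)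
  qed
  also have "\<dots> \<le> measure M A * r ^ mu ^ j / r0"
    using PA r by (intro divide_right_mono mult_right_mono) auto
  finally have "r0 * (1 - x) \<le> tilt_mass A j h" unfolding tA using r by (simp add: field_simps)
  moreover have "tilt_mass (space M) j h = r0" unfolding r0_def by (rule tilt_mass_space[OF h0])
  ultimately have "tilt_mass A' j h \<le> r0 * x" using split by (simp add: algebra_simps)
  then show ?thesis by (simp add: A'_def x_def r0_def r_def)
qed

section \<open>Second moments of the tilted offspring law\<close>

lemma square_power_quarter_le: "(real i)\<^sup>2 * s ^ (i - d) \<le> 4 ^ d" if "d \<le> i" "0 \<le> s" "s \<le> 1 / 4"
proof -
  have "real i \<le> 2 ^ i" using of_nat_less_two_power[of i] by (simp add: less_imp_le)
  then have "(real i)\<^sup>2 \<le> (2 ^ i)\<^sup>2" by (intro power_mono) auto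
  also have "((2::real) ^ i)\<^sup>2 = (2\<^sup>2) ^ i" by (simp only: power_mult[symmetric] mult.commute)
  also have "(2\<^sup>2 :: real) = 4" by simp
  finally have "(real i)\<^sup>2 * s ^ (i - d) \<le> 4 ^ i * (1 / 4) ^ (i - d)"
    using that by (intro mult_mono power_mono) auto
  also have "\<dots> = 4 ^ d"
  proof -
    have "(4::real) ^ i = 4 ^ d * 4 ^ (i - d)" using that by (simp flip: power_add)
    then show ?thesis by (simp add: power_one_over)
  qed
  finally show ?thesis .
qed

lemma tilted_second_moment_le:
  assumes s: "0 < s" "s \<le> 1 / 4"
  shows "measure_pmf.expectation p (\<lambda>n. (real (n - mu))\<^sup>2 * s ^ (n - mu)) \<le> 4 ^ gap * s ^ gap"
    and "integrable (measure_pmf p) (\<lambda>n. (real (n - mu))\<^sup>2 * s ^ (n - mu))"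
proof -
  have b: "(real (n - mu))\<^sup>2 * s ^ (n - mu) \<le> 4 ^ gap * s ^ gap" if "n \<in> set_pmf p" for n
  proof (cases "n = mu")
    case False
    then have n: "gap \<le> n - mu" using set_pmf_ge_lam[OF that] by simp
    then have "s ^ (n - mu) = s ^ gap * s ^ (n - mu - gap)" unfolding power_add[symmetric] by (metis le_add_diff_inverse)
    then have "(real (n - mu))\<^sup>2 * s ^ (n - mu) = ((real (n - mu))\<^sup>2 * s ^ (n - mu - gap)) * s ^ gap" by simp
    also have "\<dots> \<le> 4 ^ gap * s ^ gap" using s n by (intro mult_right_mono square_power_quarter_le) auto
    finally show ?thesis .
  qed (use s in simp)
  show i: "integrable (measure_pmf p) (\<lambda>n. (real (n - mu))\<^sup>2 * s ^ (n - mu))"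
    using s b by (intro measure_pmf.integrable_const_bound[where B="4 ^ gap * s ^ gap"]) (auto intro!: AE_pmfI simp: abs_mult)
  have "measure_pmf.expectation p (\<lambda>n. (real (n - mu))\<^sup>2 * s ^ (n - mu)) \<le> measure_pmf.expectation p (\<lambda>n. 4 ^ gap * s ^ gap)"
    using b by (intro integral_mono_AE i) (auto intro!: AE_pmfI)
  then show "measure_pmf.expectation p (\<lambda>n. (real (n - mu))\<^sup>2 * s ^ (n - mu)) \<le> 4 ^ gap * s ^ gap" by simp
qed

text \<open>The offspring law tilted by \<open>s\<close> has mean \<open>mu + mean_slope s\<close>.\<close>

lemma tilted_chebyshev:
  assumes s: "0 < s" "s \<le> 1 / 4" and dl: "0 < dl"
  shows "(\<integral>y. of_bool (dl < \<bar>real (\<Sum>i<m. X n i y) - real mu * real m - real m * mean_slope s\<bar>) * s ^ (\<Sum>i<m. X n i y) \<partial>M) \<le>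
     pgf p s ^ m * (real m * (4 ^ gap / pmf p mu * s ^ gap) / dl\<^sup>2)"
proof -
  define ms where "ms = mean_slope s"
  have s1: "\<bar>s\<bar> \<le> 1" "s \<le> 1" "0 \<le> s" using s by auto
  have g: "pmf p mu \<le> exgf p s" "0 < exgf p s" using exgf_bounds[of s] s1 by auto
  \<comment> \<open>\<open>h\<close> is the deviation from the tilted mean mu + ms and
    \<open>w\<close> the unnormalised tilt, so that \<open>h\<close> is centred with respect to the
    weight \<open>w\<close>.\<close>
  define h where "h j = real j - real mu - ms" for j
  define w where "w j = s ^ j" for j
  let ?E = "measure_pmf.expectation p"
  have i0: "integrable (measure_pmf p) w" unfolding w_def using integrable_power[of s id] s1 by simp
  have i0': "integrable (measure_pmf p) (\<lambda>n. s ^ (n - mu))" using s1 by (intro integrable_power) simp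
  have i1': "integrable (measure_pmf p) (\<lambda>n. real (n - mu) * s ^ (n - mu))" using s1 by (intro integrable_weighted_diff) auto
  note i2' = tilted_second_moment_le(2)[OF s]
  have hw: "AE j in measure_pmf p. h j * w j = s ^ mu * (real (j - mu) * s ^ (j - mu) - ms * s ^ (j - mu))"
    and h2w: "AE j in measure_pmf p. (h j)\<^sup>2 * w j = s ^ mu * ((real (j - mu))\<^sup>2 * s ^ (j - mu) - 2 * ms * (real (j - mu) * s ^ (j - mu)) + ms\<^sup>2 * s ^ (j - mu))"
  proof -
    have *: "h j = real (j - mu) - ms \<and> w j = s ^ mu * s ^ (j - mu)" if "j \<in> set_pmf p" for j
      using set_pmf_ge_mu[OF that] by (simp add: h_def w_def of_nat_diff flip: power_add)
    show "AE j in measure_pmf p. h j * w j = s ^ mu * (real (j - mu) * s ^ (j - mu) - ms * s ^ (j - mu))"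
      by (rule AE_pmfI) (simp add: * algebra_simps)
    show "AE j in measure_pmf p. (h j)\<^sup>2 * w j = s ^ mu * ((real (j - mu))\<^sup>2 * s ^ (j - mu) - 2 * ms * (real (j - mu) * s ^ (j - mu)) + ms\<^sup>2 * s ^ (j - mu))"
      by (rule AE_pmfI) (simp add: * algebra_simps power2_eq_square)
  qed
  have i1: "integrable (measure_pmf p) (\<lambda>j. h j * w j)"
    by (rule integrable_cong_AE_imp[where g = "\<lambda>j. s ^ mu * (real (j - mu) * s ^ (j - mu) - ms * s ^ (j - mu))"])
       (use i0' i1' hw in auto)
  have i2: "integrable (measure_pmf p) (\<lambda>j. (h j)\<^sup>2 * w j)"
    by (rule integrable_cong_AE_imp[where g = "\<lambda>j. s ^ mu * ((real (j - mu))\<^sup>2 * s ^ (j - mu) - 2 * ms * (real (j - mu) * s ^ (j - mu)) + ms\<^sup>2 * s ^ (j - mu))"])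
       (use i0' i1' i2' h2w in \<open>auto intro!: integrable_mult_right Bochner_Integration.integrable_add Bochner_Integration.integrable_diff\<close>)
  have m1: "?E (\<lambda>n. real (n - mu) * s ^ (n - mu)) = ms * exgf p s"
    using g by (simp add: ms_def mean_slope_def)
  have "?E (\<lambda>j. h j * w j) = ?E (\<lambda>j. s ^ mu * (real (j - mu) * s ^ (j - mu) - ms * s ^ (j - mu)))"
    by (rule integral_cong_AE) (use hw in auto)
  also have "\<dots> = s ^ mu * (?E (\<lambda>n. real (n - mu) * s ^ (n - mu)) - ms * ?E (\<lambda>n. s ^ (n - mu)))"
    using i0' i1' by simp
  also have "\<dots> = 0" unfolding m1 by (simp add: exgf_def)
  finally have cent: "?E (\<lambda>j. h j * w j) = 0" .
  have "?E (\<lambda>j. (h j)\<^sup>2 * w j) = ?E (\<lambda>j. s ^ mu * ((real (j - mu))\<^sup>2 * s ^ (j - mu) - 2 * ms * (real (j - mu) * s ^ (j - mu)) + ms\<^sup>2 * s ^ (j - mu)))"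
    by (rule integral_cong_AE) (use h2w in auto)
  also have "\<dots> = s ^ mu * (?E (\<lambda>j. (real (j - mu))\<^sup>2 * s ^ (j - mu)) - 2 * ms * ?E (\<lambda>n. real (n - mu) * s ^ (n - mu)) + ms\<^sup>2 * ?E (\<lambda>n. s ^ (n - mu)))"
    using i0' i1' i2' by simp
  also have "\<dots> = s ^ mu * (?E (\<lambda>j. (real (j - mu))\<^sup>2 * s ^ (j - mu)) - ms\<^sup>2 * exgf p s)"
    unfolding m1 by (simp add: exgf_def algebra_simps power2_eq_square)
  also have "\<dots> \<le> s ^ mu * (4 ^ gap * s ^ gap)"
  proof (rule mult_left_mono)
    have "0 \<le> ms\<^sup>2 * exgf p s" using g by simp
    then show "?E (\<lambda>j. (real (j - mu))\<^sup>2 * s ^ (j - mu)) - ms\<^sup>2 * exgf p s \<le> 4 ^ gap * s ^ gap"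
      using tilted_second_moment_le(1)[OF s] by linarith
  qed (use s in simp)
  \<comment> \<open>Since exgf >= p_mu, the variance is now expressed relative to the total tilted
    mass \<open>pgf p s\<close> of one individual.\<close>
  also have "\<dots> \<le> s ^ mu * exgf p s * (4 ^ gap / pmf p mu * s ^ gap)"
  proof -
    have "1 * (s ^ mu * (4 ^ gap * s ^ gap)) \<le> exgf p s / pmf p mu * (s ^ mu * (4 ^ gap * s ^ gap))"
      using s g pmf_mu_pos by (intro mult_right_mono) auto
    then show ?thesis by (simp add: mult_ac)
  qed
  finally have var: "?E (\<lambda>j. (h j)\<^sup>2 * w j) \<le> pgf p s * (4 ^ gap / pmf p mu * s ^ gap)" by (simp add: pgf_eq)
  have wE: "?E w = pgf p s" unfolding w_def pgf_def by simp
  have pg0: "0 \<le> pgf p s" using pgf_real_bounds[of s] s1 by simp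
  note wm = weighted_second_moment[OF i0 i1 i2 cent, of n m]
  have "(\<integral>y. of_bool (dl < \<bar>real (\<Sum>i<m. X n i y) - real mu * real m - real m * ms\<bar>) * s ^ (\<Sum>i<m. X n i y) \<partial>M) \<le>
     (\<integral>y. 1 / dl\<^sup>2 * ((\<Sum>i<m. h (X n i y))\<^sup>2 * (\<Prod>i<m. w (X n i y))) \<partial>M)"
  proof (rule integral_mono)
    show "integrable M (\<lambda>y. of_bool (dl < \<bar>real (\<Sum>i<m. X n i y) - real mu * real m - real m * ms\<bar>) * s ^ (\<Sum>i<m. X n i y))"
      using s1 by (intro integrable_const_bound[where B=1]) (auto simp: abs_mult power_le_one)
    show "integrable M (\<lambda>y. 1 / dl\<^sup>2 * ((\<Sum>i<m. h (X n i y))\<^sup>2 * (\<Prod>i<m. w (X n i y))))"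
      by (intro integrable_mult_right wm(2))
    fix y
    define S where "S = (\<Sum>i<m. X n i y)"
    have e1: "(\<Sum>i<m. h (X n i y)) = real S - real mu * real m - real m * ms"
      by (simp add: h_def S_def sum_subtractf mult.commute)
    have e2: "(\<Prod>i<m. w (X n i y)) = s ^ S" by (simp add: w_def S_def power_sum)
    show "of_bool (dl < \<bar>real (\<Sum>i<m. X n i y) - real mu * real m - real m * ms\<bar>) * s ^ (\<Sum>i<m. X n i y) \<le>
        1 / dl\<^sup>2 * ((\<Sum>i<m. h (X n i y))\<^sup>2 * (\<Prod>i<m. w (X n i y)))"
      unfolding e1 e2 S_def[symmetric]
    proof (cases "dl < \<bar>real S - real mu * real m - real m * ms\<bar>")
      case True
      then have "dl\<^sup>2 \<le> \<bar>real S - real mu * real m - real m * ms\<bar>\<^sup>2" using dl by (intro power_mono) auto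
      then have "1 \<le> 1 / dl\<^sup>2 * (real S - real mu * real m - real m * ms)\<^sup>2" using dl by (simp add: field_simps)
      then have "1 * s ^ S \<le> 1 / dl\<^sup>2 * (real S - real mu * real m - real m * ms)\<^sup>2 * s ^ S"
        using s by (intro mult_right_mono) auto
      then show "of_bool (dl < \<bar>real S - real mu * real m - real m * ms\<bar>) * s ^ S \<le>
        1 / dl\<^sup>2 * ((real S - real mu * real m - real m * ms)\<^sup>2 * s ^ S)" using True by simp
    qed (use s in simp)
  qed
  also have "\<dots> = 1 / dl\<^sup>2 * (real m * ?E (\<lambda>j. (h j)\<^sup>2 * w j) * pgf p s ^ (m - 1))"
    using wm(1) unfolding wE by simp
  also have "\<dots> \<le> 1 / dl\<^sup>2 * (real m * (pgf p s * (4 ^ gap / pmf p mu * s ^ gap)) * pgf p s ^ (m - 1))"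
    using var pg0 by (intro mult_left_mono mult_right_mono) auto
  also have "\<dots> = pgf p s ^ m * (real m * (4 ^ gap / pmf p mu * s ^ gap) / dl\<^sup>2)"
  proof (cases m)
    case (Suc m')
    then show ?thesis by (simp add: mult_ac)
  qed simp
  finally show ?thesis by (simp add: ms_def)
qed

text \<open>Given Z_j = mu^j, the estimate is Chebyshev's inequality for one generation. The
  normalising factor pgf(lap h)^(mu^j) equals lap(a h)^(Z_j) there, and dropping the restriction on
  Z_j reassembles the total mass lap(a^(j+1) h).\<close>

lemma tilt_mass_deviation:
  assumes h: "0 < h" and s: "lap h \<le> 1 / 4" and dl: "0 < dl"
  shows "tilt_mass {x \<in> space M. Z j x = mu ^ j \<and>
        dl < \<bar>real (Z (Suc j) x) - real mu ^ Suc j - real mu ^ j * mean_slope (lap h)\<bar>} (Suc j) h \<le>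
     lap (a ^ Suc j * h) * (real mu ^ j * (4 ^ gap / pmf p mu * lap h ^ gap) / dl\<^sup>2)"
proof -
  define ms where "ms = mean_slope (lap h)"
  define A where "A = {x \<in> space M. Z j x = mu ^ j}"
  have A: "A \<in> past j" unfolding A_def using past_gen_size[of j j "{mu ^ j}"] by simp
  have AM[measurable]: "A \<in> sets M" by (rule past_sets[OF A])
  have l: "0 < lap h" "lap h \<le> 1" using lap_pos[of h] lap_le_1[of h] h by auto
  have ah: "0 \<le> a * h" using h mean_pos by simp
  have pl: "pgf p (lap h) = lap (a * h)" using lap_mult_a[of h] h by simp
  define f :: "nat \<Rightarrow> nat \<Rightarrow> real" where
    "f m l = of_bool (dl < \<bar>real l - real mu * real m - real m * ms\<bar>) * lap h ^ l" for m l
  define B where "B = real mu ^ j * (4 ^ gap / pmf p mu * lap h ^ gap) / dl\<^sup>2"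
  have B: "0 \<le> B" unfolding B_def using l pmf_mu_pos by simp
  have fb: "norm (f m k) \<le> 1" for m k
    using l by (auto simp: f_def abs_mult power_le_one)
  have inner: "(\<integral>y. f (mu ^ j) (\<Sum>i<mu ^ j. X j i y) \<partial>M) \<le> lap (a * h) ^ mu ^ j * B"
    using tilted_chebyshev[OF l(1) s dl, of j "mu ^ j"] unfolding f_def B_def ms_def pl by simp
  have "tilt_mass {x \<in> space M. Z j x = mu ^ j \<and>
        dl < \<bar>real (Z (Suc j) x) - real mu ^ Suc j - real mu ^ j * ms\<bar>} (Suc j) h =
      (\<integral>x. indicator A x *\<^sub>R f (Z j x) (Z (Suc j) x) \<partial>M)"
    unfolding tilt_mass_def by (intro Bochner_Integration.integral_cong) (auto simp: A_def f_def indicator_def)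
  also have "\<dots> = (\<integral>x. indicator A x *\<^sub>R (\<integral>y. f (Z j x) (\<Sum>i<Z j x. X j i y) \<partial>M) \<partial>M)"
    by (rule one_step_integral[OF A fb])
  also have "\<dots> = (\<integral>x. indicator A x * (\<integral>y. f (mu ^ j) (\<Sum>i<mu ^ j. X j i y) \<partial>M) \<partial>M)"
    by (intro Bochner_Integration.integral_cong) (auto simp: A_def indicator_def)
  also have "\<dots> = measure M A * (\<integral>y. f (mu ^ j) (\<Sum>i<mu ^ j. X j i y) \<partial>M)" by simp
  also have "\<dots> \<le> measure M A * (lap (a * h) ^ mu ^ j * B)" using inner by (intro mult_left_mono) auto
  also have "\<dots> = (\<integral>x. indicator A x * lap (a * h) ^ mu ^ j \<partial>M) * B" by simp
  also have "(\<integral>x. indicator A x * lap (a * h) ^ mu ^ j \<partial>M) = (\<integral>x. indicator A x * lap (a * h) ^ Z j x \<partial>M)"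
    by (intro Bochner_Integration.integral_cong) (auto simp: A_def indicator_def)
  also have "\<dots> * B \<le> tilt_mass (space M) j (a * h) * B"
    unfolding tilt_mass_def using lap_pos[OF ah] ah
    by (intro mult_right_mono[OF _ B] integral_mono integrable_tilt) (auto simp: indicator_def)
  also have "tilt_mass (space M) j (a * h) = lap (a ^ Suc j * h)"
    unfolding tilt_mass_space[OF ah] by (simp add: mult_ac)
  finally show ?thesis by (simp add: B_def ms_def)
qed

section \<open>Asymptotics of the tilted mean\<close>

lemma exgf_tendsto: "((\<lambda>s::real. exgf p s) \<longlongrightarrow> pmf p mu) (at_right 0)"
proof -
  have "((\<lambda>s. exgf p s - pmf p mu) \<longlongrightarrow> (0::real)) (at_right 0)"
  proof (rule Lim_null_comparison)
    show "\<forall>\<^sub>F s in at_right 0. norm (exgf p s - pmf p mu) \<le> (s::real) ^ gap"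
      using eventually_at_right_less[of 0] eventually_at_right_real[of 0 1, OF zero_less_one]
    proof eventually_elim
      case (elim s)
      then show ?case using exgf_near_0[of s] by simp
    qed
    have "((\<lambda>s::real. s ^ gap) \<longlongrightarrow> 0 ^ gap) (at_right 0)" by (intro tendsto_intros)
    then show "((\<lambda>s::real. s ^ gap) \<longlongrightarrow> 0) (at_right 0)" using gap_pos by simp
  qed
  then show ?thesis by (simp add: LIM_zero_iff)
qed

text \<open>Of the excess over mu only the atom at lam survives at order s^gap; larger values
  contribute O(s^(gap + 1)), and the normalisation tends to p_mu.\<close>

lemma mean_slope_tendsto: "((\<lambda>s. mean_slope s / s ^ gap) \<longlongrightarrow> real gap * pmf p lam / pmf p mu) (at_right 0)"
proof -
  let ?E = "\<lambda>s. measure_pmf.expectation p (\<lambda>n. real (n - mu) * s ^ (n - mu))"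
  have "((\<lambda>s. ?E s / s ^ gap - real gap * pmf p lam) \<longlongrightarrow> 0) (at_right 0)"
  proof (rule Lim_null_comparison)
    show "\<forall>\<^sub>F s in at_right 0. norm (?E s / s ^ gap - real gap * pmf p lam) \<le> 4 ^ Suc gap * s"
      using eventually_at_right_real[of 0 "1/4 :: real", simplified]
    proof eventually_elim
      case (elim s)
      then have s: "0 < s" "s \<le> 1 / 4" by auto
      have i1: "integrable (measure_pmf p) (\<lambda>n. real (n - mu) * s ^ (n - mu))" using s by (intro integrable_weighted_diff) auto
      have il: "integrable (measure_pmf p) (\<lambda>n. real gap * s ^ gap * indicator {lam} n)"
        by (intro integrable_mult_right measure_pmf.integrable_const_bound[where B=1]) auto
      have pt: "\<bar>real (n - mu) * s ^ (n - mu) - real gap * s ^ gap * indicator {lam} n\<bar> \<le> 4 ^ Suc gap * s ^ Suc gap"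
        if n: "n \<in> set_pmf p" for n
      proof -
        have z: "0 \<le> 4 ^ Suc gap * s ^ Suc gap" using s by simp
        consider "n = mu" | "n = lam" | "Suc gap \<le> n - mu"
        proof -
          have "n = mu \<or> n = lam \<or> Suc gap \<le> n - mu" using set_pmf_ge_lam[OF n] lam_props(1) by arith
          then show ?thesis using that by blast
        qed
        then show ?thesis
        proof cases
          case 3
          define i where "i = n - mu"
          have "s ^ i = s ^ (i - Suc gap) * s ^ Suc gap" using 3 unfolding i_def[symmetric] by (simp flip: power_add power_Suc)
          then have "real i * s ^ i = (real i * s ^ (i - Suc gap)) * s ^ Suc gap" by simp
          also have "\<dots> \<le> ((real i)\<^sup>2 * s ^ (i - Suc gap)) * s ^ Suc gap"
          proof (intro mult_right_mono)
            show "real i \<le> (real i)\<^sup>2" using 3 unfolding i_def[symmetric] by (simp add: power2_eq_square)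
          qed (use s in auto)
          also have "\<dots> \<le> 4 ^ Suc gap * s ^ Suc gap"
            using s 3 unfolding i_def[symmetric] by (intro mult_right_mono square_power_quarter_le) auto
          finally have "real i * s ^ i \<le> 4 ^ Suc gap * s ^ Suc gap" .
          moreover have "n \<noteq> lam" using 3 by auto
          ultimately show ?thesis using s by (simp add: i_def abs_mult)
        qed (use z lam_props in auto)
      qed
      have diff: "?E s - real gap * s ^ gap * pmf p lam =
          measure_pmf.expectation p (\<lambda>n. real (n - mu) * s ^ (n - mu) - real gap * s ^ gap * indicator {lam} n)"
        unfolding Bochner_Integration.integral_diff[OF i1 il] by (simp add: measure_pmf_single)
      have "\<bar>?E s - real gap * s ^ gap * pmf p lam\<bar> \<le> measure_pmf.expectation p (\<lambda>n. \<bar>real (n - mu) * s ^ (n - mu) - real gap * s ^ gap * indicator {lam} n\<bar>)"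
        unfolding diff by (rule integral_abs_bound)
      also have "\<dots> \<le> measure_pmf.expectation p (\<lambda>n. 4 ^ Suc gap * s ^ Suc gap)"
        by (rule integral_mono_AE[OF integrable_abs[OF Bochner_Integration.integrable_diff[OF i1 il]] _ AE_pmfI[OF pt]]) simp_all
      finally have "\<bar>?E s - real gap * s ^ gap * pmf p lam\<bar> \<le> 4 ^ Suc gap * s ^ Suc gap" by simp
      then have "\<bar>?E s - real gap * s ^ gap * pmf p lam\<bar> / s ^ gap \<le> 4 ^ Suc gap * s ^ Suc gap / s ^ gap"
        using s by (intro divide_right_mono) auto
      moreover have "\<bar>?E s - real gap * s ^ gap * pmf p lam\<bar> / s ^ gap = \<bar>?E s / s ^ gap - real gap * pmf p lam\<bar>"
      proof -
        have "?E s / s ^ gap - real gap * pmf p lam = (?E s - real gap * s ^ gap * pmf p lam) / s ^ gap"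
          using s by (simp add: field_simps)
        then show ?thesis using s by (simp add: abs_divide)
      qed
      ultimately show ?case using s by simp
    qed
    have "((\<lambda>s::real. 4 ^ Suc gap * s) \<longlongrightarrow> 4 ^ Suc gap * 0) (at_right 0)" by (intro tendsto_intros)
    then show "((\<lambda>s::real. 4 ^ Suc gap * s) \<longlongrightarrow> 0) (at_right 0)" by simp
  qed
  then have "((\<lambda>s. ?E s / s ^ gap) \<longlongrightarrow> real gap * pmf p lam) (at_right 0)" by (simp add: LIM_zero_iff)
  from tendsto_divide[OF this exgf_tendsto] pmf_mu_pos
  have "((\<lambda>s. ?E s / s ^ gap / exgf p s) \<longlongrightarrow> real gap * pmf p lam / pmf p mu) (at_right 0)" by simp
  then show ?thesis by (simp add: mean_slope_def mult.commute)
qed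

section \<open>The critical generation\<close>

definition log_ratio :: real where "log_ratio = ln (a / real mu)"

lemma log_ratio_pos: "0 < log_ratio"
  using mean_gt_mu mu_pos by (simp add: log_ratio_def)

abbreviation "\<alpha> \<equiv> alpha_exp p"

text \<open>Equivalently (a / mu)^alpha = mu, which converts powers of e into powers of mu.\<close>

lemma alpha_eq: "\<alpha> = ln (real mu) / log_ratio"
proof -
  have la: "0 < ln a" using mean_gt_1 by simp
  have lr: "log_ratio = ln a - ln (real mu)" using mean_pos mu_pos by (simp add: log_ratio_def ln_div)
  have "1 - ln (real mu) / ln a = log_ratio / ln a" using la by (simp add: lr field_simps)
  then show ?thesis unfolding alpha_exp_def beta_exp_def using la by simp
qed

lemma alpha_pos: "0 < \<alpha>"
  using log_ratio_pos mu_pos by (simp add: alpha_eq)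

abbreviation "nk e \<equiv> nat (kappa_gen p e)"

text \<open>n = kappa(e) is nonnegative for e < 1, so passing to \<open>nat\<close> loses nothing,
  and its definition as a floor confines y to one period (mu/a, 1]. The last two equations express e
  a^n and e^alpha through mu^n.\<close>

lemma scale_props:
  assumes e: "0 < e" "e < 1"
  shows "y_scale p e = e * (a / real mu) ^ nk e"
    and "real mu / a < y_scale p e" "y_scale p e \<le> 1"
    and "e * a ^ nk e = y_scale p e * real mu ^ nk e"
    and "y_scale p e powr \<alpha> = exp (- \<alpha> * ln (1 / e)) * real mu ^ nk e"
proof -
  have l: "0 < ln (1 / e)" using e by simp
  have q: "0 < a / real mu" using mean_pos mu_pos by simp
  have k0: "0 \<le> kappa_gen p e"
    using l log_ratio_pos unfolding kappa_gen_def log_ratio_def[symmetric] by simp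
  then have kr: "real_of_int (kappa_gen p e) = real (nk e)" by simp
  have "real_of_int (kappa_gen p e) \<le> ln (1 / e) / log_ratio" "ln (1 / e) / log_ratio < real_of_int (kappa_gen p e) + 1"
    unfolding kappa_gen_def log_ratio_def[symmetric] by linarith+
  then have fl: "real (nk e) \<le> ln (1 / e) / log_ratio" "ln (1 / e) / log_ratio < real (nk e) + 1"
    unfolding kr by auto
  then have fl': "real (nk e) * log_ratio \<le> ln (1 / e)" "ln (1 / e) < real (nk e) * log_ratio + log_ratio"
    using log_ratio_pos by (auto simp: field_simps)
  show y: "y_scale p e = e * (a / real mu) ^ nk e"
    using k0 by (simp add: y_scale_def power_int_def)
  have pw: "(a / real mu) ^ nk e = exp (real (nk e) * log_ratio)"
    using q by (simp add: log_ratio_def exp_of_nat_mult)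
  have ee: "e = exp (- ln (1 / e))" using e by (simp add: ln_div)
  have ye: "y_scale p e = exp (real (nk e) * log_ratio - ln (1 / e))"
    unfolding y pw by (subst ee) (simp add: exp_diff exp_minus field_simps)
  show "y_scale p e \<le> 1" unfolding ye using fl' by simp
  have "real mu / a = exp (- log_ratio)"
    using q mean_pos mu_pos by (simp add: log_ratio_def exp_minus)
  also have "\<dots> < y_scale p e" unfolding ye using fl' by simp
  finally show "real mu / a < y_scale p e" .
  show "e * a ^ nk e = y_scale p e * real mu ^ nk e"
    unfolding y using mu_pos by (simp add: power_divide)
  have "y_scale p e powr \<alpha> = exp (\<alpha> * (real (nk e) * log_ratio - ln (1 / e)))"
    unfolding ye by (simp add: powr_def mult.commute)
  also have "\<dots> = exp (- \<alpha> * ln (1 / e)) * exp (real (nk e) * (\<alpha> * log_ratio))"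
    by (simp add: algebra_simps flip: exp_add)
  also have "\<alpha> * log_ratio = ln (real mu)" using log_ratio_pos by (simp add: alpha_eq)
  also have "exp (real (nk e) * ln (real mu)) = real mu ^ nk e"
    using mu_pos by (simp add: exp_of_nat_mult)
  finally show "y_scale p e powr \<alpha> = exp (- \<alpha> * ln (1 / e)) * real mu ^ nk e" .
qed

abbreviation "uu e \<equiv> u1 M p X e"
abbreviation "gam e \<equiv> gamma_fun M p X e"

lemma uu_props:
  assumes e: "0 < e" "e < 1"
  shows "uu e \<in> {U0..U1}" "BB' (uu e) = - y_scale p e" "0 < uu e" "BB (uu e) < 0"
proof -
  show u: "uu e \<in> {U0..U1}" "BB' (uu e) = - y_scale p e"
    using u1_props[OF scale_props(2,3)[OF e]] by (auto simp: U1_def)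
  then show "0 < uu e" using U0 by simp
  then show "BB (uu e) < 0" by (rule BB_neg)
qed

text \<open>By e a^n = y mu^n and y = -BB'(u), the conditioning event has the form required by the
  small-ball bounds.\<close>

lemma small_ball_event:
  assumes e: "0 < e" "e < 1"
  shows "W x < e \<longleftrightarrow> a ^ nk e * W x < - BB' (uu e) * real (mu ^ nk e)"
proof -
  have "- BB' (uu e) * real (mu ^ nk e) = a ^ nk e * e"
    using scale_props(4)[OF e] uu_props(2)[OF e] by (simp add: mult.commute)
  then show ?thesis using mean_pos by simp
qed

text \<open>This is mu^H(e); it stays between two positive constants as e varies.\<close>

definition gconst :: "real \<Rightarrow> real" where
  "gconst e = - BB (uu e) * real gap / \<alpha> * y_scale p e powr \<alpha>"

lemma gconst_pos: assumes e: "0 < e" "e < 1" shows "0 < gconst e"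
proof -
  have "0 < y_scale p e" using scale_props(2)[OF e] mu_pos mean_pos by (intro less_trans[OF _ scale_props(2)[OF e]]) simp
  then show ?thesis unfolding gconst_def using uu_props(4)[OF e] gap_pos alpha_pos
    by (intro mult_pos_pos divide_pos_pos) auto
qed

text \<open>The three summands of gamma yield e^-alpha, the divisor ln(1/e) and mu^H. The second
  identity is what gamma is made for: it equates e^(alpha mu^(gamma-k)) with exp(gap mu^(n-k)
  BB(u)).\<close>

lemma mu_powr_gamma:
  assumes e: "0 < e" "e < 1"
  shows "real mu powr gam e = gconst e * exp (\<alpha> * ln (1 / e)) / ln (1 / e)"
    and "\<alpha> * ln (1 / e) * real mu powr gam e = - BB (uu e) * real gap * real mu ^ nk e"
proof -
  have l: "0 < ln (1 / e)" using e by simp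
  have lm: "0 < ln (real mu)" using mu_pos by simp
  have H: "H_fun M p X e * ln (real mu) = ln (gconst e)"
    unfolding H_fun_def gconst_def using lm b_fun_lap[OF uu_props(3)[OF e]] by (simp add: real_gap mult_ac)
  have "gam e * ln (real mu) = \<alpha> * ln (1 / e) - ln (ln (1 / e)) + ln (gconst e)"
    unfolding gamma_fun_def alpha_eq log_ratio_def[symmetric] distrib_right left_diff_distrib H using lm by simp
  then have "real mu powr gam e = exp (\<alpha> * ln (1 / e) - ln (ln (1 / e)) + ln (gconst e))"
    using mu_pos by (simp add: powr_def)
  also have "\<dots> = gconst e * exp (\<alpha> * ln (1 / e)) / ln (1 / e)"
    using l gconst_pos[OF e] by (simp add: exp_add exp_diff)
  finally show 1: "real mu powr gam e = gconst e * exp (\<alpha> * ln (1 / e)) / ln (1 / e)" .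
  have "exp (- \<alpha> * ln (1 / e)) * exp (\<alpha> * ln (1 / e)) = 1" by (simp flip: exp_add)
  then show "\<alpha> * ln (1 / e) * real mu powr gam e = - BB (uu e) * real gap * real mu ^ nk e"
    unfolding 1 gconst_def scale_props(5)[OF e] using l alpha_pos by simp
qed

section \<open>The rate as a power of the Laplace transform\<close>

definition rate :: "real \<Rightarrow> nat \<Rightarrow> real" where
  "rate e k = e powr (\<alpha> * real mu powr (gam e - real k))"

lemma rate_pos: "0 < e \<Longrightarrow> 0 < rate e k"
  by (simp add: rate_def)

text \<open>The exact identity for ln lap at scale a^(n-k): its leading term is the logarithm of
  \<open>rate\<close>, and the correction \<open>Er\<close> tends to \<open>EE_lim\<close> as n - k
  grows.\<close>

lemma rate_eq:
  assumes e: "0 < e" "e < 1" and k: "k \<le> nk e"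
  shows "lap (a ^ (nk e - k) * uu e) ^ gap = rate e k * exp (- real gap * Er (a ^ (nk e - k) * uu e))"
proof -
  have u: "0 < uu e" by (rule uu_props(3)[OF e])
  have h: "0 < a ^ (nk e - k) * uu e" using u mean_pos by simp
  have lp: "0 < lap (a ^ (nk e - k) * uu e)" using h by (intro lap_pos) simp
  have mk: "real mu powr (gam e - real k) = real mu powr gam e / real mu ^ k"
    using mu_pos by (simp add: powr_diff powr_realpow)
  have "\<alpha> * real mu powr (gam e - real k) * ln (1 / e) = (\<alpha> * ln (1 / e) * real mu powr gam e) / real mu ^ k"
    unfolding mk by simp
  also have "\<dots> = - BB (uu e) * real gap * (real mu ^ nk e / real mu ^ k)"
    unfolding mu_powr_gamma(2)[OF e] by simp
  also have "real mu ^ nk e / real mu ^ k = real mu ^ (nk e - k)"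
    using k mu_pos by (simp add: power_diff)
  finally have x: "\<alpha> * real mu powr (gam e - real k) * ln (1 / e) = - BB (uu e) * real gap * real mu ^ (nk e - k)" .
  have "rate e k = exp (- (\<alpha> * real mu powr (gam e - real k) * ln (1 / e)))"
    using e by (simp add: rate_def powr_def ln_div)
  then have r: "rate e k = exp (real gap * (real mu ^ (nk e - k) * BB (uu e)))" unfolding x by (simp add: mult_ac)
  have "lap (a ^ (nk e - k) * uu e) ^ gap = exp (real gap * ln (lap (a ^ (nk e - k) * uu e)))"
    using lp by (simp add: exp_of_nat_mult)
  also have "\<dots> = exp (real gap * (real mu ^ (nk e - k) * BB (uu e)) + - real gap * Er (a ^ (nk e - k) * uu e))"
    unfolding ln_lap_mult_power_a[OF u] by (simp add: algebra_simps)
  finally show ?thesis unfolding exp_add r .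
qed

text \<open>With x = k - gamma the exponent has the sign of 1 - mu^-x, so the quantity is small for
  x < 0 and huge for x well above 0. At k equal to the ceiling of gamma it is omega up to bounded
  factors, which explains the hypothesis on omega.\<close>

lemma size_rate_eq:
  assumes e: "0 < e" "e < 1"
  shows "real mu ^ k * rate e k = gconst e * real mu powr (real k - gam e) *
    (exp (\<alpha> * ln (1 / e) * (1 - real mu powr - (real k - gam e))) / ln (1 / e))"
proof -
  have "real mu ^ k = real mu powr gam e * real mu powr (real k - gam e)"
    using mu_pos by (simp add: powr_realpow flip: powr_add)
  moreover have "rate e k = exp (- (\<alpha> * ln (1 / e) * real mu powr - (real k - gam e)))"
    using e by (simp add: rate_def powr_def ln_div mult_ac)
  ultimately have "real mu ^ k * rate e k = gconst e * real mu powr (real k - gam e) *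
     ((exp (\<alpha> * ln (1 / e)) * exp (- (\<alpha> * ln (1 / e) * real mu powr - (real k - gam e)))) / ln (1 / e))"
    unfolding mu_powr_gamma(1)[OF e] by simp
  then show ?thesis by (simp add: right_diff_distrib flip: exp_add)
qed

lemma omega_eq:
  assumes e: "0 < e"
  shows "omega_fun M p X e = exp (\<alpha> * ln (1 / e) * (1 - real mu powr - upper_frac (gam e))) / ln (1 / e)"
  using e by (simp add: omega_fun_def powr_def ln_div algebra_simps)

lemma upper_frac_bounds: "0 \<le> upper_frac x" "upper_frac x < 1"
  unfolding upper_frac_def by linarith+

definition gmin :: real where "gmin = - BB U0 * real gap / \<alpha> * (real mu / a) powr \<alpha>"
definition gmax :: real where "gmax = - BB U1 * real gap / \<alpha>"

lemma BB_antimono: assumes "0 < u" "u \<le> v" shows "BB v \<le> BB u"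
proof (cases "u = v")
  case False
  have "BB' v * (u - v) < BB u - BB v" using assms False by (intro BB_supporting) auto
  moreover have "0 \<le> BB' v * (u - v)" using BB'_neg[of v] assms by (intro mult_nonpos_nonpos) auto
  ultimately show ?thesis by linarith
qed simp

lemma gmin_pos: "0 < gmin"
  unfolding gmin_def using BB_neg[OF U0(1)] gap_pos alpha_pos mu_pos mean_pos by (intro mult_pos_pos divide_pos_pos) auto

lemma gconst_bounds: assumes e: "0 < e" "e < 1" shows "gmin \<le> gconst e" "gconst e \<le> gmax"
proof -
  have u: "U0 \<le> uu e" "uu e \<le> U1" "0 < uu e" using uu_props[OF e] by auto
  have B: "BB (uu e) \<le> BB U0" "BB U1 \<le> BB (uu e)" using BB_antimono U0 u by auto
  have y: "real mu / a < y_scale p e" "y_scale p e \<le> 1" "0 < real mu / a"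
    using scale_props[OF e] mu_pos mean_pos by auto
  have neg: "BB (uu e) * real gap / \<alpha> \<le> 0"
    using BB_neg[OF u(3)] alpha_pos by (intro divide_nonpos_nonneg mult_nonpos_nonneg) auto
  show "gmin \<le> gconst e" unfolding gmin_def gconst_def using neg
    using B y BB_neg[OF U0(1)] BB_neg[OF u(3)] alpha_pos
    by (intro mult_mono divide_right_mono mult_right_mono powr_mono2) auto
  have "y_scale p e powr \<alpha> \<le> 1" using y alpha_pos powr_mono2[of \<alpha> "y_scale p e" 1] by simp
  then have "gconst e \<le> - BB (uu e) * real gap / \<alpha> * 1" unfolding gconst_def
    using BB_neg[OF u(3)] alpha_pos by (intro mult_left_mono divide_nonneg_nonneg mult_nonneg_nonneg) auto
  also have "\<dots> \<le> gmax" unfolding gmax_def using B alpha_pos by (simp add: divide_right_mono mult_right_mono)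
  finally show "gconst e \<le> gmax" .
qed

lemma gmax_pos: "0 < gmax"
  unfolding gmax_def using BB_neg[OF U1_pos] gap_pos alpha_pos by (intro divide_pos_pos mult_pos_pos) auto

lemma exp_over_linear_at_top: "0 < c \<Longrightarrow> filterlim (\<lambda>l. exp (c * l) / l) at_top at_top" for c :: real
  by real_asymp

text \<open>The generation that carries the conditional law of \<open>K\<close> in the limit.\<close>

lemma ex_critical_generation:
  fixes \<epsilon> :: "nat \<Rightarrow> real"
  assumes pos: "\<And>j. 0 < \<epsilon> j" and lim: "\<epsilon> \<longlonglongrightarrow> 0"
    and om: "filterlim (\<lambda>j. omega_fun M p X (\<epsilon> j)) at_top sequentially \<or> (\<lambda>j. omega_fun M p X (\<epsilon> j)) \<longlonglongrightarrow> 0"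
  shows "\<exists>k :: nat \<Rightarrow> nat. (\<forall>\<^sub>F j in sequentially. Suc (k j) \<le> nk (\<epsilon> j)) \<and>
    filterlim (\<lambda>j. nk (\<epsilon> j) - Suc (k j)) at_top sequentially \<and>
    filterlim (\<lambda>j. real mu ^ Suc (k j) * rate (\<epsilon> j) (Suc (k j))) at_top sequentially \<and>
    (\<lambda>j. real mu ^ k j * rate (\<epsilon> j) (k j)) \<longlonglongrightarrow> 0"
proof -
  define l where "l j = ln (1 / \<epsilon> j)" for j
  have small: "\<forall>\<^sub>F j in sequentially. \<epsilon> j < 1" using order_tendstoD(2)[OF lim, of 1] by simp
  have "filterlim (\<lambda>j. 1 / \<epsilon> j) at_top sequentially"
    using lim pos by (intro filterlim_inverse_at_top[THEN filterlim_cong[OF refl refl, THEN iffD1, rotated]]) (auto simp: inverse_eq_divide)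
  then have l: "filterlim l at_top sequentially"
    unfolding l_def by (rule filterlim_compose[OF ln_at_top])
  have lpos: "\<forall>\<^sub>F j in sequentially. 0 < l j" using l by (simp add: filterlim_at_top_dense)
  have lm: "0 < ln (real mu)" using mu_pos by simp
  have glim: "filterlim (\<lambda>j. real mu powr gam (\<epsilon> j)) at_top sequentially"
  proof (rule filterlim_at_top_mono)
    show "filterlim (\<lambda>j. gmin * (exp (\<alpha> * l j) / l j)) at_top sequentially"
      by (rule filterlim_tendsto_pos_mult_at_top[OF tendsto_const gmin_pos filterlim_compose[OF exp_over_linear_at_top[OF alpha_pos] l]])
    show "\<forall>\<^sub>F j in sequentially. gmin * (exp (\<alpha> * l j) / l j) \<le> real mu powr gam (\<epsilon> j)"
      using small lpos
    proof eventually_elim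
      case (elim j)
      have "gmin * (exp (\<alpha> * l j) / l j) \<le> gconst (\<epsilon> j) * (exp (\<alpha> * l j) / l j)"
        using gconst_bounds[OF pos elim(1)] elim by (intro mult_right_mono) auto
      then show ?case using mu_powr_gamma(1)[OF pos elim(1)] by (simp add: l_def)
    qed
  qed
  have gpos: "\<forall>\<^sub>F j in sequentially. 0 < gam (\<epsilon> j)"
  proof -
    have "\<forall>\<^sub>F j in sequentially. 1 < real mu powr gam (\<epsilon> j)" using glim by (simp add: filterlim_at_top_dense)
    then show ?thesis
    proof eventually_elim
      case (elim j)
      show ?case
      proof (rule ccontr)
        assume "\<not> 0 < gam (\<epsilon> j)"
        then have "real mu powr gam (\<epsilon> j) \<le> real mu powr 0" using mu_pos by (intro powr_mono) auto
        then show False using elim mu_pos by simp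
      qed
    qed
  qed
  \<comment> \<open>mu^gamma is of order mu^n / ln(1/e), so n - gamma exceeds every constant in the
    end.\<close>
  have ngap: "\<forall>\<^sub>F j in sequentially. gam (\<epsilon> j) + C \<le> real (nk (\<epsilon> j))" for C
  proof -
    define C' where "C' = real mu powr C * (- BB U1 * real gap) / \<alpha>"
    have "\<forall>\<^sub>F j in sequentially. C' < l j" using l by (simp add: filterlim_at_top_dense)
    then show ?thesis using small lpos
    proof eventually_elim
      case (elim j)
      have u: "uu (\<epsilon> j) \<in> {U0..U1}" "0 < uu (\<epsilon> j)" "BB (uu (\<epsilon> j)) < 0" using uu_props[OF pos elim(2)] by auto
      have "BB U1 \<le> BB (uu (\<epsilon> j))" using u by (intro BB_antimono) auto
      then have "real mu powr C * (- BB (uu (\<epsilon> j)) * real gap) \<le> real mu powr C * (- BB U1 * real gap)"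
        by (intro mult_left_mono mult_right_mono) auto
      also have "\<dots> < \<alpha> * l j" using elim(1) alpha_pos unfolding C'_def by (simp add: field_simps)
      finally have *: "real mu powr C * (- BB (uu (\<epsilon> j)) * real gap) < \<alpha> * l j" .
      have "real mu powr (gam (\<epsilon> j) + C) * (- BB (uu (\<epsilon> j)) * real gap) =
          real mu powr gam (\<epsilon> j) * (real mu powr C * (- BB (uu (\<epsilon> j)) * real gap))"
        by (simp add: powr_add)
      also have "\<dots> \<le> real mu powr gam (\<epsilon> j) * (\<alpha> * l j)" using * by (intro mult_left_mono) auto
      also have "\<dots> = real mu ^ nk (\<epsilon> j) * (- BB (uu (\<epsilon> j)) * real gap)"
        using mu_powr_gamma(2)[OF pos elim(2)] by (simp add: l_def mult_ac)
      finally have "real mu powr (gam (\<epsilon> j) + C) \<le> real mu ^ nk (\<epsilon> j)"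
      proof -
        have "0 < - BB (uu (\<epsilon> j)) * real gap" using u gap_pos by (intro mult_pos_pos) auto
        then show "a \<le> b" if "a * (- BB (uu (\<epsilon> j)) * real gap) \<le> b * (- BB (uu (\<epsilon> j)) * real gap)" for a b
          using that by (simp only: mult_le_cancel_right_pos)
      qed
      also have "\<dots> = real mu powr real (nk (\<epsilon> j))" using mu_pos by (simp add: powr_realpow)
      finally show ?case using mu_pos by simp
    qed
  qed
  have linv: "(\<lambda>j. gmax / l j) \<longlonglongrightarrow> 0"
    by (rule tendsto_divide_0[OF tendsto_const filterlim_at_top_imp_at_infinity[OF l]])
  \<comment> \<open>The first generation with large expected excess is the ceiling of gamma if omega
    tends to infinity, and the next one if omega tends to 0. In both cases it is
    \<open>Suc (k j)\<close>, and \<open>k j\<close> is the last minimal generation.\<close>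
  define shift :: nat where
    "shift = (if filterlim (\<lambda>j. omega_fun M p X (\<epsilon> j)) at_top sequentially then 0 else 1)"
  define k where "k j = nat \<lceil>gam (\<epsilon> j)\<rceil> - 1 + shift" for j
  have kg: "\<forall>\<^sub>F j in sequentially. real (Suc (k j)) - gam (\<epsilon> j) = upper_frac (gam (\<epsilon> j)) + real shift"
    using gpos
  proof eventually_elim
    case (elim j)
    then have "1 \<le> \<lceil>gam (\<epsilon> j)\<rceil>" by simp
    then have "int (Suc (k j)) = \<lceil>gam (\<epsilon> j)\<rceil> + int shift" unfolding k_def by linarith
    then have "real_of_int (int (Suc (k j))) = real_of_int (\<lceil>gam (\<epsilon> j)\<rceil> + int shift)" by (rule arg_cong)
    then show ?case by (simp add: upper_frac_def)
  qed
  have sh: "real shift \<le> 1" by (simp add: shift_def)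
  have kn: "\<forall>\<^sub>F j in sequentially. Suc (k j) + C \<le> nk (\<epsilon> j)" for C :: nat
    using kg ngap[of "2 + real C"]
  proof eventually_elim
    case (elim j)
    then have "real (Suc (k j) + C) \<le> real (nk (\<epsilon> j))" using upper_frac_bounds(2)[of "gam (\<epsilon> j)"] sh by simp
    then show ?case by linarith
  qed
  have lims: "filterlim (\<lambda>j. real mu ^ Suc (k j) * rate (\<epsilon> j) (Suc (k j))) at_top sequentially \<and>
    (\<lambda>j. real mu ^ k j * rate (\<epsilon> j) (k j)) \<longlonglongrightarrow> 0"
  proof (cases "filterlim (\<lambda>j. omega_fun M p X (\<epsilon> j)) at_top sequentially")
    case True
    then have s0: "shift = 0" by (simp add: shift_def)
    have "filterlim (\<lambda>j. real mu ^ Suc (k j) * rate (\<epsilon> j) (Suc (k j))) at_top sequentially"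
    proof (rule filterlim_at_top_mono)
      show "filterlim (\<lambda>j. gmin * omega_fun M p X (\<epsilon> j)) at_top sequentially"
        by (rule filterlim_tendsto_pos_mult_at_top[OF tendsto_const gmin_pos True])
      show "\<forall>\<^sub>F j in sequentially. gmin * omega_fun M p X (\<epsilon> j) \<le> real mu ^ Suc (k j) * rate (\<epsilon> j) (Suc (k j))"
        using small lpos kg
      proof eventually_elim
        case (elim j)
        let ?f = "upper_frac (gam (\<epsilon> j))"
        have e: "0 < \<epsilon> j" "\<epsilon> j < 1" using pos elim by auto
        have x: "real (Suc (k j)) - gam (\<epsilon> j) = ?f" using elim(3) s0 by simp
        have om0: "0 \<le> omega_fun M p X (\<epsilon> j)" unfolding omega_eq[OF e(1)] using elim(2) by (simp add: l_def)
        have "real mu powr 0 \<le> real mu powr ?f" using upper_frac_bounds[of "gam (\<epsilon> j)"] mu_pos by (intro powr_mono) auto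
        then have "1 \<le> real mu powr ?f" using mu_pos by simp
        then have "gmin * 1 \<le> gconst (\<epsilon> j) * real mu powr ?f"
          using gconst_bounds[OF e] gmin_pos by (intro mult_mono) auto
        then have "gmin * omega_fun M p X (\<epsilon> j) \<le> gconst (\<epsilon> j) * real mu powr ?f * omega_fun M p X (\<epsilon> j)"
          using om0 by (intro mult_right_mono) auto
        then show ?case unfolding size_rate_eq[OF e, of "Suc (k j)"] x omega_eq[OF e(1)] .
      qed
    qed
    moreover have "(\<lambda>j. real mu ^ k j * rate (\<epsilon> j) (k j)) \<longlonglongrightarrow> 0"
    proof (rule Lim_null_comparison[OF _ linv])
      show "\<forall>\<^sub>F j in sequentially. norm (real mu ^ k j * rate (\<epsilon> j) (k j)) \<le> gmax / l j"
        using small lpos kg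
      proof eventually_elim
        case (elim j)
        let ?x = "real (k j) - gam (\<epsilon> j)"
        have e: "0 < \<epsilon> j" "\<epsilon> j < 1" using pos elim by auto
        \<comment> \<open>Here the exponential is at most 1, and the divisor ln(1/e) alone forces
          the limit 0.\<close>
        have x: "?x \<le> 0" using elim(3) s0 upper_frac_bounds(2)[of "gam (\<epsilon> j)"] by simp
        have p1: "real mu powr ?x \<le> 1" using x mu_pos powr_mono[of ?x 0 "real mu"] by simp
        have p2: "1 \<le> real mu powr - ?x" using x mu_pos powr_mono[of 0 "- ?x" "real mu"] by simp
        have "exp (\<alpha> * ln (1 / \<epsilon> j) * (1 - real mu powr - ?x)) \<le> 1"
          using p2 alpha_pos elim(2) unfolding l_def[symmetric] by (simp add: mult_nonneg_nonpos)
        then have ex: "exp (\<alpha> * ln (1 / \<epsilon> j) * (1 - real mu powr - ?x)) / ln (1 / \<epsilon> j) \<le> 1 / l j"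
          using elim(2) unfolding l_def[symmetric] by (intro divide_right_mono) auto
        have "gconst (\<epsilon> j) * real mu powr ?x * (exp (\<alpha> * ln (1 / \<epsilon> j) * (1 - real mu powr - ?x)) / ln (1 / \<epsilon> j)) \<le> gmax * 1 * (1 / l j)"
          using gconst_bounds[OF e] gconst_pos[OF e] gmax_pos p1 ex elim(2)
          by (intro mult_mono) (auto simp: l_def[symmetric])
        then have "real mu ^ k j * rate (\<epsilon> j) (k j) \<le> gmax / l j" unfolding size_rate_eq[OF e, of "k j"] by simp
        then show ?case using rate_pos[OF e(1), of "k j"] by (simp add: abs_mult)
      qed
    qed
    ultimately show ?thesis ..
  next
    case False
    then have s1: "shift = 1" and om0: "(\<lambda>j. omega_fun M p X (\<epsilon> j)) \<longlonglongrightarrow> 0" using om by (auto simp: shift_def)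
    \<comment> \<open>Now k + 1 - gamma >= 1, so the exponent is at least alpha (1 - 1/mu) ln(1/e),
      which outgrows the divisor ln(1/e).\<close>
    define c where "c = \<alpha> * (1 - 1 / real mu)"
    have c: "0 < c" unfolding c_def using alpha_pos mu_pos by (intro mult_pos_pos) auto
    have "filterlim (\<lambda>j. real mu ^ Suc (k j) * rate (\<epsilon> j) (Suc (k j))) at_top sequentially"
    proof (rule filterlim_at_top_mono)
      show "filterlim (\<lambda>j. gmin * (exp (c * l j) / l j)) at_top sequentially"
        by (rule filterlim_tendsto_pos_mult_at_top[OF tendsto_const gmin_pos filterlim_compose[OF exp_over_linear_at_top[OF c] l]])
      show "\<forall>\<^sub>F j in sequentially. gmin * (exp (c * l j) / l j) \<le> real mu ^ Suc (k j) * rate (\<epsilon> j) (Suc (k j))"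
        using small lpos kg
      proof eventually_elim
        case (elim j)
        let ?x = "real (Suc (k j)) - gam (\<epsilon> j)"
        have e: "0 < \<epsilon> j" "\<epsilon> j < 1" using pos elim by auto
        have x: "1 \<le> ?x" using elim(3) s1 upper_frac_bounds(1)[of "gam (\<epsilon> j)"] by simp
        have p1: "1 \<le> real mu powr ?x" using x mu_pos powr_mono[of 0 ?x "real mu"] by simp
        have p2: "real mu powr - ?x \<le> 1 / real mu"
          using x mu_pos powr_mono[of "- ?x" "- 1" "real mu"] by (simp add: powr_minus_divide)
        have "c * l j \<le> \<alpha> * ln (1 / \<epsilon> j) * (1 - real mu powr - ?x)"
        proof -
          have "\<alpha> * l j * (1 - 1 / real mu) \<le> \<alpha> * l j * (1 - real mu powr - ?x)"
            using p2 alpha_pos elim(2) by (intro mult_left_mono) auto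
          then show ?thesis by (simp add: c_def l_def mult_ac)
        qed
        then have ex: "exp (c * l j) / l j \<le> exp (\<alpha> * ln (1 / \<epsilon> j) * (1 - real mu powr - ?x)) / ln (1 / \<epsilon> j)"
          using elim(2) unfolding l_def[symmetric] by (intro divide_right_mono) auto
        have "gmin * 1 * (exp (c * l j) / l j) \<le> gconst (\<epsilon> j) * real mu powr ?x * (exp (\<alpha> * ln (1 / \<epsilon> j) * (1 - real mu powr - ?x)) / ln (1 / \<epsilon> j))"
          using gconst_bounds[OF e] gmin_pos p1 ex elim(2) by (intro mult_mono) auto
        then show ?case unfolding size_rate_eq[OF e, of "Suc (k j)"] by simp
      qed
    qed
    \<comment> \<open>\<open>k j\<close> is now the ceiling of gamma, so this sequence is omega
      times factors bounded by \<open>gmax\<close> and \<open>mu\<close>.\<close>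
    moreover have "(\<lambda>j. real mu ^ k j * rate (\<epsilon> j) (k j)) \<longlonglongrightarrow> 0"
    proof (rule Lim_null_comparison)
      have "(\<lambda>j. gmax * real mu * omega_fun M p X (\<epsilon> j)) \<longlonglongrightarrow> gmax * real mu * 0" by (intro tendsto_intros om0)
      then show "(\<lambda>j. gmax * real mu * omega_fun M p X (\<epsilon> j)) \<longlonglongrightarrow> 0" by simp
      show "\<forall>\<^sub>F j in sequentially. norm (real mu ^ k j * rate (\<epsilon> j) (k j)) \<le> gmax * real mu * omega_fun M p X (\<epsilon> j)"
        using small lpos kg
      proof eventually_elim
        case (elim j)
        let ?f = "upper_frac (gam (\<epsilon> j))"
        have e: "0 < \<epsilon> j" "\<epsilon> j < 1" using pos elim by auto
        have x: "real (k j) - gam (\<epsilon> j) = ?f" using elim(3) s1 by simp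
        have om0: "0 \<le> omega_fun M p X (\<epsilon> j)" unfolding omega_eq[OF e(1)] using elim(2) by (simp add: l_def)
        have "real mu powr ?f \<le> real mu powr 1" using upper_frac_bounds[of "gam (\<epsilon> j)"] mu_pos by (intro powr_mono) auto
        then have "real mu powr ?f \<le> real mu" using mu_pos by simp
        then have "gconst (\<epsilon> j) * real mu powr ?f * omega_fun M p X (\<epsilon> j) \<le> gmax * real mu * omega_fun M p X (\<epsilon> j)"
          using gconst_bounds[OF e] gmax_pos om0 by (intro mult_right_mono mult_mono) auto
        then have "real mu ^ k j * rate (\<epsilon> j) (k j) \<le> gmax * real mu * omega_fun M p X (\<epsilon> j)"
          unfolding size_rate_eq[OF e, of "k j"] x omega_eq[OF e(1)] .
        then show ?case using rate_pos[OF e(1), of "k j"] by (simp add: abs_mult)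
      qed
    qed
    ultimately show ?thesis ..
  qed
  have "filterlim (\<lambda>j. nk (\<epsilon> j) - Suc (k j)) at_top sequentially"
    unfolding filterlim_at_top
  proof
    fix C :: nat
    show "\<forall>\<^sub>F j in sequentially. C \<le> nk (\<epsilon> j) - Suc (k j)" using kn[of C] by eventually_elim simp
  qed
  with lims kn[of 0] show ?thesis by (intro exI[of _ k]) simp
qed

section \<open>The conditional limit\<close>

definition limit_const :: real where
  "limit_const = (real lam / real mu - 1) * pmf p lam * pmf p mu powr (- ((real lam - 1) / (real mu - 1)))"

lemma limit_const_pos: "0 < limit_const"
  unfolding limit_const_def using lam_props mu_pos pmf_mu_pos by (intro mult_pos_pos) auto

text \<open>The exponent splits as -1 - gap / (mu - 1): the first part comes from the normalisation
  of the tilted law, the second from the limit of exp(-gap Er). The division by mu relates the mu^k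
  parents to the denominator mu^(k+1).\<close>

lemma limit_const_eq:
  "limit_const = real gap * pmf p lam / pmf p mu * exp (- real gap * EE_lim) / real mu"
proof -
  have m1: "real mu - 1 \<noteq> 0" using mu_pos by simp
  have "- ((real lam - 1) / (real mu - 1)) * ln (pmf p mu) = - ln (pmf p mu) + - real gap * EE_lim"
    unfolding EE_lim_def real_gap using m1 by (simp add: field_simps)
  then have "pmf p mu powr (- ((real lam - 1) / (real mu - 1))) = exp (- ln (pmf p mu)) * exp (- real gap * EE_lim)"
    using pmf_mu_pos by (simp only: powr_def exp_add) simp
  also have "exp (- ln (pmf p mu)) = 1 / pmf p mu" using pmf_mu_pos by (simp add: exp_minus inverse_eq_divide)
  finally show ?thesis using mu_pos by (simp add: limit_const_def real_gap field_simps)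
qed

text \<open>Once a generation exceeds its minimal size, all later ones do. So Z_k = mu^k makes all
  earlier generations minimal, and \<open>d < c\<close> makes the excess at k + 1 positive; together
  K = k + 1.\<close>

lemma excess_ratio_close:
  "AE x in M. \<forall>e k c d ms. 0 < e \<longrightarrow> d < c \<longrightarrow> Z k x = mu ^ k \<longrightarrow>
     \<bar>real (Z (Suc k) x) - real mu ^ Suc k - real mu ^ k * ms\<bar> \<le> d / 2 * (real mu ^ Suc k * rate e (Suc k)) \<longrightarrow>
     \<bar>real mu ^ k * ms / (real mu ^ Suc k * rate e (Suc k)) - c\<bar> \<le> d / 2 \<longrightarrow>
     \<bar>excess_ratio M p X e x - c\<bar> \<le> d"
  using gen_size_pos_lower
proof (eventually_elim, intro allI impI)
  fix x e k c d ms
  assume low: "\<forall>n. mu ^ n \<le> Z n x \<and> mu * Z n x \<le> Z (Suc n) x" and e: "0 < e" and dc: "d < c"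
    and zk: "Z k x = mu ^ k"
    and dev: "\<bar>real (Z (Suc k) x) - real mu ^ Suc k - real mu ^ k * ms\<bar> \<le> d / 2 * (real mu ^ Suc k * rate e (Suc k))"
    and mean: "\<bar>real mu ^ k * ms / (real mu ^ Suc k * rate e (Suc k)) - c\<bar> \<le> d / 2"
  define D where "D = real mu ^ Suc k * rate e (Suc k)"
  have D: "0 < D" unfolding D_def using mu_pos rate_pos[OF e] by simp
  have "(real (Z (Suc k) x) - real mu ^ Suc k) / D - c =
      (real (Z (Suc k) x) - real mu ^ Suc k - real mu ^ k * ms) / D + (real mu ^ k * ms / D - c)"
    by (simp add: diff_divide_distrib)
  also have "\<bar>\<dots>\<bar> \<le> \<bar>(real (Z (Suc k) x) - real mu ^ Suc k - real mu ^ k * ms) / D\<bar> + \<bar>real mu ^ k * ms / D - c\<bar>"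
    by (rule abs_triangle_ineq)
  also have "\<dots> \<le> d / 2 + d / 2"
  proof (rule add_mono)
    show "\<bar>(real (Z (Suc k) x) - real mu ^ Suc k - real mu ^ k * ms) / D\<bar> \<le> d / 2"
      using dev D unfolding D_def[symmetric] by (simp add: abs_divide divide_le_eq)
    show "\<bar>real mu ^ k * ms / D - c\<bar> \<le> d / 2" using mean by (simp only: D_def)
  qed
  finally have close: "\<bar>(real (Z (Suc k) x) - real mu ^ Suc k) / D - c\<bar> \<le> d" by simp
  then have "0 < (real (Z (Suc k) x) - real mu ^ Suc k) / D" using dc by (simp only: abs_le_iff) linarith
  then have "real (mu ^ Suc k) < real (Z (Suc k) x)" using D by (simp add: zero_less_divide_iff)
  then have big: "mu ^ Suc k < Z (Suc k) x" by (simp only: of_nat_less_iff)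
  have mono: "mu ^ (i + m) < Z (i + m) x" if "mu ^ i < Z i x" for i m
  proof (induction m)
    case (Suc m)
    have "mu ^ (i + Suc m) < mu * Z (i + m) x" using Suc mu_pos by simp
    also have "\<dots> \<le> Z (i + Suc m) x" using low by simp
    finally show ?case .
  qed (use that in simp)
  have "first_nonmin_gen p X x = Suc k" unfolding first_nonmin_gen_def
  proof (rule Least_equality)
    fix i assume i: "mu ^ i < Z i x"
    show "Suc k \<le> i"
    proof (rule ccontr)
      assume "\<not> Suc k \<le> i"
      then have "mu ^ k < Z k x" using mono[OF i, of "k - i"] by simp
      then show False using zk by simp
    qed
  qed (rule big)
  then have "excess_ratio M p X e x = (real (Z (Suc k) x) - real mu ^ Suc k) / D"
    unfolding excess_ratio_def Let_def D_def rate_def by (simp only:)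
  then show "\<bar>excess_ratio M p X e x - c\<bar> \<le> d" using close by simp
qed

lemma lap_scaled_tendsto_0:
  assumes m: "filterlim m at_top F" and u: "\<forall>\<^sub>F j in F. U0 \<le> u j"
  shows "((\<lambda>j. lap (a ^ m j * u j)) \<longlongrightarrow> 0) F"
    and "((\<lambda>j. Er (a ^ m j * u j)) \<longlongrightarrow> EE_lim) F"
proof -
  have "filterlim (\<lambda>j. a ^ m j * U0) at_top F"
  proof -
    have "filterlim (\<lambda>n. a ^ n * U0) at_top sequentially"
    proof -
      have "filterlim (\<lambda>n. b ^ n * c) at_top sequentially" if "1 < b" "0 < c" for b c :: real
        using that by real_asymp
      then show ?thesis using mean_gt_1 U0 by blast
    qed
    then show ?thesis using m by (rule filterlim_compose)
  qed
  then have base: "((\<lambda>j. lap (a ^ m j * U0)) \<longlongrightarrow> 0) F" by (rule filterlim_compose[OF lap_tendsto_0])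
  have le: "\<forall>\<^sub>F j in F. 0 < a ^ m j * u j \<and> 0 < lap (a ^ m j * u j) \<and> lap (a ^ m j * u j) \<le> lap (a ^ m j * U0)"
    using u
  proof eventually_elim
    case (elim j)
    have "0 < a ^ m j" using mean_pos by simp
    then have "0 < a ^ m j * U0" "a ^ m j * U0 \<le> a ^ m j * u j" using elim U0 by auto
    then show ?case by (auto intro: lap_antimono lap_pos)
  qed
  show lim0: "((\<lambda>j. lap (a ^ m j * u j)) \<longlongrightarrow> 0) F"
    by (rule tendsto_sandwich[OF _ _ tendsto_const base]) (use le in \<open>auto elim!: eventually_mono\<close>)
  have "((\<lambda>j. Er (a ^ m j * u j) - EE_lim) \<longlongrightarrow> 0) F"
  proof (rule Lim_null_comparison)
    show "\<forall>\<^sub>F j in F. norm (Er (a ^ m j * u j) - EE_lim) \<le> 2 / pmf p mu * lap (a ^ m j * u j) ^ gap"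
      using le by eventually_elim (auto simp del: times_divide_eq_left intro!: Er_near_lim)
    have "((\<lambda>j. 2 / pmf p mu * lap (a ^ m j * u j) ^ gap) \<longlongrightarrow> 2 / pmf p mu * 0 ^ gap) F"
      by (intro tendsto_intros lim0)
    moreover have "2 / pmf p mu * 0 ^ gap = 0" using gap_pos by (simp only: zero_power mult_zero_right)
    ultimately show "((\<lambda>j. 2 / pmf p mu * lap (a ^ m j * u j) ^ gap) \<longlongrightarrow> 0) F" by (simp only:)
  qed
  then show "((\<lambda>j. Er (a ^ m j * u j)) \<longlongrightarrow> EE_lim) F" by (simp add: LIM_zero_iff)
qed

text \<open>Two tilted probabilities have to vanish: that generation k is not minimal, and that the
  excess of generation k + 1 deviates from its tilted mean.\<close>

theorem excess_ratio_limit: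
  fixes \<epsilon> :: "nat \<Rightarrow> real"
  assumes pos: "\<And>j. 0 < \<epsilon> j" and lim: "\<epsilon> \<longlonglongrightarrow> 0"
    and om: "filterlim (\<lambda>j. omega_fun M p X (\<epsilon> j)) at_top sequentially \<or> (\<lambda>j. omega_fun M p X (\<epsilon> j)) \<longlonglongrightarrow> 0"
    and eta: "0 < \<eta>"
  shows "(\<lambda>j. cond_prob M (\<lambda>x. \<bar>excess_ratio M p X (\<epsilon> j) x - limit_const\<bar> > \<eta>) (\<lambda>x. W x < \<epsilon> j)) \<longlonglongrightarrow> 0"
proof -
  \<comment> \<open>Capped below the limit constant, so that closeness up to \<open>d\<close>
    already forces a positive excess and thereby determines K.\<close>
  define d where "d = min \<eta> (limit_const / 2)"
  have d: "0 < d" "d \<le> \<eta>" "d < limit_const" using eta limit_const_pos by (auto simp: d_def)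
  obtain k where k1: "\<forall>\<^sub>F j in sequentially. Suc (k j) \<le> nk (\<epsilon> j)"
    and k2: "filterlim (\<lambda>j. nk (\<epsilon> j) - Suc (k j)) at_top sequentially"
    and k3: "filterlim (\<lambda>j. real mu ^ Suc (k j) * rate (\<epsilon> j) (Suc (k j))) at_top sequentially"
    and k4: "(\<lambda>j. real mu ^ k j * rate (\<epsilon> j) (k j)) \<longlonglongrightarrow> 0"
    using ex_critical_generation[OF pos lim om] by blast
  obtain C n0 where C: "0 < C" and *: "\<forall>n\<ge>n0. \<forall>k\<le>n. \<forall>A\<in>past k. \<forall>u\<in>{U0..U1}. \<forall>y. y = - BB' u * real (mu ^ n) \<longrightarrow>
      0 < measure M {x \<in> space M. a ^ n * W x < y} \<and>
      measure M {x \<in> A. a ^ n * W x < y} \<le>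
      C * measure M {x \<in> space M. a ^ n * W x < y} * (tilt_mass A k (a ^ (n - k) * u) / lap (a ^ n * u))"
    using conditional_past_bound by (elim exE conjE)
  note bnd = *[rule_format]
  have small: "\<forall>\<^sub>F j in sequentially. \<epsilon> j < 1" using order_tendstoD(2)[OF lim, of 1] by simp
  define n where "n j = nk (\<epsilon> j)" for j
  define u where "u j = uu (\<epsilon> j)" for j
  have uU: "\<forall>\<^sub>F j in sequentially. u j \<in> {U0..U1}"
    using small by eventually_elim (use uu_props(1)[OF pos] in \<open>simp add: u_def\<close>)
  then have uU0: "\<forall>\<^sub>F j in sequentially. U0 \<le> u j" by eventually_elim simp
  define s where "s j = lap (a ^ (n j - Suc (k j)) * u j)" for j
  define s' where "s' j = lap (a ^ (n j - k j) * u j)" for j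
  have k2': "filterlim (\<lambda>j. n j - k j) at_top sequentially"
    by (rule filterlim_at_top_mono[OF k2 always_eventually]) (simp add: n_def diff_le_mono2)
  have s0: "s \<longlonglongrightarrow> 0" unfolding s_def n_def by (rule lap_scaled_tendsto_0(1)[OF k2 uU0])
  have spos: "\<forall>\<^sub>F j in sequentially. 0 < s j"
    using uU0 by eventually_elim (use U0 mean_pos in \<open>auto simp: s_def intro!: lap_pos mult_nonneg_nonneg\<close>)
  have sfl: "filterlim s (at_right 0) sequentially"
    unfolding filterlim_at using s0 spos by (auto elim: eventually_mono)
  define r where "r j = exp (- real gap * Er (a ^ (n j - Suc (k j)) * u j))" for j
  define r' where "r' j = exp (- real gap * Er (a ^ (n j - k j) * u j))" for j
  define r0 where "r0 = exp (- real gap * EE_lim)"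
  have rl: "r \<longlonglongrightarrow> r0" "r' \<longlonglongrightarrow> r0"
    unfolding r_def r'_def r0_def using lap_scaled_tendsto_0(2)[OF k2 uU0] lap_scaled_tendsto_0(2)[OF k2' uU0]
    by (auto intro!: tendsto_intros simp: n_def)
  define D where "D j = real mu ^ Suc (k j) * rate (\<epsilon> j) (Suc (k j))" for j
  define D' where "D' j = real mu ^ k j * rate (\<epsilon> j) (k j)" for j
  have Dpos: "0 < D j" for j unfolding D_def using mu_pos rate_pos[OF pos] by simp
  have sr: "\<forall>\<^sub>F j in sequentially. s j ^ gap = rate (\<epsilon> j) (Suc (k j)) * r j \<and> s' j ^ gap = rate (\<epsilon> j) (k j) * r' j"
    using small k1
  proof eventually_elim
    case (elim j)
    then show ?case using rate_eq[OF pos elim(1), of "Suc (k j)"] rate_eq[OF pos elim(1), of "k j"]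
      by (simp add: s_def s'_def r_def r'_def n_def u_def)
  qed
  have mean_lim: "(\<lambda>j. real mu ^ k j * mean_slope (s j) / D j) \<longlonglongrightarrow> limit_const"
  proof -
    have "(\<lambda>j. mean_slope (s j) / s j ^ gap * r j / real mu) \<longlonglongrightarrow> real gap * pmf p lam / pmf p mu * r0 / real mu"
      using mu_pos by (intro tendsto_intros filterlim_compose[OF mean_slope_tendsto sfl] rl) auto
    then have "(\<lambda>j. mean_slope (s j) / s j ^ gap * r j / real mu) \<longlonglongrightarrow> limit_const"
      by (simp only: limit_const_eq r0_def)
    then show ?thesis
    proof (rule Lim_transform_eventually)
      show "\<forall>\<^sub>F j in sequentially. mean_slope (s j) / s j ^ gap * r j / real mu = real mu ^ k j * mean_slope (s j) / D j"
        using sr spos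
      proof eventually_elim
        case (elim j)
        have rp: "0 < r j" "0 < rate (\<epsilon> j) (Suc (k j))" using rate_pos[OF pos] by (auto simp: r_def)
        have "mean_slope (s j) / s j ^ gap * r j / real mu = mean_slope (s j) / (rate (\<epsilon> j) (Suc (k j)) * r j) * r j / real mu"
          using elim by simp
        also have "\<dots> = real mu ^ k j * mean_slope (s j) / D j"
          using rp mu_pos by (simp add: D_def field_simps)
        finally show ?case .
      qed
    qed
  qed
  \<comment> \<open>The first summand is of the order mu^k rate(k), which vanishes before the
    critical generation; the second is the Chebyshev bound, inversely proportional to the expected
    order \<open>D j\<close> of the excess.\<close>
  define b where "b j = C * (4 / pmf p mu * (D' j * r' j)) + C * (4 ^ gap / pmf p mu * (r j / (real mu * (d / 2)\<^sup>2)) / D j)" for j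
  have b0: "b \<longlonglongrightarrow> 0"
  proof -
    have "(\<lambda>j. C * (4 / pmf p mu * (D' j * r' j))) \<longlonglongrightarrow> C * (4 / pmf p mu * (0 * r0))"
      unfolding D'_def by (intro tendsto_intros k4 rl)
    moreover have "(\<lambda>j. 4 ^ gap / pmf p mu * (r j / (real mu * (d / 2)\<^sup>2)) / D j) \<longlonglongrightarrow> 0"
    proof (rule tendsto_divide_0)
      show "(\<lambda>j. 4 ^ gap / pmf p mu * (r j / (real mu * (d / 2)\<^sup>2))) \<longlonglongrightarrow> 4 ^ gap / pmf p mu * (r0 / (real mu * (d / 2)\<^sup>2))"
        using d mu_pos by (intro tendsto_intros rl) auto
      show "filterlim D at_infinity sequentially"
        unfolding D_def by (rule filterlim_at_top_imp_at_infinity[OF k3])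
    qed
    then have "(\<lambda>j. C * (4 ^ gap / pmf p mu * (r j / (real mu * (d / 2)\<^sup>2)) / D j)) \<longlonglongrightarrow> C * 0" by (intro tendsto_intros)
    ultimately have "b \<longlonglongrightarrow> C * (4 / pmf p mu * (0 * r0)) + C * 0" unfolding b_def by (rule tendsto_add)
    then show ?thesis by simp
  qed
  have nlarge: "\<forall>\<^sub>F j in sequentially. n0 \<le> n j"
  proof -
    have "\<forall>\<^sub>F j in sequentially. n0 \<le> n j - Suc (k j)" using k2 by (simp add: filterlim_at_top n_def)
    then show ?thesis by eventually_elim simp
  qed
  have mclose: "\<forall>\<^sub>F j in sequentially. \<bar>real mu ^ k j * mean_slope (s j) / D j - limit_const\<bar> \<le> d / 2"
  proof -
    have "\<forall>\<^sub>F j in sequentially. dist (real mu ^ k j * mean_slope (s j) / D j) limit_const < d / 2"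
      using d by (intro tendstoD[OF mean_lim]) simp
    then show ?thesis by eventually_elim (simp add: dist_real_def)
  qed
  have squart: "\<forall>\<^sub>F j in sequentially. s j \<le> 1 / 4"
    using order_tendstoD(2)[OF s0, of "1/4"] by (auto elim: eventually_mono)
  show ?thesis
  proof (rule Lim_null_comparison[OF _ b0])
    show "\<forall>\<^sub>F j in sequentially. norm (cond_prob M (\<lambda>x. \<bar>excess_ratio M p X (\<epsilon> j) x - limit_const\<bar> > \<eta>) (\<lambda>x. W x < \<epsilon> j)) \<le> b j"
      using small k1 uU sr nlarge mclose squart
    proof eventually_elim
      case (elim j)
      have e: "0 < \<epsilon> j" "\<epsilon> j < 1" using pos elim by auto
      have Kn: "Suc (k j) \<le> n j" using elim by (simp add: n_def)
      have u0: "0 < u j" using elim(3) U0 by simp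
      define y where "y = - BB' (u j) * real (mu ^ n j)"
      have ev: "W x < \<epsilon> j \<longleftrightarrow> a ^ n j * W x < y" for x
        unfolding y_def n_def u_def by (rule small_ball_event[OF e])
      define Q where "Q = measure M {x \<in> space M. a ^ n j * W x < y}"
      define h where "h = a ^ (n j - Suc (k j)) * u j"
      have h: "0 < h" unfolding h_def using u0 mean_pos by simp
      have sh: "s j = lap h" by (simp add: s_def h_def)
      define dl where "dl = d / 2 * D j"
      have dl: "0 < dl" unfolding dl_def using d Dpos by simp
      \<comment> \<open>\<open>A1\<close> belongs to the past of generation k and \<open>A2\<close>
        to that of k + 1, so the two are compared with tilts at different scales.\<close>
      define A1 where "A1 = {x \<in> space M. Z (k j) x \<noteq> mu ^ k j}"
      define A2 where "A2 = {x \<in> space M. Z (k j) x = mu ^ k j \<and>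
        dl < \<bar>real (Z (Suc (k j)) x) - real mu ^ Suc (k j) - real mu ^ k j * mean_slope (lap h)\<bar>}"
      have A1: "A1 \<in> past (k j)" unfolding A1_def using past_gen_size[of "k j" "k j" "- {mu ^ k j}"] by simp
      have A2: "A2 \<in> past (Suc (k j))"
      proof -
        have "A2 = {x \<in> space M. Z (k j) x \<in> {mu ^ k j}} \<inter>
            {x \<in> space M. Z (Suc (k j)) x \<in> {z. dl < \<bar>real z - real mu ^ Suc (k j) - real mu ^ k j * mean_slope (lap h)\<bar>}}"
          by (auto simp: A2_def)
        then show ?thesis by (simp only: past_Int past_gen_size le_SucI order_refl)
      qed
      have Qpos: "0 < Q" using bnd[OF elim(5) _ past_space[of 0] elim(3) y_def] by (simp add: Q_def)
      have m1: "measure M {x \<in> A1. a ^ n j * W x < y} \<le> C * Q * (4 / pmf p mu * (D' j * r' j))"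
      proof -
        have aa: "a ^ k j * (a ^ (n j - k j) * u j) = a ^ n j * u j"
          using Kn by (simp flip: power_add mult.assoc)
        have "measure M {x \<in> A1. a ^ n j * W x < y} \<le> C * Q * (tilt_mass A1 (k j) (a ^ (n j - k j) * u j) / lap (a ^ n j * u j))"
          using bnd[OF elim(5) _ A1 elim(3) y_def] Kn by (simp add: Q_def)
        also have "tilt_mass A1 (k j) (a ^ (n j - k j) * u j) / lap (a ^ n j * u j) \<le> 4 / pmf p mu * (real mu ^ k j * s' j ^ gap)"
        proof -
          have l: "0 < lap (a ^ n j * u j)" using u0 mean_pos by (intro lap_pos) simp
          have "tilt_mass A1 (k j) (a ^ (n j - k j) * u j) \<le> lap (a ^ n j * u j) * (4 / pmf p mu * (real mu ^ k j * s' j ^ gap))"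
            using tilt_mass_nonminimal[of "a ^ (n j - k j) * u j" "k j"] u0 mean_pos unfolding aa A1_def s'_def by simp
          then show ?thesis using l by (simp add: divide_le_eq mult.commute)
        qed
        also have "real mu ^ k j * s' j ^ gap = D' j * r' j" using elim(4) by (simp add: D'_def)
        finally show ?thesis using C Qpos by simp
      qed
      have m2: "measure M {x \<in> A2. a ^ n j * W x < y} \<le> C * Q * (4 ^ gap / pmf p mu * (r j / (real mu * (d / 2)\<^sup>2)) / D j)"
      proof -
        have aa: "a ^ Suc (k j) * h = a ^ n j * u j"
          unfolding h_def using Kn by (simp only: power_add[symmetric] mult.assoc[symmetric] le_add_diff_inverse)
        have "measure M {x \<in> A2. a ^ n j * W x < y} \<le> C * Q * (tilt_mass A2 (Suc (k j)) h / lap (a ^ n j * u j))"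
          using bnd[OF elim(5) Kn A2 elim(3) y_def] by (simp add: Q_def h_def)
        also have "tilt_mass A2 (Suc (k j)) h / lap (a ^ n j * u j) \<le> real mu ^ k j * (4 ^ gap / pmf p mu * s j ^ gap) / dl\<^sup>2"
        proof -
          have l: "0 < lap (a ^ n j * u j)" using u0 mean_pos by (intro lap_pos) simp
          have "tilt_mass A2 (Suc (k j)) h \<le> lap (a ^ n j * u j) * (real mu ^ k j * (4 ^ gap / pmf p mu * s j ^ gap) / dl\<^sup>2)"
            using tilt_mass_deviation[OF h _ dl, of "k j"] elim(7) unfolding aa A2_def sh by simp
          then show ?thesis using l by (simp add: divide_le_eq mult.commute)
        qed
        also have "real mu ^ k j * (4 ^ gap / pmf p mu * s j ^ gap) / dl\<^sup>2 = 4 ^ gap / pmf p mu * (r j / (real mu * (d / 2)\<^sup>2)) / D j"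
        proof -
          have "real mu ^ k j * s j ^ gap = D j / real mu * r j" using elim(4) mu_pos by (simp add: D_def)
          moreover have "real mu ^ k j * (4 ^ gap / pmf p mu * s j ^ gap) = 4 ^ gap / pmf p mu * (real mu ^ k j * s j ^ gap)"
            by (simp only: mult_ac)
          ultimately have "real mu ^ k j * (4 ^ gap / pmf p mu * s j ^ gap) = 4 ^ gap / pmf p mu * (D j / real mu * r j)"
            by (simp only:)
          then show ?thesis unfolding dl_def using Dpos[of j] d mu_pos
            by (simp add: power_mult_distrib power2_eq_square field_simps)
        qed
        finally show ?thesis using C Qpos by simp
      qed
      have sets12: "{x \<in> A. a ^ n j * W x < y} \<in> sets M" if "A \<in> sets M" for A
      proof -
        have "{x \<in> A. a ^ n j * W x < y} = A \<inter> {x \<in> space M. a ^ n j * W x < y}"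
          using sets.sets_into_space[OF that] by auto
        then show ?thesis using that by simp
      qed
      define Bad where "Bad = {x \<in> space M. \<bar>excess_ratio M p X (\<epsilon> j) x - limit_const\<bar> > \<eta> \<and> W x < \<epsilon> j}"
      have "measure M Bad \<le> measure M ({x \<in> A1. a ^ n j * W x < y} \<union> {x \<in> A2. a ^ n j * W x < y})"
      proof (rule finite_measure_mono_AE)
        show "AE x in M. x \<in> Bad \<longrightarrow> x \<in> {x \<in> A1. a ^ n j * W x < y} \<union> {x \<in> A2. a ^ n j * W x < y}"
          using excess_ratio_close
        proof eventually_elim
          case close: (elim x)
          show ?case
          proof
            assume x: "x \<in> Bad"
            then have xs: "x \<in> space M" "a ^ n j * W x < y" and far: "\<bar>excess_ratio M p X (\<epsilon> j) x - limit_const\<bar> > \<eta>"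
              using ev by (auto simp: Bad_def)
            show "x \<in> {x \<in> A1. a ^ n j * W x < y} \<union> {x \<in> A2. a ^ n j * W x < y}"
            proof (rule ccontr)
              assume "\<not> ?thesis"
              then have z: "Z (k j) x = mu ^ k j"
                and "\<not> dl < \<bar>real (Z (Suc (k j)) x) - real mu ^ Suc (k j) - real mu ^ k j * mean_slope (lap h)\<bar>"
                using xs by (auto simp: A1_def A2_def simp del: gen_size.simps)
              then have "\<bar>real (Z (Suc (k j)) x) - real mu ^ Suc (k j) - real mu ^ k j * mean_slope (lap h)\<bar> \<le>
                  d / 2 * (real mu ^ Suc (k j) * rate (\<epsilon> j) (Suc (k j)))"
                unfolding dl_def D_def by linarith
              moreover have "\<bar>real mu ^ k j * mean_slope (lap h) / (real mu ^ Suc (k j) * rate (\<epsilon> j) (Suc (k j))) - limit_const\<bar> \<le> d / 2"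
                using elim(6) unfolding sh D_def .
              ultimately have "\<bar>excess_ratio M p X (\<epsilon> j) x - limit_const\<bar> \<le> d"
                using close e(1) d(3) z by blast
              then show False using far d by linarith
            qed
          qed
        qed
        show "{x \<in> A1. a ^ n j * W x < y} \<union> {x \<in> A2. a ^ n j * W x < y} \<in> sets M"
          by (intro sets.Un sets12 past_sets[OF A1] past_sets[OF A2])
      qed
      also have "\<dots> \<le> measure M {x \<in> A1. a ^ n j * W x < y} + measure M {x \<in> A2. a ^ n j * W x < y}"
        by (intro measure_Un_le sets12 past_sets[OF A1] past_sets[OF A2])
      also have "\<dots> \<le> Q * b j" using m1 m2 by (simp add: b_def algebra_simps)
      finally have "measure M Bad \<le> Q * b j" .
      then have "measure M Bad / Q \<le> b j" using Qpos by (simp add: divide_le_eq mult.commute)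
      moreover have "cond_prob M (\<lambda>x. \<bar>excess_ratio M p X (\<epsilon> j) x - limit_const\<bar> > \<eta>) (\<lambda>x. W x < \<epsilon> j) = measure M Bad / Q"
        unfolding cond_prob_def Bad_def Q_def ev by simp
      ultimately show ?case using Qpos by simp
    qed
  qed
qed

end

theorem theorem5:
  fixes M :: "'a measure" and p :: "nat pmf" and X :: "nat \<Rightarrow> nat \<Rightarrow> 'a \<Rightarrow> nat"
    and \<epsilon> :: "nat \<Rightarrow> real"
  assumes gw: "galton_watson M p X"
    and nondegenerate: "\<not> (\<exists>c. AE n in measure_pmf p. n = c)"
    and p0: "pmf p 0 = 0"
    and NlogN: "integrable (measure_pmf p) (\<lambda>n. real n * ln (real n))"
    and mu_ge_2: "min_offspring p \<ge> 2"
    and eps_pos: "\<And>j. \<epsilon> j > 0"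
    and eps_decr: "decseq \<epsilon>"
    and eps_lim: "\<epsilon> \<longlonglongrightarrow> 0"
    and omega_lim: "filterlim (\<lambda>j. omega_fun M p X (\<epsilon> j)) at_top sequentially \<or>
           (\<lambda>j. omega_fun M p X (\<epsilon> j)) \<longlonglongrightarrow> 0"
  shows "\<forall>\<eta>>0. (\<lambda>j. cond_prob M
      (\<lambda>x. \<bar>excess_ratio M p X (\<epsilon> j) x -
        (real (next_offspring p) / real (min_offspring p) - 1) * pmf p (next_offspring p) *
        pmf p (min_offspring p) powr
          (- ((real (next_offspring p) - 1) / (real (min_offspring p) - 1)))\<bar> > \<eta>)
      (\<lambda>x. mart_limit p X x < \<epsilon> j)) \<longlonglongrightarrow> 0"
proof -
  interpret boettcher_gw M p X
    using gw nondegenerate NlogN mu_ge_2 by (simp add: boettcher_gw_def boettcher_gw_axioms_def)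
  show ?thesis
    using excess_ratio_limit[OF eps_pos eps_lim omega_lim] unfolding limit_const_def by blast
qed

end
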